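(* Let $M$ be a finite-dimensional complete Riemannian manifold of class $C^\infty$, $I=[0,1]$, $k\ge1$, and let $A$ be a smooth time-dependent vector field on $M$, i.e. $A(t,p)\in T_pM$ for $(t,p)\in I\times M$. Let $v,w\in\bigoplus_{k-1}TM$ and define $J_k(x):=\tfrac12\int_0^1\|\nabla_t^{k-1}\dot x(t)-A(t,x(t))\|^2\,dt$. If $\|A(t,p)\|$ is bounded on $I\times M$, then $J_k$ is weakly proper on $H^k(I,M)_{v,w}$ with respect to $C^{k-1}(I,M)$; that is, every subset $U\subset H^k(I,M)_{v,w}$ on which $J_k$ is bounded is relatively compact in $C^{k-1}(I,M)$.
   Context: $H^k(I,M)$ is the Hilbert manifold of curves $x:I\to M$ of Sobolev class $H^k=W^{k,2}$, and $C^{k-1}(I,M)$ is the Banach manifold of $C^{k-1}$ curves with the $C^{k-1}$ topology; $H^k(I,M)\subset C^{k-1}(I,M)$. $\nabla_t$ denotes covariant differentiation along $x$ with respect to the Levi-Civita connection. $\bigoplus_{k-1}TM$ is the Whitney sum over $M$ of $k-1$ copies of $TM$ (equal to $M$ if $k=1$). For $v,w\in\bigoplus_{k-1}TM$, $H^k(I,M)_{v,w}$ is the submanifold of all $x\in H^k(I,M)$ satisfying the boundary conditions $(x(0),\dot x(0),\dots,\nabla_t^{k-2}\dot x(0))=v$ and $(x(1),\dot x(1),\dots,\nabla_t^{k-2}\dot x(1))=w$ (where each element of $\bigoplus_{k-1}TM$ is viewed as a base point together with $k-1$ tangent vectors at it). *)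

theory Defs
  imports "HOL-Analysis.Analysis"
begin

primrec Cn_on ::
  "nat \<Rightarrow> 'c::real_normed_vector set \<Rightarrow> ('c \<Rightarrow> 'd::real_normed_vector) \<Rightarrow> bool" where
  "Cn_on 0 S f \<longleftrightarrow> continuous_on S f"
| "Cn_on (Suc n) S f \<longleftrightarrow> (\<forall>x\<in>S. f differentiable (at x)) \<and>
     (\<forall>v. Cn_on n S (\<lambda>x. frechet_derivative f (at x) v))"

text \<open>\<^const>\<open>Cn_on\<close> is meant for open sets.  On an arbitrary set (such as
  \<open>[0,1] \<times> W\<close> below) smoothness means the existence of local smooth extensions; on open
  sets this is the same as being of class \<open>C\<^sup>n\<close> for all \<open>n\<close>.\<close>

definition smooth_on ::
  "'c::real_normed_vector set \<Rightarrow> ('c \<Rightarrow> 'd::real_normed_vector) \<Rightarrow> bool" where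
  "smooth_on S f \<longleftrightarrow>
     (\<forall>x\<in>S. \<exists>U F. open U \<and> x \<in> U \<and> (\<forall>n. Cn_on n U F) \<and> (\<forall>y\<in>U \<inter> S. F y = f y))"

datatype ('a, 'b) chart = Chart (chart_dom: "'a set") (chart_map: "'a \<Rightarrow> 'b")

definition chart_inv :: "('a, 'b) chart \<Rightarrow> 'b \<Rightarrow> 'a" where
  "chart_inv c = inv_into (chart_dom c) (chart_map c)"

definition chart_img :: "('a, 'b) chart \<Rightarrow> 'b set" where
  "chart_img c = chart_map c ` chart_dom c"

definition transition :: "('a, 'b) chart \<Rightarrow> ('a, 'b) chart \<Rightarrow> 'b \<Rightarrow> 'b" where
  "transition c d = chart_map d \<circ> chart_inv c"

definition carrier :: "('a, 'b) chart set \<Rightarrow> 'a set" where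
  "carrier \<A> = (\<Union>c\<in>\<A>. chart_dom c)"

definition smooth_atlas ::
  "('a::{t2_space, second_countable_topology}, 'b::euclidean_space) chart set \<Rightarrow> bool" where
  "smooth_atlas \<A> \<longleftrightarrow>
     (\<forall>c\<in>\<A>. open (chart_dom c) \<and> open (chart_img c) \<and>
        homeomorphism (chart_dom c) (chart_img c) (chart_map c) (chart_inv c)) \<and>
     (\<forall>c\<in>\<A>. \<forall>d\<in>\<A>. smooth_on (chart_map c ` (chart_dom c \<inter> chart_dom d)) (transition c d))"

text \<open>A tangent vector at \<open>p\<close> is the family of its coordinate vectors in all charts around
  \<open>p\<close>, related to each other by the differentials of the transition maps; the entries at all
  other charts are \<open>0\<close>.\<close>

type_synonym ('a, 'b) tvec = "('a, 'b) chart \<Rightarrow> 'b"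

definition charts_at :: "('a, 'b) chart set \<Rightarrow> 'a \<Rightarrow> ('a, 'b) chart set" where
  "charts_at \<A> p = {c \<in> \<A>. p \<in> chart_dom c}"

definition tangent_space ::
  "('a, 'b::euclidean_space) chart set \<Rightarrow> 'a \<Rightarrow> ('a, 'b) tvec set" where
  "tangent_space \<A> p = {\<xi>.
     (\<forall>c\<in>charts_at \<A> p. \<forall>d\<in>charts_at \<A> p.
        \<xi> d = frechet_derivative (transition c d) (at (chart_map c p)) (\<xi> c)) \<and>
     (\<forall>c. c \<notin> charts_at \<A> p \<longrightarrow> \<xi> c = 0)}"

text \<open>The tangent vector at \<open>p\<close> that has coordinates \<open>u\<close> in the chart \<open>c\<close>.\<close>

definition tvec_of ::
  "('a, 'b::euclidean_space) chart set \<Rightarrow> ('a, 'b) chart \<Rightarrow> 'a \<Rightarrow> 'b \<Rightarrow> ('a, 'b) tvec" where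
  "tvec_of \<A> c p u = (\<lambda>d. if d \<in> charts_at \<A> p
     then frechet_derivative (transition c d) (at (chart_map c p)) u else 0)"

text \<open>A metric assigns to \<open>p\<close> a function \<open>g p\<close> that is an inner product on the tangent space
  at \<open>p\<close>; its values elsewhere are irrelevant.\<close>

type_synonym ('a, 'b) metric = "'a \<Rightarrow> ('a, 'b) tvec \<Rightarrow> ('a, 'b) tvec \<Rightarrow> real"

definition metric_in_chart ::
  "('a, 'b::euclidean_space) chart set \<Rightarrow> ('a, 'b) metric \<Rightarrow> ('a, 'b) chart
     \<Rightarrow> 'b \<Rightarrow> 'b \<Rightarrow> 'b \<Rightarrow> real" where
  "metric_in_chart \<A> g c z u v =
     g (chart_inv c z) (tvec_of \<A> c (chart_inv c z) u) (tvec_of \<A> c (chart_inv c z) v)"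

definition riemannian_metric ::
  "('a, 'b::euclidean_space) chart set \<Rightarrow> ('a, 'b) metric \<Rightarrow> bool" where
  "riemannian_metric \<A> g \<longleftrightarrow> (\<forall>c\<in>\<A>.
     (\<forall>z\<in>chart_img c.
        bilinear (metric_in_chart \<A> g c z) \<and>
        (\<forall>u v. metric_in_chart \<A> g c z u v = metric_in_chart \<A> g c z v u) \<and>
        (\<forall>u. u \<noteq> 0 \<longrightarrow> metric_in_chart \<A> g c z u u > 0)) \<and>
     (\<forall>u v. smooth_on (chart_img c) (\<lambda>z. metric_in_chart \<A> g c z u v)))"

definition riemannian_manifold ::
  "('a::{t2_space, second_countable_topology}, 'b::euclidean_space) chart set
     \<Rightarrow> ('a, 'b) metric \<Rightarrow> bool" where
  "riemannian_manifold \<A> g \<longleftrightarrow> smooth_atlas \<A> \<and> riemannian_metric \<A> g"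

definition tnorm :: "('a, 'b) metric \<Rightarrow> 'a \<Rightarrow> ('a, 'b) tvec \<Rightarrow> real" where
  "tnorm g p \<xi> = sqrt (g p \<xi> \<xi>)"

text \<open>The connection form of the Levi-Civita connection in the chart \<open>c\<close>, i.e. the bilinear map
  \<open>\<Gamma>\<^sub>z(u,v)\<close> with \<open>\<nabla>\<^sub>u V = D V(u) + \<Gamma>\<^sub>z(u,V)\<close>.  It is the unique one that is torsion free
  (symmetric) and compatible with the metric.\<close>

definition levi_civita ::
  "('a, 'b::euclidean_space) chart set \<Rightarrow> ('a, 'b) metric \<Rightarrow> ('a, 'b) chart
     \<Rightarrow> 'b \<Rightarrow> 'b \<Rightarrow> 'b \<Rightarrow> 'b" where
  "levi_civita \<A> g c z = (THE \<Gamma>. bilinear \<Gamma> \<and> (\<forall>u v. \<Gamma> u v = \<Gamma> v u) \<and>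
     (\<forall>u v w. frechet_derivative (\<lambda>y. metric_in_chart \<A> g c y v w) (at z) u =
        metric_in_chart \<A> g c z (\<Gamma> u v) w + metric_in_chart \<A> g c z v (\<Gamma> u w)))"

text \<open>Derivatives of curves are always taken within the parameter interval, so they are
  one-sided at its end points.\<close>

definition curve_deriv ::
  "real set \<Rightarrow> (real \<Rightarrow> 'b::real_normed_vector) \<Rightarrow> real \<Rightarrow> 'b" where
  "curve_deriv S f = (\<lambda>t. vector_derivative f (at t within S))"

primrec Cr_vec_curve :: "nat \<Rightarrow> real set \<Rightarrow> (real \<Rightarrow> 'b::real_normed_vector) \<Rightarrow> bool" where
  "Cr_vec_curve 0 S f \<longleftrightarrow> continuous_on S f"
| "Cr_vec_curve (Suc r) S f \<longleftrightarrow>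
     (\<forall>t\<in>S. f differentiable (at t within S)) \<and> Cr_vec_curve r S (curve_deriv S f)"

definition Cr_curve_on ::
  "('a::topological_space, 'b::euclidean_space) chart set \<Rightarrow> nat \<Rightarrow> real \<Rightarrow> real
     \<Rightarrow> (real \<Rightarrow> 'a) \<Rightarrow> bool" where
  "Cr_curve_on \<A> r a b x \<longleftrightarrow>
     continuous_on {a..b} x \<and> x ` {a..b} \<subseteq> carrier \<A> \<and>
     (\<forall>c\<in>\<A>. \<forall>s t. a \<le> s \<and> s < t \<and> t \<le> b \<and> x ` {s..t} \<subseteq> chart_dom c \<longrightarrow>
        Cr_vec_curve r {s..t} (chart_map c \<circ> x))"

definition velocity ::
  "('a, 'b::euclidean_space) chart set \<Rightarrow> (real \<Rightarrow> 'a) \<Rightarrow> real \<Rightarrow> ('a, 'b) tvec" where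
  "velocity \<A> x t = (\<lambda>c. if c \<in> charts_at \<A> (x t)
     then curve_deriv {0..1} (chart_map c \<circ> x) t else 0)"

text \<open>Covariant derivative of a vector field \<open>X\<close> along \<open>x : [0,1] \<rightarrow> M\<close>.  For a curve of
  class \<open>H\<^sup>k\<close>, the field \<open>\<nabla>\<^sub>t\<^sup>k\<^sup>-\<^sup>1 x'\<close> is thereby defined almost everywhere.\<close>

definition cov_deriv ::
  "('a, 'b::euclidean_space) chart set \<Rightarrow> ('a, 'b) metric \<Rightarrow> (real \<Rightarrow> 'a)
     \<Rightarrow> (real \<Rightarrow> ('a, 'b) tvec) \<Rightarrow> real \<Rightarrow> ('a, 'b) tvec" where
  "cov_deriv \<A> g x X t = (\<lambda>c. if c \<in> charts_at \<A> (x t)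
     then curve_deriv {0..1} (\<lambda>s. X s c) t +
          levi_civita \<A> g c (chart_map c (x t)) (velocity \<A> x t c) (X t c)
     else 0)"

definition cov_velocity ::
  "('a, 'b::euclidean_space) chart set \<Rightarrow> ('a, 'b) metric \<Rightarrow> nat \<Rightarrow> (real \<Rightarrow> 'a)
     \<Rightarrow> real \<Rightarrow> ('a, 'b) tvec" where
  "cov_velocity \<A> g j x = (cov_deriv \<A> g x ^^ j) (velocity \<A> x)"

text \<open>Each piece is \<open>C\<^sup>1\<close> up to its end points, so the velocity stays bounded; the library's
  \<^const>\<open>piecewise_C1_differentiable_on\<close> does not guarantee that.\<close>

definition piecewise_C1_curve ::
  "('a::topological_space, 'b::euclidean_space) chart set \<Rightarrow> (real \<Rightarrow> 'a) \<Rightarrow> bool" where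
  "piecewise_C1_curve \<A> x \<longleftrightarrow>
     (\<exists>(n::nat) \<tau>. \<tau> 0 = 0 \<and> \<tau> n = 1 \<and>
        (\<forall>i<n. \<tau> i < \<tau> (Suc i) \<and> Cr_curve_on \<A> 1 (\<tau> i) (\<tau> (Suc i)) x))"

definition curve_length ::
  "('a, 'b::euclidean_space) chart set \<Rightarrow> ('a, 'b) metric \<Rightarrow> (real \<Rightarrow> 'a) \<Rightarrow> real" where
  "curve_length \<A> g x = (\<integral>t. tnorm g (x t) (velocity \<A> x t) \<partial>lebesgue_on {0..1})"

text \<open>Infinite for points in different components.\<close>

definition riemannian_dist ::
  "('a::topological_space, 'b::euclidean_space) chart set \<Rightarrow> ('a, 'b) metric
     \<Rightarrow> 'a \<Rightarrow> 'a \<Rightarrow> ennreal" where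
  "riemannian_dist \<A> g p q =
     (INF x\<in>{x. piecewise_C1_curve \<A> x \<and> x 0 = p \<and> x 1 = q}. ennreal (curve_length \<A> g x))"

definition complete_riemannian ::
  "('a::topological_space, 'b::euclidean_space) chart set \<Rightarrow> ('a, 'b) metric \<Rightarrow> bool" where
  "complete_riemannian \<A> g \<longleftrightarrow>
     (\<forall>\<sigma>::nat \<Rightarrow> 'a. range \<sigma> \<subseteq> carrier \<A> \<and>
        (\<forall>e>0. \<exists>N. \<forall>m\<ge>N. \<forall>n\<ge>N. riemannian_dist \<A> g (\<sigma> m) (\<sigma> n) < e) \<longrightarrow>
        (\<exists>p\<in>carrier \<A>. (\<lambda>n. riemannian_dist \<A> g (\<sigma> n) p) \<longlonglongrightarrow> 0))"

definition L2_on :: "real \<Rightarrow> real \<Rightarrow> (real \<Rightarrow> 'b::euclidean_space) \<Rightarrow> bool" where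
  "L2_on a b f \<longleftrightarrow> f \<in> borel_measurable (lebesgue_on {a..b}) \<and>
     integrable (lebesgue_on {a..b}) (\<lambda>t. (norm (f t))\<^sup>2)"

definition test_function :: "real \<Rightarrow> real \<Rightarrow> (real \<Rightarrow> real) \<Rightarrow> bool" where
  "test_function a b \<phi> \<longleftrightarrow>
     \<phi> C1_differentiable_on UNIV \<and> closure {t. \<phi> t \<noteq> 0} \<subseteq> {a<..<b}"

definition weak_deriv_on ::
  "real \<Rightarrow> real \<Rightarrow> (real \<Rightarrow> 'b::euclidean_space) \<Rightarrow> (real \<Rightarrow> 'b) \<Rightarrow> bool" where
  "weak_deriv_on a b f f' \<longleftrightarrow> (\<forall>\<phi>. test_function a b \<phi> \<longrightarrow>
     (\<integral>t. deriv \<phi> t *\<^sub>R f t \<partial>lebesgue_on {a..b}) = - (\<integral>t. \<phi> t *\<^sub>R f' t \<partial>lebesgue_on {a..b}))"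

text \<open>The Sobolev space \<open>W\<^sup>k\<^sup>,\<^sup>2(a,b)\<close>, by recursion on weak derivatives.  Compactly supported
  test functions of class \<open>C\<^sup>1\<close> and of class \<open>C\<^sup>\<infinity>\<close> give the same weak derivatives.\<close>

primrec sobolev_on :: "nat \<Rightarrow> real \<Rightarrow> real \<Rightarrow> (real \<Rightarrow> 'b::euclidean_space) \<Rightarrow> bool" where
  "sobolev_on 0 a b f \<longleftrightarrow> L2_on a b f"
| "sobolev_on (Suc k) a b f \<longleftrightarrow>
     L2_on a b f \<and> (\<exists>f'. weak_deriv_on a b f f' \<and> sobolev_on k a b f')"

text \<open>Curves \<open>[0,1] \<rightarrow> M\<close> are functions on the reals that are \<open>undefined\<close> outside \<open>[0,1]\<close>, so
  that equality of curves is equality on \<open>[0,1]\<close>.  For \<open>k \<ge> 1\<close> (the only case used) curves of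
  class \<open>H\<^sup>k\<close> are continuous.\<close>

definition Hk_curves ::
  "('a::topological_space, 'b::euclidean_space) chart set \<Rightarrow> nat \<Rightarrow> (real \<Rightarrow> 'a) set" where
  "Hk_curves \<A> k = {x \<in> extensional {0..1}.
     continuous_on {0..1} x \<and> x ` {0..1} \<subseteq> carrier \<A> \<and>
     (\<forall>c\<in>\<A>. \<forall>s t. 0 \<le> s \<and> s < t \<and> t \<le> 1 \<and> x ` {s..t} \<subseteq> chart_dom c \<longrightarrow>
        sobolev_on k s t (chart_map c \<circ> x))}"

definition whitney_sum ::
  "nat \<Rightarrow> ('a, 'b::euclidean_space) chart set \<Rightarrow> ('a \<times> ('a, 'b) tvec list) set" where
  "whitney_sum m \<A> =
     {(p, vs). p \<in> carrier \<A> \<and> length vs = m \<and> set vs \<subseteq> tangent_space \<A> p}"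

definition boundary_value ::
  "('a, 'b::euclidean_space) chart set \<Rightarrow> ('a, 'b) metric \<Rightarrow> nat \<Rightarrow> (real \<Rightarrow> 'a) \<Rightarrow> real
     \<Rightarrow> 'a \<times> ('a, 'b) tvec list" where
  "boundary_value \<A> g k x t = (x t, map (\<lambda>j. cov_velocity \<A> g j x t) [0..<k - 1])"

definition Hk_curves_between ::
  "('a::topological_space, 'b::euclidean_space) chart set \<Rightarrow> ('a, 'b) metric \<Rightarrow> nat
     \<Rightarrow> 'a \<times> ('a, 'b) tvec list \<Rightarrow> 'a \<times> ('a, 'b) tvec list \<Rightarrow> (real \<Rightarrow> 'a) set" where
  "Hk_curves_between \<A> g k v w =
     {x \<in> Hk_curves \<A> k. boundary_value \<A> g k x 0 = v \<and> boundary_value \<A> g k x 1 = w}"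

definition Cr_curves ::
  "('a::topological_space, 'b::euclidean_space) chart set \<Rightarrow> nat \<Rightarrow> (real \<Rightarrow> 'a) set" where
  "Cr_curves \<A> r = {x \<in> extensional {0..1}. Cr_curve_on \<A> r 0 1 x}"

text \<open>The usual subbasis of the \<open>C\<^sup>r\<close> topology: closeness to \<open>x\<close> of all derivatives up to order
  \<open>r\<close>, uniformly on a compact interval that \<open>x\<close> maps into the domain of a chart.\<close>

definition Cr_nbhd ::
  "('a::topological_space, 'b::euclidean_space) chart set \<Rightarrow> nat \<Rightarrow> (real \<Rightarrow> 'a)
     \<Rightarrow> ('a, 'b) chart \<Rightarrow> real \<Rightarrow> real \<Rightarrow> real \<Rightarrow> (real \<Rightarrow> 'a) set" where
  "Cr_nbhd \<A> r x c a b e = {y \<in> Cr_curves \<A> r. y ` {a..b} \<subseteq> chart_dom c \<and>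
     (\<forall>j\<le>r. \<forall>t\<in>{a..b}.
        norm ((curve_deriv {a..b} ^^ j) (chart_map c \<circ> y) t -
              (curve_deriv {a..b} ^^ j) (chart_map c \<circ> x) t) < e)}"

definition Cr_topology ::
  "('a::topological_space, 'b::euclidean_space) chart set \<Rightarrow> nat \<Rightarrow> (real \<Rightarrow> 'a) topology" where
  "Cr_topology \<A> r = topology_generated_by
     {Cr_nbhd \<A> r x c a b e | x c a b e. x \<in> Cr_curves \<A> r \<and> c \<in> \<A> \<and>
        0 \<le> a \<and> a < b \<and> b \<le> 1 \<and> x ` {a..b} \<subseteq> chart_dom c \<and> 0 < e}"

definition relatively_compact_in :: "'x topology \<Rightarrow> 'x set \<Rightarrow> bool" where
  "relatively_compact_in T U \<longleftrightarrow> U \<subseteq> topspace T \<and> compactin T (T closure_of U)"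

definition weakly_proper :: "('x \<Rightarrow> real) \<Rightarrow> 'x set \<Rightarrow> 'x topology \<Rightarrow> bool" where
  "weakly_proper J X T \<longleftrightarrow> (\<forall>U\<subseteq>X. bounded (J ` U) \<longrightarrow> relatively_compact_in T U)"

definition smooth_time_dependent_field ::
  "('a, 'b::euclidean_space) chart set \<Rightarrow> (real \<Rightarrow> 'a \<Rightarrow> ('a, 'b) tvec) \<Rightarrow> bool" where
  "smooth_time_dependent_field \<A> A \<longleftrightarrow>
     (\<forall>t\<in>{0..1}. \<forall>p\<in>carrier \<A>. A t p \<in> tangent_space \<A> p) \<and>
     (\<forall>c\<in>\<A>. smooth_on ({0..1} \<times> chart_img c) (\<lambda>(t, z). A t (chart_inv c z) c))"

definition J_functional ::
  "('a, 'b::euclidean_space) chart set \<Rightarrow> ('a, 'b) metric \<Rightarrow> (real \<Rightarrow> 'a \<Rightarrow> ('a, 'b) tvec)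
     \<Rightarrow> nat \<Rightarrow> (real \<Rightarrow> 'a) \<Rightarrow> real" where
  "J_functional \<A> g A k x = 1/2 *
     (\<integral>t. (tnorm g (x t) (\<lambda>c. cov_velocity \<A> g (k - 1) x t c - A t (x t) c))\<^sup>2
        \<partial>lebesgue_on {0..1})"

end

theory Submission
  imports Defs
begin

text \<open>Bounds on \<open>J\<close> and \<open>A\<close> bound the last covariant derivative \<open>\<nabla>\<^sup>k\<^sup>-\<^sup>1 x'\<close> in \<open>L\<^sup>2\<close>.  Since
  \<open>|\<nabla>\<^sup>j x'|(t) \<le> |\<nabla>\<^sup>j x'|(0) + \<integral> |\<nabla>\<^sup>j\<^sup>+\<^sup>1 x'|\<close> and the initial values are prescribed, the lower ones
  are bounded as well, and \<open>dist (x s) (x t) \<le> R \<surd>(t - s)\<close> uniformly.  All curves start at the same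
  point, so completeness confines them to one compact set.  In charts the covariant bounds become
  bounds on the derivatives up to order \<open>k - 1\<close>, the last of which is \<open>1/2\<close>-Hoelder.  By Tychonoff's theorem
  the closure of \<open>U\<close> under pointwise convergence is compact, these bounds persist on it, and there
  they make the identity into the \<open>C\<^sup>k\<^sup>-\<^sup>1\<close> topology continuous.\<close>

text \<open>The derivatives in \<open>J_functional\<close> and in the boundary values are pointwise
  ones within \<open>{0..1}\<close>, while \<open>sobolev_on\<close> speaks of weak derivatives.
  Matching the two calls for du Bois-Reymond's lemma and Lebesgue's differentiation theorem: at the
  top order the covariant derivative exists only almost everywhere, and there it has to agree with
  the square integrable density. Completeness refers to the infimum of lengths of piecewise C1
  curves, but for \<open>k = 1\<close> the curves in question are merely of class H1. Broken lines
  mediate: they replace an H1 curve at the cost of a factor 4, which affects neither Cauchy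
  sequences nor limits. The metric \<open>rdist\<close> made from them is truncated at 1, hence real
  valued even across components. Uniformity over all curves and chart intervals is carried by
  indexed families (\<open>interval_family\<close>) with one constant per family. Closeness of
  derivatives is deduced from closeness of values by interpolation within a Hoelder class
  (\<open>Hol_curve_deriv_close\<close>); this is where the modulus of continuity of the top
  derivative is spent.\<close>

lemmas HK_integrable_combine = Henstock_Kurzweil_Integration.integrable_combine
lemmas HK_integral_add = Henstock_Kurzweil_Integration.integral_add
lemmas HK_integral_combine = Henstock_Kurzweil_Integration.integral_combine
lemmas HK_integral_cong = Henstock_Kurzweil_Integration.integral_cong
lemmas HK_integral_diff = Henstock_Kurzweil_Integration.integral_diff
lemmas HK_integral_nonneg = Henstock_Kurzweil_Integration.integral_nonneg

section \<open>Lebesgue differentiation\<close>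

lemma absolutely_integrable_on_iff_integrable:
  fixes f :: "real \<Rightarrow> 'b::euclidean_space"
  assumes "S \<in> sets lebesgue"
  shows "f absolutely_integrable_on S \<longleftrightarrow> integrable (lebesgue_on S) f"
  using assms by (simp add: set_integrable_def integrable_restrict_space)

text \<open>Density of continuous functions in L1, by two rounds of dominated convergence. The
  values of \<open>p\<close> are first cut down to a ball of radius \<open>R\<close>; continuous
  functions converging to \<open>p\<close> off a negligible set are then cut down by the same map,
  and this supplies the bound \<open>2 * R\<close> that dominates the second limit.\<close>

lemma absolutely_integrable_approximate_continuous:
  fixes p :: "real \<Rightarrow> 'b::euclidean_space"
  assumes p: "p absolutely_integrable_on {a..b}" and "0 < e"
  obtains u where "continuous_on UNIV u" "integral {a..b} (\<lambda>t. norm (p t - u t)) < e"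
proof -
  let ?M = "lebesgue_on {a..b}"
  \<comment> \<open>The radial retraction onto the ball of radius \<open>R\<close>. It is
    continuous, so composing with it keeps measurability of \<open>p\<close> and continuity of the
    approximants.\<close>
  define clip :: "real \<Rightarrow> 'b \<Rightarrow> 'b" where "clip R v = (R / max R (norm v)) *\<^sub>R v" for R v
  have tri: "norm (x - z) \<le> norm (x - y) + norm (y - z)" for x y z :: 'b
    using norm_triangle_ineq[of "x - y" "y - z"] by simp
  have clip_le: "norm (clip R v) \<le> R" if "R > 0" for R v
    using that by (auto simp: clip_def max_def field_simps)
  have clip_le': "norm (clip R v) \<le> norm v" if "R > 0" for R v
    using that by (auto simp: clip_def max_def field_simps intro: mult_mono)
  have clip_cont: "continuous_on UNIV (clip R)" if "R > 0" for R
    unfolding clip_def using that by (intro continuous_intros) (auto simp: max_def)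
  have Ip: "integrable ?M p" using p by (simp add: absolutely_integrable_on_iff_integrable)
  have mp: "p \<in> borel_measurable ?M" using Ip by auto
  have mclip: "(\<lambda>t. clip R (h t)) \<in> borel_measurable ?M" if "R > 0" "h \<in> borel_measurable ?M" for R h
    using borel_measurable_continuous_on[OF clip_cont[OF that(1)] that(2)] .
  have "(\<lambda>n. integral\<^sup>L ?M (\<lambda>t. norm (p t - clip (real (Suc n)) (p t)))) \<longlonglongrightarrow> integral\<^sup>L ?M (\<lambda>t. 0)"
  proof (rule integral_dominated_convergence[where w="\<lambda>t. 2 * norm (p t)"])
    show "AE t in ?M. (\<lambda>n. norm (p t - clip (real (Suc n)) (p t))) \<longlonglongrightarrow> 0"
    proof (intro AE_I2)
      fix t
      have "\<forall>\<^sub>F n in sequentially. norm (p t - clip (real (Suc n)) (p t)) = 0"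
        using eventually_ge_at_top[of "nat \<lceil>norm (p t)\<rceil>"]
        by eventually_elim (auto simp: clip_def max_def ceiling_le_iff)
      then show "(\<lambda>n. norm (p t - clip (real (Suc n)) (p t))) \<longlonglongrightarrow> 0"
        by (rule tendsto_eventually)
    qed
    show "AE t in ?M. norm (norm (p t - clip (real (Suc n)) (p t))) \<le> 2 * norm (p t)" for n
    proof (rule AE_I2)
      fix t
      show "norm (norm (p t - clip (real (Suc n)) (p t))) \<le> 2 * norm (p t)"
        using clip_le'[of "real (Suc n)" "p t"] norm_triangle_ineq4[of "p t" "clip (real (Suc n)) (p t)"] by simp
    qed
    show "(\<lambda>t. norm (p t - clip (real (Suc n)) (p t))) \<in> borel_measurable ?M" for n
      using mp mclip[of "real (Suc n)" p] by (auto intro!: borel_measurable_norm borel_measurable_diff)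
  qed (use Ip in auto)
  then have "\<forall>\<^sub>F n in sequentially. integral\<^sup>L ?M (\<lambda>t. norm (p t - clip (real (Suc n)) (p t))) < e/2"
    by (rule order_tendstoD(2)) (use \<open>0 < e\<close> in simp)
  then obtain n0 where n0: "integral\<^sup>L ?M (\<lambda>t. norm (p t - clip (real (Suc n0)) (p t))) < e/2"
    by (auto simp: eventually_sequentially)
  define R where "R = real (Suc n0)"
  have R: "R > 0" by (simp add: R_def)
  have Iclip: "integrable ?M (\<lambda>t. clip R (h t))" if "h \<in> borel_measurable ?M" for h
    by (rule Bochner_Integration.integrable_bound[where f="\<lambda>_. R"])
       (use mclip[OF R that] clip_le[OF R] in \<open>auto intro!: AE_I2 intro: order_trans[OF _ abs_ge_self]\<close>)
  have "p measurable_on {a..b}"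
    using mp by (simp add: measurable_on_iff_borel_measurable)
  then obtain N g where N: "negligible N" and g: "\<And>n::nat. continuous_on UNIV (g n)"
    and lim: "\<And>t. t \<notin> N \<Longrightarrow> (\<lambda>n. g n t) \<longlonglongrightarrow> (if t \<in> {a..b} then p t else 0)"
    unfolding measurable_on_def by metis
  have mg: "g n \<in> borel_measurable ?M" for n
    using g[of n] by (intro continuous_imp_measurable_on_sets_lebesgue) (auto intro: continuous_on_subset)
  have "(\<lambda>n. integral\<^sup>L ?M (\<lambda>t. norm (clip R (p t) - clip R (g n t)))) \<longlonglongrightarrow> integral\<^sup>L ?M (\<lambda>t. 0)"
  proof (rule integral_dominated_convergence[where w="\<lambda>t. 2 * R"])
    have "AE t in ?M. t \<notin> N"
      using N by (auto simp: AE_restrict_space_iff negligible_iff_null_sets intro: AE_mp[OF AE_not_in])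
    then show "AE t in ?M. (\<lambda>n. norm (clip R (p t) - clip R (g n t))) \<longlonglongrightarrow> 0"
    proof (rule AE_mp, intro AE_I2 impI)
      fix t assume t: "t \<in> space ?M" "t \<notin> N"
      then have "(\<lambda>n. g n t) \<longlonglongrightarrow> p t" using lim[of t] by auto
      then have "(\<lambda>n. clip R (g n t)) \<longlonglongrightarrow> clip R (p t)"
        by (rule continuous_on_tendsto_compose[OF clip_cont[OF R]]) auto
      then have "(\<lambda>n. norm (clip R (p t) - clip R (g n t))) \<longlonglongrightarrow> norm (clip R (p t) - clip R (p t))"
        by (intro tendsto_intros)
      then show "(\<lambda>n. norm (clip R (p t) - clip R (g n t))) \<longlonglongrightarrow> 0" by simp
    qed
    show "AE t in ?M. norm (norm (clip R (p t) - clip R (g n t))) \<le> 2 * R" for n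
    proof (rule AE_I2)
      fix t
      show "norm (norm (clip R (p t) - clip R (g n t))) \<le> 2 * R"
        using clip_le[OF R, of "p t"] clip_le[OF R, of "g n t"] norm_triangle_ineq4[of "clip R (p t)" "clip R (g n t)"] by simp
    qed
    show "(\<lambda>t. norm (clip R (p t) - clip R (g n t))) \<in> borel_measurable ?M" for n
      using mclip[OF R mp] mclip[OF R mg] by (auto intro!: borel_measurable_norm borel_measurable_diff)
  qed auto
  then have "\<forall>\<^sub>F n in sequentially. integral\<^sup>L ?M (\<lambda>t. norm (clip R (p t) - clip R (g n t))) < e/2"
    by (rule order_tendstoD(2)) (use \<open>0 < e\<close> in simp)
  then obtain n where n: "integral\<^sup>L ?M (\<lambda>t. norm (clip R (p t) - clip R (g n t))) < e/2"
    by (auto simp: eventually_sequentially)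
  define u where "u t = clip R (g n t)" for t
  have "continuous_on UNIV u"
    unfolding u_def by (rule continuous_on_compose2[OF clip_cont[OF R] g]) auto
  have Iu: "integrable ?M u" unfolding u_def by (rule Iclip[OF mg])
  have "integral\<^sup>L ?M (\<lambda>t. norm (p t - u t))
      \<le> integral\<^sup>L ?M (\<lambda>t. norm (p t - clip R (p t)) + norm (clip R (p t) - clip R (g n t)))"
    using Ip Iu Iclip[OF mp] Iclip[OF mg, of n]
    by (intro integral_mono) (auto simp: u_def intro: tri)
  also have "\<dots> < e"
    using n0 n Ip Iu Iclip[OF mp] Iclip[OF mg, of n] by (subst Bochner_Integration.integral_add) (auto simp: R_def)
  finally have "integral {a..b} (\<lambda>t. norm (p t - u t)) < e"
    using Ip Iu by (subst (asm) lebesgue_integral_eq_integral) auto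
  then show ?thesis using that \<open>continuous_on UNIV u\<close> by blast
qed

text \<open>The weak type estimate for the centred maximal function. Vitali's lemma selects disjoint
  balls whose fivefold dilates cover the exceptional set. A dilate has length \<open>10 * r\<close>,
  and \<open>r\<close> is less than \<open>1 / k\<close> times the integral over the selected
  interval; summing over disjoint intervals gives \<open>10 / k\<close>.\<close>

lemma maximal_inequality_interval:
  fixes g :: "real \<Rightarrow> real"
  assumes g: "g integrable_on {a..b}" and pos: "\<And>t. 0 \<le> g t" and "k > 0"
  obtains T where "T \<in> lmeasurable" "measure lebesgue T \<le> 10 / k * integral {a..b} g"
    "{t. \<exists>r>0. {t - r..t + r} \<subseteq> {a..b} \<and> integral {t - r..t + r} g > k * r} \<subseteq> T"
proof -
  define K where "K = {(t, r). r > 0 \<and> {t - r..t + r} \<subseteq> {a..b} \<and> integral {t - r..t + r} g > k * r}"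
  let ?E = "{t. \<exists>r>0. {t - r..t + r} \<subseteq> {a..b} \<and> integral {t - r..t + r} g > k * r}"
  have E: "?E \<subseteq> (\<Union>i\<in>K. ball (fst i) (snd i))"
    by (force simp: K_def)
  have r: "0 < snd i \<and> snd i \<le> \<bar>b - a\<bar>" if "i \<in> K" for i
  proof -
    from that have "0 < snd i" "{fst i - snd i..fst i + snd i} \<subseteq> {a..b}" by (auto simp only: K_def split_beta mem_Collect_eq)
    then show ?thesis unfolding atLeastatMost_subset_iff by linarith
  qed
  define Q where "Q C \<longleftrightarrow> countable C \<and> C \<subseteq> K \<and>
     pairwise (\<lambda>i j. disjnt (ball (fst i) (snd i)) (ball (fst j) (snd j))) C \<and>
     ?E \<subseteq> (\<Union>i\<in>C. ball (fst i) (5 * snd i))" for C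
  have "\<exists>C. Q C"
    unfolding Q_def
    by (rule Vitali_covering_lemma_balls[where a=fst and r=snd and B="\<bar>b - a\<bar>", OF E r]) blast+
  then obtain C where "Q C" ..
  then have C: "countable C" "C \<subseteq> K"
     "pairwise (\<lambda>i j. disjnt (ball (fst i) (snd i)) (ball (fst j) (snd j))) C"
     "?E \<subseteq> (\<Union>i\<in>C. ball (fst i) (5 * snd i))"
    unfolding Q_def by simp_all
  have bnd: "measure lebesgue (\<Union>i\<in>I. ball (fst i) (5 * snd i)) \<le> 10 / k * integral {a..b} g"
    if I: "I \<subseteq> C" "finite I" for I
  proof -
    have "measure lebesgue (\<Union>i\<in>I. ball (fst i) (5 * snd i)) \<le> (\<Sum>i\<in>I. measure lebesgue (ball (fst i) (5 * snd i)))"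
      using I(2) by (rule measure_UNION_le) auto
    also have "\<dots> = (\<Sum>i\<in>I. 10 * snd i)"
    proof (rule sum.cong[OF refl])
      fix i assume "i \<in> I"
      then have "snd i > 0" using r I C by blast
      then show "measure lebesgue (ball (fst i) (5 * snd i)) = 10 * snd i"
        by (simp add: ball_eq_greaterThanLessThan)
    qed
    also have "\<dots> \<le> (\<Sum>i\<in>I. 10 / k * integral {fst i - snd i..fst i + snd i} g)"
    proof (rule sum_mono)
      fix i assume "i \<in> I"
      then have "i \<in> K" using I C by blast
      then have "k * snd i \<le> integral {fst i - snd i..fst i + snd i} g" by (auto simp: K_def)
      then show "10 * snd i \<le> 10 / k * integral {fst i - snd i..fst i + snd i} g"
        using \<open>k > 0\<close> by (simp add: field_simps)
    qed
    also have "\<dots> = 10 / k * (\<Sum>i\<in>I. integral {fst i - snd i..fst i + snd i} g)"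
      by (simp add: sum_distrib_left)
    also have "\<dots> \<le> 10 / k * integral {a..b} g"
    proof (rule mult_left_mono)
      have sub: "{fst i - snd i..fst i + snd i} \<subseteq> {a..b}" if "i \<in> I" for i
      proof -
        have "i \<in> K" using that I C by blast
        then show ?thesis by (simp add: K_def split_beta)
      qed
      have "(g has_integral (\<Sum>i\<in>I. integral {fst i - snd i..fst i + snd i} g)) (\<Union>i\<in>I. {fst i - snd i..fst i + snd i})"
      proof (rule has_integral_UN[OF I(2)])
        fix i assume "i \<in> I"
        then show "(g has_integral integral {fst i - snd i..fst i + snd i} g) {fst i - snd i..fst i + snd i}"
          by (intro integrable_integral integrable_subinterval_real[OF g] sub)
      next
        show "pairwise (\<lambda>i i'. negligible ({fst i - snd i..fst i + snd i} \<inter> {fst i' - snd i'..fst i' + snd i'})) I"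
        proof (rule pairwiseI)
          fix i j assume ij: "i \<in> I" "j \<in> I" "i \<noteq> j"
          then have "disjnt (ball (fst i) (snd i)) (ball (fst j) (snd j))"
            using C(3) I(1) by (meson pairwiseD subsetD)
          then have disj: "\<not> (x \<in> ball (fst i) (snd i) \<and> x \<in> ball (fst j) (snd j))" for x
            unfolding disjnt_iff by blast
          \<comment> \<open>The open balls are disjoint, so the closed intervals can meet only in
            end points.\<close>
          have "{fst i - snd i..fst i + snd i} \<inter> {fst j - snd j..fst j + snd j}
             \<subseteq> {fst i - snd i, fst i + snd i, fst j - snd j, fst j + snd j}"
          proof
            fix x assume "x \<in> {fst i - snd i..fst i + snd i} \<inter> {fst j - snd j..fst j + snd j}"
            with disj[of x] show "x \<in> {fst i - snd i, fst i + snd i, fst j - snd j, fst j + snd j}"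
              unfolding ball_eq_greaterThanLessThan by (simp add: not_less) linarith
          qed
          then show "negligible ({fst i - snd i..fst i + snd i} \<inter> {fst j - snd j..fst j + snd j})"
            by (meson finite.emptyI finite.insertI negligible_finite negligible_subset)
        qed
      qed
      then show "(\<Sum>i\<in>I. integral {fst i - snd i..fst i + snd i} g) \<le> integral {a..b} g"
        by (intro has_integral_subset_le[OF UN_least[OF sub] _ integrable_integral[OF g]]) (use pos in \<open>auto\<close>)
    qed (use \<open>k > 0\<close> in simp)
    finally show ?thesis .
  qed
  show ?thesis
    by (rule that[OF fmeasurable_UN_bound[OF C(1) _ bnd] measure_UN_bound[OF C(1) _ bnd] C(4)]) auto
qed

text \<open>Lebesgue's differentiation theorem. A continuous \<open>w\<close> close to
  \<open>f\<close> in L1 satisfies it everywhere; the remainder \<open>f - w\<close> has small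
  averages outside \<open>T\<close>, by the maximal inequality, and small values outside
  \<open>D\<close>, by Chebyshev's inequality. Hence for each \<open>e\<close> the exceptional set
  is covered by sets of arbitrarily small measure.\<close>

lemma integral_has_vector_derivative_AE:
  fixes f :: "real \<Rightarrow> 'b::euclidean_space"
  assumes f: "f absolutely_integrable_on {a..b}"
  obtains N where "negligible N"
    "\<And>t. t \<in> {a<..<b} - N \<Longrightarrow> ((\<lambda>s. integral {a..s} f) has_vector_derivative f t) (at t)"
proof -
  have If: "f integrable_on {a..b}" using f set_lebesgue_integral_eq_integral(1) by blast
  define bad where "bad e = {t\<in>{a<..<b}. \<forall>d>0. \<exists>s\<in>{a<..<b}. s \<noteq> t \<and> \<bar>s - t\<bar> < d \<and>
     norm (integral {a..s} f - integral {a..t} f - (s - t) *\<^sub>R f t) > e * \<bar>s - t\<bar>}" for e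
  have seg: "integral {a..s} h - integral {a..t} h = (if t \<le> s then integral {t..s} h else - integral {s..t} h)"
    if "h integrable_on {a..b}" "t \<in> {a<..<b}" "s \<in> {a<..<b}" for h :: "real \<Rightarrow> 'b" and s t
  proof -
    have *: "integral {a..u} h + integral {u..v} h = integral {a..v} h" if "u \<le> v" "u \<in> {a<..<b}" "v \<in> {a<..<b}" for u v
      using that \<open>h integrable_on {a..b}\<close> by (intro HK_integral_combine) (auto intro: integrable_subinterval_real)
    show ?thesis using *[of t s] *[of s t] that by (auto simp: algebra_simps)
  qed
  have "negligible (bad e)" if "e > 0" for e
    unfolding negligible_outer_le
  proof (intro allI impI)
    fix \<epsilon> :: real assume "\<epsilon> > 0"
    \<comment> \<open>\<open>44 = 40 + 4\<close>: at level \<open>e / 4\<close> the maximal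
      inequality contributes \<open>40 / e\<close> and Chebyshev's inequality \<open>4 / e\<close>
      times the integral of \<open>g\<close>.\<close>
    define \<eta> where "\<eta> = e * \<epsilon> / 44"
    have "\<eta> > 0" using \<open>e > 0\<close> \<open>\<epsilon> > 0\<close> by (simp add: \<eta>_def)
    obtain w where w: "continuous_on UNIV w" "integral {a..b} (\<lambda>t. norm (f t - w t)) < \<eta>"
      using absolutely_integrable_approximate_continuous[OF f \<open>\<eta> > 0\<close>] .
    define g where "g t = norm (f t - w t)" for t
    have wa: "w absolutely_integrable_on {a..b}"
      using w(1) by (intro absolutely_integrable_continuous_real) (auto intro: continuous_on_subset)
    have d: "(\<lambda>t. f t - w t) absolutely_integrable_on {a..b}" using f wa by (rule set_integral_diff)
    have ga: "g absolutely_integrable_on {a..b}" unfolding g_def by (rule absolutely_integrable_norm[OF d, unfolded o_def])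
    then have gi: "g integrable_on {a..b}" using set_lebesgue_integral_eq_integral(1) by blast
    have di: "(\<lambda>t. f t - w t) integrable_on {a..b}" using d set_lebesgue_integral_eq_integral(1) by blast
    have wi: "w integrable_on {a..b}" using wa set_lebesgue_integral_eq_integral(1) by blast
    have g0: "0 \<le> g t" for t by (simp add: g_def)
    have "e/4 > 0" using \<open>e > 0\<close> by simp
    obtain T where T: "T \<in> lmeasurable" "measure lebesgue T \<le> 10 / (e/4) * integral {a..b} g"
      "{t. \<exists>r>0. {t - r..t + r} \<subseteq> {a..b} \<and> integral {t - r..t + r} g > e/4 * r} \<subseteq> T"
      using maximal_inequality_interval[OF gi g0 \<open>e/4 > 0\<close>] .
    define D where "D = {t\<in>{a..b}. g t \<ge> e/4}"
    have gm: "g \<in> borel_measurable (lebesgue_on {a..b})"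
      using ga by (simp add: absolutely_integrable_on_iff_integrable borel_measurable_integrable)
    have Dm: "D \<in> lmeasurable"
    proof -
      have "D \<in> sets (lebesgue_on {a..b})"
      proof -
        have "{t \<in> space (lebesgue_on {a..b}). e/4 \<le> g t} \<in> sets (lebesgue_on {a..b})"
          using gm unfolding borel_measurable_iff_ge by blast
        then show ?thesis by (simp add: D_def)
      qed
      then have "D \<in> sets lebesgue" by (simp add: sets_restrict_space_iff)
      moreover have "bounded D"
        by (rule bounded_subset[OF bounded_closed_interval[of a b]]) (auto simp: D_def)
      ultimately show ?thesis by (rule bounded_set_imp_lmeasurable[rotated])
    qed
    have gD: "g integrable_on D"
      using absolutely_integrable_on_def set_integrable_subset[OF ga, of D] Dm D_def by blast
    have DM: "e/4 * measure lebesgue D \<le> integral {a..b} g"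
    proof -
      have "e/4 * measure lebesgue D = integral D (\<lambda>t. e/4 * 1)"
        by (simp only: integral_mult_right lmeasure_integral[OF Dm])
      also have "\<dots> = integral D (\<lambda>t. e/4)" by simp
      also have "\<dots> \<le> integral D g"
        using Dm gD by (intro integral_le) (auto simp: D_def intro: integrable_on_const)
      also have "\<dots> \<le> integral {a..b} g"
        using gD g0 by (intro integral_subset_le gi) (auto simp: D_def)
      finally show ?thesis .
    qed
    have "bad e \<subseteq> T \<union> D"
    proof
      fix t assume t: "t \<in> bad e"
      show "t \<in> T \<union> D"
      proof (rule ccontr)
        assume not: "t \<notin> T \<union> D"
        have tab: "t \<in> {a<..<b}" using t by (simp add: bad_def)
        have gt: "g t < e/4" using not tab by (auto simp: D_def)
        have "isCont w t" using w(1) by (simp add: continuous_on_eq_continuous_at)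
        then obtain d1 where d1: "d1 > 0" "\<And>s. \<bar>s - t\<bar> < d1 \<Longrightarrow> norm (w s - w t) < e/4"
          using \<open>e/4 > 0\<close> unfolding continuous_at_eps_delta by (metis dist_norm real_norm_def)
        define d where "d = min d1 (min (t - a) (b - t))"
        have "d > 0" using d1 tab by (auto simp: d_def)
        then obtain s where s: "s \<in> {a<..<b}" "s \<noteq> t" "\<bar>s - t\<bar> < d"
           "norm (integral {a..s} f - integral {a..t} f - (s - t) *\<^sub>R f t) > e * \<bar>s - t\<bar>"
          using t by (auto simp: bad_def)
        define r where "r = \<bar>s - t\<bar>"
        define u v where "u = min s t" and "v = max s t"
        have uv: "u < v" "{u..v} \<subseteq> {a..b}" "v - u = r" "{u..v} \<subseteq> {t - r..t + r}" "{t-r..t+r} \<subseteq> {a..b}"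
          using s tab by (auto simp: u_def v_def r_def d_def)
        have "r > 0" using s by (simp add: r_def)
        have gI: "integral {t - r..t + r} g \<le> e/4 * r"
          using not T(3) \<open>r > 0\<close> uv(5) by (force simp: not_less)
        have A: "integral {a..s} f - integral {a..t} f - (s - t) *\<^sub>R f t
           = sgn (s - t) *\<^sub>R (integral {u..v} (\<lambda>x. f x - w x) + integral {u..v} (\<lambda>x. w x - w t) + r *\<^sub>R (w t - f t))"
        proof -
          have 1: "integral {u..v} (\<lambda>x. f x - w x) = integral {u..v} f - integral {u..v} w"
            by (rule HK_integral_diff) (use uv If wi in \<open>auto intro: integrable_subinterval_real\<close>)
          have 2: "integral {u..v} (\<lambda>x. w x - w t) = integral {u..v} w - r *\<^sub>R w t"
            using uv by (subst HK_integral_diff) (use uv wi in \<open>auto intro: integrable_subinterval_real\<close>)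
          show ?thesis
            unfolding 1 2 using seg[OF If tab s(1)] s(2)
            by (auto simp: u_def v_def r_def sgn_if algebra_simps min_def max_def)
        qed
        have B1: "norm (integral {u..v} (\<lambda>x. f x - w x)) \<le> e/4 * r"
        proof -
          have "norm (integral {u..v} (\<lambda>x. f x - w x)) \<le> integral {u..v} g"
            by (rule integral_norm_bound_integral) (use uv integrable_subinterval_real[OF di] integrable_subinterval_real[OF gi] in \<open>auto simp: g_def\<close>)
          also have "\<dots> \<le> integral {t-r..t+r} g"
            by (rule integral_subset_le) (use uv gi g0 in \<open>auto intro: integrable_subinterval_real\<close>)
          finally show ?thesis using gI by simp
        qed
        have B2: "norm (integral {u..v} (\<lambda>x. w x - w t)) \<le> e/4 * r"
        proof -
          have "norm (integral {u..v} (\<lambda>x. w x - w t)) \<le> e/4 * (v - u)"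
          proof (rule integral_bound)
            show "continuous_on {u..v} (\<lambda>x. w x - w t)"
              by (intro continuous_intros continuous_on_subset[OF w(1)]) auto
            fix x assume "x \<in> {u..v}"
            then have "\<bar>x - t\<bar> \<le> r" using uv by (auto simp: subset_iff abs_le_iff)
            then have "\<bar>x - t\<bar> < d1" using s by (simp add: r_def d_def)
            then show "norm (w x - w t) \<le> e/4" using d1(2)[of x] by simp
          qed (use uv in auto)
          then show ?thesis using uv by simp
        qed
        have B3: "norm (r *\<^sub>R (w t - f t)) \<le> e/4 * r"
          using gt \<open>r > 0\<close> by (simp add: g_def norm_minus_commute)
        have "norm (integral {a..s} f - integral {a..t} f - (s - t) *\<^sub>R f t)
            = norm (integral {u..v} (\<lambda>x. f x - w x) + integral {u..v} (\<lambda>x. w x - w t) + r *\<^sub>R (w t - f t))"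
          unfolding A using s(2) by (simp add: sgn_if)
        also have "\<dots> \<le> e/4 * r + e/4 * r + e/4 * r"
          using B1 B2 B3 by (intro norm_triangle_le add_mono) auto
        also have "\<dots> \<le> e * \<bar>s - t\<bar>" using \<open>r > 0\<close> \<open>e > 0\<close> by (simp add: r_def)
        finally show False using s(4) by simp
      qed
    qed
    moreover have "T \<union> D \<in> lmeasurable" using T Dm by blast
    moreover have "measure lebesgue (T \<union> D) \<le> \<epsilon>"
    proof -
      have "measure lebesgue (T \<union> D) \<le> measure lebesgue T + measure lebesgue D"
        using T Dm by (intro measure_Un_le) auto
      also have "\<dots> \<le> 40 / e * integral {a..b} g + 4 / e * integral {a..b} g"
        using T(2) DM \<open>e > 0\<close> by (intro add_mono) (auto simp: field_simps)
      also have "\<dots> = 44 / e * integral {a..b} g" using \<open>e > 0\<close> by (simp add: field_simps)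
      also have "\<dots> \<le> 44 / e * \<eta>" using w(2) \<open>e > 0\<close> by (intro mult_left_mono) (auto simp: g_def[abs_def])
      also have "\<dots> = \<epsilon>" using \<open>e > 0\<close> by (simp add: \<eta>_def)
      finally show ?thesis .
    qed
    ultimately show "\<exists>T. bad e \<subseteq> T \<and> T \<in> lmeasurable \<and> measure lebesgue T \<le> \<epsilon>" by blast
  qed
  then have neg: "negligible (\<Union>n. bad (inverse (real (Suc n))))"
    by (intro negligible_Union_nat) auto
  show ?thesis
  proof (rule that[OF neg])
    fix t assume t: "t \<in> {a<..<b} - (\<Union>n. bad (inverse (real (Suc n))))"
    show "((\<lambda>s. integral {a..s} f) has_vector_derivative f t) (at t)"
      unfolding has_vector_derivative_def has_derivative_at_alt
    proof (intro conjI allI impI)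
      show "bounded_linear (\<lambda>x. x *\<^sub>R f t)" by (rule bounded_linear_scaleR_left)
      fix e :: real assume "e > 0"
      then obtain n where n: "inverse (real (Suc n)) < e" using reals_Archimedean by blast
      have "t \<notin> bad (inverse (real (Suc n)))" using t by blast
      then obtain d where d: "d > 0" and d': "\<not> (\<exists>s\<in>{a<..<b}. s \<noteq> t \<and> \<bar>s - t\<bar> < d \<and>
         norm (integral {a..s} f - integral {a..t} f - (s - t) *\<^sub>R f t) > inverse (real (Suc n)) * \<bar>s - t\<bar>)"
        using t unfolding bad_def by blast
      show "\<exists>d>0. \<forall>y. norm (y - t) < d \<longrightarrow>
         norm (integral {a..y} f - integral {a..t} f - (y - t) *\<^sub>R f t) \<le> e * norm (y - t)"
      proof (intro exI conjI allI impI)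
        show "min d (min (t - a) (b - t)) > 0" using d t by auto
        fix y assume y: "norm (y - t) < min d (min (t - a) (b - t))"
        show "norm (integral {a..y} f - integral {a..t} f - (y - t) *\<^sub>R f t) \<le> e * norm (y - t)"
        proof (cases "y = t")
          case False
          have "y \<in> {a<..<b}" "\<bar>y - t\<bar> < d" using y by (auto simp: abs_less_iff)
          have "norm (integral {a..y} f - integral {a..t} f - (y - t) *\<^sub>R f t) \<le> inverse (real (Suc n)) * \<bar>y - t\<bar>"
            using d' False \<open>y \<in> {a<..<b}\<close> \<open>\<bar>y - t\<bar> < d\<close> unfolding not_less[symmetric] by blast
          also have "\<dots> \<le> e * norm (y - t)" using n by (simp add: mult_right_mono)
          finally show ?thesis .
        qed auto
      qed
    qed
  qed
qed

section \<open>Sobolev functions on an interval\<close>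

lemma bilinear_scaleR_real: "bilinear (\<lambda>(r::real) (v::'b::euclidean_space). r *\<^sub>R v)"
  by (simp add: bilinear_conv_bounded_bilinear bounded_bilinear_scaleR)

lemma continuous_on_bounded_norm_Icc:
  fixes f :: "real \<Rightarrow> 'b::real_normed_vector"
  assumes "continuous_on {a..b} f"
  obtains B where "B > 0" "\<And>t. t \<in> {a..b} \<Longrightarrow> norm (f t) \<le> B"
proof -
  have "bounded (f ` {a..b})" by (intro compact_imp_bounded compact_continuous_image assms) auto
  then show ?thesis using that by (auto simp: bounded_pos)
qed

text \<open>The defect \<open>L\<close> of the formula is linear in \<open>f\<close> and bounded by
  a multiple of the L1 norm of \<open>f\<close>. It vanishes for continuous \<open>f\<close> by the
  product rule and the fundamental theorem of calculus, hence for all \<open>f\<close> by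
  density.\<close>

lemma integral_by_parts_primitive:
  fixes f :: "real \<Rightarrow> 'b::euclidean_space"
  assumes ab: "a \<le> b" and f: "f absolutely_integrable_on {a..b}"
    and p: "\<And>t. t \<in> {a..b} \<Longrightarrow> (p has_real_derivative p' t) (at t within {a..b})"
    and p': "continuous_on {a..b} p'"
  shows "integral {a..b} (\<lambda>t. p' t *\<^sub>R integral {a..t} f) =
    p b *\<^sub>R integral {a..b} f - integral {a..b} (\<lambda>t. p t *\<^sub>R f t)"
proof -
  define L where "L f = integral {a..b} (\<lambda>t. p' t *\<^sub>R integral {a..t} f) -
    (p b *\<^sub>R integral {a..b} f - integral {a..b} (\<lambda>t. p t *\<^sub>R f t))" for f :: "real \<Rightarrow> 'b"
  have pc: "continuous_on {a..b} p"
    unfolding continuous_on_eq_continuous_within using p DERIV_continuous by blast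
  obtain P where P: "P > 0" "\<And>t. t \<in> {a..b} \<Longrightarrow> \<bar>p t\<bar> \<le> P" "\<And>t. t \<in> {a..b} \<Longrightarrow> \<bar>p' t\<bar> \<le> P"
  proof -
    obtain P1 where "P1 > 0" "\<And>t. t \<in> {a..b} \<Longrightarrow> norm (p t) \<le> P1"
      using continuous_on_bounded_norm_Icc[OF pc] by blast
    moreover obtain P2 where "P2 > 0" "\<And>t. t \<in> {a..b} \<Longrightarrow> norm (p' t) \<le> P2"
      using continuous_on_bounded_norm_Icc[OF p'] by blast
    ultimately show ?thesis by (intro that[of "P1 + P2"]) force+
  qed
  have aint: "h integrable_on {a..b}" if "h absolutely_integrable_on {a..b}" for h :: "real \<Rightarrow> 'b"
    using that set_lebesgue_integral_eq_integral(1) by blast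
  have i1: "(\<lambda>t. p' t *\<^sub>R integral {a..t} h) integrable_on {a..b}" if "h absolutely_integrable_on {a..b}" for h :: "real \<Rightarrow> 'b"
    by (intro integrable_continuous_real continuous_intros p' indefinite_integral_continuous_1 aint that)
  have i2: "(\<lambda>t. p t *\<^sub>R h t) absolutely_integrable_on {a..b}" if h: "h absolutely_integrable_on {a..b}" for h :: "real \<Rightarrow> 'b"
  proof (rule absolutely_integrable_bounded_measurable_product[OF bilinear_scaleR_real])
    show "p \<in> borel_measurable (lebesgue_on {a..b})"
      using pc by (intro continuous_imp_measurable_on_sets_lebesgue) auto
    show "bounded (p ` {a..b})" using P by (intro boundedI[of _ P]) auto
  qed (use h in auto)
  have Ldiff: "L (\<lambda>t. h t - k t) = L h - L k"
    if hk: "h absolutely_integrable_on {a..b}" "k absolutely_integrable_on {a..b}" for h k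
  proof -
    have 1: "integral {a..b} (\<lambda>t. p' t *\<^sub>R integral {a..t} (\<lambda>t. h t - k t))
      = integral {a..b} (\<lambda>t. p' t *\<^sub>R integral {a..t} h - p' t *\<^sub>R integral {a..t} k)"
    proof (rule integral_cong)
      fix t assume "t \<in> {a..b}"
      then have "integral {a..t} (\<lambda>t. h t - k t) = integral {a..t} h - integral {a..t} k"
        by (intro HK_integral_diff integrable_subinterval_real[OF aint]) (use hk in auto)
      then show "p' t *\<^sub>R integral {a..t} (\<lambda>t. h t - k t) = p' t *\<^sub>R integral {a..t} h - p' t *\<^sub>R integral {a..t} k"
        by (simp only: scaleR_diff_right)
    qed
    show ?thesis unfolding L_def 1
      using hk i1[OF hk(1)] i1[OF hk(2)] aint[OF hk(1)] aint[OF hk(2)] aint[OF i2[OF hk(1)]] aint[OF i2[OF hk(2)]]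
      by (simp add: HK_integral_diff algebra_simps)
  qed
  have Lbnd: "norm (L h) \<le> P * (b - a + 2) * integral {a..b} (\<lambda>t. norm (h t))"
    if h: "h absolutely_integrable_on {a..b}" for h
  proof -
    define N where "N = integral {a..b} (\<lambda>t. norm (h t))"
    have ni: "(\<lambda>t. norm (h t)) integrable_on {a..b}"
      using h absolutely_integrable_on_def by blast
    have N: "norm (integral {a..t} h) \<le> N" if "t \<in> {a..b}" for t
    proof -
      have "norm (integral {a..t} h) \<le> integral {a..t} (\<lambda>t. norm (h t))"
        by (rule integral_norm_bound_integral)
           (use that aint[OF h] ni in \<open>auto intro: integrable_subinterval_real\<close>)
      also have "\<dots> \<le> N" unfolding N_def
        by (rule integral_subset_le) (use that ni in \<open>auto intro: integrable_subinterval_real\<close>)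
      finally show ?thesis .
    qed
    have "norm (integral {a..b} (\<lambda>t. p' t *\<^sub>R integral {a..t} h)) \<le> P * N * (b - a)"
      using ab
    proof (rule integral_bound)
      show "continuous_on {a..b} (\<lambda>t. p' t *\<^sub>R integral {a..t} h)"
        by (intro continuous_intros p' indefinite_integral_continuous_1 aint h)
      show "norm (p' t *\<^sub>R integral {a..t} h) \<le> P * N" if "t \<in> {a..b}" for t
        using P that N[OF that] by (auto intro!: mult_mono)
    qed
    moreover have "norm (p b *\<^sub>R integral {a..b} h) \<le> P * N"
      using P(2)[of b] N[of b] ab P(1) by (auto intro!: mult_mono)
    moreover have "norm (integral {a..b} (\<lambda>t. p t *\<^sub>R h t)) \<le> integral {a..b} (\<lambda>t. P * norm (h t))"
      by (rule integral_norm_bound_integral)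
         (use aint[OF i2[OF h]] ni P in \<open>auto intro: mult_right_mono integrable_cmul[of "\<lambda>t. norm (h t)" _ P, simplified]\<close>)
    moreover have "integral {a..b} (\<lambda>t. P * norm (h t)) = P * N" by (simp add: N_def)
    ultimately have "norm (L h) \<le> P * N * (b - a) + (P * N + P * N)"
      unfolding L_def by (intro order_trans[OF norm_triangle_ineq4] add_mono) auto
    also have "\<dots> = P * (b - a + 2) * N" by (simp add: algebra_simps)
    finally show ?thesis by (simp add: N_def)
  qed
  have L0: "L w = 0" if w: "continuous_on {a..b} w" for w
  proof -
    have d: "((\<lambda>u. integral {a..u} w) has_vector_derivative w t) (at t within {a..b})" if "t \<in> {a..b}" for t
      by (rule integral_has_vector_derivative[OF w that])
    have "((\<lambda>t. p t *\<^sub>R w t + p' t *\<^sub>R integral {a..t} w) has_integral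
        (p b *\<^sub>R integral {a..b} w - p a *\<^sub>R integral {a..a} w)) {a..b}"
      by (rule fundamental_theorem_of_calculus[OF ab])
         (use has_vector_derivative_scaleR[OF p d] in auto)
    then have "integral {a..b} (\<lambda>t. p t *\<^sub>R w t + p' t *\<^sub>R integral {a..t} w) = p b *\<^sub>R integral {a..b} w"
      by (simp add: integral_unique)
    moreover have "integral {a..b} (\<lambda>t. p t *\<^sub>R w t + p' t *\<^sub>R integral {a..t} w)
      = integral {a..b} (\<lambda>t. p t *\<^sub>R w t) + integral {a..b} (\<lambda>t. p' t *\<^sub>R integral {a..t} w)"
      using w by (intro HK_integral_add aint i1 i2) (auto intro: absolutely_integrable_continuous_real)
    ultimately show ?thesis by (simp add: L_def algebra_simps)
  qed
  have "norm (L f) \<le> e" if "e > 0" for e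
  proof -
    define \<delta> where "\<delta> = e / (P * (b - a + 2))"
    have pos: "P * (b - a + 2) > 0" using P ab by auto
    then have "\<delta> > 0" using \<open>e > 0\<close> by (simp add: \<delta>_def)
    then obtain w where w: "continuous_on UNIV w" "integral {a..b} (\<lambda>t. norm (f t - w t)) < \<delta>"
      using absolutely_integrable_approximate_continuous[OF f] by blast
    have wc: "continuous_on {a..b} w" using w(1) by (rule continuous_on_subset) auto
    have wa: "w absolutely_integrable_on {a..b}" using wc by (rule absolutely_integrable_continuous_real)
    have "norm (L f) = norm (L (\<lambda>t. f t - w t))" using Ldiff[OF f wa] L0[OF wc] by simp
    also have "\<dots> \<le> P * (b - a + 2) * integral {a..b} (\<lambda>t. norm (f t - w t))"
      by (rule Lbnd) (intro set_integral_diff f wa)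
    also have "\<dots> \<le> P * (b - a + 2) * \<delta>" using pos w(2) by (intro mult_left_mono) auto
    also have "\<dots> = e"
      unfolding \<delta>_def by (simp only: times_divide_eq_right nonzero_mult_div_cancel_left[OF less_imp_neq[OF pos, symmetric]])
    finally show ?thesis .
  qed
  then have "L f = 0" by (metis field_le_epsilon add_0 norm_le_zero_iff)
  then show ?thesis by (simp add: L_def)
qed

lemma continuous_scaleR_absolutely_integrable:
  fixes h :: "real \<Rightarrow> 'b::euclidean_space"
  assumes "continuous_on {a..b} p" "h absolutely_integrable_on {a..b}"
  shows "(\<lambda>t. p t *\<^sub>R h t) absolutely_integrable_on {a..b}"
proof (rule absolutely_integrable_bounded_measurable_product[OF bilinear_scaleR_real])
  show "p \<in> borel_measurable (lebesgue_on {a..b})"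
    using assms(1) by (rule continuous_imp_measurable_on_sets_lebesgue) auto
  show "bounded (p ` {a..b})"
    by (intro compact_imp_bounded compact_continuous_image assms(1)) auto
qed (use assms in auto)

section \<open>Weak derivatives and du Bois-Reymond's lemma\<close>

lemma test_function_facts:
  assumes p: "test_function a b p"
  shows "(p has_real_derivative deriv p t) (at t within S)" "continuous_on S (deriv p)" "continuous_on S p"
    "t \<notin> {a<..<b} \<Longrightarrow> p t = 0"
proof -
  obtain D where D: "\<And>t. (p has_vector_derivative D t) (at t)" "continuous_on UNIV D"
    using p unfolding test_function_def C1_differentiable_on_def by auto
  have "deriv p = D"
    using D(1) by (auto simp: fun_eq_iff has_real_derivative_iff_has_vector_derivative[symmetric] intro: DERIV_imp_deriv)
  then show d: "(p has_real_derivative deriv p t) (at t within S)" "continuous_on S (deriv p)" for t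
    using D by (auto simp: has_real_derivative_iff_has_vector_derivative has_vector_derivative_at_within intro: continuous_on_subset)
  then show "continuous_on S p"
    unfolding continuous_on_eq_continuous_within using DERIV_continuous by blast
  show "p t = 0" if "t \<notin> {a<..<b}"
    using that p closure_subset[of "{t. p t \<noteq> 0}"] unfolding test_function_def by blast
qed

text \<open>Test functions are obtained by prescribing their derivative. The vanishing mean of
  \<open>w\<close> makes the primitive return to 0 to the right of \<open>M\<close>, so its support
  stays inside \<open>{m..M}\<close>.\<close>

lemma test_function_primitive:
  assumes w: "continuous_on UNIV w" and z: "\<And>t. t \<notin> {m..M} \<Longrightarrow> w t = 0"
    and mM: "a < m" "m \<le> M" "M < b" and int0: "integral {a..b} w = 0"
  shows "test_function a b (\<lambda>t. integral {a..t} w)"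
    and "((\<lambda>t. integral {a..t} w) has_real_derivative w t) (at t)"
proof -
  define \<Phi> where "\<Phi> t = integral {a..t} w" for t
  have ii: "w integrable_on {x..y}" for x y
    by (intro integrable_continuous_real continuous_on_subset[OF w]) auto
  have z1: "integral {x..y} w = 0" if "y < m \<or> M < x" for x y
  proof -
    have "integral {x..y} w = integral {x..y} (\<lambda>_. 0)"
      using that z by (intro integral_cong) auto
    then show ?thesis by simp
  qed
  have ext: "\<Phi> u = integral {A..u} w" if "A \<le> a" "A \<le> u" for A u
  proof (cases "a \<le> u")
    case True
    then have "integral {A..a} w + integral {a..u} w = integral {A..u} w"
      using that ii by (intro HK_integral_combine) auto
    then show ?thesis using z1[of a A] mM by (simp add: \<Phi>_def)
  next
    case False
    then show ?thesis using z1[of u A] mM by (simp add: \<Phi>_def)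
  qed
  have der: "(\<Phi> has_vector_derivative w t) (at t)" for t
  proof -
    \<comment> \<open>Integrating from a point to the left of both \<open>a\<close> and
      \<open>t\<close> gives a two-sided derivative at \<open>t\<close> even when
      \<open>t \<le> a\<close>.\<close>
    define A where "A = min a t - 1"
    have "((\<lambda>u. integral {A..u} w) has_vector_derivative w t) (at t within {A..t+1})"
      by (rule integral_has_vector_derivative) (auto simp: A_def intro: continuous_on_subset[OF w])
    moreover have "at t within {A..t+1} = at t"
      by (rule at_within_interior) (auto simp: A_def)
    ultimately have "((\<lambda>u. integral {A..u} w) has_vector_derivative w t) (at t)" by simp
    then show ?thesis
      by (rule has_vector_derivative_transform_within_open[where S="{A<..}"]) (use ext[of A] in \<open>auto simp: A_def\<close>)
  qed
  have "\<Phi> t = 0" if "t \<notin> {m..M}" for t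
  proof (cases "t < m")
    case True then show ?thesis using z1[of t a] by (simp add: \<Phi>_def)
  next
    case False
    then have "M < t" using that by auto
    show ?thesis
    proof (cases "t \<le> b")
      case True
      then have "integral {a..t} w + integral {t..b} w = integral {a..b} w"
        using ii mM \<open>M < t\<close> by (intro HK_integral_combine) auto
      then show ?thesis using z1[of b t] \<open>M < t\<close> int0 by (simp add: \<Phi>_def)
    next
      case False
      then have "integral {a..b} w + integral {b..t} w = integral {a..t} w"
        using ii mM by (intro HK_integral_combine) auto
      then show ?thesis using z1[of t b] mM int0 by (simp add: \<Phi>_def)
    qed
  qed
  then have "closure {t. \<Phi> t \<noteq> 0} \<subseteq> {m..M}"
    by (intro closure_minimal closed_atLeastAtMost) blast
  then have "test_function a b \<Phi>"
    using der w mM unfolding test_function_def C1_differentiable_on_def by fastforce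
  then show "test_function a b (\<lambda>t. integral {a..t} w)" by (simp add: \<Phi>_def[abs_def])
  show "((\<lambda>t. integral {a..t} w) has_real_derivative w t) (at t)"
    using der[of t] by (simp add: \<Phi>_def[abs_def] has_real_derivative_iff_has_vector_derivative)
qed

text \<open>Du Bois-Reymond's lemma. Testing against primitives of functions with mean zero shows
  that the integral of \<open>u\<close> against a trapezoid is a fixed multiple \<open>c\<close> of
  the integral of that trapezoid. Letting the trapezoids tend to indicators of intervals gives
  \<open>integral {s..t} u = (t - s) *\<^sub>R c\<close>, and Lebesgue differentiation gives
  \<open>u = c\<close>.\<close>

lemma weakly_constant_imp_constant_AE:
  fixes u :: "real \<Rightarrow> 'b::euclidean_space"
  assumes ab: "a < b" and u: "u absolutely_integrable_on {a..b}"
    and w: "\<And>p. test_function a b p \<Longrightarrow> integral {a..b} (\<lambda>t. deriv p t *\<^sub>R u t) = 0"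
  obtains c where "AE t in lebesgue_on {a..b}. u t = c"
proof -
  \<comment> \<open>A continuous trapezoid supported in \<open>{s..t}\<close> with slopes
    \<open>n\<close>; it tends to the indicator of the open interval as \<open>n\<close>
    grows.\<close>
  define h where "h n s t r = max 0 (min 1 (real n * min (r - s) (t - r)))" for n s t r
  have hc: "continuous_on UNIV (h n s t)" for n s t
    unfolding h_def by (intro continuous_intros)
  have hz: "h n s t r = 0" if "r \<notin> {s..t}" for n s t r
  proof -
    have "min (r - s) (t - r) \<le> 0" using that by auto
    then have "real n * min (r - s) (t - r) \<le> 0" by (rule mult_nonneg_nonpos[OF of_nat_0_le_iff])
    then show ?thesis by (simp add: h_def)
  qed
  have h01: "0 \<le> h n s t r" "h n s t r \<le> 1" for n s t r by (auto simp: h_def)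
  have ii: "h n s t integrable_on {x..y}" for n s t x y
    by (intro integrable_continuous_real continuous_on_subset[OF hc]) auto
  have prod: "(\<lambda>r. h n s t r *\<^sub>R u r) absolutely_integrable_on {a..b}" for n s t
  proof (rule absolutely_integrable_bounded_measurable_product[OF bilinear_scaleR_real])
    show "h n s t \<in> borel_measurable (lebesgue_on {a..b})"
      by (intro continuous_imp_measurable_on_sets_lebesgue continuous_on_subset[OF hc]) auto
    show "bounded (h n s t ` {a..b})" using h01 by (auto simp: bounded_iff intro!: exI[of _ 1])
  qed (use u in auto)
  have prodi: "(\<lambda>r. h n s t r *\<^sub>R u r) integrable_on {a..b}" for n s t
    using prod set_lebesgue_integral_eq_integral(1) by blast
  define s0 t0 where "s0 = a + (b - a)/3" and "t0 = a + 2*(b - a)/3"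
  have st0: "a < s0" "s0 < t0" "t0 < b" using ab by (auto simp: s0_def t0_def field_simps)
  define \<kappa> where "\<kappa> = integral {a..b} (h 1 s0 t0)"
  have "\<kappa> \<noteq> 0"
  proof
    assume "\<kappa> = 0"
    then have "(h 1 s0 t0 has_integral 0) (cbox a b)"
      using ii[of 1 s0 t0 a b] by (simp add: \<kappa>_def has_integral_integrable_integral)
    then have "h 1 s0 t0 ((s0 + t0)/2) = 0"
      using st0 h01(1) by (intro has_integral_0_cbox_imp_0[of a b "h 1 s0 t0"]) (auto intro: continuous_on_subset[OF hc])
    then show False using st0 by (auto simp: h_def min_def max_def field_simps split: if_splits)
  qed
  define I where "I k = integral {a..b} (\<lambda>r. k r *\<^sub>R u r)" for k
  define c where "c = (1/\<kappa>) *\<^sub>R I (h 1 s0 t0)"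
  have key: "I (h n s t) = integral {a..b} (h n s t) *\<^sub>R c" if st: "a < s" "s < t" "t < b" for n s t
  proof -
    define q where "q = integral {a..b} (h n s t) / \<kappa>"
    \<comment> \<open>Subtracting the right multiple of one fixed trapezoid makes the mean vanish,
      so that \<open>k\<close> is the derivative of a test function.\<close>
    define k where "k r = h n s t r - q * h 1 s0 t0 r" for r
    have c: "continuous_on UNIV k" unfolding k_def by (intro continuous_intros hc)
    have z: "k r = 0" if "r \<notin> {min s s0..max t t0}" for r
    proof -
      have "r \<notin> {s..t}" "r \<notin> {s0..t0}" using that by auto
      then show ?thesis by (simp add: k_def hz)
    qed
    have i: "integral {a..b} k = 0"
      unfolding k_def using \<open>\<kappa> \<noteq> 0\<close> ii
      by (subst HK_integral_diff) (auto simp: q_def \<kappa>_def integrable_on_cmult_left[of "h 1 s0 t0", simplified] intro!: integrable_on_mult_right)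
    have m: "a < min s s0" "min s s0 \<le> max t t0" "max t t0 < b" using st st0 by auto
    obtain \<Phi> where \<Phi>: "test_function a b \<Phi>" "\<And>t. (\<Phi> has_real_derivative k t) (at t)"
      using test_function_primitive[OF c z m i] by simp
    have "deriv \<Phi> = k" using \<Phi>(2) by (auto intro: DERIV_imp_deriv)
    then have "integral {a..b} (\<lambda>r. k r *\<^sub>R u r) = 0" using w[OF \<Phi>(1)] by simp
    moreover have "integral {a..b} (\<lambda>r. k r *\<^sub>R u r) = I (h n s t) - q *\<^sub>R I (h 1 s0 t0)"
    proof -
      have "integral {a..b} (\<lambda>r. k r *\<^sub>R u r) = integral {a..b} (\<lambda>r. h n s t r *\<^sub>R u r - q *\<^sub>R (h 1 s0 t0 r *\<^sub>R u r))"
        by (simp add: k_def algebra_simps)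
      also have "\<dots> = I (h n s t) - q *\<^sub>R I (h 1 s0 t0)"
        unfolding I_def using prodi by (subst HK_integral_diff) (auto intro: integrable_cmul simp del: scaleR_scaleR)
      finally show ?thesis .
    qed
    ultimately show ?thesis using \<open>\<kappa> \<noteq> 0\<close> by (simp add: q_def c_def)
  qed
  have ui: "u integrable_on {a..b}" using u set_lebesgue_integral_eq_integral(1) by blast
  have seg: "integral {s..t} u = (t - s) *\<^sub>R c" if st: "a < s" "s < t" "t < b" for s t
  proof -
    have lim: "(\<lambda>n. h n s t r) \<longlonglongrightarrow> indicator {s<..<t} r" for r
    proof (cases "r \<in> {s<..<t}")
      case True
      define d where "d = min (r - s) (t - r)"
      have "d > 0" using True by (auto simp: d_def)
      have "\<forall>\<^sub>F n in sequentially. h n s t r = indicator {s<..<t} r"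
        using eventually_ge_at_top[of "nat \<lceil>1/d\<rceil>"]
      proof eventually_elim
        case (elim n)
        then have "1/d \<le> real n" by linarith
        then have "1 \<le> real n * d" using \<open>d > 0\<close> by (simp add: field_simps)
        then show ?case using True by (simp add: h_def d_def)
      qed
      then show ?thesis by (rule tendsto_eventually)
    next
      case False
      then have "h n s t r = 0" for n
    proof (cases "r = s \<or> r = t")
      case True
      then show ?thesis using st by (auto simp: h_def)
    next
      case F: False
      then have "r \<notin> {s..t}" using False by auto
      then show ?thesis by (rule hz)
    qed
      then show ?thesis using False by simp
    qed
    let ?M = "lebesgue_on {a..b}"
    have uM: "integrable ?M u" using u by (simp add: absolutely_integrable_on_iff_integrable)
    have hm: "h n s t \<in> borel_measurable ?M" for n
      by (intro continuous_imp_measurable_on_sets_lebesgue continuous_on_subset[OF hc]) auto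
    have ss: "{s<..<t} \<in> sets ?M" using st by (auto simp: sets_restrict_space_iff)
    then have im: "(indicator {s<..<t} :: real \<Rightarrow> real) \<in> borel_measurable ?M"
      by (rule borel_measurable_indicator)
    have "(\<lambda>n. integral\<^sup>L ?M (\<lambda>r. h n s t r *\<^sub>R u r)) \<longlonglongrightarrow> integral\<^sup>L ?M (\<lambda>r. indicator {s<..<t} r *\<^sub>R u r)"
    proof (rule integral_dominated_convergence[where w="\<lambda>r. norm (u r)"])
      show "AE r in ?M. (\<lambda>n. h n s t r *\<^sub>R u r) \<longlonglongrightarrow> indicator {s<..<t} r *\<^sub>R u r"
        by (intro AE_I2 tendsto_intros lim)
      show "AE r in ?M. norm (h n s t r *\<^sub>R u r) \<le> norm (u r)" for n
        using h01 by (intro AE_I2) (auto intro: mult_left_le_one_le)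
    qed (use uM hm im in \<open>auto intro!: borel_measurable_scaleR\<close>)
    moreover have "integral\<^sup>L ?M (\<lambda>r. h n s t r *\<^sub>R u r) = I (h n s t)" for n
      unfolding I_def by (rule lebesgue_integral_eq_integral) (use prod in \<open>auto simp: absolutely_integrable_on_iff_integrable\<close>)
    moreover have "integral\<^sup>L ?M (\<lambda>r. indicator {s<..<t} r *\<^sub>R u r) = integral {s..t} u"
    proof -
      have "integral\<^sup>L ?M (\<lambda>r. indicator {s<..<t} r *\<^sub>R u r) = integral {a..b} (\<lambda>r. indicator {s<..<t} r *\<^sub>R u r)"
      proof (rule lebesgue_integral_eq_integral)
        show "integrable ?M (\<lambda>r. indicator {s<..<t} r *\<^sub>R u r)"
          by (rule integrable_mult_indicator[OF ss uM])
      qed auto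
      also have "\<dots> = integral {a..b} (\<lambda>r. if r \<in> {s<..<t} then u r else 0)"
        by (rule integral_cong) (auto simp: indicator_def)
      also have "\<dots> = integral {s<..<t} u"
        using st by (subst integral_restrict_Int) (auto simp: Int_absorb1 subset_iff intro!: arg_cong[where f="\<lambda>S. integral S u"])
      also have "\<dots> = integral {s..t} u"
        using integral_open_interval_real by metis
      finally show ?thesis .
    qed
    ultimately have L1: "(\<lambda>n. I (h n s t)) \<longlonglongrightarrow> integral {s..t} u" by simp
    have "(\<lambda>n. integral\<^sup>L ?M (h n s t)) \<longlonglongrightarrow> integral\<^sup>L ?M (indicator {s<..<t})"
    proof (rule integral_dominated_convergence[where w="\<lambda>r. 1"])
      show "AE r in ?M. (\<lambda>n. h n s t r) \<longlonglongrightarrow> indicator {s<..<t} r" by (intro AE_I2 lim)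
      show "AE r in ?M. norm (h n s t r) \<le> 1" for n using h01 by (intro AE_I2) auto
    qed (use hm im in auto)
    moreover have "integral\<^sup>L ?M (h n s t) = integral {a..b} (h n s t)" for n
      by (rule lebesgue_integral_eq_integral) (auto intro!: continuous_imp_integrable_real continuous_on_subset[OF hc])
    moreover have "integral\<^sup>L ?M (indicator {s<..<t}) = t - s"

    proof -
      have "integral\<^sup>L ?M (indicator {s<..<t}) = measure ?M ({s<..<t} \<inter> space ?M)"
        by (rule Bochner_Integration.integral_indicator)
      also have "{s<..<t} \<inter> space ?M = {s<..<t}" using st by auto
      also have "measure ?M {s<..<t} = t - s" using st by (subst measure_restrict_space) auto
      finally show ?thesis .
    qed
    ultimately have "(\<lambda>n. integral {a..b} (h n s t)) \<longlonglongrightarrow> t - s" by simp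
    then have "(\<lambda>n. I (h n s t)) \<longlonglongrightarrow> (t - s) *\<^sub>R c"
      unfolding key[OF st] by (intro tendsto_intros)
    with L1 show ?thesis by (rule LIMSEQ_unique)
  qed
  obtain N where N: "negligible N"
    "\<And>t. t \<in> {a<..<b} - N \<Longrightarrow> ((\<lambda>s. integral {a..s} u) has_vector_derivative u t) (at t)"
    using integral_has_vector_derivative_AE[OF u] by blast
  have uc: "u t = c" if t: "t \<in> {a<..<b} - N" for t
  proof -
    have "((\<lambda>s. integral {a..s} u) has_vector_derivative u t) (at t)" by (rule N(2)[OF t])
    moreover have "((\<lambda>s. integral {a..t} u + (s - t) *\<^sub>R c) has_vector_derivative c) (at t)"
      by (auto intro!: derivative_eq_intros)
    then have "((\<lambda>s. integral {a..s} u) has_vector_derivative c) (at t)"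
    proof (rule has_vector_derivative_transform_within_open[where S="{a<..<b}"])
      fix s assume s: "s \<in> {a<..<b}"
      have *: "integral {a..x} u + integral {x..y} u = integral {a..y} u" if "x \<le> y" "x \<in> {a<..<b}" "y \<in> {a<..<b}" for x y
        using that by (intro HK_integral_combine) (auto intro: integrable_subinterval_real[OF ui])
      show "integral {a..t} u + (s - t) *\<^sub>R c = integral {a..s} u"
        using *[of s t] *[of t s] seg[of s t] seg[of t s] s t
        by (cases s t rule: linorder_cases) (auto simp: algebra_simps)
    qed (use t in auto)
    ultimately show ?thesis by (rule vector_derivative_unique_at)
  qed
  have "negligible (N \<union> {a, b})" using N(1) by (intro negligible_Un) auto
  then have "AE t in lebesgue. t \<notin> N \<union> {a, b}"
    by (intro AE_not_in) (simp add: negligible_iff_null_sets)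
  then have "AE t in lebesgue_on {a..b}. u t = c"
    unfolding AE_restrict_space_iff[of "{a..b}" lebesgue, simplified]
    by (rule AE_mp) (use uc in \<open>auto intro!: AE_I2\<close>)
  then show ?thesis by (rule that)
qed

lemma L2_on_absolutely_integrable:
  assumes "L2_on a b f"
  shows "f absolutely_integrable_on {a..b}"
proof -
  have "integrable (lebesgue_on {a..b}) f"
  proof (rule Bochner_Integration.integrable_bound)
    show "integrable (lebesgue_on {a..b}) (\<lambda>t. 1 + (norm (f t))\<^sup>2)"
      using assms by (auto simp: L2_on_def)
    show "AE t in lebesgue_on {a..b}. norm (f t) \<le> norm (1 + (norm (f t))\<^sup>2)"
    proof (rule AE_I2)
      fix t
      have "0 \<le> (norm (f t) - 1)\<^sup>2" by simp
      then have "2 * norm (f t) \<le> 1 + (norm (f t))\<^sup>2" by (simp add: power2_eq_square algebra_simps)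
      then show "norm (f t) \<le> norm (1 + (norm (f t))\<^sup>2)" using norm_ge_zero[of "f t"] by (simp del: norm_ge_zero)
    qed
  qed (use assms in \<open>auto simp: L2_on_def\<close>)
  then show ?thesis by (simp add: absolutely_integrable_on_iff_integrable)
qed

text \<open>Integration by parts shows that \<open>f\<close> minus the primitive of
  \<open>f'\<close> has weak derivative 0, so du Bois-Reymond's lemma applies to the
  difference.\<close>

lemma weak_deriv_imp_primitive:
  fixes f :: "real \<Rightarrow> 'b::euclidean_space"
  assumes ab: "a < b" and f: "f absolutely_integrable_on {a..b}" and f': "f' absolutely_integrable_on {a..b}"
    and w: "weak_deriv_on a b f f'"
  obtains c where "AE t in lebesgue_on {a..b}. f t = c + integral {a..t} f'"
proof -
  define F where "F t = integral {a..t} f'" for t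
  have f'i: "f' integrable_on {a..b}" using f' set_lebesgue_integral_eq_integral(1) by blast
  have Fc: "continuous_on {a..b} F" unfolding F_def by (rule indefinite_integral_continuous_1[OF f'i])
  have Fa: "F absolutely_integrable_on {a..b}" by (rule absolutely_integrable_continuous_real[OF Fc])
  note prodc = continuous_scaleR_absolutely_integrable
  have "integral {a..b} (\<lambda>t. deriv u t *\<^sub>R (f t - F t)) = 0" if u: "test_function a b u" for u
  proof -
    define D where dD: "D = deriv u"
    note dp = test_function_facts(1)[OF u, of _ "{a..b}", folded dD]
      and Dc = test_function_facts(2)[OF u, of "{a..b}", folded dD]
      and uc = test_function_facts(3)[OF u, of "{a..b}"]
    have b0: "u b = 0" by (rule test_function_facts(4)[OF u]) simp
    have 1: "integral {a..b} (\<lambda>t. D t *\<^sub>R F t) = - integral {a..b} (\<lambda>t. u t *\<^sub>R f' t)"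
      using integral_by_parts_primitive[OF less_imp_le[OF ab] f' dp Dc] b0 by (simp add: F_def)
    have "(\<integral>t. D t *\<^sub>R f t \<partial>lebesgue_on {a..b}) = - (\<integral>t. u t *\<^sub>R f' t \<partial>lebesgue_on {a..b})"
      using w u dD unfolding weak_deriv_on_def by auto
    then have 2: "integral {a..b} (\<lambda>t. D t *\<^sub>R f t) = - integral {a..b} (\<lambda>t. u t *\<^sub>R f' t)"
      using prodc[OF Dc f] prodc[OF uc f']
      by (simp add: absolutely_integrable_on_iff_integrable lebesgue_integral_eq_integral)
    have "integral {a..b} (\<lambda>t. D t *\<^sub>R (f t - F t)) = integral {a..b} (\<lambda>t. D t *\<^sub>R f t) - integral {a..b} (\<lambda>t. D t *\<^sub>R F t)"
      unfolding scaleR_diff_right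
      by (rule HK_integral_diff)
         (use prodc[OF Dc f] prodc[OF Dc Fa] set_lebesgue_integral_eq_integral(1) in blast)+
    then show ?thesis using 1 2 dD by simp
  qed
  then obtain c where "AE t in lebesgue_on {a..b}. f t - F t = c"
    using weakly_constant_imp_constant_AE[OF ab set_integral_diff(1)[OF f Fa]] by blast
  then have "AE t in lebesgue_on {a..b}. f t = c + F t"
    by (rule AE_mp) (auto intro!: AE_I2 simp: algebra_simps)
  then show ?thesis using that by (simp add: F_def)
qed

text \<open>A curve of class \<open>H\<^sup>i\<^sup>+\<^sup>1\<close> in classical terms: it is of class \<open>C\<^sup>i\<close> and its \<open>i\<close>-th derivative is a
  primitive of an \<open>L\<^sup>2\<close> function.\<close>

primrec Hreg :: "nat \<Rightarrow> real \<Rightarrow> real \<Rightarrow> (real \<Rightarrow> 'b::euclidean_space) \<Rightarrow> bool" where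
  "Hreg 0 a b h \<longleftrightarrow> (\<exists>\<phi>. L2_on a b \<phi> \<and> (\<forall>t\<in>{a..b}. h t = h a + integral {a..t} \<phi>))"
| "Hreg (Suc i) a b h \<longleftrightarrow>
     (\<exists>h'. (\<forall>t\<in>{a..b}. (h has_vector_derivative h' t) (at t within {a..b})) \<and> Hreg i a b h')"

lemma Hreg_continuous_on:
  assumes "Hreg i a b h"
  shows "continuous_on {a..b} h"
proof (cases i)
  case 0
  with assms obtain f where f: "L2_on a b f" "\<forall>t\<in>{a..b}. h t = h a + integral {a..t} f"
    unfolding 0 Hreg.simps by blast
  have "f integrable_on {a..b}"
    using L2_on_absolutely_integrable[OF f(1)] set_lebesgue_integral_eq_integral(1) by blast
  then have "continuous_on {a..b} (\<lambda>t. h a + integral {a..t} f)"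
    by (intro continuous_intros indefinite_integral_continuous_1)
  then show ?thesis by (rule continuous_on_eq) (metis f(2))
next
  case (Suc j)
  with assms obtain h' where "\<forall>t\<in>{a..b}. (h has_vector_derivative h' t) (at t within {a..b})"
    unfolding Suc Hreg.simps by blast
  then have "\<And>t. t \<in> {a..b} \<Longrightarrow> continuous (at t within {a..b}) h"
    using has_vector_derivative_continuous by blast
  then show ?thesis by (simp add: continuous_on_eq_continuous_within)
qed

lemma Hreg_cong:
  assumes "Hreg i a b h" "\<And>t. t \<in> {a..b} \<Longrightarrow> f t = h t" "a \<le> b"
  shows "Hreg i a b f"
proof (cases i)
  case 0
  then show ?thesis using assms by auto
next
  case (Suc j)
  then obtain h' where h': "\<forall>t\<in>{a..b}. (h has_vector_derivative h' t) (at t within {a..b})" "Hreg j a b h'"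
    using assms by auto
  have "(f has_vector_derivative h' t) (at t within {a..b})" if "t \<in> {a..b}" for t
    by (rule has_vector_derivative_transform[OF that _ bspec[OF h'(1) that]]) (use assms(2) in auto)
  then show ?thesis using h'(2) unfolding Suc Hreg.simps by blast
qed

lemma continuous_AE_eq_Icc:
  fixes f h :: "real \<Rightarrow> 'b::euclidean_space"
  assumes "continuous_on {a..b} f" "continuous_on {a..b} h" "AE t in lebesgue_on {a..b}. f t = h t" "a < b" "t \<in> {a..b}"
  shows "f t = h t"
proof -
  let ?n = "\<lambda>t. norm (f t - h t)"
  have c: "continuous_on {a..b} ?n" by (intro continuous_intros assms)
  have "integral\<^sup>L (lebesgue_on {a..b}) ?n = integral\<^sup>L (lebesgue_on {a..b}) (\<lambda>t. 0)"
    using assms(3) c by (intro integral_cong_AE) (auto intro: continuous_imp_measurable_on_sets_lebesgue)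
  then have "integral {a..b} ?n = 0"
    using c by (subst (asm) lebesgue_integral_eq_integral) (auto intro: continuous_imp_integrable_real)
  then have "(?n has_integral 0) (cbox a b)"
    using integrable_continuous_real[OF c] by (simp add: has_integral_integrable_integral)
  then have "?n t = 0"
    using assms c by (intro has_integral_0_cbox_imp_0[of a b ?n]) auto
  then show ?thesis by simp
qed

text \<open>The inductive step replaces the weak derivative by its continuous representative
  \<open>h'\<close>. The primitive of \<open>h'\<close> is then differentiable at every point, and
  it agrees almost everywhere with \<open>f\<close>.\<close>

lemma sobolev_on_AE_Hreg:
  fixes f :: "real \<Rightarrow> 'b::euclidean_space"
  assumes "sobolev_on (Suc k) a b f" "a < b"
  shows "\<exists>h. (AE t in lebesgue_on {a..b}. f t = h t) \<and> Hreg k a b h"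
  using assms(1)
proof (induction k arbitrary: f)
  case 0
  then obtain f' where f': "L2_on a b f" "weak_deriv_on a b f f'" "L2_on a b f'" by auto
  obtain c where c: "AE t in lebesgue_on {a..b}. f t = c + integral {a..t} f'"
    using weak_deriv_imp_primitive[OF \<open>a < b\<close> L2_on_absolutely_integrable[OF f'(1)] L2_on_absolutely_integrable[OF f'(3)] f'(2)]
    by blast
  show ?case
    by (intro exI[of _ "\<lambda>t. c + integral {a..t} f'"] conjI c) (use f'(3) in auto)
next
  case (Suc k)
  then obtain f' where f': "L2_on a b f" "weak_deriv_on a b f f'" "sobolev_on (Suc k) a b f'" by auto
  have "L2_on a b f'" using f'(3) by simp
  note f'a = L2_on_absolutely_integrable[OF this]
  obtain c where c: "AE t in lebesgue_on {a..b}. f t = c + integral {a..t} f'"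
    using weak_deriv_imp_primitive[OF \<open>a < b\<close> L2_on_absolutely_integrable[OF f'(1)] f'a f'(2)] by blast
  obtain h' where h': "AE t in lebesgue_on {a..b}. f' t = h' t" "Hreg k a b h'"
    using Suc.IH[OF f'(3)] by blast
  have h'c: "continuous_on {a..b} h'" using h'(2) by (rule Hreg_continuous_on)
  have eq: "integral {a..t} f' = integral {a..t} h'" if "t \<in> {a..b}" for t
  proof -
    have AE: "AE s in lebesgue_on {a..t}. f' s = h' s"
    proof -
      have "AE s in lebesgue. s \<in> {a..b} \<longrightarrow> f' s = h' s"
        using h'(1) by (simp add: AE_restrict_space_iff)
      then have "AE s in lebesgue. s \<in> {a..t} \<longrightarrow> f' s = h' s"
        by (rule AE_mp) (use that in \<open>auto intro!: AE_I2\<close>)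
      then show ?thesis by (simp add: AE_restrict_space_iff)
    qed
    have 1: "integrable (lebesgue_on {a..t}) f'"
      using f'a that absolutely_integrable_on_subinterval[OF f'a, of a t]
      by (simp add: absolutely_integrable_on_iff_integrable[symmetric])
    have 2: "integrable (lebesgue_on {a..t}) h'"
      using h'c that by (intro continuous_imp_integrable_real) (auto intro: continuous_on_subset)
    have "integral\<^sup>L (lebesgue_on {a..t}) f' = integral\<^sup>L (lebesgue_on {a..t}) h'"
      using AE 1 2 by (intro integral_cong_AE) auto
    then show ?thesis using 1 2 by (simp add: lebesgue_integral_eq_integral)
  qed
  define h where "h t = c + integral {a..t} h'" for t
  have "AE t in lebesgue_on {a..b}. f t = h t"
    using c by (rule AE_mp) (auto intro!: AE_I2 simp: h_def eq)
  moreover have "(h has_vector_derivative h' t) (at t within {a..b})" if "t \<in> {a..b}" for t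
    using has_vector_derivative_add[OF has_vector_derivative_const integral_has_vector_derivative[OF h'c that]]
    by (simp add: h_def[abs_def])
  ultimately show ?case using h'(2) unfolding Hreg.simps by blast
qed

lemma sobolev_on_Hreg:
  fixes f :: "real \<Rightarrow> 'b::euclidean_space"
  assumes "sobolev_on (Suc k) a b f" "a < b" "continuous_on {a..b} f"
  shows "Hreg k a b f"
proof -
  obtain h where h: "AE t in lebesgue_on {a..b}. f t = h t" "Hreg k a b h"
    using sobolev_on_AE_Hreg[OF assms(1,2)] by blast
  have "f t = h t" if "t \<in> {a..b}" for t
    using continuous_AE_eq_Icc[OF assms(3) Hreg_continuous_on[OF h(2)] h(1) assms(2) that] by simp
  then show ?thesis using Hreg_cong[OF h(2)] assms(2) by auto
qed

section \<open>Hoelder classes\<close>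

text \<open>\<open>Hol\<close> is for Hoelder: an \<open>L\<^sup>2\<close> bound on the next derivative gives the exponent \<open>1/2\<close>.\<close>

primrec Hol :: "nat \<Rightarrow> real \<Rightarrow> real \<Rightarrow> real \<Rightarrow> (real \<Rightarrow> 'b::real_normed_vector) \<Rightarrow> bool" where
  "Hol 0 B a b h \<longleftrightarrow> (\<forall>t\<in>{a..b}. norm (h t) \<le> B) \<and>
     (\<forall>s\<in>{a..b}. \<forall>t\<in>{a..b}. norm (h t - h s) \<le> B * sqrt \<bar>t - s\<bar>)"
| "Hol (Suc i) B a b h \<longleftrightarrow> (\<forall>t\<in>{a..b}. norm (h t) \<le> B) \<and>
     (\<exists>h'. (\<forall>t\<in>{a..b}. (h has_vector_derivative h' t) (at t within {a..b})) \<and> Hol i B a b h')"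

lemma Hol_bounded: "Hol i B a b h \<Longrightarrow> t \<in> {a..b} \<Longrightarrow> norm (h t) \<le> B"
  by (cases i) auto

lemma Hol_mono: "Hol i B a b h \<Longrightarrow> B \<le> C \<Longrightarrow> Hol i C a b h"
proof (induction i arbitrary: h)
  case 0
  have "norm (h t - h s) \<le> C * sqrt \<bar>t - s\<bar>" if "s \<in> {a..b}" "t \<in> {a..b}" for s t
  proof -
    have "norm (h t - h s) \<le> B * sqrt \<bar>t - s\<bar>" using 0 that by simp
    also have "\<dots> \<le> C * sqrt \<bar>t - s\<bar>" using 0 by (intro mult_right_mono) auto
    finally show ?thesis .
  qed
  moreover have "norm (h t) \<le> C" if "t \<in> {a..b}" for t
    using Hol_bounded[OF 0(1) that] 0(2) by simp
  ultimately show ?case unfolding Hol.simps by blast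
next
  case (Suc i)
  have "norm (h t) \<le> C" if "t \<in> {a..b}" for t
    using Hol_bounded[OF Suc(2) that] Suc(3) by simp
  then show ?case using Suc unfolding Hol.simps by blast
qed

lemma Hol_cong:
  assumes "\<And>t. t \<in> {a..b} \<Longrightarrow> f t = h t" "Hol i B a b h"
  shows "Hol i B a b f"
proof (cases i)
  case 0
  then show ?thesis using assms by simp
next
  case (Suc j)
  then obtain h' where h': "\<forall>t\<in>{a..b}. (h has_vector_derivative h' t) (at t within {a..b})" "Hol j B a b h'"
    using assms by auto
  have "(f has_vector_derivative h' t) (at t within {a..b})" if "t \<in> {a..b}" for t
    by (rule has_vector_derivative_transform[OF that _ bspec[OF h'(1) that]]) (use assms(1) in auto)
  moreover have "norm (f t) \<le> B" if "t \<in> {a..b}" for t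
    using Hol_bounded[OF assms(2) that] assms(1)[OF that] by simp
  ultimately show ?thesis using h'(2) unfolding Suc Hol.simps by blast
qed

lemma norm_diff_le_of_vector_derivative:
  fixes h :: "real \<Rightarrow> 'b::real_normed_vector"
  assumes "\<And>t. t \<in> {a..b} \<Longrightarrow> (h has_vector_derivative h' t) (at t within {a..b})"
    and "\<And>t. t \<in> {a..b} \<Longrightarrow> norm (h' t) \<le> B" and "s \<in> {a..b}" "t \<in> {a..b}"
  shows "norm (h t - h s) \<le> B * \<bar>t - s\<bar>"
proof -
  have "norm (h t - h s) \<le> B * norm (t - s)"
  proof (rule differentiable_bound[of "{a..b}" h "\<lambda>t x. x *\<^sub>R h' t"])
    show "onorm (\<lambda>x. x *\<^sub>R h' t) \<le> B" if "t \<in> {a..b}" for t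
      using assms(2)[OF that] by (simp add: onorm_scaleR_left bounded_linear_ident onorm_id)
  qed (use assms in \<open>auto simp: has_vector_derivative_def\<close>)
  then show ?thesis by simp
qed

lemma le_sqrt_of_le_one: "0 \<le> x \<Longrightarrow> x \<le> 1 \<Longrightarrow> x \<le> sqrt (x::real)"
  by (rule real_le_rsqrt) (simp add: power2_eq_square mult_left_le_one_le)

text \<open>On an interval of length at most 1 a Lipschitz bound implies the square root bound with
  the same constant. This is why \<open>b \<le> a + 1\<close> accompanies \<open>Hol\<close>
  throughout and why one \<open>B\<close> can serve all orders.\<close>

lemma Hol_imp_hoelder:
  assumes "Hol i B a b h" "b \<le> a + 1" "s \<in> {a..b}" "t \<in> {a..b}"
  shows "norm (h t - h s) \<le> B * sqrt \<bar>t - s\<bar>"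
proof (cases i)
  case 0
  then show ?thesis using assms by simp
next
  case (Suc j)
  then obtain h' where h': "\<forall>t\<in>{a..b}. (h has_vector_derivative h' t) (at t within {a..b})" "Hol j B a b h'"
    using assms by auto
  have "norm (h t - h s) \<le> B * \<bar>t - s\<bar>"
    by (rule norm_diff_le_of_vector_derivative[OF bspec[OF h'(1)] Hol_bounded[OF h'(2)] assms(3,4)])
  also have "\<dots> \<le> B * sqrt \<bar>t - s\<bar>"
  proof (rule mult_left_mono)
    show "\<bar>t - s\<bar> \<le> sqrt \<bar>t - s\<bar>" using assms by (intro le_sqrt_of_le_one) auto
    show "0 \<le> B" using Hol_bounded[OF assms(1,3)] norm_ge_zero order_trans by blast
  qed
  finally show ?thesis .
qed

lemma Hol_Suc_imp: "Hol (Suc i) B a b h \<Longrightarrow> b \<le> a + 1 \<Longrightarrow> Hol i B a b h"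
proof (induction i arbitrary: h)
  case 0
  then show ?case using Hol_imp_hoelder[OF 0] Hol_bounded[OF 0(1)] by simp
next
  case (Suc i)
  then show ?case unfolding Hol.simps(2)[of "Suc i"] Hol.simps(2)[of i] by blast
qed

lemma Hol_le: "Hol i B a b h \<Longrightarrow> b \<le> a + 1 \<Longrightarrow> j \<le> i \<Longrightarrow> Hol j B a b h"
proof (induction i)
  case (Suc i)
  show ?case
  proof (cases "j = Suc i")
    case False
    then show ?thesis using Suc.IH[OF Hol_Suc_imp[OF Suc.prems(1,2)] Suc.prems(2)] Suc.prems(3) by simp
  qed (use Suc in simp)
qed auto

lemma Hol_continuous_on:
  assumes "Hol i B a b h" "b \<le> a + 1"
  shows "continuous_on {a..b} h"
proof -
  have *: "((\<lambda>s. norm (h s - h t)) \<longlongrightarrow> 0) (at t within {a..b})" if t: "t \<in> {a..b}" for t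
  proof (rule tendsto_sandwich[of "\<lambda>_. 0" _ _ "\<lambda>s. B * sqrt \<bar>s - t\<bar>"])
    show "\<forall>\<^sub>F s in at t within {a..b}. norm (h s - h t) \<le> B * sqrt \<bar>s - t\<bar>"
      using Hol_imp_hoelder[OF assms t] by (auto simp: eventually_at_filter intro!: always_eventually)
    have "((\<lambda>s. B * sqrt \<bar>s - t\<bar>) \<longlongrightarrow> B * sqrt \<bar>t - t\<bar>) (at t within {a..b})"
      by (intro tendsto_intros)
    then show "((\<lambda>s. B * sqrt \<bar>s - t\<bar>) \<longlongrightarrow> 0) (at t within {a..b})" by simp
  qed auto
  show ?thesis
    unfolding continuous_on_def by (rule ballI) (rule LIM_zero_cancel[OF tendsto_norm_zero_cancel[OF *]])
qed

lemma curve_deriv_eq: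
  fixes h :: "real \<Rightarrow> 'b::euclidean_space"
  assumes "(h has_vector_derivative d) (at t within {a..b})" "a < b" "t \<in> {a..b}"
  shows "curve_deriv {a..b} h t = d"
  unfolding curve_deriv_def by (rule vector_derivative_within_closed_interval) (use assms in auto)

lemma Hol_curve_deriv:
  fixes h :: "real \<Rightarrow> 'b::euclidean_space"
  assumes "Hol (Suc i) B a b h" "a < b"
  shows "Hol i B a b (curve_deriv {a..b} h)"
    and "t \<in> {a..b} \<Longrightarrow> (h has_vector_derivative curve_deriv {a..b} h t) (at t within {a..b})"
proof -
  obtain h' where h': "\<forall>t\<in>{a..b}. (h has_vector_derivative h' t) (at t within {a..b})" "Hol i B a b h'"
    using assms by auto
  have eq: "curve_deriv {a..b} h t = h' t" if "t \<in> {a..b}" for t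
    using curve_deriv_eq[OF bspec[OF h'(1) that] assms(2) that] .
  show "Hol i B a b (curve_deriv {a..b} h)" by (rule Hol_cong[OF eq h'(2)])
  show "(h has_vector_derivative curve_deriv {a..b} h t) (at t within {a..b})" if "t \<in> {a..b}"
    using bspec[OF h'(1) that] eq[OF that] by simp
qed

lemma Hol_imp_Cr_vec_curve:
  fixes h :: "real \<Rightarrow> 'b::euclidean_space"
  assumes "Hol i B a b h" "a < b" "b \<le> a + 1"
  shows "Cr_vec_curve i {a..b} h"
  using assms(1)
proof (induction i arbitrary: h)
  case 0
  then show ?case using Hol_continuous_on[OF 0 assms(3)] by simp
next
  case (Suc i)
  have "h differentiable (at t within {a..b})" if "t \<in> {a..b}" for t
    using Hol_curve_deriv(2)[OF Suc.prems assms(2) that] differentiableI_vector by blast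
  then show ?case using Suc.IH[OF Hol_curve_deriv(1)[OF Suc.prems assms(2)]] by simp
qed

text \<open>Interpolation inside a Hoelder ball. A derivative differs from a difference quotient
  with step \<open>w\<close> by at most a multiple of \<open>sqrt w\<close>, uniformly over the
  ball. So \<open>w\<close> is fixed first, and then closeness of the values relative to
  \<open>w\<close> controls the quotients; the induction repeats this for each order.\<close>

lemma Hol_curve_deriv_close:
  fixes a b B :: real
  assumes ab: "a < b" "b \<le> a + 1" and "e > 0"
  shows "\<exists>\<delta>>0. \<forall>f h :: real \<Rightarrow> 'b::euclidean_space. Hol r B a b f \<longrightarrow> Hol r B a b h \<longrightarrow>
     (\<forall>t\<in>{a..b}. norm (f t - h t) \<le> \<delta>) \<longrightarrow>
     (\<forall>j\<le>r. \<forall>t\<in>{a..b}. norm ((curve_deriv {a..b} ^^ j) f t - (curve_deriv {a..b} ^^ j) h t) \<le> e)"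
  using \<open>e > 0\<close>
proof (induction r arbitrary: e)
  case 0
  then show ?case by auto
next
  case (Suc r)
  obtain \<delta>' where \<delta>': "\<delta>' > 0" and IH: "\<And>(f :: real \<Rightarrow> 'b) h. Hol r B a b f \<Longrightarrow> Hol r B a b h \<Longrightarrow>
     (\<forall>t\<in>{a..b}. norm (f t - h t) \<le> \<delta>') \<Longrightarrow>
     (\<forall>j\<le>r. \<forall>t\<in>{a..b}. norm ((curve_deriv {a..b} ^^ j) f t - (curve_deriv {a..b} ^^ j) h t) \<le> e)"
    using Suc.IH[OF Suc.prems] by blast
  define B1 where "B1 = \<bar>B\<bar> + 1"
  have B1: "B1 > 0" "B \<le> B1" by (auto simp: B1_def)
  \<comment> \<open>The first bound leaves room for a step of size \<open>w\<close> to the left or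
    right of any point; the second makes \<open>B1 * sqrt w \<le> \<delta>' / 4\<close>.\<close>
  define w where "w = min ((b - a) / 2) ((\<delta>' / (4 * B1))\<^sup>2)"
  have w: "w > 0" using ab \<delta>' B1 by (auto simp: w_def)
  have wb: "w \<le> (b - a) / 2" unfolding w_def by (rule min.cobounded1)
  have "sqrt w \<le> sqrt ((\<delta>' / (4 * B1))\<^sup>2)" unfolding w_def by (intro real_sqrt_le_mono) simp
  also have "\<dots> = \<delta>' / (4 * B1)" using \<delta>' B1 by simp
  finally have sq: "B1 * sqrt w \<le> \<delta>' / 4" using B1 by (simp add: field_simps)
  \<comment> \<open>With this choice the difference quotients of the two curves differ by at most
    \<open>2 * \<delta> / w \<le> \<delta>' / 2\<close>; together with two errors of
    \<open>\<delta>' / 4\<close> this adds up to \<open>\<delta>'\<close>.\<close>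
  define \<delta> where "\<delta> = min e (w * \<delta>' / 4)"
  have \<delta>: "\<delta> > 0" using w \<delta>' Suc.prems by (simp add: \<delta>_def)
  have quot: "norm (curve_deriv {a..b} f t - (1 / (s - t)) *\<^sub>R (f s - f t)) \<le> \<delta>' / 4"
    if f: "Hol (Suc r) B a b f" and st: "t \<in> {a..b}" "s \<in> {a..b}" "\<bar>s - t\<bar> = w" for f :: "real \<Rightarrow> 'b" and s t
  proof -
    define lo hi where "lo = min s t" and "hi = max s t"
    have sub: "{lo..hi} \<subseteq> {a..b}" "s \<in> {lo..hi}" "t \<in> {lo..hi}" using st by (auto simp: lo_def hi_def)
    have d: "((\<lambda>u. f u - u *\<^sub>R curve_deriv {a..b} f t) has_vector_derivative
        (curve_deriv {a..b} f u - curve_deriv {a..b} f t)) (at u within {lo..hi})" if "u \<in> {lo..hi}" for u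
    proof -
      have "(f has_vector_derivative curve_deriv {a..b} f u) (at u within {lo..hi})"
        using Hol_curve_deriv(2)[OF f ab(1)] that sub has_vector_derivative_within_subset by blast
      then show ?thesis by (auto intro!: derivative_eq_intros)
    qed
    have bnd: "norm (curve_deriv {a..b} f u - curve_deriv {a..b} f t) \<le> \<delta>' / 4" if "u \<in> {lo..hi}" for u
    proof -
      have "\<bar>u - t\<bar> \<le> w" using that st by (auto simp: lo_def hi_def)
      have "norm (curve_deriv {a..b} f u - curve_deriv {a..b} f t) \<le> B1 * sqrt \<bar>u - t\<bar>"
        by (rule Hol_imp_hoelder[OF Hol_mono[OF Hol_curve_deriv(1)[OF f ab(1)] B1(2)] ab(2) st(1)]) (use that sub in auto)
      also have "\<dots> \<le> B1 * sqrt w" using \<open>\<bar>u - t\<bar> \<le> w\<close> B1 by (intro mult_left_mono real_sqrt_le_mono) auto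
      finally show ?thesis using sq by simp
    qed
    have "norm ((f s - s *\<^sub>R curve_deriv {a..b} f t) - (f t - t *\<^sub>R curve_deriv {a..b} f t)) \<le> \<delta>' / 4 * \<bar>s - t\<bar>"
      by (rule norm_diff_le_of_vector_derivative[OF d bnd]) (use sub in auto)
    then have "norm ((f s - f t) - (s - t) *\<^sub>R curve_deriv {a..b} f t) \<le> \<delta>' / 4 * w"
      using st by (simp add: algebra_simps)
    moreover have "curve_deriv {a..b} f t - (1 / (s - t)) *\<^sub>R (f s - f t)
       = (-1 / (s - t)) *\<^sub>R ((f s - f t) - (s - t) *\<^sub>R curve_deriv {a..b} f t)"
      using st w by (auto simp: scaleR_diff_right)
    then have "norm (curve_deriv {a..b} f t - (1 / (s - t)) *\<^sub>R (f s - f t))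
       = \<bar>1 / (s - t)\<bar> * norm ((f s - f t) - (s - t) *\<^sub>R curve_deriv {a..b} f t)"
      by simp
    ultimately have "norm (curve_deriv {a..b} f t - (1 / (s - t)) *\<^sub>R (f s - f t)) \<le> \<bar>1 / (s - t)\<bar> * (\<delta>' / 4 * w)"
      by (simp only: mult_left_mono abs_ge_zero)
    also have "\<dots> = \<delta>' / 4" using st w by (simp add: abs_divide)
    finally show ?thesis .
  qed
  show ?case
  proof (intro exI[of _ \<delta>] conjI allI impI ballI \<delta>)
    fix f h :: "real \<Rightarrow> 'b" and j t
    assume f: "Hol (Suc r) B a b f" and h: "Hol (Suc r) B a b h"
      and c: "\<forall>t\<in>{a..b}. norm (f t - h t) \<le> \<delta>" and j: "j \<le> Suc r" and t: "t \<in> {a..b}"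
    have c': "norm (curve_deriv {a..b} f t - curve_deriv {a..b} h t) \<le> \<delta>'" if t: "t \<in> {a..b}" for t
    proof -
      obtain s where s: "s \<in> {a..b}" "\<bar>s - t\<bar> = w"
      proof (cases "t + w \<le> b")
        case True then show ?thesis using that[of "t + w"] t w by auto
      next
        case False then show ?thesis using that[of "t - w"] t w wb ab by (auto simp: field_simps)
      qed
      define q where "q f = (1 / (s - t)) *\<^sub>R (f s - f t)" for f :: "real \<Rightarrow> 'b"
      have "norm (q f - q h) = \<bar>1 / (s - t)\<bar> * norm ((f s - h s) - (f t - h t))"
        unfolding q_def scaleR_diff_right[symmetric] norm_scaleR by (simp add: algebra_simps)
      also have "\<dots> \<le> \<bar>1 / (s - t)\<bar> * (\<delta> + \<delta>)"
        by (rule mult_left_mono[OF order_trans[OF norm_triangle_ineq4 add_mono]]) (use c s t in auto)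
      also have "\<dots> = 2 * \<delta> / w" using s by (simp add: abs_divide)
      also have "\<dots> \<le> \<delta>' / 2" using w(1) by (simp add: \<delta>_def field_simps min_def)
      finally have "norm (q f - q h) \<le> \<delta>' / 2" .
      moreover have "norm (curve_deriv {a..b} f t - curve_deriv {a..b} h t) =
         norm ((curve_deriv {a..b} f t - q f) - (curve_deriv {a..b} h t - q h) + (q f - q h))" by simp
      then have "norm (curve_deriv {a..b} f t - curve_deriv {a..b} h t) \<le>
         norm (curve_deriv {a..b} f t - q f) + norm (curve_deriv {a..b} h t - q h) + norm (q f - q h)"
        using norm_triangle_ineq[of "(curve_deriv {a..b} f t - q f) - (curve_deriv {a..b} h t - q h)" "q f - q h"]
          norm_triangle_ineq4[of "curve_deriv {a..b} f t - q f" "curve_deriv {a..b} h t - q h"] by linarith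
      moreover have "norm (curve_deriv {a..b} f t - q f) \<le> \<delta>' / 4" "norm (curve_deriv {a..b} h t - q h) \<le> \<delta>' / 4"
        unfolding q_def by (rule quot[OF f t s]) (rule quot[OF h t s])
      ultimately show ?thesis by linarith
    qed
    show "norm ((curve_deriv {a..b} ^^ j) f t - (curve_deriv {a..b} ^^ j) h t) \<le> e"
    proof (cases j)
      case 0
      then show ?thesis using bspec[OF c t] by (simp add: \<delta>_def)
    next
      case (Suc i)
      then have "norm ((curve_deriv {a..b} ^^ i) (curve_deriv {a..b} f) t - (curve_deriv {a..b} ^^ i) (curve_deriv {a..b} h) t) \<le> e"
        using IH[OF Hol_curve_deriv(1)[OF f ab(1)] Hol_curve_deriv(1)[OF h ab(1)]] c' t j by simp
      then show ?thesis using Suc by (simp add: funpow_swap1)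
    qed
  qed
qed

text \<open>By \<open>Hol_curve_deriv_close\<close> uniform convergence within a Hoelder ball makes
  the derivatives uniformly Cauchy. Their limit is in the class by induction, and it is the
  derivative of \<open>h\<close> by differentiation of uniformly convergent sequences.\<close>

lemma Hol_limit:
  fixes h :: "real \<Rightarrow> 'b::euclidean_space"
  assumes ab: "a < b" "b \<le> a + 1" and H: "\<And>n::nat. Hol r B a b (H n)"
    and lim: "uniform_limit {a..b} H h sequentially"
  shows "Hol r B a b h"
  using H lim
proof (induction r arbitrary: H h)
  case 0
  have l: "(\<lambda>n. H n t) \<longlonglongrightarrow> h t" if "t \<in> {a..b}" for t
    using tendsto_uniform_limitI[OF 0(2) that] .
  show ?case
    unfolding Hol.simps
  proof (intro conjI ballI)
    fix t assume t: "t \<in> {a..b}"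
    show "norm (h t) \<le> B"
      by (rule Lim_norm_ubound[OF _ l[OF t]]) (use 0(1) t in auto)
    fix s assume s: "s \<in> {a..b}"
    show "norm (h s - h t) \<le> B * sqrt \<bar>s - t\<bar>"
      by (rule Lim_norm_ubound[OF _ tendsto_diff[OF l[OF s] l[OF t]]]) (use 0(1) s t in auto)
  qed
next
  case (Suc r)
  define H' where "H' n = curve_deriv {a..b} (H n)" for n
  have H': "Hol r B a b (H' n)" "\<And>t. t \<in> {a..b} \<Longrightarrow> (H n has_vector_derivative H' n t) (at t within {a..b})" for n
    unfolding H'_def using Hol_curve_deriv[OF Suc.prems(1) ab(1)] by auto
  have "uniformly_Cauchy_on {a..b} H'"
  proof (rule uniformly_Cauchy_onI)
    fix e :: real assume "e > 0"
    then obtain d where d: "d > 0" "\<And>(f :: real \<Rightarrow> 'b) h. Hol (Suc r) B a b f \<Longrightarrow> Hol (Suc r) B a b h \<Longrightarrow>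
       (\<forall>t\<in>{a..b}. norm (f t - h t) \<le> d) \<Longrightarrow>
       (\<forall>j\<le>Suc r. \<forall>t\<in>{a..b}. norm ((curve_deriv {a..b} ^^ j) f t - (curve_deriv {a..b} ^^ j) h t) \<le> e/2)"
      using Hol_curve_deriv_close[OF ab, of "e/2" "Suc r" B] by (metis half_gt_zero)
    have "uniformly_Cauchy_on {a..b} H"
      using Suc.prems(2) by (intro uniformly_convergent_Cauchy) (auto simp: uniformly_convergent_on_def)
    then obtain M where M: "\<And>t m n. t \<in> {a..b} \<Longrightarrow> m \<ge> M \<Longrightarrow> n \<ge> M \<Longrightarrow> dist (H m t) (H n t) < d"
      using d(1) unfolding uniformly_Cauchy_on_def by metis
    show "\<exists>M. \<forall>x\<in>{a..b}. \<forall>m\<ge>M. \<forall>n\<ge>M. dist (H' m x) (H' n x) < e"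
    proof (intro exI[of _ M] ballI allI impI)
      fix t m n assume t: "t \<in> {a..b}" and mn: "M \<le> m" "M \<le> n"
      have "\<forall>t\<in>{a..b}. norm (H m t - H n t) \<le> d"
        using M mn by (auto simp: dist_norm less_imp_le)
      then have "norm ((curve_deriv {a..b} ^^ 1) (H m) t - (curve_deriv {a..b} ^^ 1) (H n) t) \<le> e/2"
        using d(2)[OF Suc.prems(1) Suc.prems(1)] t by (metis One_nat_def Suc_le_mono le0)
      then show "dist (H' m t) (H' n t) < e" using \<open>e > 0\<close> by (simp add: H'_def dist_norm)
    qed
  qed
  then obtain h' where h': "uniform_limit {a..b} H' h' sequentially"
    using Cauchy_uniformly_convergent unfolding uniformly_convergent_on_def by blast
  have Hh': "Hol r B a b h'" using Suc.IH[OF H'(1) h'] .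
  have l: "(\<lambda>n. H n t) \<longlonglongrightarrow> h t" if "t \<in> {a..b}" for t
    using tendsto_uniform_limitI[OF Suc.prems(2) that] .
  have "\<exists>g. \<forall>x\<in>{a..b}. (\<lambda>n. H n x) \<longlonglongrightarrow> g x \<and> (g has_derivative (\<lambda>v. v *\<^sub>R h' x)) (at x within {a..b})"
  proof (rule has_derivative_sequence[where f'="\<lambda>n x v. v *\<^sub>R H' n x"])
    show "convex {a..b}" by simp
    show "(H n has_derivative (\<lambda>v. v *\<^sub>R H' n x)) (at x within {a..b})" if "x \<in> {a..b}" for n x
      using H'(2)[OF that] by (simp add: has_vector_derivative_def)
    show "\<forall>\<^sub>F n in sequentially. \<forall>x\<in>{a..b}. \<forall>v. norm (v *\<^sub>R H' n x - v *\<^sub>R h' x) \<le> e * norm v" if "e > 0" for e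
    proof -
      have "\<forall>\<^sub>F n in sequentially. \<forall>x\<in>{a..b}. dist (H' n x) (h' x) < e"
        using h' that by (rule uniform_limitD)
      then show ?thesis
      proof eventually_elim
        case (elim n)
        show ?case
        proof (intro ballI allI)
          fix x v assume "x \<in> {a..b}"
          then have "norm (H' n x - h' x) \<le> e" using elim by (auto simp: dist_norm less_imp_le)
          then have "\<bar>v\<bar> * norm (H' n x - h' x) \<le> \<bar>v\<bar> * e" by (rule mult_left_mono) simp
          then show "norm (v *\<^sub>R H' n x - v *\<^sub>R h' x) \<le> e * norm v"
            by (simp add: scaleR_diff_right[symmetric] mult.commute)
        qed
      qed
    qed
    show "a \<in> {a..b}" using ab by simp
    then show "(\<lambda>n. H n a) \<longlonglongrightarrow> h a" by (rule l)
  qed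
  then obtain g where g: "\<And>x. x \<in> {a..b} \<Longrightarrow> (\<lambda>n. H n x) \<longlonglongrightarrow> g x"
    "\<And>x. x \<in> {a..b} \<Longrightarrow> (g has_derivative (\<lambda>v. v *\<^sub>R h' x)) (at x within {a..b})" by blast
  have gh: "h x = g x" if "x \<in> {a..b}" for x using LIMSEQ_unique[OF l[OF that] g(1)[OF that]] .
  have "(h has_vector_derivative h' t) (at t within {a..b})" if "t \<in> {a..b}" for t
    by (rule has_vector_derivative_transform[OF that gh])
       (use g(2)[OF that] in \<open>auto simp: has_vector_derivative_def\<close>)
  moreover have "norm (h t) \<le> B" if "t \<in> {a..b}" for t
    by (rule Lim_norm_ubound[OF _ l[OF that]]) (use Hol_bounded[OF Suc.prems(1) that] in auto)
  ultimately show ?case using Hh' unfolding Hol.simps by blast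
qed

text \<open>Young's inequality instead of Cauchy-Schwarz costs the constant, but suffices throughout.\<close>

lemma integral_le_sqrt:
  fixes h :: "real \<Rightarrow> real"
  assumes "s \<le> t" "h integrable_on {s..t}" "(\<lambda>r. (h r)\<^sup>2) integrable_on {s..t}" "integral {s..t} (\<lambda>r. (h r)\<^sup>2) \<le> R"
  shows "integral {s..t} h \<le> (1 + R) * sqrt (t - s)"
proof (cases "s = t")
  case False
  then have p: "t - s > 0" using assms by simp
  \<comment> \<open>The weight in Young's inequality \<open>h \<le> q * h^2 + 1 / q\<close>: with
    \<open>q = sqrt (t - s)\<close> both terms contribute a multiple of
    \<open>sqrt (t - s)\<close>.\<close>
  define q where "q = sqrt (t - s)"
  have q: "q > 0" "q * q = t - s" using p by (auto simp: q_def)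
  have "integral {s..t} h \<le> integral {s..t} (\<lambda>r. q * (h r)\<^sup>2 + 1 / q)"
  proof (rule integral_le)
    show "(\<lambda>r. q * (h r)\<^sup>2 + 1 / q) integrable_on {s..t}"
      by (intro integrable_add integrable_on_mult_right assms) auto
    fix r
    have "0 \<le> (q * h r - 1)\<^sup>2" by simp
    then have "2 * (q * h r) \<le> (q * h r)\<^sup>2 + 1" by (simp add: power2_eq_square algebra_simps)
    moreover have "0 \<le> (q * h r)\<^sup>2 + 1" by simp
    ultimately have "q * h r \<le> (q * h r)\<^sup>2 + 1" by linarith
    then show "h r \<le> q * (h r)\<^sup>2 + 1 / q" using q(1) by (simp add: field_simps power2_eq_square)
  qed (use assms in auto)
  also have "\<dots> = q * integral {s..t} (\<lambda>r. (h r)\<^sup>2) + (t - s) / q"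
    using assms by (subst HK_integral_add) (auto intro: integrable_on_mult_right)
  also have "\<dots> \<le> q * R + (t - s) / q" using assms q by (intro add_mono mult_left_mono) auto
  also have "(t - s) / q = q" using q by (simp add: q(2)[symmetric])
  finally show ?thesis by (simp add: q_def algebra_simps)
qed simp

lemma L2_on_subinterval:
  assumes "L2_on a b f" "{s..t} \<subseteq> {a..b}"
  shows "L2_on s t f"
proof -
  have "integrable (lebesgue_on {a..b}) f"
    using L2_on_absolutely_integrable[OF assms(1)] by (simp add: absolutely_integrable_on_iff_integrable)
  then have "integrable (lebesgue_on {s..t}) f" using assms(2) by (rule integrable_subinterval)
  moreover have "integrable (lebesgue_on {s..t}) (\<lambda>t. (norm (f t))\<^sup>2)"
    by (rule integrable_subinterval[OF _ assms(2)]) (use assms(1) in \<open>simp add: L2_on_def\<close>)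
  ultimately show ?thesis by (simp add: L2_on_def borel_measurable_integrable)
qed

lemma L2_on_integrable_on:
  assumes "L2_on a b f"
  shows "f integrable_on {a..b}" "(\<lambda>t. norm (f t)) integrable_on {a..b}" "(\<lambda>t. (norm (f t))\<^sup>2) integrable_on {a..b}"
proof -
  have a: "f absolutely_integrable_on {a..b}" by (rule L2_on_absolutely_integrable[OF assms])
  then show "f integrable_on {a..b}" "(\<lambda>t. norm (f t)) integrable_on {a..b}"
    using absolutely_integrable_on_def set_lebesgue_integral_eq_integral(1) by blast+
  show "(\<lambda>t. (norm (f t))\<^sup>2) integrable_on {a..b}"
    using assms integrable_on_lebesgue_on[of "{a..b}" "\<lambda>t. (norm (f t))\<^sup>2"] unfolding L2_on_def by simp
qed

text \<open>Qualitative only: the constant depends on the curve. It provides continuity and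
  measurability of single curves, while the bounds common to all curves come from
  \<open>chart_curves_uniform_Hol\<close>.\<close>

lemma Hreg_imp_Hol:
  assumes "Hreg i a b h" "a < b" "b \<le> a + 1"
  shows "\<exists>B. Hol i B a b h"
  using assms(1)
proof (induction i arbitrary: h)
  case 0
  then obtain f where f: "L2_on a b f" "\<forall>t\<in>{a..b}. h t = h a + integral {a..t} f"
    unfolding Hreg.simps by blast
  note i = L2_on_integrable_on[OF f(1)]
  define R where "R = integral {a..b} (\<lambda>t. (norm (f t))\<^sup>2)"
  have main: "norm (h t - h s) \<le> (1 + R) * sqrt (t - s)" if st: "s \<in> {a..b}" "t \<in> {a..b}" "s \<le> t" for s t
  proof -
    have j: "L2_on s t f" by (rule L2_on_subinterval[OF f(1)]) (use st in auto)
    have "integral {a..s} f + integral {s..t} f = integral {a..t} f"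
      using st by (intro HK_integral_combine integrable_subinterval_real[OF i(1)]) auto
    then have "h t - h s = integral {s..t} f"
      using bspec[OF f(2) st(1)] bspec[OF f(2) st(2)] by (simp add: algebra_simps)
    then have "norm (h t - h s) \<le> integral {s..t} (\<lambda>r. norm (f r))"
      using integral_norm_bound_integral[OF L2_on_integrable_on(1,2)[OF j]] by simp
    also have "\<dots> \<le> (1 + R) * sqrt (t - s)"
    proof (rule integral_le_sqrt[OF st(3) L2_on_integrable_on(2,3)[OF j]])
      show "integral {s..t} (\<lambda>r. (norm (f r))\<^sup>2) \<le> R"
        unfolding R_def using st i(3) L2_on_integrable_on(3)[OF j] by (intro integral_subset_le) auto
    qed
    finally show ?thesis .
  qed
  have R0: "R \<ge> 0" unfolding R_def by (intro integral_nonneg i(3)) auto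
  define B where "B = norm (h a) + (1 + R)"
  have "norm (h t) \<le> B" if "t \<in> {a..b}" for t
  proof -
    have "norm (h t) \<le> norm (h a) + norm (h t - h a)" by (metis add_diff_cancel_left' diff_add_cancel norm_triangle_ineq)
    also have "norm (h t - h a) \<le> (1 + R) * sqrt (t - a)" using main[of a t] that assms by auto
    also have "\<dots> \<le> (1 + R) * 1" using that assms R0 by (intro mult_left_mono) auto
    finally show ?thesis by (simp add: B_def)
  qed
  moreover have "norm (h t - h s) \<le> B * sqrt \<bar>t - s\<bar>" if "s \<in> {a..b}" "t \<in> {a..b}" for s t
  proof -
    have "norm (h t - h s) \<le> (1 + R) * sqrt \<bar>t - s\<bar>"
      using main[of s t] main[of t s] that by (cases "s \<le> t") (auto simp: norm_minus_commute)
    also have "\<dots> \<le> B * sqrt \<bar>t - s\<bar>" unfolding B_def by (intro mult_right_mono) auto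
    finally show ?thesis .
  qed
  ultimately have "Hol 0 B a b h" unfolding Hol.simps by blast
  then show ?case by blast
next
  case (Suc i)
  then obtain h' where h': "\<forall>t\<in>{a..b}. (h has_vector_derivative h' t) (at t within {a..b})" "Hreg i a b h'"
    unfolding Hreg.simps by blast
  obtain B where B: "Hol i B a b h'" using Suc.IH[OF h'(2)] by blast
  obtain C where C: "C > 0" "\<And>t. t \<in> {a..b} \<Longrightarrow> norm (h t) \<le> C"
    using continuous_on_bounded_norm_Icc[OF Hreg_continuous_on[OF Suc.prems]] by blast
  have "Hol (Suc i) (max B C) a b h"
    unfolding Hol.simps using Hol_mono[OF B, of "max B C"] h'(1) C(2) by (metis max.cobounded1 max.coboundedI2)
  then show ?case by blast
qed

section \<open>Uniformly Hoelder families of curves\<close>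

text \<open>A calculus of Hoelder classes whose constants are uniform in an index. The index will be
  a curve together with a chart interval, a point of a compact set, or a single element when only
  one curve is considered.\<close>

locale interval_family =
  fixes I :: "'i set" and a b :: "'i \<Rightarrow> real"
  assumes interval: "\<iota> \<in> I \<Longrightarrow> a \<iota> < b \<iota> \<and> b \<iota> \<le> a \<iota> + 1"
begin

definition UH :: "nat \<Rightarrow> ('i \<Rightarrow> real \<Rightarrow> 'b::euclidean_space) \<Rightarrow> bool" where
  "UH i h \<longleftrightarrow> (\<exists>B. \<forall>\<iota>\<in>I. Hol i B (a \<iota>) (b \<iota>) (h \<iota>))"

definition ubounded :: "('i \<Rightarrow> real \<Rightarrow> 'b::euclidean_space) \<Rightarrow> bool" where
  "ubounded h \<longleftrightarrow> (\<exists>B. \<forall>\<iota>\<in>I. \<forall>t\<in>{a \<iota>..b \<iota>}. norm (h \<iota> t) \<le> B)"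

lemma UH_ubounded: "UH i h \<Longrightarrow> ubounded h"
  unfolding UH_def ubounded_def using Hol_bounded by blast

lemma uboundedE:
  assumes "ubounded h"
  obtains B where "B > 0" "\<And>k t. k \<in> I \<Longrightarrow> t \<in> {a k..b k} \<Longrightarrow> norm (h k t) \<le> B"
proof -
  obtain B where B: "\<forall>k\<in>I. \<forall>t\<in>{a k..b k}. norm (h k t) \<le> B"
    using assms unfolding ubounded_def by blast
  show ?thesis
  proof (rule that[of "\<bar>B\<bar> + 1"])
    fix k t assume "k \<in> I" "t \<in> {a k..b k}"
    then have "norm (h k t) \<le> B" using B by blast
    then show "norm (h k t) \<le> \<bar>B\<bar> + 1" by linarith
  qed simp
qed

lemma UH_cong:
  assumes "UH i h" "\<And>k t. k \<in> I \<Longrightarrow> t \<in> {a k..b k} \<Longrightarrow> f k t = h k t"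
  shows "UH i f"
proof -
  obtain B where B: "\<forall>k\<in>I. Hol i B (a k) (b k) (h k)"
    using assms(1) unfolding UH_def by blast
  have "Hol i B (a k) (b k) (f k)" if "k \<in> I" for k
    using Hol_cong[OF assms(2)[OF that] bspec[OF B that]] .
  then show ?thesis unfolding UH_def by blast
qed

lemma UH_Suc_imp: "UH (Suc i) h \<Longrightarrow> UH i h"
  unfolding UH_def using Hol_Suc_imp interval by blast

lemma UH_SucI:
  assumes "ubounded h" "\<And>k t. k \<in> I \<Longrightarrow> t \<in> {a k..b k} \<Longrightarrow> (h k has_vector_derivative h' k t) (at t within {a k..b k})"
    and "UH i h'"
  shows "UH (Suc i) h"
proof -
  obtain B where B: "\<And>k t. k \<in> I \<Longrightarrow> t \<in> {a k..b k} \<Longrightarrow> norm (h k t) \<le> B"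
    using uboundedE[OF assms(1)] by metis
  obtain C where C: "\<forall>k\<in>I. Hol i C (a k) (b k) (h' k)"
    using assms(3) unfolding UH_def by blast
  have "Hol (Suc i) (max B C) (a k) (b k) (h k)" if "k \<in> I" for k
  proof -
    have "Hol i (max B C) (a k) (b k) (h' k)" using Hol_mono[OF bspec[OF C that], of "max B C"] by simp
    moreover have "\<forall>t\<in>{a k..b k}. norm (h k t) \<le> max B C" using B[OF that] by (simp add: max.coboundedI1)
    ultimately show ?thesis using assms(2)[OF that] unfolding Hol.simps by blast
  qed
  then show ?thesis unfolding UH_def by blast
qed

lemma UH_SucE:
  assumes "UH (Suc i) h"
  obtains h' where "\<And>k t. k \<in> I \<Longrightarrow> t \<in> {a k..b k} \<Longrightarrow> (h k has_vector_derivative h' k t) (at t within {a k..b k})"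
    "UH i h'"
proof -
  obtain B where B: "\<forall>k\<in>I. Hol (Suc i) B (a k) (b k) (h k)"
    using assms unfolding UH_def by blast
  show ?thesis
  proof (rule that[of "\<lambda>k. curve_deriv {a k..b k} (h k)"])
    fix k t assume "k \<in> I" "t \<in> {a k..b k}"
    then show "(h k has_vector_derivative curve_deriv {a k..b k} (h k) t) (at t within {a k..b k})"
      using Hol_curve_deriv(2)[OF bspec[OF B]] interval by blast
  next
    show "UH i (\<lambda>k. curve_deriv {a k..b k} (h k))"
      unfolding UH_def using Hol_curve_deriv(1)[OF bspec[OF B]] interval by blast
  qed
qed

lemma UH_0I:
  assumes "ubounded h" "\<And>k s t. k \<in> I \<Longrightarrow> s \<in> {a k..b k} \<Longrightarrow> t \<in> {a k..b k} \<Longrightarrow>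
     norm (h k t - h k s) \<le> C * sqrt \<bar>t - s\<bar>"
  shows "UH 0 h"
proof -
  obtain B where B: "\<And>k t. k \<in> I \<Longrightarrow> t \<in> {a k..b k} \<Longrightarrow> norm (h k t) \<le> B"
    using uboundedE[OF assms(1)] by metis
  have "Hol 0 (max B C) (a k) (b k) (h k)" if k: "k \<in> I" for k
  proof -
    have "norm (h k t - h k s) \<le> max B C * sqrt \<bar>t - s\<bar>" if "s \<in> {a k..b k}" "t \<in> {a k..b k}" for s t
      using assms(2)[OF k that] by (rule order_trans) (auto intro: mult_right_mono)
    then show ?thesis unfolding Hol.simps using B[OF k] by (simp add: max.coboundedI1)
  qed
  then show ?thesis unfolding UH_def by blast
qed

lemma UH_0E:
  assumes "UH i h"
  obtains B where "B > 0" "\<And>k t. k \<in> I \<Longrightarrow> t \<in> {a k..b k} \<Longrightarrow> norm (h k t) \<le> B"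
   "\<And>k s t. k \<in> I \<Longrightarrow> s \<in> {a k..b k} \<Longrightarrow> t \<in> {a k..b k} \<Longrightarrow> norm (h k t - h k s) \<le> B * sqrt \<bar>t - s\<bar>"
proof -
  obtain B where B: "\<forall>k\<in>I. Hol i B (a k) (b k) (h k)"
    using assms unfolding UH_def by blast
  have *: "Hol i (\<bar>B\<bar> + 1) (a k) (b k) (h k)" if "k \<in> I" for k
    using Hol_mono[OF bspec[OF B that]] by simp
  show ?thesis
    by (rule that[of "\<bar>B\<bar> + 1"]) (use * Hol_bounded Hol_imp_hoelder interval in \<open>blast | simp\<close>)+
qed

lemma UH_const: "UH i (\<lambda>k t. c)"
proof (induction i arbitrary: c)
  case 0
  show ?case by (rule UH_0I[of _ 0]) (auto simp: ubounded_def)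
next
  case (Suc i)
  show ?case by (rule UH_SucI[of _ "\<lambda>k t. 0", OF _ _ Suc]) (auto simp: ubounded_def)
qed

lemma UH_add:
  assumes "UH i f" "UH i g"
  shows "UH i (\<lambda>k t. f k t + g k t)"
  using assms
proof (induction i arbitrary: f g)
  case 0
  obtain B where B: "B > 0" "\<And>k t. k \<in> I \<Longrightarrow> t \<in> {a k..b k} \<Longrightarrow> norm (f k t) \<le> B"
   "\<And>k s t. k \<in> I \<Longrightarrow> s \<in> {a k..b k} \<Longrightarrow> t \<in> {a k..b k} \<Longrightarrow> norm (f k t - f k s) \<le> B * sqrt \<bar>t - s\<bar>"
    using UH_0E[OF 0(1)] by metis
  obtain C where C: "C > 0" "\<And>k t. k \<in> I \<Longrightarrow> t \<in> {a k..b k} \<Longrightarrow> norm (g k t) \<le> C"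
   "\<And>k s t. k \<in> I \<Longrightarrow> s \<in> {a k..b k} \<Longrightarrow> t \<in> {a k..b k} \<Longrightarrow> norm (g k t - g k s) \<le> C * sqrt \<bar>t - s\<bar>"
    using UH_0E[OF 0(2)] by metis
  show ?case
  proof (rule UH_0I[of _ "B + C"])
    have "norm (f k t + g k t) \<le> B + C" if "k \<in> I" "t \<in> {a k..b k}" for k t
      using norm_triangle_mono[OF B(2)[OF that] C(2)[OF that]] .
    then show "ubounded (\<lambda>k t. f k t + g k t)" unfolding ubounded_def by blast
    fix k s t assume *: "k \<in> I" "s \<in> {a k..b k}" "t \<in> {a k..b k}"
    show "norm (f k t + g k t - (f k s + g k s)) \<le> (B + C) * sqrt \<bar>t - s\<bar>"
      using norm_triangle_mono[OF B(3)[OF *] C(3)[OF *]] by (simp add: algebra_simps)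
  qed
next
  case (Suc i)
  obtain f' where f': "\<And>k t. k \<in> I \<Longrightarrow> t \<in> {a k..b k} \<Longrightarrow> (f k has_vector_derivative f' k t) (at t within {a k..b k})" "UH i f'"
    using UH_SucE[OF Suc.prems(1)] by metis
  obtain g' where g': "\<And>k t. k \<in> I \<Longrightarrow> t \<in> {a k..b k} \<Longrightarrow> (g k has_vector_derivative g' k t) (at t within {a k..b k})" "UH i g'"
    using UH_SucE[OF Suc.prems(2)] by metis
  show ?case
  proof (rule UH_SucI[OF _ _ Suc.IH[OF f'(2) g'(2)]])
    show "ubounded (\<lambda>k t. f k t + g k t)"
      using UH_ubounded[OF Suc.IH[OF UH_Suc_imp[OF Suc.prems(1)] UH_Suc_imp[OF Suc.prems(2)]]] .
  qed (intro has_vector_derivative_add f' g')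
qed

lemma UH_sum: "finite S \<Longrightarrow> (\<And>s. s \<in> S \<Longrightarrow> UH i (f s)) \<Longrightarrow> UH i (\<lambda>k t. \<Sum>s\<in>S. f s k t)"
  by (induction S rule: finite_induct) (auto intro: UH_add UH_const)

lemma UH_bilinear:
  assumes "bounded_bilinear pr" "UH i f" "UH i g"
  shows "UH i (\<lambda>k t. pr (f k t) (g k t))"
proof -
  interpret bounded_bilinear pr by fact
  obtain K where K: "K > 0" "\<And>x y. norm (pr x y) \<le> norm x * norm y * K"
    using pos_bounded by blast
  show ?thesis using assms(2,3)
  proof (induction i arbitrary: f g)
    case 0
    obtain B where B: "B > 0" "\<And>k t. k \<in> I \<Longrightarrow> t \<in> {a k..b k} \<Longrightarrow> norm (f k t) \<le> B"
     "\<And>k s t. k \<in> I \<Longrightarrow> s \<in> {a k..b k} \<Longrightarrow> t \<in> {a k..b k} \<Longrightarrow> norm (f k t - f k s) \<le> B * sqrt \<bar>t - s\<bar>"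
      using UH_0E[OF 0(1)] by metis
    obtain C where C: "C > 0" "\<And>k t. k \<in> I \<Longrightarrow> t \<in> {a k..b k} \<Longrightarrow> norm (g k t) \<le> C"
     "\<And>k s t. k \<in> I \<Longrightarrow> s \<in> {a k..b k} \<Longrightarrow> t \<in> {a k..b k} \<Longrightarrow> norm (g k t - g k s) \<le> C * sqrt \<bar>t - s\<bar>"
      using UH_0E[OF 0(2)] by metis
    have P: "norm (pr x y) \<le> X * Y * K" if "norm x \<le> X" "norm y \<le> Y" for x y X Y
    proof -
      have "norm x * norm y \<le> X * Y" using that by (intro mult_mono) (auto intro: order_trans[OF norm_ge_zero])
      then have "norm x * norm y * K \<le> X * Y * K" using K(1) by (intro mult_right_mono) auto
      then show ?thesis using K(2)[of x y] by linarith
    qed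
    show ?case
    proof (rule UH_0I[of _ "2 * B * C * K"])
      show "ubounded (\<lambda>k t. pr (f k t) (g k t))"
        unfolding ubounded_def using P[OF B(2) C(2)] by blast
      fix k s t assume *: "k \<in> I" "s \<in> {a k..b k}" "t \<in> {a k..b k}"
      have "pr (f k t) (g k t) - pr (f k s) (g k s) = pr (f k t - f k s) (g k t) + pr (f k s) (g k t - g k s)"
        by (simp add: diff_left diff_right)
      then have "norm (pr (f k t) (g k t) - pr (f k s) (g k s)) \<le> B * sqrt \<bar>t - s\<bar> * C * K + B * (C * sqrt \<bar>t - s\<bar>) * K"
        using norm_triangle_mono[OF P[OF B(3)[OF *] C(2)[OF *(1,3)]] P[OF B(2)[OF *(1,2)] C(3)[OF *]]] by simp
      then show "norm (pr (f k t) (g k t) - pr (f k s) (g k s)) \<le> 2 * B * C * K * sqrt \<bar>t - s\<bar>"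
        by (simp add: algebra_simps)
    qed
  next
    case (Suc i)
    obtain f' where f': "\<And>k t. k \<in> I \<Longrightarrow> t \<in> {a k..b k} \<Longrightarrow> (f k has_vector_derivative f' k t) (at t within {a k..b k})" "UH i f'"
      using UH_SucE[OF Suc.prems(1)] by metis
    obtain g' where g': "\<And>k t. k \<in> I \<Longrightarrow> t \<in> {a k..b k} \<Longrightarrow> (g k has_vector_derivative g' k t) (at t within {a k..b k})" "UH i g'"
      using UH_SucE[OF Suc.prems(2)] by metis
    note fg = UH_Suc_imp[OF Suc.prems(1)] UH_Suc_imp[OF Suc.prems(2)]
    show ?case
      by (rule UH_SucI[OF UH_ubounded[OF Suc.IH[OF fg]] _ UH_add[OF Suc.IH[OF fg(1) g'(2)] Suc.IH[OF f'(2) fg(2)]]])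
         (intro has_vector_derivative f' g')
  qed
qed

lemma UH_bounded_linear:
  assumes "bounded_linear L" "UH i f"
  shows "UH i (\<lambda>k t. L (f k t))"
  using UH_bilinear[OF bounded_bilinear.comp[OF bounded_bilinear_scaleR bounded_linear_ident assms(1)]
      UH_const[of i 1] assms(2)] by simp

lemma UH_diff:
  assumes "UH i f" "UH i g"
  shows "UH i (\<lambda>k t. f k t - g k t)"
  using UH_add[OF assms(1) UH_bounded_linear[OF bounded_linear_minus[OF bounded_linear_ident] assms(2)]] by simp

lemmas UH_scaleR = UH_bilinear[OF bounded_bilinear_scaleR]
lemmas UH_mult = UH_bilinear[OF bounded_bilinear_mult]
lemmas UH_inner_const = UH_bounded_linear[OF bounded_linear_inner_left]

end

lemma Cn_on_SucD:
  assumes "Cn_on (Suc n) W F" "x \<in> W"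
  shows "(F has_derivative frechet_derivative F (at x)) (at x)"
  using assms by (simp add: frechet_derivative_works)

lemma frechet_derivative_euclidean_sum:
  fixes F :: "'b::euclidean_space \<Rightarrow> 'c::real_normed_vector"
  assumes "(F has_derivative F') (at x)"
  shows "F' v = (\<Sum>e\<in>Basis. (v \<bullet> e) *\<^sub>R F' e)"
proof -
  interpret linear F' using assms by (rule has_derivative_linear)
  have "F' v = F' (\<Sum>e\<in>Basis. (v \<bullet> e) *\<^sub>R e)" by (simp add: euclidean_representation)
  also have "\<dots> = (\<Sum>e\<in>Basis. (v \<bullet> e) *\<^sub>R F' e)" by (simp add: sum scaleR)
  finally show ?thesis .
qed

text \<open>\<open>K\<close> may fail to be convex, so the mean value inequality is applied on small
  balls only. Compactness turns the resulting local Lipschitz property into a global one on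
  \<open>K\<close>.\<close>

lemma C1_lipschitz_on_compact:
  fixes F :: "'b::euclidean_space \<Rightarrow> 'c::real_normed_vector"
  assumes F: "Cn_on (Suc 0) W F" and W: "open W" and K: "compact K" "K \<subseteq> W"
  obtains L where "L \<ge> 0" "\<And>x y. x \<in> K \<Longrightarrow> y \<in> K \<Longrightarrow> norm (F x - F y) \<le> L * norm (x - y)"
proof -
  note der = Cn_on_SucD[OF F]
  have loc: "\<exists>u>0. \<exists>L. L-lipschitz_on (cball x u) F" if "x \<in> K" for x
  proof -
    have "x \<in> W" using that K by blast
    then obtain u where u: "u > 0" "cball x u \<subseteq> W" using W unfolding open_contains_cball by blast
    have "\<exists>B. \<forall>y\<in>cball x u. norm (frechet_derivative F (at y) e) \<le> B" for e
    proof -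
      have "continuous_on (cball x u) (\<lambda>y. frechet_derivative F (at y) e)"
        using F u(2) by (auto intro: continuous_on_subset)
      then have "bounded ((\<lambda>y. frechet_derivative F (at y) e) ` cball x u)"
        by (intro compact_imp_bounded compact_continuous_image) auto
      then show ?thesis by (auto simp: bounded_iff)
    qed
    then obtain B where B: "\<And>e y. y \<in> cball x u \<Longrightarrow> norm (frechet_derivative F (at y) e) \<le> B e" by metis
    define M where "M = (\<Sum>e\<in>Basis. \<bar>B e\<bar>)"
    have M: "onorm (frechet_derivative F (at y)) \<le> M" if y: "y \<in> cball x u" for y
    proof (rule onorm_le)
      fix v
      have "frechet_derivative F (at y) v = (\<Sum>e\<in>Basis. (v \<bullet> e) *\<^sub>R frechet_derivative F (at y) e)"
        using frechet_derivative_euclidean_sum[OF der[of y]] y u(2) by blast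
      also have "norm \<dots> \<le> (\<Sum>e\<in>Basis. \<bar>B e\<bar> * norm v)"
      proof (rule sum_norm_le)
        fix e :: 'b assume "e \<in> Basis"
        then have "norm (v \<bullet> e) \<le> norm v" by (simp add: Basis_le_norm)
        moreover have "norm (frechet_derivative F (at y) e) \<le> \<bar>B e\<bar>" using B[OF y, of e] by linarith
        ultimately show "norm ((v \<bullet> e) *\<^sub>R frechet_derivative F (at y) e) \<le> \<bar>B e\<bar> * norm v"
          by (simp add: mult_mono mult.commute)
      qed
      finally show "norm (frechet_derivative F (at y) v) \<le> M * norm v" by (simp add: M_def sum_distrib_right)
    qed
    have "norm (F y - F z) \<le> M * norm (y - z)" if "y \<in> cball x u" "z \<in> cball x u" for y z
      by (rule differentiable_bound[OF convex_cball[of x u] _ M that])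
         (use der u(2) has_derivative_at_withinI in blast)
    moreover have "0 \<le> M" unfolding M_def by (intro sum_nonneg) auto
    ultimately have "M-lipschitz_on (cball x u) F" by (intro lipschitz_onI) (auto simp: dist_norm)
    then show ?thesis using u(1) by blast
  qed
  \<comment> \<open>\<open>F\<close> is treated as a time-dependent map over the one-point time set
    \<open>{0}\<close>.\<close>
  have ll: "local_lipschitz {0::real} K (\<lambda>_. F)"
  proof (rule local_lipschitzI)
    fix t x assume "x \<in> K"
    then obtain u L where "u > 0" "L-lipschitz_on (cball x u) F" using loc by blast
    then show "\<exists>u>0. \<exists>L. \<forall>t\<in>cball t u \<inter> {0}. L-lipschitz_on (cball x u \<inter> K) F"
      using lipschitz_on_subset by blast
  qed
  obtain L where L: "\<And>t. t \<in> {0::real} \<Longrightarrow> L-lipschitz_on K F"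
    using local_lipschitz_compact_implies_lipschitz[OF ll K(1) compact_sing] continuous_on_const by blast
  then have "L-lipschitz_on K F" by simp
  then show ?thesis using that lipschitz_on_nonneg lipschitz_on_normD by metis
qed

context interval_family
begin

text \<open>By the chain rule the derivative of the composite is a combination of compositions with
  directional derivatives of \<open>F\<close> along basis vectors. These are again smooth on
  \<open>W\<close>, so the induction is on the order with \<open>F\<close> arbitrary. A common
  compact set of values keeps the constants uniform.\<close>

lemma UH_compose:
  fixes F :: "'b::euclidean_space \<Rightarrow> 'c::euclidean_space"
  assumes W: "open W" and K: "compact K" "K \<subseteq> W"
    and h: "UH i h" and hK: "\<And>k t. k \<in> I \<Longrightarrow> t \<in> {a k..b k} \<Longrightarrow> h k t \<in> K"
    and F: "\<And>n. Cn_on n W F"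
  shows "UH i (\<lambda>k t. F (h k t))"
  using h F
proof (induction i arbitrary: F)
  case 0
  obtain L where L: "L \<ge> 0" "\<And>x y. x \<in> K \<Longrightarrow> y \<in> K \<Longrightarrow> norm (F x - F y) \<le> L * norm (x - y)"
    using C1_lipschitz_on_compact[OF 0(2) W K] by metis
  obtain B where B: "\<And>k s t. k \<in> I \<Longrightarrow> s \<in> {a k..b k} \<Longrightarrow> t \<in> {a k..b k} \<Longrightarrow> norm (h k t - h k s) \<le> B * sqrt \<bar>t - s\<bar>"
    using UH_0E[OF 0(1)] by metis
  show ?case
  proof (rule UH_0I[of _ "L * B"])
    have "continuous_on K F" using 0(2)[of 0] K(2) by (auto intro: continuous_on_subset)
    then have "bounded (F ` K)" using K(1) by (intro compact_imp_bounded compact_continuous_image)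
    then obtain M where M: "\<forall>x\<in>F ` K. norm x \<le> M" unfolding bounded_iff by blast
    then show "ubounded (\<lambda>k t. F (h k t))" unfolding ubounded_def using hK by blast
    fix k s t assume *: "k \<in> I" "s \<in> {a k..b k}" "t \<in> {a k..b k}"
    have "norm (F (h k t) - F (h k s)) \<le> L * norm (h k t - h k s)"
      using L(2) hK * by blast
    also have "\<dots> \<le> L * (B * sqrt \<bar>t - s\<bar>)" using B[OF *] L(1) by (intro mult_left_mono)
    finally show "norm (F (h k t) - F (h k s)) \<le> L * B * sqrt \<bar>t - s\<bar>" by (simp add: mult.assoc)
  qed
next
  case (Suc i)
  obtain h' where h': "\<And>k t. k \<in> I \<Longrightarrow> t \<in> {a k..b k} \<Longrightarrow> (h k has_vector_derivative h' k t) (at t within {a k..b k})" "UH i h'"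
    using UH_SucE[OF Suc.prems(1)] by metis
  have h: "UH i h" using Suc.prems(1) by (rule UH_Suc_imp)
  have Fe: "Cn_on n W (\<lambda>x. frechet_derivative F (at x) e)" for n e using Suc.prems(2)[of "Suc n"] by simp
  have der: "((\<lambda>t. F (h k t)) has_vector_derivative (\<Sum>e\<in>Basis. (h' k t \<bullet> e) *\<^sub>R frechet_derivative F (at (h k t)) e))
     (at t within {a k..b k})" if "k \<in> I" "t \<in> {a k..b k}" for k t
  proof -
    have d: "(F has_derivative frechet_derivative F (at (h k t))) (at (h k t))"
      by (rule Cn_on_SucD[OF Suc.prems(2)]) (use hK[OF that] K in blast)
    have "((F \<circ> h k) has_vector_derivative frechet_derivative F (at (h k t)) (h' k t)) (at t within {a k..b k})"
      by (rule vector_derivative_diff_chain_within[OF h'(1)[OF that] has_derivative_at_withinI[OF d]])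
    then show ?thesis unfolding o_def frechet_derivative_euclidean_sum[OF d, of "h' k t"] .
  qed
  show ?case
  proof (rule UH_SucI[OF UH_ubounded[OF Suc.IH[OF h Suc.prems(2)]] der])
    show "UH i (\<lambda>k t. \<Sum>e\<in>Basis. (h' k t \<bullet> e) *\<^sub>R frechet_derivative F (at (h k t)) e)"
      by (intro UH_sum UH_scaleR UH_inner_const h'(2) Suc.IH[OF h] Fe finite_Basis)
  qed
qed

text \<open>Differentiating \<open>L w = r\<close> gives \<open>L w' = r' - L' w\<close>, an equation of the same kind for \<open>w'\<close>, so
  the inverse of \<open>L\<close> never has to be differentiated.\<close>

lemma UH_solve:
  fixes h :: "'b::euclidean_space \<Rightarrow> 'b \<Rightarrow> 'i \<Rightarrow> real \<Rightarrow> real" and w r :: "'i \<Rightarrow> real \<Rightarrow> 'b"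
  defines "L \<equiv> \<lambda>h (k::'i) (t::real) u. (\<Sum>c\<in>Basis. \<Sum>e\<in>Basis. ((u \<bullet> e) * h e c k t) *\<^sub>R (c::'b))"
  assumes h: "\<And>e c. e \<in> Basis \<Longrightarrow> c \<in> Basis \<Longrightarrow> UH i (h e c)" and r: "UH i r"
    and w: "\<And>k t. k \<in> I \<Longrightarrow> t \<in> {a k..b k} \<Longrightarrow> L h k t (w k t) = r k t"
    and m: "m > 0" "\<And>k t u. k \<in> I \<Longrightarrow> t \<in> {a k..b k} \<Longrightarrow> m * (norm u)\<^sup>2 \<le> L h k t u \<bullet> u"
  shows "UH i w"
proof -
  have lower: "m * norm u \<le> norm (L h k t u)" if "k \<in> I" "t \<in> {a k..b k}" for k t u
  proof (cases "u = 0")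
    case False
    have "m * norm u * norm u \<le> norm (L h k t u) * norm u"
      using m(2)[OF that, of u] norm_cauchy_schwarz[of "L h k t u" u] by (simp add: power2_eq_square)
    then show ?thesis using False by simp
  qed simp
  have Llin: "linear (L h k t)" for h :: "'b \<Rightarrow> 'b \<Rightarrow> 'i \<Rightarrow> real \<Rightarrow> real" and k t
    unfolding L_def by (intro linear_compose_sum ballI)
      (auto intro!: linearI simp: inner_add_left algebra_simps)
  have ub: "ubounded w" if "ubounded r" "\<And>k t. k \<in> I \<Longrightarrow> t \<in> {a k..b k} \<Longrightarrow> L h k t (w k t) = r k t"
    for w r :: "'i \<Rightarrow> real \<Rightarrow> 'b"
  proof -
    obtain B where B: "\<And>k t. k \<in> I \<Longrightarrow> t \<in> {a k..b k} \<Longrightarrow> norm (r k t) \<le> B"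
      using uboundedE[OF \<open>ubounded r\<close>] by metis
    have "norm (w k t) \<le> B / m" if "k \<in> I" "t \<in> {a k..b k}" for k t
      using lower[OF that, of "w k t"] B[OF that] that(2)[THEN \<open>\<And>k t. k \<in> I \<Longrightarrow> t \<in> {a k..b k} \<Longrightarrow> L h k t (w k t) = r k t\<close>[OF that(1)]] m(1)
      by (simp add: field_simps)
    then show ?thesis unfolding ubounded_def by blast
  qed
  have UHL: "UH j (\<lambda>k t. L h' k t (u k t))"
    if "\<And>e c. e \<in> Basis \<Longrightarrow> c \<in> Basis \<Longrightarrow> UH j (h' e c)" "UH j u" for j h' u
    unfolding L_def by (intro UH_sum UH_scaleR UH_mult UH_inner_const UH_const that finite_Basis)
  show ?thesis using h r w
  proof (induction i arbitrary: w r)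
    case 0
    note wb = ub[OF UH_ubounded[OF 0(2)] 0(3)]
    obtain B where B: "B > 0" "\<And>k t. k \<in> I \<Longrightarrow> t \<in> {a k..b k} \<Longrightarrow> norm (w k t) \<le> B"
      using uboundedE[OF wb] by metis
    obtain C where C: "\<And>k s t. k \<in> I \<Longrightarrow> s \<in> {a k..b k} \<Longrightarrow> t \<in> {a k..b k} \<Longrightarrow> norm (r k t - r k s) \<le> C * sqrt \<bar>t - s\<bar>"
      using UH_0E[OF 0(2)] by metis
    have "\<exists>D. \<forall>k\<in>I. \<forall>s\<in>{a k..b k}. \<forall>t\<in>{a k..b k}. norm (h e c k t - h e c k s) \<le> D * sqrt \<bar>t - s\<bar>"
      if "e \<in> Basis" "c \<in> Basis" for e c
      using UH_0E[OF 0(1)[OF that]] by metis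
    then obtain D where D: "\<And>e c k s t. e \<in> Basis \<Longrightarrow> c \<in> Basis \<Longrightarrow> k \<in> I \<Longrightarrow> s \<in> {a k..b k} \<Longrightarrow> t \<in> {a k..b k} \<Longrightarrow>
       norm (h e c k t - h e c k s) \<le> D e c * sqrt \<bar>t - s\<bar>" by metis
    define E where "E = (\<Sum>c\<in>Basis. \<Sum>e\<in>Basis. B * D e c)"
    show ?case
    proof (rule UH_0I[OF wb, of "(C + E) / m"])
      fix k s t assume *: "k \<in> I" "s \<in> {a k..b k}" "t \<in> {a k..b k}"
      have e1: "L h k t (w k t - w k s) = (r k t - r k s) - (L h k t (w k s) - L h k s (w k s))"
        using linear_diff[OF Llin] 0(3)[OF *(1,2)] 0(3)[OF *(1,3)] by simp
      have e2: "norm (L h k t (w k s) - L h k s (w k s)) \<le> E * sqrt \<bar>t - s\<bar>"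
      proof -
        have "L h k t (w k s) - L h k s (w k s) = (\<Sum>c\<in>Basis. \<Sum>e\<in>Basis. ((w k s \<bullet> e) * (h e c k t - h e c k s)) *\<^sub>R c)"
          unfolding L_def sum_subtractf[symmetric] by (simp add: algebra_simps)
        also have "norm \<dots> \<le> (\<Sum>c\<in>Basis. \<Sum>e\<in>Basis. B * D e c * sqrt \<bar>t - s\<bar>)"
        proof (intro sum_norm_le)
          fix c e :: 'b assume ce: "c \<in> Basis" "e \<in> Basis"
          have "\<bar>w k s \<bullet> e\<bar> \<le> B" using B(2)[OF *(1,2)] Basis_le_norm[OF ce(2), of "w k s"] by linarith
          moreover have "\<bar>h e c k t - h e c k s\<bar> \<le> D e c * sqrt \<bar>t - s\<bar>" using D[OF ce(2,1) *] by simp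
          ultimately have "\<bar>w k s \<bullet> e\<bar> * \<bar>h e c k t - h e c k s\<bar> \<le> B * (D e c * sqrt \<bar>t - s\<bar>)"
            by (intro mult_mono) (use B(1) in auto)
          then show "norm (((w k s \<bullet> e) * (h e c k t - h e c k s)) *\<^sub>R c) \<le> B * D e c * sqrt \<bar>t - s\<bar>"
            using ce by (simp add: abs_mult mult.assoc)
        qed
        also have "\<dots> = E * sqrt \<bar>t - s\<bar>" by (simp add: E_def sum_distrib_right)
        finally show ?thesis .
      qed
      have "norm (L h k t (w k t - w k s)) \<le> C * sqrt \<bar>t - s\<bar> + E * sqrt \<bar>t - s\<bar>"
        unfolding e1 by (rule order_trans[OF norm_triangle_ineq4 add_mono[OF C[OF *] e2]])
      then have "m * norm (w k t - w k s) \<le> (C + E) * sqrt \<bar>t - s\<bar>"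
        using lower[OF *(1,3), of "w k t - w k s"] by (simp add: algebra_simps)
      then show "norm (w k t - w k s) \<le> (C + E) / m * sqrt \<bar>t - s\<bar>"
        using m(1) by (simp add: field_simps)
    qed
  next
    case (Suc i)
    obtain r' where r': "\<And>k t. k \<in> I \<Longrightarrow> t \<in> {a k..b k} \<Longrightarrow> (r k has_vector_derivative r' k t) (at t within {a k..b k})" "UH i r'"
      using UH_SucE[OF Suc.prems(2)] by metis
    have "\<exists>h'. (\<forall>k\<in>I. \<forall>t\<in>{a k..b k}. (h e c k has_vector_derivative h' k t) (at t within {a k..b k})) \<and> UH i h'"
      if "e \<in> Basis" "c \<in> Basis" for e c
      using UH_SucE[OF Suc.prems(1)[OF that]] by metis
    then obtain h' where h': "\<And>e c. e \<in> Basis \<Longrightarrow> c \<in> Basis \<Longrightarrow>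
       (\<forall>k\<in>I. \<forall>t\<in>{a k..b k}. (h e c k has_vector_derivative h' e c k t) (at t within {a k..b k})) \<and> UH i (h' e c)"
      by metis
    have wi: "UH i w"
      by (rule Suc.IH[OF _ UH_Suc_imp[OF Suc.prems(2)] Suc.prems(3)]) (rule UH_Suc_imp, rule Suc.prems(1))
    \<comment> \<open>The right-hand side of the differentiated equation. Its solution
      \<open>w'\<close> is constructed before \<open>w\<close> is known to be differentiable, and
      the induction hypothesis gives its regularity.\<close>
    define \<rho> where "\<rho> k t = r' k t - L h' k t (w k t)" for k t
    have \<rho>: "UH i \<rho>" unfolding \<rho>_def by (intro UH_diff r'(2) UHL wi) (use h' in blast)
    have "\<exists>u. L h k t u = \<rho> k t" if "k \<in> I" "t \<in> {a k..b k}" for k t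
    proof -
      have "inj (L h k t)"
        unfolding linear_injective_0[OF Llin]
      proof (intro allI impI)
        fix u assume "L h k t u = 0"
        then have "m * norm u \<le> 0" using lower[OF that, of u] by simp
        then show "u = 0" using m(1) by (simp add: mult_le_0_iff)
      qed
      then have "surj (L h k t)" using linear_inj_imp_surj[OF Llin] by blast
      then show ?thesis by (metis surjD)
    qed
    then obtain w' where w': "\<And>k t. k \<in> I \<Longrightarrow> t \<in> {a k..b k} \<Longrightarrow> L h k t (w' k t) = \<rho> k t" by metis
    have w'i: "UH i w'"
      by (rule Suc.IH[OF _ \<rho> w']) (rule UH_Suc_imp, rule Suc.prems(1))
    show ?case
    proof (rule UH_SucI[OF ub[OF UH_ubounded[OF Suc.prems(2)] Suc.prems(3)] _ w'i])
      fix k t assume k: "k \<in> I" "t \<in> {a k..b k}"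
      let ?S = "{a k..b k}"
      \<comment> \<open>\<open>u\<close> is the candidate tangent line of \<open>w\<close> at
        \<open>t\<close> and \<open>Q\<close> its residual in the equation. \<open>Q\<close>
        vanishes to first order at \<open>t\<close>, and coercivity bounds the norm of
        \<open>w - u\<close> by that of \<open>Q\<close> divided by \<open>m\<close>, so
        \<open>w' k t\<close> is the derivative of \<open>w\<close>.\<close>
      define u where "u s = w k t + (s - t) *\<^sub>R w' k t" for s
      define Q where "Q s = r k s - L h k s (u s)" for s
      have ud: "(u has_vector_derivative w' k t) (at t within ?S)"
        unfolding u_def by (auto intro!: derivative_eq_intros)
      have "((\<lambda>s. L h k s (u s)) has_vector_derivative
         (\<Sum>c\<in>Basis. \<Sum>e\<in>Basis. ((u t \<bullet> e) * h' e c k t + (w' k t \<bullet> e) * h e c k t) *\<^sub>R c)) (at t within ?S)"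
        unfolding L_def
      proof (intro has_vector_derivative_sum)
        fix c e :: 'b assume ce: "c \<in> Basis" "e \<in> Basis"
        have 1: "((\<lambda>s. u s \<bullet> e) has_vector_derivative (w' k t \<bullet> e)) (at t within ?S)"
          by (rule bounded_linear.has_vector_derivative[OF bounded_linear_inner_left ud])
        have 2: "(h e c k has_vector_derivative h' e c k t) (at t within ?S)"
          using h'[OF ce(2,1)] k by blast
        have "((\<lambda>s. (u s \<bullet> e) * h e c k s) has_vector_derivative ((u t \<bullet> e) * h' e c k t + (w' k t \<bullet> e) * h e c k t)) (at t within ?S)"
          by (rule has_vector_derivative_mult[OF 1 2])
        then show "((\<lambda>s. ((u s \<bullet> e) * h e c k s) *\<^sub>R c) has_vector_derivative
           ((u t \<bullet> e) * h' e c k t + (w' k t \<bullet> e) * h e c k t) *\<^sub>R c) (at t within ?S)"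
          by (rule bounded_linear.has_vector_derivative[OF bounded_linear_scaleR_left])
      qed
      moreover have "(\<Sum>c\<in>Basis. \<Sum>e\<in>Basis. ((u t \<bullet> e) * h' e c k t + (w' k t \<bullet> e) * h e c k t) *\<^sub>R c)
         = L h' k t (w k t) + L h k t (w' k t)"
        unfolding L_def u_def by (simp add: scaleR_left_distrib sum.distrib)
      ultimately have "(Q has_vector_derivative r' k t - (L h' k t (w k t) + L h k t (w' k t))) (at t within ?S)"
        unfolding Q_def by (intro has_vector_derivative_diff r'(1) k) simp
      then have Qd: "(Q has_vector_derivative 0) (at t within ?S)"
        using w'[OF k] by (simp add: \<rho>_def)
      have Qt: "Q t = 0" using Suc.prems(3)[OF k] by (simp add: Q_def u_def)
      show "(w k has_vector_derivative w' k t) (at t within ?S)"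
        unfolding has_vector_derivative_def has_derivative_within_alt
      proof (intro conjI allI impI)
        show "bounded_linear (\<lambda>x. x *\<^sub>R w' k t)" by (rule bounded_linear_scaleR_left)
        fix e :: real assume "e > 0"
        then have "e * m > 0" using m(1) by simp
        then obtain d where d: "d > 0" "\<forall>y\<in>?S. norm (y - t) < d \<longrightarrow> norm (Q y - Q t - (y - t) *\<^sub>R 0) \<le> e * m * norm (y - t)"
          using Qd unfolding has_vector_derivative_def has_derivative_within_alt by blast
        show "\<exists>d>0. \<forall>y\<in>?S. norm (y - t) < d \<longrightarrow> norm (w k y - w k t - (y - t) *\<^sub>R w' k t) \<le> e * norm (y - t)"
        proof (intro exI[of _ d] conjI ballI impI d(1))
          fix y assume y: "y \<in> ?S" "norm (y - t) < d"
          have "L h k y (w k y - u y) = Q y"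
            using linear_diff[OF Llin] Suc.prems(3)[OF k(1) y(1)] by (simp add: Q_def)
          then have "m * norm (w k y - u y) \<le> norm (Q y)" using lower[OF k(1) y(1), of "w k y - u y"] by simp
          also have "\<dots> \<le> e * m * norm (y - t)" using d(2) y Qt by simp
          finally have "norm (w k y - u y) \<le> e * norm (y - t)" using m(1) by (simp add: mult.commute mult.left_commute)
          then show "norm (w k y - w k t - (y - t) *\<^sub>R w' k t) \<le> e * norm (y - t)"
            by (simp add: u_def algebra_simps)
        qed
      qed
    qed
  qed
qed

end

section \<open>Symmetry of second derivatives\<close>

lemma frechet_derivative_cong_open:
  assumes "f differentiable (at x)" "open U" "x \<in> U" "\<And>y. y \<in> U \<Longrightarrow> f y = h y"
  shows "(h has_derivative frechet_derivative f (at x)) (at x)"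
    and "frechet_derivative h (at x) = frechet_derivative f (at x)"
proof -
  have "(f has_derivative frechet_derivative f (at x)) (at x)"
    using assms(1) by (simp add: frechet_derivative_works)
  then show 1: "(h has_derivative frechet_derivative f (at x)) (at x)"
    by (rule has_derivative_transform_within_open[OF _ assms(2,3,4)])
  show "frechet_derivative h (at x) = frechet_derivative f (at x)"
    using frechet_derivative_at[OF 1] by simp
qed

text \<open>On an open set a local extension agrees with \<open>f\<close> near each point, hence so
  do the derivatives. This reduces \<open>smooth_on\<close> on open sets to \<open>Cn_on\<close> of
  the function itself.\<close>

lemma Cn_on_local:
  assumes "open S" "\<And>x. x \<in> S \<Longrightarrow> \<exists>U F. open U \<and> x \<in> U \<and> Cn_on n U F \<and> (\<forall>y\<in>U \<inter> S. F y = f y)"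
  shows "Cn_on n S f"
  using assms(2)
proof (induction n arbitrary: f)
  case 0
  have "isCont f x" if xS: "x \<in> S" for x
  proof -
    obtain U F where U: "open U" "x \<in> U" "continuous_on U F" "\<forall>y\<in>U \<inter> S. F y = f y"
      using 0[OF xS] unfolding Cn_on.simps by blast
    have "continuous_on (U \<inter> S) F" using U(3) by (rule continuous_on_subset) auto
    then have "continuous_on (U \<inter> S) f" by (rule continuous_on_eq) (use U(4) in auto)
    then show ?thesis using U(1,2) assms(1) xS continuous_on_eq_continuous_at[of "U \<inter> S" f] by auto
  qed
  then show ?case using assms(1) by (simp add: continuous_on_eq_continuous_at)
next
  case (Suc n)
  have *: "f differentiable (at x) \<and> (\<exists>U F. open U \<and> x \<in> U \<and> Cn_on (Suc n) U F \<and>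
      (\<forall>y\<in>U \<inter> S. frechet_derivative F (at y) = frechet_derivative f (at y)))" if xS: "x \<in> S" for x
  proof -
    obtain U F where U: "open U" "x \<in> U" "Cn_on (Suc n) U F" "\<forall>y\<in>U \<inter> S. F y = f y"
      using Suc.prems[OF xS] by blast
    have o: "open (U \<inter> S)" using U(1) assms(1) by auto
    have d: "(f has_derivative frechet_derivative F (at y)) (at y)"
      "frechet_derivative f (at y) = frechet_derivative F (at y)" if "y \<in> U \<inter> S" for y
    proof -
      have "F differentiable (at y)" using U(3) that by auto
      from frechet_derivative_cong_open[OF this o that bspec[OF U(4)]]
      show "(f has_derivative frechet_derivative F (at y)) (at y)"
        "frechet_derivative f (at y) = frechet_derivative F (at y)" by auto
    qed
    have "f differentiable (at x)" using d(1)[of x] U(2) xS unfolding differentiable_def by blast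
    moreover have "\<forall>y\<in>U \<inter> S. frechet_derivative F (at y) = frechet_derivative f (at y)"
      using d(2) by simp
    ultimately show ?thesis using U(1-3) by blast
  qed
  have "Cn_on n S (\<lambda>x. frechet_derivative f (at x) v)" for v
  proof (rule Suc.IH)
    fix x assume "x \<in> S"
    then obtain U F where U: "open U" "x \<in> U" "Cn_on (Suc n) U F"
      "\<forall>y\<in>U \<inter> S. frechet_derivative F (at y) = frechet_derivative f (at y)" using * by blast
    show "\<exists>U F. open U \<and> x \<in> U \<and> Cn_on n U F \<and> (\<forall>y\<in>U \<inter> S. F y = frechet_derivative f (at y) v)"
      by (rule exI[of _ U], rule exI[of _ "\<lambda>y. frechet_derivative F (at y) v"]) (use U in auto)
  qed
  then show ?case using * by simp
qed

lemma smooth_on_imp_Cn_on: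
  assumes "open S" "smooth_on S f"
  shows "Cn_on n S f"
  by (rule Cn_on_local[OF assms(1)]) (use assms(2) in \<open>unfold smooth_on_def, blast\<close>)

text \<open>Two applications of the mean value theorem to the second difference over a small
  parallelogram, first along \<open>u\<close> and then along \<open>v\<close>. The condition on
  \<open>t\<close> keeps the parallelogram inside the ball.\<close>

lemma second_derivative_mean_value:
  fixes h :: "'b::euclidean_space \<Rightarrow> real"
  assumes h: "Cn_on 2 W h" and ball: "ball z r \<subseteq> W" and t: "0 < t" "t * (norm u + norm v) < r"
  obtains y where "dist z y < r"
    "h (z + t *\<^sub>R u + t *\<^sub>R v) - h (z + t *\<^sub>R u) - h (z + t *\<^sub>R v) + h z
       = t * t * frechet_derivative (\<lambda>y. frechet_derivative h (at y) u) (at y) v"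
proof -
  define Du where "Du y = frechet_derivative h (at y) u" for y
  have d1: "(h has_derivative frechet_derivative h (at y)) (at y)" if "y \<in> W" for y
    by (rule Cn_on_SucD[of 1 W]) (use h that in \<open>simp_all add: numeral_2_eq_2\<close>)
  have d2: "(Du has_derivative frechet_derivative Du (at y)) (at y)" if "y \<in> W" for y
    unfolding Du_def by (rule Cn_on_SucD[of 0 W]) (use h that in \<open>simp_all add: numeral_2_eq_2\<close>)
  have inW: "z + a *\<^sub>R u + b *\<^sub>R v \<in> W" "dist z (z + a *\<^sub>R u + b *\<^sub>R v) < r"
    if "0 \<le> a" "a \<le> t" "0 \<le> b" "b \<le> t" for a b
  proof -
    have "norm (a *\<^sub>R u + b *\<^sub>R v) \<le> a * norm u + b * norm v"
      using that by (intro norm_triangle_le) simp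
    also have "\<dots> \<le> t * norm u + t * norm v" using that by (intro add_mono mult_right_mono) auto
    also have "\<dots> < r" using t by (simp add: algebra_simps)
    finally show "dist z (z + a *\<^sub>R u + b *\<^sub>R v) < r" by (simp add: dist_norm norm_minus_commute algebra_simps)
    then show "z + a *\<^sub>R u + b *\<^sub>R v \<in> W" using ball by (auto simp: mem_ball)
  qed
  define p where "p a = h (z + a *\<^sub>R u + t *\<^sub>R v) - h (z + a *\<^sub>R u)" for a
  have pd: "(p has_real_derivative (Du (z + a *\<^sub>R u + t *\<^sub>R v) - Du (z + a *\<^sub>R u))) (at a)" if "0 \<le> a" "a \<le> t" for a
  proof -
    have c: "((\<lambda>a. h (z + a *\<^sub>R u + w)) has_derivative (\<lambda>s. frechet_derivative h (at (z + a *\<^sub>R u + w)) (s *\<^sub>R u))) (at a)"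
      if "z + a *\<^sub>R u + w \<in> W" for w
      by (rule has_derivative_compose[where f="\<lambda>a. z + a *\<^sub>R u + w" and g=h, OF _ d1[OF that]]) (auto intro!: derivative_eq_intros)
    have lin: "frechet_derivative h (at y) (s *\<^sub>R u) = s * Du y" if "y \<in> W" for y s
      unfolding Du_def using linear_scale[OF has_derivative_linear[OF d1[OF that]]] by simp
    have i1: "z + a *\<^sub>R u + t *\<^sub>R v \<in> W" "z + a *\<^sub>R u + 0 \<in> W" using inW(1)[of a t] inW(1)[of a 0] that t by auto
    have "((\<lambda>a. h (z + a *\<^sub>R u + t *\<^sub>R v) - h (z + a *\<^sub>R u + 0)) has_derivative
      (\<lambda>s. s * Du (z + a *\<^sub>R u + t *\<^sub>R v) - s * Du (z + a *\<^sub>R u + 0))) (at a)"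
      using has_derivative_diff[OF c[OF i1(1)] c[OF i1(2)]] lin[OF i1(1)] lin[OF i1(2)] by simp
    moreover have "(\<lambda>s. s * Du (z + a *\<^sub>R u + t *\<^sub>R v) - s * Du (z + a *\<^sub>R u + 0))
       = (*) (Du (z + a *\<^sub>R u + t *\<^sub>R v) - Du (z + a *\<^sub>R u))"
      by (rule ext) (simp add: algebra_simps)
    ultimately show ?thesis unfolding p_def has_field_derivative_def by simp
  qed
  obtain a where a: "0 < a" "a < t" "p t - p 0 = (t - 0) * (Du (z + a *\<^sub>R u + t *\<^sub>R v) - Du (z + a *\<^sub>R u))"
    using MVT2[OF t(1), of p "\<lambda>a. Du (z + a *\<^sub>R u + t *\<^sub>R v) - Du (z + a *\<^sub>R u)"] pd by blast
  define q where "q b = Du (z + a *\<^sub>R u + b *\<^sub>R v)" for b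
  have qd: "(q has_real_derivative frechet_derivative Du (at (z + a *\<^sub>R u + b *\<^sub>R v)) v) (at b)" if "0 \<le> b" "b \<le> t" for b
  proof -
    have i: "z + a *\<^sub>R u + b *\<^sub>R v \<in> W" using inW(1)[of a b] that a by auto
    have "(q has_derivative (\<lambda>s. frechet_derivative Du (at (z + a *\<^sub>R u + b *\<^sub>R v)) (s *\<^sub>R v))) (at b)"
      unfolding q_def
      by (rule has_derivative_compose[where f="\<lambda>b. z + a *\<^sub>R u + b *\<^sub>R v" and g=Du, OF _ d2[OF i]]) (auto intro!: derivative_eq_intros)
    moreover have "frechet_derivative Du (at (z + a *\<^sub>R u + b *\<^sub>R v)) (s *\<^sub>R v) = s * frechet_derivative Du (at (z + a *\<^sub>R u + b *\<^sub>R v)) v" for s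
      using linear_scale[OF has_derivative_linear[OF d2[OF i]]] by simp
    ultimately show ?thesis unfolding has_field_derivative_def by (simp add: mult_commute_abs)
  qed
  obtain b where b: "0 < b" "b < t" "q t - q 0 = (t - 0) * frechet_derivative Du (at (z + a *\<^sub>R u + b *\<^sub>R v)) v"
    using MVT2[OF t(1), of q "\<lambda>b. frechet_derivative Du (at (z + a *\<^sub>R u + b *\<^sub>R v)) v"] qd by blast
  show ?thesis
  proof (rule that[of "z + a *\<^sub>R u + b *\<^sub>R v"])
    show "dist z (z + a *\<^sub>R u + b *\<^sub>R v) < r" using inW(2)[of a b] a b by auto
    have "h (z + t *\<^sub>R u + t *\<^sub>R v) - h (z + t *\<^sub>R u) - h (z + t *\<^sub>R v) + h z = p t - p 0" by (simp add: p_def)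
    also have "\<dots> = t * (q t - q 0)" using a(3) by (simp add: q_def)
    also have "\<dots> = t * t * frechet_derivative Du (at (z + a *\<^sub>R u + b *\<^sub>R v)) v" using b(3) by simp
    finally show "h (z + t *\<^sub>R u + t *\<^sub>R v) - h (z + t *\<^sub>R u) - h (z + t *\<^sub>R v) + h z =
      t * t * frechet_derivative (\<lambda>y. frechet_derivative h (at y) u) (at (z + a *\<^sub>R u + b *\<^sub>R v)) v"
      by (simp add: Du_def[abs_def])
  qed
qed

text \<open>The second difference is symmetric in \<open>u\<close> and \<open>v\<close>. So both
  mixed derivatives take a common value at points near \<open>z\<close>, and continuity identifies
  them at \<open>z\<close>.\<close>

lemma second_derivative_symmetric_real:
  fixes h :: "'b::euclidean_space \<Rightarrow> real"
  assumes h: "Cn_on 2 W h" and W: "open W" "z \<in> W"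
  shows "frechet_derivative (\<lambda>y. frechet_derivative h (at y) u) (at z) v =
         frechet_derivative (\<lambda>y. frechet_derivative h (at y) v) (at z) u"
proof -
  define H where "H u v y = frechet_derivative (\<lambda>y. frechet_derivative h (at y) u) (at y) v" for u v y
  have Hc: "isCont (H u v) z" for u v
  proof -
    have "continuous_on W (H u v)" using h by (simp add: H_def[abs_def] numeral_2_eq_2)
    then show ?thesis using W by (simp add: continuous_on_eq_continuous_at)
  qed
  have "\<bar>H u v z - H v u z\<bar> \<le> 2 * e" if "e > 0" for e
  proof -
    obtain r1 where r1: "r1 > 0" "\<And>y. dist y z < r1 \<Longrightarrow> dist (H u v y) (H u v z) < e"
      using Hc[of u v] \<open>e > 0\<close> unfolding continuous_at_eps_delta by blast
    obtain r2 where r2: "r2 > 0" "\<And>y. dist y z < r2 \<Longrightarrow> dist (H v u y) (H v u z) < e"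
      using Hc[of v u] \<open>e > 0\<close> unfolding continuous_at_eps_delta by blast
    obtain r3 where r3: "r3 > 0" "ball z r3 \<subseteq> W" using W open_contains_ball by blast
    define r where "r = min r1 (min r2 r3)"
    have r: "r > 0" "ball z r \<subseteq> W" using r1 r2 r3 by (auto simp: r_def)
    define N where "N = norm u + norm v + 1"
    define t where "t = r / (2 * N)"
    have np: "N > 0" using norm_ge_zero[of u] norm_ge_zero[of v] unfolding N_def by linarith
    have t: "t > 0" using r np by (simp add: t_def)
    have "t * (norm u + norm v) \<le> t * N" using t by (intro mult_left_mono) (auto simp: N_def)
    also have "\<dots> = r / 2" using np by (simp add: t_def)
    also have "\<dots> < r" using r by simp
    finally have tr: "t * (norm u + norm v) < r" .
    obtain y1 where y1: "dist z y1 < r" "h (z + t *\<^sub>R u + t *\<^sub>R v) - h (z + t *\<^sub>R u) - h (z + t *\<^sub>R v) + h z = t * t * H u v y1"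
      using second_derivative_mean_value[OF h r(2) t tr] unfolding H_def by metis
    have tr': "t * (norm v + norm u) < r" using tr by (simp add: add.commute)
    obtain y2 where y2: "dist z y2 < r" "h (z + t *\<^sub>R v + t *\<^sub>R u) - h (z + t *\<^sub>R v) - h (z + t *\<^sub>R u) + h z = t * t * H v u y2"
      using second_derivative_mean_value[OF h r(2) t tr'] unfolding H_def by metis
    have "z + t *\<^sub>R v + t *\<^sub>R u = z + t *\<^sub>R u + t *\<^sub>R v" by simp
    then have "h (z + t *\<^sub>R v + t *\<^sub>R u) = h (z + t *\<^sub>R u + t *\<^sub>R v)" by (rule arg_cong)
    then have "t * t * H u v y1 = t * t * H v u y2" using y1(2) y2(2) by linarith
    then have "H u v y1 = H v u y2" using t by simp
    moreover have "dist (H u v y1) (H u v z) < e" using r1(2)[of y1] y1(1) by (simp add: r_def dist_commute)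
    moreover have "dist (H v u y2) (H v u z) < e" using r2(2)[of y2] y2(1) by (simp add: r_def dist_commute)
    ultimately show ?thesis by (simp add: dist_real_def)
  qed
  then have "H u v z = H v u z"
  proof -
    have "\<bar>H u v z - H v u z\<bar> \<le> 0 + e" if "e > 0" for e
      using \<open>\<And>e. e > 0 \<Longrightarrow> \<bar>H u v z - H v u z\<bar> \<le> 2 * e\<close>[of "e/2"] that by simp
    then have "\<bar>H u v z - H v u z\<bar> \<le> 0" by (rule field_le_epsilon)
    then show ?thesis by simp
  qed
  then show ?thesis by (simp add: H_def)
qed

lemma Cn_on_inner:
  fixes f :: "'b::real_normed_vector \<Rightarrow> 'c::real_inner"
  assumes "Cn_on n W f" "open W"
  shows "Cn_on n W (\<lambda>y. f y \<bullet> i)"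
  using assms(1)
proof (induction n arbitrary: f)
  case 0
  then show ?case by (auto intro: continuous_intros)
next
  case (Suc n)
  have d: "((\<lambda>y. f y \<bullet> i) has_derivative (\<lambda>v. frechet_derivative f (at x) v \<bullet> i)) (at x)" if "x \<in> W" for x
    using Cn_on_SucD[OF Suc.prems that] by (rule has_derivative_inner_left)
  have e: "frechet_derivative (\<lambda>y. f y \<bullet> i) (at x) v = frechet_derivative f (at x) v \<bullet> i" if "x \<in> W" for x v
    using frechet_derivative_at[OF d[OF that]] by metis
  have "Cn_on n W (\<lambda>x. frechet_derivative (\<lambda>y. f y \<bullet> i) (at x) v)" for v
  proof (rule Cn_on_local[OF assms(2)])
    fix x assume "x \<in> W"
    then show "\<exists>U F. open U \<and> x \<in> U \<and> Cn_on n U F \<and> (\<forall>y\<in>U \<inter> W. F y = frechet_derivative (\<lambda>y. f y \<bullet> i) (at y) v)"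
      using Suc.IH[of "\<lambda>x. frechet_derivative f (at x) v"] Suc.prems assms(2) e
      by (intro exI[of _ W] exI[of _ "\<lambda>x. frechet_derivative f (at x) v \<bullet> i"]) auto
  qed
  then show ?case using d unfolding Cn_on.simps differentiable_def by blast
qed

lemma second_derivative_symmetric:
  fixes f :: "'b::euclidean_space \<Rightarrow> 'c::euclidean_space"
  assumes f: "Cn_on 2 W f" and W: "open W" "z \<in> W"
  shows "frechet_derivative (\<lambda>y. frechet_derivative f (at y) u) (at z) v =
         frechet_derivative (\<lambda>y. frechet_derivative f (at y) v) (at z) u"
proof (rule euclidean_eqI)
  fix i :: 'c
  have f2: "Cn_on (Suc (Suc 0)) W f" using f by (simp add: numeral_2_eq_2)
  have e1: "frechet_derivative (\<lambda>y. f y \<bullet> i) (at x) u = frechet_derivative f (at x) u \<bullet> i" if "x \<in> W" for x u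
    using frechet_derivative_at[OF has_derivative_inner_left[OF Cn_on_SucD[OF f2 that]]] by metis
  have e2: "frechet_derivative (\<lambda>y. frechet_derivative (\<lambda>y. f y \<bullet> i) (at y) u) (at z) v
     = frechet_derivative (\<lambda>y. frechet_derivative f (at y) u) (at z) v \<bullet> i" for u v
  proof -
    have "Cn_on (Suc 0) W (\<lambda>y. frechet_derivative f (at y) u)" using f2 by simp
    from has_derivative_inner_left[OF Cn_on_SucD[OF this W(2)], of i]
    have "((\<lambda>y. frechet_derivative f (at y) u \<bullet> i) has_derivative (\<lambda>v. frechet_derivative (\<lambda>y. frechet_derivative f (at y) u) (at z) v \<bullet> i)) (at z)" .
    then have "((\<lambda>y. frechet_derivative (\<lambda>y. f y \<bullet> i) (at y) u) has_derivative (\<lambda>v. frechet_derivative (\<lambda>y. frechet_derivative f (at y) u) (at z) v \<bullet> i)) (at z)"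
      by (rule has_derivative_transform_within_open[OF _ W]) (simp add: e1)
    from frechet_derivative_at[OF this] show ?thesis by metis
  qed
  show "frechet_derivative (\<lambda>y. frechet_derivative f (at y) u) (at z) v \<bullet> i =
        frechet_derivative (\<lambda>y. frechet_derivative f (at y) v) (at z) u \<bullet> i"
    unfolding e2[symmetric] by (rule second_derivative_symmetric_real[OF Cn_on_inner[OF f W(1)] W])
qed

section \<open>Metric and connection in charts\<close>

locale riemannian =
  fixes \<A> :: "('a::{t2_space, second_countable_topology}, 'b::euclidean_space) chart set"
    and g :: "('a, 'b) metric"
  assumes riemannian_manifold: "riemannian_manifold \<A> g"
begin

abbreviation "crd c x \<equiv> chart_map c \<circ> x"
abbreviation "cvel \<equiv> cov_velocity \<A> g"
abbreviation "speed j x q \<equiv> tnorm g (x q) (cvel j x q)"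
abbreviation "Chr \<equiv> levi_civita \<A> g"
abbreviation "Hk \<equiv> Hk_curves \<A>"
abbreviation "TM \<equiv> tangent_space \<A>"
abbreviation "\<M> \<equiv> carrier \<A>"

lemma chart_homeo:
  assumes "c \<in> \<A>"
  shows "open (chart_dom c)" "open (chart_img c)"
    "homeomorphism (chart_dom c) (chart_img c) (chart_map c) (chart_inv c)"
    "continuous_on (chart_dom c) (chart_map c)" "continuous_on (chart_img c) (chart_inv c)"
  using riemannian_manifold assms
  unfolding riemannian_manifold_def smooth_atlas_def homeomorphism_def by blast+

lemma chart_inv_map [simp]: "c \<in> \<A> \<Longrightarrow> p \<in> chart_dom c \<Longrightarrow> chart_inv c (chart_map c p) = p"
  using chart_homeo(3) homeomorphism_apply1 by blast

lemma chart_map_inv [simp]: "c \<in> \<A> \<Longrightarrow> z \<in> chart_img c \<Longrightarrow> chart_map c (chart_inv c z) = z"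
  using chart_homeo(3) homeomorphism_apply2 by blast

lemma chart_map_in: "p \<in> chart_dom c \<Longrightarrow> chart_map c p \<in> chart_img c"
  by (simp add: chart_img_def)

lemma chart_inv_in: "c \<in> \<A> \<Longrightarrow> z \<in> chart_img c \<Longrightarrow> chart_inv c z \<in> chart_dom c"
  by (auto simp: chart_img_def)

lemma open_chart_image:
  assumes "c \<in> \<A>" "open S"
  shows "open (chart_map c ` (chart_dom c \<inter> S))"
proof -
  have "chart_map c ` (chart_dom c \<inter> S) = chart_inv c -` S \<inter> chart_img c"
    using assms(1) by (force simp: chart_img_def)
  moreover have "open (chart_inv c -` S \<inter> chart_img c)"
    using chart_homeo[OF assms(1)] assms(2) continuous_on_open_vimage by blast
  ultimately show ?thesis by simp
qed

lemma transition_Cn_on: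
  assumes "c \<in> \<A>" "d \<in> \<A>"
  shows "open (chart_map c ` (chart_dom c \<inter> chart_dom d))"
    and "Cn_on n (chart_map c ` (chart_dom c \<inter> chart_dom d)) (transition c d)"
proof -
  show o: "open (chart_map c ` (chart_dom c \<inter> chart_dom d))"
    using open_chart_image[OF assms(1) chart_homeo(1)[OF assms(2)]] .
  have "smooth_on (chart_map c ` (chart_dom c \<inter> chart_dom d)) (transition c d)"
    using riemannian_manifold assms unfolding riemannian_manifold_def smooth_atlas_def by blast
  then show "Cn_on n (chart_map c ` (chart_dom c \<inter> chart_dom d)) (transition c d)"
    by (rule smooth_on_imp_Cn_on[OF o])
qed

lemma transition_map [simp]: "c \<in> \<A> \<Longrightarrow> p \<in> chart_dom c \<Longrightarrow> transition c d (chart_map c p) = chart_map d p"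
  by (simp add: transition_def)

section \<open>Chart transitions and tangent vectors\<close>

definition dtrans :: "('a, 'b) chart \<Rightarrow> ('a, 'b) chart \<Rightarrow> 'b \<Rightarrow> 'b \<Rightarrow> 'b" where
  "dtrans c d z = frechet_derivative (transition c d) (at z)"

lemma dtrans_has_derivative:
  assumes "c \<in> \<A>" "d \<in> \<A>" "p \<in> chart_dom c" "p \<in> chart_dom d"
  shows "(transition c d has_derivative dtrans c d (chart_map c p)) (at (chart_map c p))"
  unfolding dtrans_def
  by (rule Cn_on_SucD[OF transition_Cn_on(2)[OF assms(1,2), of "Suc 0"]]) (use assms in blast)

lemma dtrans_linear:
  assumes "c \<in> \<A>" "d \<in> \<A>" "p \<in> chart_dom c" "p \<in> chart_dom d"
  shows "linear (dtrans c d (chart_map c p))"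
  using has_derivative_linear[OF dtrans_has_derivative[OF assms]] .

lemma dtrans_self:
  assumes "c \<in> \<A>" "p \<in> chart_dom c"
  shows "dtrans c c (chart_map c p) u = u"
proof -
  have "((\<lambda>z. z) has_derivative (\<lambda>u. u)) (at (chart_map c p))" by (rule has_derivative_ident)
  then have "(transition c c has_derivative (\<lambda>u. u)) (at (chart_map c p))"
    by (rule has_derivative_transform_within_open[OF _ chart_homeo(2)[OF assms(1)] chart_map_in[OF assms(2)]])
       (use assms(1) in \<open>simp add: transition_def\<close>)
  from frechet_derivative_at[OF this] show ?thesis unfolding dtrans_def by metis
qed

lemma dtrans_trans:
  assumes "c \<in> \<A>" "d \<in> \<A>" "e \<in> \<A>" "p \<in> chart_dom c" "p \<in> chart_dom d" "p \<in> chart_dom e"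
  shows "dtrans d e (chart_map d p) (dtrans c d (chart_map c p) u) = dtrans c e (chart_map c p) u"
proof -
  have "((\<lambda>z. transition d e (transition c d z)) has_derivative (\<lambda>u. dtrans d e (chart_map d p) (dtrans c d (chart_map c p) u))) (at (chart_map c p))"
    by (rule has_derivative_compose[where g="transition d e", OF dtrans_has_derivative[OF assms(1,2,4,5)]])
       (use dtrans_has_derivative[OF assms(2,3,5,6)] assms in simp)
  then have "(transition c e has_derivative (\<lambda>u. dtrans d e (chart_map d p) (dtrans c d (chart_map c p) u))) (at (chart_map c p))"
  proof (rule has_derivative_transform_within_open[OF _ open_chart_image[OF assms(1), of "chart_dom d \<inter> chart_dom e"]])
    show "open (chart_dom d \<inter> chart_dom e)" using chart_homeo(1) assms by blast
    show "chart_map c p \<in> chart_map c ` (chart_dom c \<inter> (chart_dom d \<inter> chart_dom e))" using assms by blast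
    show "transition d e (transition c d z) = transition c e z"
      if "z \<in> chart_map c ` (chart_dom c \<inter> (chart_dom d \<inter> chart_dom e))" for z
      using that assms by auto
  qed
  from frechet_derivative_at[OF this] show ?thesis unfolding dtrans_def by metis
qed

lemma dtrans_inverse:
  assumes "c \<in> \<A>" "d \<in> \<A>" "p \<in> chart_dom c" "p \<in> chart_dom d"
  shows "dtrans d c (chart_map d p) (dtrans c d (chart_map c p) u) = u"
  using dtrans_trans[OF assms(1,2,1) assms(3,4,3)] dtrans_self[OF assms(1,3)] by simp

lemma tangent_spaceD:
  assumes "X \<in> TM p" "c \<in> \<A>" "d \<in> \<A>" "p \<in> chart_dom c" "p \<in> chart_dom d"
  shows "X d = dtrans c d (chart_map c p) (X c)"
  using assms unfolding tangent_space_def charts_at_def dtrans_def by blast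

lemma tangent_spaceI:
  assumes "c \<in> \<A>" "p \<in> chart_dom c"
    and "\<And>d. d \<in> \<A> \<Longrightarrow> p \<in> chart_dom d \<Longrightarrow> X d = dtrans c d (chart_map c p) (X c)"
    and "\<And>d. d \<notin> charts_at \<A> p \<Longrightarrow> X d = 0"
  shows "X \<in> TM p"
proof -
  have "X e = frechet_derivative (transition d e) (at (chart_map d p)) (X d)"
    if de: "d \<in> charts_at \<A> p" "e \<in> charts_at \<A> p" for d e
  proof -
    have *: "d \<in> \<A>" "p \<in> chart_dom d" "e \<in> \<A>" "p \<in> chart_dom e" using de by (auto simp: charts_at_def)
    have "dtrans d e (chart_map d p) (X d) = dtrans c e (chart_map c p) (X c)"
      unfolding assms(3)[OF *(1,2)] by (rule dtrans_trans[OF assms(1) *(1,3) assms(2) *(2,4)])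
    then show ?thesis using assms(3)[OF *(3,4)] by (simp add: dtrans_def)
  qed
  then show ?thesis using assms(4) unfolding tangent_space_def by blast
qed

lemma tvec_of_eq: "tvec_of \<A> c p u = (\<lambda>d. if d \<in> charts_at \<A> p then dtrans c d (chart_map c p) u else 0)"
  unfolding tvec_of_def dtrans_def by (rule refl)

lemma tangent_space_eq_tvec_of:
  assumes "X \<in> TM p" "c \<in> \<A>" "p \<in> chart_dom c"
  shows "tvec_of \<A> c p (X c) = X"
proof
  fix d
  show "tvec_of \<A> c p (X c) d = X d"
  proof (cases "d \<in> charts_at \<A> p")
    case True
    then show ?thesis using tangent_spaceD[OF assms(1,2) _ assms(3)] by (simp add: tvec_of_eq charts_at_def)
  next
    case False
    then show ?thesis using assms(1) by (simp add: tvec_of_eq tangent_space_def)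
  qed
qed

lemma tvec_of_change:
  assumes "c \<in> \<A>" "d \<in> \<A>" "p \<in> chart_dom c" "p \<in> chart_dom d"
  shows "tvec_of \<A> c p u = tvec_of \<A> d p (dtrans c d (chart_map c p) u)"
  unfolding tvec_of_eq using dtrans_trans[OF assms(1,2) _ assms(3,4)] by (auto simp: charts_at_def fun_eq_iff)

section \<open>The metric in coordinates\<close>

abbreviation (input) G :: "('a, 'b) chart \<Rightarrow> 'b \<Rightarrow> 'b \<Rightarrow> 'b \<Rightarrow> real" where
  "G \<equiv> metric_in_chart \<A> g"

lemma G_metric:
  assumes "c \<in> \<A>" "z \<in> chart_img c"
  shows "bilinear (G c z)" "G c z u v = G c z v u" "u \<noteq> 0 \<Longrightarrow> G c z u u > 0"
  using riemannian_manifold assms unfolding riemannian_manifold_def riemannian_metric_def by blast+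

lemma G_Cn_on: "c \<in> \<A> \<Longrightarrow> Cn_on n (chart_img c) (\<lambda>z. G c z u v)"
  using riemannian_manifold chart_homeo(2)
  unfolding riemannian_manifold_def riemannian_metric_def by (intro smooth_on_imp_Cn_on) blast+

lemma g_eq_G:
  assumes "X \<in> TM p" "h \<in> TM p" "c \<in> \<A>" "p \<in> chart_dom c"
  shows "g p X h = G c (chart_map c p) (X c) (h c)"
  using assms tangent_space_eq_tvec_of by (simp add: metric_in_chart_def)

lemma tnorm_eq_G:
  assumes "X \<in> TM p" "c \<in> \<A>" "p \<in> chart_dom c"
  shows "tnorm g p X = sqrt (G c (chart_map c p) (X c) (X c))"
  using g_eq_G[OF assms(1,1,2,3)] by (simp add: tnorm_def)

lemma G_change:
  assumes "c \<in> \<A>" "d \<in> \<A>" "p \<in> chart_dom c" "p \<in> chart_dom d"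
  shows "G c (chart_map c p) u v = G d (chart_map d p) (dtrans c d (chart_map c p) u) (dtrans c d (chart_map c p) v)"
  using assms tvec_of_change[OF assms] by (simp add: metric_in_chart_def)

lemma tangent_space_add_scale:
  assumes "X \<in> TM p" "h \<in> TM p" "p \<in> \<M>"
  shows "(\<lambda>c. r *\<^sub>R X c + s *\<^sub>R h c) \<in> TM p"
proof -
  obtain c where c: "c \<in> \<A>" "p \<in> chart_dom c" using assms(3) by (auto simp: carrier_def)
  show ?thesis
  proof (rule tangent_spaceI[OF c])
    fix d assume d: "d \<in> \<A>" "p \<in> chart_dom d"
    show "r *\<^sub>R X d + s *\<^sub>R h d = dtrans c d (chart_map c p) (r *\<^sub>R X c + s *\<^sub>R h c)"
      using dtrans_linear[OF c(1) d(1) c(2) d(2)] tangent_spaceD[OF assms(1) c(1) d(1) c(2) d(2)]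
        tangent_spaceD[OF assms(2) c(1) d(1) c(2) d(2)] by (simp add: linear_add linear_scale)
  next
    fix d assume "d \<notin> charts_at \<A> p"
    then show "r *\<^sub>R X d + s *\<^sub>R h d = 0" using assms by (simp add: tangent_space_def)
  qed
qed

text \<open>\<open>riemannian_metric\<close> gives smoothness only for fixed vectors
  \<open>u\<close> and \<open>v\<close>. The expansion reduces differentiability, continuity and
  measurability with moving vectors to those coefficient functions.\<close>

lemma G_sum:
  assumes "c \<in> \<A>" "z \<in> chart_img c"
  shows "G c z u v = (\<Sum>e\<in>Basis. \<Sum>f\<in>Basis. (u \<bullet> e) * (v \<bullet> f) * G c z e f)"
proof -
  note bl = G_metric(1)[OF assms]
  have "G c z u v = G c z (\<Sum>e\<in>Basis. (u \<bullet> e) *\<^sub>R e) (\<Sum>f\<in>Basis. (v \<bullet> f) *\<^sub>R f)"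
    by (simp add: euclidean_representation)
  also have "\<dots> = (\<Sum>(e, f)\<in>Basis \<times> Basis. G c z ((u \<bullet> e) *\<^sub>R e) ((v \<bullet> f) *\<^sub>R f))"
    by (rule bilinear_sum[OF bl])
  also have "\<dots> = (\<Sum>e\<in>Basis. \<Sum>f\<in>Basis. (u \<bullet> e) * (v \<bullet> f) * G c z e f)"
    by (simp add: sum.cartesian_product bilinear_lmul[OF bl] bilinear_rmul[OF bl] mult_ac)
  finally show ?thesis .
qed

lemma G_cauchy_schwarz:
  assumes "c \<in> \<A>" "z \<in> chart_img c"
  shows "\<bar>G c z u v\<bar> \<le> sqrt (G c z u u) * sqrt (G c z v v)"
proof -
  note bl = G_metric(1)[OF assms]
  have nn: "G c z w w \<ge> 0" for w
    using G_metric(3)[OF assms, of w] bilinear_lzero[OF bl] by (cases "w = 0") (auto intro: less_imp_le)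
  have "(G c z u v)\<^sup>2 \<le> G c z u u * G c z v v"
  proof (cases "v = 0")
    case True
    then show ?thesis using bilinear_rzero[OF bl] by simp
  next
    case False
    then have p: "G c z v v > 0" using G_metric(3)[OF assms] by blast
    define k where "k = G c z u v / G c z v v"
    have "0 \<le> G c z (u - k *\<^sub>R v) (u - k *\<^sub>R v)" by (rule nn)
    also have "\<dots> = G c z u u - 2 * k * G c z u v + k * k * G c z v v"
      by (simp add: bilinear_lsub[OF bl] bilinear_rsub[OF bl] bilinear_lmul[OF bl] bilinear_rmul[OF bl]
          G_metric(2)[OF assms, of v u] algebra_simps)
    also have "\<dots> = G c z u u - (G c z u v)\<^sup>2 / G c z v v"
      using p by (simp add: k_def power2_eq_square field_simps)
    finally show ?thesis using p by (simp add: field_simps)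
  qed
  then have "sqrt ((G c z u v)\<^sup>2) \<le> sqrt (G c z u u * G c z v v)" by (rule real_sqrt_le_mono)
  then show ?thesis by (simp add: real_sqrt_mult)
qed

lemma G_nonneg:
  assumes "c \<in> \<A>" "z \<in> chart_img c"
  shows "G c z u u \<ge> 0"
  using G_metric(3)[OF assms, of u] bilinear_lzero[OF G_metric(1)[OF assms]] by (cases "u = 0") (auto intro: less_imp_le)

lemma G_norm_triangle:
  assumes "c \<in> \<A>" "z \<in> chart_img c"
  shows "sqrt (G c z (u + v) (u + v)) \<le> sqrt (G c z u u) + sqrt (G c z v v)"
proof -
  note bl = G_metric(1)[OF assms]
  have "G c z (u + v) (u + v) = G c z u u + 2 * G c z u v + G c z v v"
    by (simp add: bilinear_ladd[OF bl] bilinear_radd[OF bl] G_metric(2)[OF assms, of v u])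
  also have "\<dots> \<le> (sqrt (G c z u u) + sqrt (G c z v v))\<^sup>2"
    using G_cauchy_schwarz[OF assms, of u v] G_nonneg[OF assms] by (simp add: power2_sum)
  finally have "sqrt (G c z (u + v) (u + v)) \<le> sqrt ((sqrt (G c z u u) + sqrt (G c z v v))\<^sup>2)"
    by (rule real_sqrt_le_mono)
  then show ?thesis using G_nonneg[OF assms] by simp
qed

text \<open>\<open>m\<close> and \<open>M\<close> are the extreme values of the norm on
  \<open>K\<close> times the unit sphere, which is compact; homogeneity extends the bounds to all
  vectors.\<close>

lemma G_norm_bounds:
  assumes "c \<in> \<A>" "compact K" "K \<subseteq> chart_img c"
  obtains m M where "0 < m" "0 < M" "\<And>z u. z \<in> K \<Longrightarrow> m * norm u \<le> sqrt (G c z u u)"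
    "\<And>z u. z \<in> K \<Longrightarrow> sqrt (G c z u u) \<le> M * norm u"
proof -
  let ?q = "\<lambda>(z, u). sqrt (G c z u u)"
  let ?C = "K \<times> sphere (0::'b) 1"
  have comp: "compact ?C" using assms(2) by (intro compact_Times compact_sphere)
  have cont: "continuous_on ?C ?q"
  proof -
    have "continuous_on ?C (\<lambda>x. \<Sum>e\<in>Basis. \<Sum>f\<in>Basis. (snd x \<bullet> e) * (snd x \<bullet> f) * G c (fst x) e f)"
    proof (intro continuous_intros)
      fix e f :: 'b
      have "continuous_on K (\<lambda>z. G c z e f)"
        using G_Cn_on[OF assms(1), of 0 e f] assms(3) by (auto intro: continuous_on_subset)
      then show "continuous_on ?C (\<lambda>x. G c (fst x) e f)"
        by (rule continuous_on_compose2) (auto intro: continuous_intros)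
    qed
    then have "continuous_on ?C (\<lambda>x. G c (fst x) (snd x) (snd x))"
      by (rule continuous_on_eq) (use G_sum[OF assms(1)] assms(3) in \<open>auto\<close>)
    then show ?thesis by (auto simp: split_beta intro: continuous_intros)
  qed
  have hom: "sqrt (G c z u u) = norm u * ?q (z, u /\<^sub>R norm u)" if zu: "z \<in> K" "u \<noteq> 0" for z u
  proof -
    have z: "z \<in> chart_img c" using zu assms(3) by blast
    have "G c z u u = G c z (norm u *\<^sub>R (u /\<^sub>R norm u)) (norm u *\<^sub>R (u /\<^sub>R norm u))" using zu by simp
    also have "\<dots> = (norm u)\<^sup>2 * G c z (u /\<^sub>R norm u) (u /\<^sub>R norm u)"
      unfolding bilinear_lmul[OF G_metric(1)[OF assms(1) z]] bilinear_rmul[OF G_metric(1)[OF assms(1) z]]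
      by (simp add: power2_eq_square)
    finally show ?thesis by (simp add: real_sqrt_mult)
  qed
  have z0: "sqrt (G c z 0 0) = 0" if "z \<in> K" for z
    using bilinear_lzero[OF G_metric(1)[OF assms(1)]] that assms(3) by auto
  show ?thesis
  proof (cases "K = {}")
    case True
    then show ?thesis using that[of 1 1] by simp
  next
    case False
    then have ne: "?C \<noteq> {}" using vector_choose_size[of 1] by (auto simp: sphere_def dist_norm)
    obtain x0 where x0: "x0 \<in> ?C" "\<And>y. y \<in> ?C \<Longrightarrow> ?q x0 \<le> ?q y"
      using continuous_attains_inf[OF comp ne cont] by blast
    obtain x1 where x1: "x1 \<in> ?C" "\<And>y. y \<in> ?C \<Longrightarrow> ?q y \<le> ?q x1"
      using continuous_attains_sup[OF comp ne cont] by blast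
    have p0: "?q x0 > 0"
    proof -
      obtain z u where zu: "x0 = (z, u)" by (metis surj_pair)
      then have "z \<in> chart_img c" "u \<noteq> 0" using x0(1) assms(3) by auto
      then show ?thesis using G_metric(3)[OF assms(1)] zu by simp
    qed
    have mem: "(z, u /\<^sub>R norm u) \<in> ?C" if "z \<in> K" "u \<noteq> 0" for z u using that by simp
    show ?thesis
    proof (rule that[of "?q x0" "?q x1"])
      show "0 < ?q x0" by (rule p0)
      show "0 < ?q x1" using p0 x0(2)[OF x1(1)] by linarith
      fix z u assume z: "z \<in> K"
      show "?q x0 * norm u \<le> sqrt (G c z u u)"
      proof (cases "u = 0")
        case False
        show ?thesis unfolding hom[OF z False] using x0(2)[OF mem[OF z False]]
          by (subst mult.commute) (rule mult_left_mono, auto)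
      qed (use z0[OF z] in simp)
      show "sqrt (G c z u u) \<le> ?q x1 * norm u"
      proof (cases "u = 0")
        case False
        show ?thesis unfolding hom[OF z False] using x1(2)[OF mem[OF z False]]
          by (subst (2) mult.commute) (rule mult_left_mono, auto)
      qed (use z0[OF z] in simp)
    qed
  qed
qed

definition dG :: "('a, 'b) chart \<Rightarrow> 'b \<Rightarrow> 'b \<Rightarrow> 'b \<Rightarrow> 'b \<Rightarrow> real" where
  "dG c z u v w = frechet_derivative (\<lambda>y. G c y v w) (at z) u"

lemma dG_has_derivative:
  assumes "c \<in> \<A>" "z \<in> chart_img c"
  shows "((\<lambda>y. G c y v w) has_derivative (\<lambda>u. dG c z u v w)) (at z)"
  unfolding dG_def by (rule Cn_on_SucD[OF G_Cn_on[OF assms(1), of "Suc 0"] assms(2)])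

lemma dG_linear1: "c \<in> \<A> \<Longrightarrow> z \<in> chart_img c \<Longrightarrow> linear (\<lambda>u. dG c z u v w)"
  by (rule has_derivative_linear[OF dG_has_derivative])

lemma dG_unique:
  assumes "c \<in> \<A>" "z \<in> chart_img c" "(h has_derivative h') (at z)" "\<And>y. y \<in> chart_img c \<Longrightarrow> G c y v w = h y"
  shows "dG c z u v w = h' u"
proof -
  have "((\<lambda>y. G c y v w) has_derivative h') (at z)"
    by (rule has_derivative_transform_within_open[OF assms(3) chart_homeo(2)[OF assms(1)] assms(2)]) (simp add: assms(4))
  from frechet_derivative_at[OF this] show ?thesis unfolding dG_def by metis
qed

lemma dG_sym: "c \<in> \<A> \<Longrightarrow> z \<in> chart_img c \<Longrightarrow> dG c z u v w = dG c z u w v"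
  by (rule dG_unique[OF _ _ dG_has_derivative]) (auto intro: G_metric(2))

lemma dG_bilinear:
  assumes "c \<in> \<A>" "z \<in> chart_img c"
  shows "bilinear (dG c z u)"
proof -
  have l: "linear (\<lambda>v. dG c z u v w)" for w
  proof (rule linearI)
    fix v v' r
    show "dG c z u (v + v') w = dG c z u v w + dG c z u v' w"
      by (rule dG_unique[OF assms has_derivative_add[OF dG_has_derivative[OF assms, of v w] dG_has_derivative[OF assms, of v' w]]])
         (simp add: bilinear_ladd[OF G_metric(1)[OF assms(1)]])
    show "dG c z u (r *\<^sub>R v) w = r *\<^sub>R dG c z u v w"
      by (rule dG_unique[OF assms has_derivative_scaleR_right[OF dG_has_derivative[OF assms, of v w]]])
         (simp add: bilinear_lmul[OF G_metric(1)[OF assms(1)]])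
  qed
  have "linear (\<lambda>w. dG c z u v w)" for v
    using l[of v] dG_sym[OF assms, of u v] by simp
  with l show ?thesis by (simp add: bilinear_def)
qed

text \<open>The product rule with moving base point. The domain is a general normed space because it
  serves both for transition maps (change of charts) and for curves (growth of norms).\<close>

lemma G_has_derivative:
  fixes w u v :: "'x::real_normed_vector \<Rightarrow> 'b"
  assumes c: "c \<in> \<A>" "\<And>y. y \<in> S \<Longrightarrow> w y \<in> chart_img c" "x \<in> S"
    and d: "(w has_derivative w') (at x within S)" "(u has_derivative u') (at x within S)" "(v has_derivative v') (at x within S)"
  shows "((\<lambda>y. G c (w y) (u y) (v y)) has_derivative
     (\<lambda>h. dG c (w x) (w' h) (u x) (v x) + G c (w x) (u' h) (v x) + G c (w x) (u x) (v' h))) (at x within S)"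
proof -
  have zx: "w x \<in> chart_img c" using c by blast
  have "((\<lambda>y. \<Sum>e\<in>Basis. \<Sum>f\<in>Basis. (u y \<bullet> e) * (v y \<bullet> f) * G c (w y) e f) has_derivative
     (\<lambda>h. \<Sum>e\<in>Basis. \<Sum>f\<in>Basis. (u x \<bullet> e) * (v x \<bullet> f) * dG c (w x) (w' h) e f +
        ((u x \<bullet> e) * (v' h \<bullet> f) + (u' h \<bullet> e) * (v x \<bullet> f)) * G c (w x) e f)) (at x within S)"
  proof (intro has_derivative_sum)
    fix e f :: 'b
    have 1: "((\<lambda>y. G c (w y) e f) has_derivative (\<lambda>h. dG c (w x) (w' h) e f)) (at x within S)"
      by (rule has_derivative_compose[where g="\<lambda>z. G c z e f", OF d(1) dG_has_derivative[OF c(1) zx]])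
    have 2: "((\<lambda>y. (u y \<bullet> e) * (v y \<bullet> f)) has_derivative (\<lambda>h. (u x \<bullet> e) * (v' h \<bullet> f) + (u' h \<bullet> e) * (v x \<bullet> f))) (at x within S)"
      by (rule has_derivative_mult[OF has_derivative_inner_left[OF d(2)] has_derivative_inner_left[OF d(3)]])
    show "((\<lambda>y. (u y \<bullet> e) * (v y \<bullet> f) * G c (w y) e f) has_derivative
       (\<lambda>h. (u x \<bullet> e) * (v x \<bullet> f) * dG c (w x) (w' h) e f +
        ((u x \<bullet> e) * (v' h \<bullet> f) + (u' h \<bullet> e) * (v x \<bullet> f)) * G c (w x) e f)) (at x within S)"
      by (rule has_derivative_mult[OF 2 1])
  qed
  moreover have "(\<Sum>e\<in>Basis. \<Sum>f\<in>Basis. (u x \<bullet> e) * (v x \<bullet> f) * dG c (w x) (w' h) e f +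
        ((u x \<bullet> e) * (v' h \<bullet> f) + (u' h \<bullet> e) * (v x \<bullet> f)) * G c (w x) e f)
     = dG c (w x) (w' h) (u x) (v x) + G c (w x) (u' h) (v x) + G c (w x) (u x) (v' h)" for h
  proof -
    have "dG c (w x) (w' h) (u x) (v x) = (\<Sum>e\<in>Basis. \<Sum>f\<in>Basis. (u x \<bullet> e) * (v x \<bullet> f) * dG c (w x) (w' h) e f)"
    proof -
      note bl = dG_bilinear[OF c(1) zx]
      have "dG c (w x) (w' h) (u x) (v x) = dG c (w x) (w' h) (\<Sum>e\<in>Basis. (u x \<bullet> e) *\<^sub>R e) (\<Sum>f\<in>Basis. (v x \<bullet> f) *\<^sub>R f)"
        by (simp add: euclidean_representation)
      also have "\<dots> = (\<Sum>(e, f)\<in>Basis \<times> Basis. dG c (w x) (w' h) ((u x \<bullet> e) *\<^sub>R e) ((v x \<bullet> f) *\<^sub>R f))"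
        by (rule bilinear_sum[OF bl])
      also have "\<dots> = (\<Sum>e\<in>Basis. \<Sum>f\<in>Basis. (u x \<bullet> e) * (v x \<bullet> f) * dG c (w x) (w' h) e f)"
        by (simp add: sum.cartesian_product bilinear_lmul[OF bl] bilinear_rmul[OF bl] mult_ac)
      finally show ?thesis .
    qed
    then show ?thesis
      unfolding G_sum[OF c(1) zx, of "u' h"] G_sum[OF c(1) zx, of "u x"]
      by (simp add: sum.distrib distrib_right)
  qed
  ultimately have "((\<lambda>y. \<Sum>e\<in>Basis. \<Sum>f\<in>Basis. (u y \<bullet> e) * (v y \<bullet> f) * G c (w y) e f) has_derivative
     (\<lambda>h. dG c (w x) (w' h) (u x) (v x) + G c (w x) (u' h) (v x) + G c (w x) (u x) (v' h))) (at x within S)"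
    by simp
  then show ?thesis
    by (rule has_derivative_transform[OF c(3), rotated]) (use G_sum[OF c(1) c(2)] in auto)
qed

text \<open>The predicate under the definite description in \<open>levi_civita\<close>; existence
  and uniqueness below are what give that description a meaning.\<close>

definition LC_char :: "('a, 'b) chart \<Rightarrow> 'b \<Rightarrow> ('b \<Rightarrow> 'b \<Rightarrow> 'b) \<Rightarrow> bool" where
  "LC_char c z \<Gamma> \<longleftrightarrow> bilinear \<Gamma> \<and> (\<forall>u v. \<Gamma> u v = \<Gamma> v u) \<and>
     (\<forall>u v w. dG c z u v w = G c z (\<Gamma> u v) w + G c z v (\<Gamma> u w))"

text \<open>The Koszul formula: compatibility for \<open>(u, v, w)\<close> plus that for
  \<open>(v, u, w)\<close> minus that for \<open>(w, u, v)\<close>; the symmetry of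
  \<open>\<Gamma>\<close> cancels all other terms.\<close>

lemma LC_char_koszul:
  assumes "c \<in> \<A>" "z \<in> chart_img c" "LC_char c z \<Gamma>"
  shows "2 * G c z (\<Gamma> u v) w = dG c z u v w + dG c z v u w - dG c z w u v"
proof -
  have sy: "\<And>u v. \<Gamma> u v = \<Gamma> v u" and co: "\<And>u v w. dG c z u v w = G c z (\<Gamma> u v) w + G c z v (\<Gamma> u w)"
    using assms(3) unfolding LC_char_def by blast+
  have "dG c z u v w = G c z (\<Gamma> u v) w + G c z v (\<Gamma> u w)" "dG c z v u w = G c z (\<Gamma> u v) w + G c z u (\<Gamma> v w)"
    "dG c z w u v = G c z v (\<Gamma> u w) + G c z u (\<Gamma> v w)"
    using co[of u v w] co[of v u w] co[of w u v] sy[of v u] sy[of w u] sy[of w v] G_metric(2)[OF assms(1,2), of "\<Gamma> u w" v]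
    by simp_all
  then show ?thesis by simp
qed

lemma G_nondegenerate:
  assumes "c \<in> \<A>" "z \<in> chart_img c" "\<And>w. G c z x w = G c z y w"
  shows "x = y"
proof (rule ccontr)
  assume "x \<noteq> y"
  then have "G c z (x - y) (x - y) > 0" using G_metric(3)[OF assms(1,2)] by simp
  then show False using assms(3)[of "x - y"] bilinear_lsub[OF G_metric(1)[OF assms(1,2)], of x y "x - y"] by simp
qed

lemma LC_char_unique:
  assumes "c \<in> \<A>" "z \<in> chart_img c" "LC_char c z \<Gamma>" "LC_char c z \<Gamma>'"
  shows "\<Gamma> = \<Gamma>'"
proof (intro ext)
  fix u v
  show "\<Gamma> u v = \<Gamma>' u v"
  proof (rule G_nondegenerate[OF assms(1,2)])
    fix w
    show "G c z (\<Gamma> u v) w = G c z (\<Gamma>' u v) w"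
      using LC_char_koszul[OF assms(1,2,3), of u v w] LC_char_koszul[OF assms(1,2,4), of u v w] by simp
  qed
qed

text \<open>Riesz representation for the inner product \<open>G c z\<close>: sending a vector to its
  pairings with the basis is injective by positive definiteness, hence onto by dimension.\<close>

lemma G_represent:
  assumes "c \<in> \<A>" "z \<in> chart_img c" "linear u"
  shows "\<exists>x. \<forall>w. G c z x w = u w"
proof -
  note bl = G_metric(1)[OF assms(1,2)]
  define L where "L x = (\<Sum>f\<in>Basis. G c z x f *\<^sub>R f)" for x
  have lin: "linear L" unfolding L_def
    by (rule linearI) (simp_all add: bilinear_ladd[OF bl] bilinear_lmul[OF bl] scaleR_left_distrib sum.distrib scaleR_sum_right)
  have Lf: "L x \<bullet> f = G c z x f" if "f \<in> Basis" for x f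
    using that by (simp add: L_def)
  have ex: "G c z x w = (\<Sum>f\<in>Basis. (w \<bullet> f) * G c z x f)" for x w
  proof -
    have "G c z x w = G c z x (\<Sum>f\<in>Basis. (w \<bullet> f) *\<^sub>R f)" by (simp add: euclidean_representation)
    also have "\<dots> = (\<Sum>f\<in>Basis. (w \<bullet> f) * G c z x f)"
      using bl by (simp add: bilinear_def linear_sum linear_scale)
    finally show ?thesis .
  qed
  have "inj L"
    unfolding linear_injective_0[OF lin]
  proof (intro allI impI)
    fix x assume "L x = 0"
    then have "G c z x f = 0" if "f \<in> Basis" for f using Lf[OF that, of x] by simp
    then have "G c z x x = 0" unfolding ex[of x x] by simp
    then show "x = 0" using G_metric(3)[OF assms(1,2), of x] by fastforce
  qed
  then have "surj L" using linear_inj_imp_surj[OF lin] by blast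
  then obtain x where x: "L x = (\<Sum>f\<in>Basis. u f *\<^sub>R f)" by (metis surjD)
  have A: "G c z x f = u f" if "f \<in> Basis" for f
    using Lf[OF that, of x] x that by simp
  have B: "u w = (\<Sum>f\<in>Basis. (w \<bullet> f) * u f)" for w
  proof -
    have "u w = u (\<Sum>f\<in>Basis. (w \<bullet> f) *\<^sub>R f)" by (simp add: euclidean_representation)
    then show ?thesis by (simp add: linear_sum[OF assms(3)] linear_scale[OF assms(3)])
  qed
  have "G c z x w = u w" for w
    unfolding ex[of x w] B[of w] by (rule sum.cong) (simp_all add: A)
  then show ?thesis by blast
qed

text \<open>The right-hand side of the Koszul formula is linear in \<open>w\<close> and so
  represents a vector, which is taken as \<open>\<Gamma> u v\<close>. Bilinearity, symmetry and
  compatibility are checked after pairing with \<open>G\<close>.\<close>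

lemma LC_char_exists:
  assumes "c \<in> \<A>" "z \<in> chart_img c"
  shows "\<exists>\<Gamma>. LC_char c z \<Gamma>"
proof -
  define K where "K u v w = (dG c z u v w + dG c z v u w - dG c z w u v) / 2" for u v w
  note b = dG_bilinear[OF assms]
  note l1 = dG_linear1[OF assms]
  have "linear (K u v)" for u v
    unfolding K_def
    by (rule linearI) (simp_all add: bilinear_radd[OF b] bilinear_rmul[OF b] linear_add[OF l1] linear_scale[OF l1] algebra_simps add_divide_distrib diff_divide_distrib)
  then have "\<forall>u v. \<exists>x. \<forall>w. G c z x w = K u v w" using G_represent[OF assms] by blast
  then obtain \<Gamma> where \<Gamma>: "\<And>u v w. G c z (\<Gamma> u v) w = K u v w" by metis
  note bl = G_metric(1)[OF assms]
  have sym: "\<Gamma> u v = \<Gamma> v u" for u v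
    by (rule G_nondegenerate[OF assms]) (simp add: \<Gamma> K_def dG_sym[OF assms, of _ u v])
  have lin: "linear (\<lambda>u. \<Gamma> u v)" for v
  proof (rule linearI)
    fix u u' r
    show "\<Gamma> (u + u') v = \<Gamma> u v + \<Gamma> u' v"
      by (rule G_nondegenerate[OF assms])
         (simp add: \<Gamma> bilinear_ladd[OF bl] K_def bilinear_ladd[OF b] linear_add[OF l1] algebra_simps add_divide_distrib diff_divide_distrib)
    show "\<Gamma> (r *\<^sub>R u) v = r *\<^sub>R \<Gamma> u v"
      by (rule G_nondegenerate[OF assms])
         (simp add: \<Gamma> bilinear_lmul[OF bl] K_def bilinear_lmul[OF b] linear_scale[OF l1] algebra_simps add_divide_distrib diff_divide_distrib)
  qed
  have "linear (\<lambda>v. \<Gamma> u v)" for u using lin[of u] sym[of u] by simp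
  then have "bilinear \<Gamma>" using lin by (simp add: bilinear_def)
  moreover have "dG c z u v w = G c z (\<Gamma> u v) w + G c z v (\<Gamma> u w)" for u v w
    using \<Gamma>[of u v w] \<Gamma>[of u w v] G_metric(2)[OF assms, of v "\<Gamma> u w"] dG_sym[OF assms, of u v w]
      dG_sym[OF assms, of v u w] dG_sym[OF assms, of w u v]
    by (simp add: K_def field_simps)
  ultimately show ?thesis using sym unfolding LC_char_def by blast
qed

lemma LC_char_levi_civita:
  assumes "c \<in> \<A>" "z \<in> chart_img c"
  shows "LC_char c z (Chr c z)"
proof -
  have "Chr c z = (THE \<Gamma>. LC_char c z \<Gamma>)"
    unfolding levi_civita_def LC_char_def dG_def by simp
  then show ?thesis
    using theI'[of "LC_char c z"] LC_char_exists[OF assms] LC_char_unique[OF assms] by metis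
qed

lemmas levi_civita_koszul = LC_char_koszul[OF _ _ LC_char_levi_civita]

lemma levi_civita_bilinear: "c \<in> \<A> \<Longrightarrow> z \<in> chart_img c \<Longrightarrow> bilinear (Chr c z)"
  using LC_char_levi_civita unfolding LC_char_def by blast

lemma levi_civita_compatible: "c \<in> \<A> \<Longrightarrow> z \<in> chart_img c \<Longrightarrow>
    dG c z u v w = G c z (Chr c z u v) w + G c z v (Chr c z u w)"
  using LC_char_levi_civita unfolding LC_char_def by blast

definition ddtrans :: "('a, 'b) chart \<Rightarrow> ('a, 'b) chart \<Rightarrow> 'b \<Rightarrow> 'b \<Rightarrow> 'b \<Rightarrow> 'b" where
  "ddtrans c d z u v = frechet_derivative (\<lambda>y. dtrans c d y v) (at z) u"

lemma ddtrans_has_derivative: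
  assumes "c \<in> \<A>" "d \<in> \<A>" "p \<in> chart_dom c" "p \<in> chart_dom d"
  shows "((\<lambda>y. dtrans c d y v) has_derivative (\<lambda>u. ddtrans c d (chart_map c p) u v)) (at (chart_map c p))"
proof -
  have "Cn_on (Suc 0) (chart_map c ` (chart_dom c \<inter> chart_dom d)) (\<lambda>y. dtrans c d y v)"
    using transition_Cn_on(2)[OF assms(1,2), of "Suc (Suc 0)"] by (simp add: dtrans_def)
  then show ?thesis unfolding ddtrans_def by (rule Cn_on_SucD) (use assms in blast)
qed

text \<open>The connection of chart \<open>d\<close>, pulled back to \<open>c\<close> with the
  second derivative of the transition added, satisfies the characterisation in \<open>c\<close>;
  uniqueness identifies it with the connection of \<open>c\<close>. Its symmetry rests on the
  symmetry of second derivatives, its compatibility on differentiating the transformation law of the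
  metric.\<close>

lemma levi_civita_change:
  assumes "c \<in> \<A>" "d \<in> \<A>" "p \<in> chart_dom c" "p \<in> chart_dom d"
  shows "dtrans c d (chart_map c p) (Chr c (chart_map c p) u v) =
     ddtrans c d (chart_map c p) u v +
     Chr d (chart_map d p) (dtrans c d (chart_map c p) u) (dtrans c d (chart_map c p) v)"
proof -
  define z y where "z = chart_map c p" and "y = chart_map d p"
  define D S where "D = dtrans c d z" and "S = dtrans d c y"
  define \<Gamma> where "\<Gamma> = Chr d y"
  define \<Gamma>' where "\<Gamma>' u v = S (ddtrans c d z u v + \<Gamma> (D u) (D v))" for u v
  have z: "z \<in> chart_img c" and y: "y \<in> chart_img d"
    unfolding z_def y_def by (rule chart_map_in; fact)+
  have DS: "D (S u) = u" for u unfolding D_def S_def z_def y_def by (rule dtrans_inverse[OF assms(2,1,4,3)])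
  have SD: "S (D u) = u" for u unfolding D_def S_def z_def y_def by (rule dtrans_inverse[OF assms])
  have Dl: "linear D" and Sl: "linear S"
    unfolding D_def S_def z_def y_def using dtrans_linear assms by blast+
  let ?W = "chart_map c ` (chart_dom c \<inter> chart_dom d)"
  have W: "open ?W" "z \<in> ?W" using transition_Cn_on(1)[OF assms(1,2)] assms by (auto simp: z_def)
  have ddsym: "ddtrans c d z u v = ddtrans c d z v u" for u v
    unfolding ddtrans_def dtrans_def by (rule second_derivative_symmetric[OF transition_Cn_on(2)[OF assms(1,2)] W])
  have ddl: "linear (\<lambda>u. ddtrans c d z u v)" for v
    unfolding z_def by (rule has_derivative_linear[OF ddtrans_has_derivative[OF assms]])
  have ddl2: "linear (\<lambda>v. ddtrans c d z u v)" for u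
    using ddl[of u] ddsym[of u] by simp
  have LC: "LC_char d y \<Gamma>" unfolding \<Gamma>_def by (rule LC_char_levi_civita[OF assms(2) y])
  have \<Gamma>b: "bilinear \<Gamma>" and \<Gamma>s: "\<And>u v. \<Gamma> u v = \<Gamma> v u"
    and \<Gamma>c: "\<And>u v w. dG d y u v w = G d y (\<Gamma> u v) w + G d y v (\<Gamma> u w)"
    using LC unfolding LC_char_def by blast+
  have sym: "\<Gamma>' u v = \<Gamma>' v u" for u v unfolding \<Gamma>'_def ddsym[of u v] \<Gamma>s[of "D u"] by simp
  have lin: "linear (\<lambda>u. \<Gamma>' u v)" for v
    unfolding \<Gamma>'_def
    by (rule linearI) (simp_all add: linear_add[OF ddl] linear_scale[OF ddl] linear_add[OF Dl] linear_scale[OF Dl]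
        linear_add[OF Sl] linear_scale[OF Sl] bilinear_ladd[OF \<Gamma>b] bilinear_lmul[OF \<Gamma>b] algebra_simps)
  then have bil: "bilinear \<Gamma>'" using lin sym by (simp add: bilinear_def)
  have Gc: "G c z a b = G d y (D a) (D b)" for a b
    unfolding z_def y_def D_def by (rule G_change[OF assms])
  have comp: "dG c z u v w = G c z (\<Gamma>' u v) w + G c z v (\<Gamma>' u w)" for u v w
  proof -
    have ty: "transition c d z = y" using assms by (simp add: z_def y_def)
    have "((\<lambda>q. G d (transition c d q) (dtrans c d q v) (dtrans c d q w)) has_derivative
       (\<lambda>h. dG d (transition c d z) (D h) (dtrans c d z v) (dtrans c d z w) +
          G d (transition c d z) (ddtrans c d z h v) (dtrans c d z w) + G d (transition c d z) (dtrans c d z v) (ddtrans c d z h w))) (at z within ?W)"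
    proof (rule G_has_derivative[OF assms(2) _ W(2)])
      show "transition c d q \<in> chart_img d" if "q \<in> ?W" for q
        using that assms(1,2) by (auto intro: chart_map_in)
      show "(transition c d has_derivative D) (at z within ?W)"
        unfolding D_def z_def by (rule has_derivative_at_withinI[OF dtrans_has_derivative[OF assms]])
      show "((\<lambda>q. dtrans c d q v) has_derivative (\<lambda>h. ddtrans c d z h v)) (at z within ?W)"
        "((\<lambda>q. dtrans c d q w) has_derivative (\<lambda>h. ddtrans c d z h w)) (at z within ?W)"
        unfolding z_def by (rule has_derivative_at_withinI[OF ddtrans_has_derivative[OF assms]])+
    qed
    then have "((\<lambda>q. G d (transition c d q) (dtrans c d q v) (dtrans c d q w)) has_derivative
       (\<lambda>h. dG d y (D h) (D v) (D w) + G d y (ddtrans c d z h v) (D w) + G d y (D v) (ddtrans c d z h w))) (at z)"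
      unfolding at_within_open[OF W(2,1)] ty D_def[symmetric] .
    then have "((\<lambda>q. G c q v w) has_derivative
       (\<lambda>h. dG d y (D h) (D v) (D w) + G d y (ddtrans c d z h v) (D w) + G d y (D v) (ddtrans c d z h w))) (at z)"
      by (rule has_derivative_transform_within_open[OF _ W]) (use G_change[OF assms(1,2)] assms(1) in auto)
    from dG_unique[OF assms(1) z this refl]
    have "dG c z u v w = dG d y (D u) (D v) (D w) + G d y (ddtrans c d z u v) (D w) + G d y (D v) (ddtrans c d z u w)" .
    then show ?thesis
      unfolding Gc \<Gamma>'_def DS \<Gamma>c
      by (simp add: bilinear_ladd[OF G_metric(1)[OF assms(2) y]] bilinear_radd[OF G_metric(1)[OF assms(2) y]])
  qed
  have "LC_char c z \<Gamma>'" unfolding LC_char_def using bil sym comp by blast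
  then have "Chr c z = \<Gamma>'"
    by (rule LC_char_unique[OF assms(1) z LC_char_levi_civita[OF assms(1) z]])
  then have "D (Chr c z u v) = ddtrans c d z u v + \<Gamma> (D u) (D v)"
    using DS by (simp add: \<Gamma>'_def)
  then show ?thesis by (simp add: D_def z_def y_def \<Gamma>_def)
qed

end

section \<open>Covariant derivatives along Sobolev curves\<close>

lemma bilinear_euclidean_sum:
  fixes B :: "'b::euclidean_space \<Rightarrow> 'b \<Rightarrow> real"
  assumes "bilinear B"
  shows "B u v = (\<Sum>e\<in>Basis. \<Sum>f\<in>Basis. (u \<bullet> e) * (v \<bullet> f) * B e f)"
proof -
  have "B u v = B (\<Sum>e\<in>Basis. (u \<bullet> e) *\<^sub>R e) (\<Sum>f\<in>Basis. (v \<bullet> f) *\<^sub>R f)"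
    by (simp add: euclidean_representation)
  also have "\<dots> = (\<Sum>(e, f)\<in>Basis \<times> Basis. B ((u \<bullet> e) *\<^sub>R e) ((v \<bullet> f) *\<^sub>R f))"
    by (rule bilinear_sum[OF assms])
  also have "\<dots> = (\<Sum>e\<in>Basis. \<Sum>f\<in>Basis. (u \<bullet> e) * (v \<bullet> f) * B e f)"
    by (simp add: sum.cartesian_product bilinear_lmul[OF assms] bilinear_rmul[OF assms] mult_ac)
  finally show ?thesis .
qed

context riemannian
begin

text \<open>Paired with basis vectors, the Koszul formula is a linear system for the Christoffel
  term, with the metric coefficients as matrix and their derivatives on the right.
  \<open>UH_solve\<close> therefore applies directly; the lower bound \<open>m\<close> for the norm
  makes the system coercive with constant \<open>m\<^sup>2\<close>.\<close>

lemma UH_levi_civita: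
  fixes f u v :: "'i \<Rightarrow> real \<Rightarrow> 'b"
  assumes fam: "interval_family I a b" and c: "c \<in> \<A>" and K: "compact K" "K \<subseteq> chart_img c"
    and fK: "\<And>k t. k \<in> I \<Longrightarrow> t \<in> {a k..b k} \<Longrightarrow> f k t \<in> K"
    and f: "interval_family.UH I a b i f" and u: "interval_family.UH I a b i u" and v: "interval_family.UH I a b i v"
  shows "interval_family.UH I a b i (\<lambda>k t. Chr c (f k t) (u k t) (v k t))"
proof -
  interpret interval_family I a b by (rule fam)
  have img: "f k t \<in> chart_img c" if "k \<in> I" "t \<in> {a k..b k}" for k t using fK[OF that] K(2) by blast
  note comp = UH_compose[OF chart_homeo(2)[OF c] K f fK]
  have UG: "UH i (\<lambda>k t. G c (f k t) e e')" for e e'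
    by (rule comp[where F="\<lambda>z. G c z e e'"]) (simp_all add: G_Cn_on[OF c])
  have UdG: "UH i (\<lambda>k t. dG c (f k t) e e' e'')" for e e' e''
    by (rule comp[where F="\<lambda>z. dG c z e e' e''"]) (use G_Cn_on[OF c, of "Suc _"] in \<open>simp_all add: dG_def\<close>)
  have b23: "bilinear (\<lambda>u v. dG c z w u v)" and b12: "bilinear (\<lambda>u v. dG c z u v w)" if "z \<in> chart_img c" for z w
    using dG_bilinear[OF c that] dG_linear1[OF c that] by (auto simp: bilinear_def)
  have U23: "UH i (\<lambda>k t. dG c (f k t) w (u k t) (v k t))" if u: "UH i u" and v: "UH i v" for u v w
  proof (rule UH_cong)
    show "UH i (\<lambda>k t. \<Sum>e\<in>Basis. \<Sum>e'\<in>Basis. (u k t \<bullet> e) * (v k t \<bullet> e') * dG c (f k t) w e e')"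
      by (intro UH_sum UH_mult UH_inner_const u v UdG finite_Basis)
  qed (rule bilinear_euclidean_sum[OF b23[OF img]])
  have U12: "UH i (\<lambda>k t. dG c (f k t) (u k t) (v k t) w)" if u: "UH i u" and v: "UH i v" for u v w
  proof (rule UH_cong)
    show "UH i (\<lambda>k t. \<Sum>e\<in>Basis. \<Sum>e'\<in>Basis. (u k t \<bullet> e) * (v k t \<bullet> e') * dG c (f k t) e e' w)"
      by (intro UH_sum UH_mult UH_inner_const u v UdG finite_Basis)
  qed (rule bilinear_euclidean_sum[OF b12[OF img]])
  define r where "r k t = (\<Sum>w\<in>Basis. ((dG c (f k t) (u k t) (v k t) w + dG c (f k t) (v k t) (u k t) w
     - dG c (f k t) w (u k t) (v k t)) * (1/2)) *\<^sub>R w)" for k t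
  have Ur: "UH i r"
    unfolding r_def by (intro UH_sum UH_scaleR UH_mult UH_diff UH_add U12 U23 u v UH_const finite_Basis)
  obtain m M where m: "0 < m" "\<And>z u. z \<in> K \<Longrightarrow> m * norm u \<le> sqrt (G c z u u)"
    using G_norm_bounds[OF c K] by metis
  have LG: "(\<Sum>e'\<in>Basis. \<Sum>e\<in>Basis. ((x \<bullet> e) * G c z e e') *\<^sub>R e') = (\<Sum>e'\<in>Basis. G c z x e' *\<^sub>R e')"
    if "z \<in> chart_img c" for z x
  proof (rule sum.cong[OF refl])
    fix e' :: 'b
    have l: "linear (\<lambda>x. G c z x e')" using G_metric(1)[OF c that] by (simp add: bilinear_def)
    have "G c z x e' = G c z (\<Sum>e\<in>Basis. (x \<bullet> e) *\<^sub>R e) e'" by (simp add: euclidean_representation)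
    also have "\<dots> = (\<Sum>e\<in>Basis. (x \<bullet> e) * G c z e e')"
      using linear_sum[OF l, of "\<lambda>e. (x \<bullet> e) *\<^sub>R e" Basis] linear_scale[OF l] by simp
    finally show "(\<Sum>e\<in>Basis. ((x \<bullet> e) * G c z e e') *\<^sub>R e') = G c z x e' *\<^sub>R e'"
      by (simp add: scaleR_sum_left)
  qed
  show ?thesis
  proof (rule UH_solve[where h="\<lambda>e e' k t. G c (f k t) e e'" and r=r and m="m\<^sup>2"])
    show "UH i (\<lambda>k t. G c (f k t) e e')" for e e' by (rule UG)
    show "UH i r" by (rule Ur)
    show "0 < m\<^sup>2" using m by simp
  next
    fix k t assume k: "k \<in> I" "t \<in> {a k..b k}"
    show "(\<Sum>e'\<in>Basis. \<Sum>e\<in>Basis. ((Chr c (f k t) (u k t) (v k t) \<bullet> e) * G c (f k t) e e') *\<^sub>R e') = r k t"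
      unfolding LG[OF img[OF k]] r_def
    proof (rule sum.cong[OF refl])
      fix e' :: 'b
      show "G c (f k t) (Chr c (f k t) (u k t) (v k t)) e' *\<^sub>R e' =
       ((dG c (f k t) (u k t) (v k t) e' + dG c (f k t) (v k t) (u k t) e' - dG c (f k t) e' (u k t) (v k t)) * (1/2)) *\<^sub>R e'"
        using levi_civita_koszul[OF c img[OF k] c img[OF k], of "u k t" "v k t" e'] by simp
    qed
    fix x
    have "(m * norm x)\<^sup>2 \<le> (sqrt (G c (f k t) x x))\<^sup>2"
      using m(2)[OF fK[OF k], of x] m(1) by (intro power_mono) auto
    then have "m\<^sup>2 * (norm x)\<^sup>2 \<le> G c (f k t) x x"
      using G_nonneg[OF c img[OF k]] by (simp add: power_mult_distrib)
    also have "\<dots> = (\<Sum>e'\<in>Basis. G c (f k t) x e' *\<^sub>R e') \<bullet> x"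
    proof -
      have l: "linear (\<lambda>w. G c (f k t) x w)" using G_metric(1)[OF c img[OF k]] by (simp add: bilinear_def)
      have "G c (f k t) x x = G c (f k t) x (\<Sum>e\<in>Basis. (x \<bullet> e) *\<^sub>R e)" by (simp add: euclidean_representation)
      also have "\<dots> = (\<Sum>e\<in>Basis. (x \<bullet> e) * G c (f k t) x e)"
        using linear_sum[OF l, of "\<lambda>e. (x \<bullet> e) *\<^sub>R e" Basis] linear_scale[OF l] by simp
      also have "\<dots> = (\<Sum>e'\<in>Basis. G c (f k t) x e' *\<^sub>R e') \<bullet> x"
        unfolding inner_sum_left by (simp add: inner_commute mult.commute)
      finally show ?thesis .
    qed
    finally show "m\<^sup>2 * (norm x)\<^sup>2 \<le> (\<Sum>e'\<in>Basis. \<Sum>e\<in>Basis. ((x \<bullet> e) * G c (f k t) e e') *\<^sub>R e') \<bullet> x"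
      unfolding LG[OF img[OF k]] .
  qed
qed

end

lemma interval_family_single: "s < t \<Longrightarrow> t \<le> s + 1 \<Longrightarrow> interval_family {()} (\<lambda>_. s) (\<lambda>_. t)"
  by unfold_locales auto

text \<open>Transfers the closure properties proved for families to a single curve.\<close>

lemma UH_single:
  assumes "s < t" "t \<le> s + 1"
  shows "interval_family.UH {()} (\<lambda>_. s) (\<lambda>_. t) i (\<lambda>_. h) \<longleftrightarrow> (\<exists>B. Hol i B s t h)"
proof -
  interpret interval_family "{()}" "\<lambda>_. s" "\<lambda>_. t" by (rule interval_family_single[OF assms])
  show ?thesis by (simp add: UH_def)
qed

lemma L2_on_continuous:
  fixes f :: "real \<Rightarrow> 'b::euclidean_space"
  assumes "continuous_on {a..b} f"
  shows "L2_on a b f"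
  unfolding L2_on_def
  using assms by (auto intro!: continuous_imp_measurable_on_sets_lebesgue continuous_imp_integrable_real continuous_intros)

lemma L2_on_add:
  fixes f h :: "real \<Rightarrow> 'b::euclidean_space"
  assumes "L2_on a b f" "L2_on a b h"
  shows "L2_on a b (\<lambda>t. f t + h t)"
  unfolding L2_on_def
proof
  show m: "(\<lambda>t. f t + h t) \<in> borel_measurable (lebesgue_on {a..b})"
    using assms unfolding L2_on_def by (intro borel_measurable_add) auto
  show "integrable (lebesgue_on {a..b}) (\<lambda>t. (norm (f t + h t))\<^sup>2)"
  proof (rule Bochner_Integration.integrable_bound)
    show "integrable (lebesgue_on {a..b}) (\<lambda>t. 2 * (norm (f t))\<^sup>2 + 2 * (norm (h t))\<^sup>2)"
      using assms unfolding L2_on_def by auto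
    show "(\<lambda>t. (norm (f t + h t))\<^sup>2) \<in> borel_measurable (lebesgue_on {a..b})"
      by (intro borel_measurable_power) (use m in auto)
    show "AE t in lebesgue_on {a..b}. norm ((norm (f t + h t))\<^sup>2) \<le> norm (2 * (norm (f t))\<^sup>2 + 2 * (norm (h t))\<^sup>2)"
    proof (rule AE_I2)
      fix t
      have "(norm (f t + h t))\<^sup>2 \<le> (norm (f t) + norm (h t))\<^sup>2" by (intro power_mono norm_triangle_ineq) simp
      also have "\<dots> \<le> 2 * (norm (f t))\<^sup>2 + 2 * (norm (h t))\<^sup>2"
        using zero_le_power2[of "norm (f t) - norm (h t)"] by (simp add: power2_sum power2_diff)
      finally show "norm ((norm (f t + h t))\<^sup>2) \<le> norm (2 * (norm (f t))\<^sup>2 + 2 * (norm (h t))\<^sup>2)" by simp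
    qed
  qed
qed

lemma C1_imp_Hreg_0:
  assumes "\<forall>t\<in>{a..b}. (h has_vector_derivative h' t) (at t within {a..b})" "continuous_on {a..b} h'"
  shows "Hreg 0 a b h"
proof -
  have "h t = h a + integral {a..t} h'" if "t \<in> {a..b}" for t
  proof -
    have "(h' has_integral (h t - h a)) {a..t}"
    proof (rule fundamental_theorem_of_calculus)
      show "a \<le> t" using that by simp
      fix u assume "u \<in> {a..t}"
      then show "(h has_vector_derivative h' u) (at u within {a..t})"
        using bspec[OF assms(1), of u] that by (intro has_vector_derivative_within_subset[of h "h' u" u "{a..b}" "{a..t}"]) auto
    qed
    then show ?thesis by (simp add: integral_unique)
  qed
  then show ?thesis unfolding Hreg.simps using L2_on_continuous[OF assms(2)] by blast
qed

lemma Hreg_imp_Hreg_0: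
  assumes "Hreg i a b h"
  shows "Hreg 0 a b h"
proof (cases i)
  case 0
  then show ?thesis using assms by simp
next
  case (Suc j)
  then obtain h' where h': "\<forall>t\<in>{a..b}. (h has_vector_derivative h' t) (at t within {a..b})" "Hreg j a b h'"
    using assms by auto
  show ?thesis by (rule C1_imp_Hreg_0[OF h'(1) Hreg_continuous_on[OF h'(2)]])
qed

lemma Hreg_0_add:
  assumes "Hreg 0 a b f" "Hreg 0 a b h"
  shows "Hreg 0 a b (\<lambda>t. f t + h t)"
proof -
  obtain p where p: "L2_on a b p" "\<forall>t\<in>{a..b}. f t = f a + integral {a..t} p" using assms(1) by auto
  obtain w where w: "L2_on a b w" "\<forall>t\<in>{a..b}. h t = h a + integral {a..t} w" using assms(2) by auto
  have "f t + h t = (f a + h a) + integral {a..t} (\<lambda>s. p s + w s)" if "t \<in> {a..b}" for t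
  proof -
    have "integral {a..t} (\<lambda>s. p s + w s) = integral {a..t} p + integral {a..t} w"
      using that by (intro HK_integral_add integrable_subinterval_real[OF L2_on_integrable_on(1)[OF p(1)]]
          integrable_subinterval_real[OF L2_on_integrable_on(1)[OF w(1)]]) auto
    then show ?thesis using bspec[OF p(2) that] bspec[OF w(2) that] by simp
  qed
  then show ?thesis unfolding Hreg.simps using L2_on_add[OF p(1) w(1)] by blast
qed

context riemannian
begin

section \<open>Derivatives of curves on chart intervals\<close>

lemma chart_interval_nhd:
  assumes "continuous_on {0..1::real} x" "c \<in> \<A>" "r \<in> {0..1}" "x r \<in> chart_dom c"
  obtains d where "d > 0" "\<And>q. q \<in> {0..1} \<Longrightarrow> \<bar>q - r\<bar> < d \<Longrightarrow> x q \<in> chart_dom c"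
proof -
  have "continuous (at r within {0..1}) x" using assms(1,3) by (simp add: continuous_on_eq_continuous_within)
  then have "\<forall>\<^sub>F q in at r within {0..1}. x q \<in> chart_dom c"
    using chart_homeo(1)[OF assms(2)] assms(4) by (simp add: continuous_within topological_tendstoD)
  then obtain d where "d > 0" "\<And>q. q \<in> {0..1} \<Longrightarrow> q \<noteq> r \<Longrightarrow> dist q r < d \<Longrightarrow> x q \<in> chart_dom c"
    unfolding eventually_at by blast
  then show ?thesis using that[of d] assms(4) by (metis dist_real_def)
qed

definition chart_interval :: "(real \<Rightarrow> 'a) \<Rightarrow> ('a, 'b) chart \<Rightarrow> real \<Rightarrow> real \<Rightarrow> bool" where
  "chart_interval x c s t \<longleftrightarrow> c \<in> \<A> \<and> 0 \<le> s \<and> s < t \<and> t \<le> 1 \<and> x ` {s..t} \<subseteq> chart_dom c"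

text \<open>Velocity and covariant derivatives are defined by derivatives within \<open>{0..1}\<close>.  A larger chart
  interval is a neighbourhood, relative to \<open>{0..1}\<close>, of every point of the smaller one, so these
  derivatives can be computed within chart intervals.\<close>

lemma chart_interval_extend:
  assumes x: "continuous_on {0..1::real} x" and st: "chart_interval x c s t"
  obtains s' t' where "chart_interval x c s' t'" "{s..t} \<subseteq> {s'..t'}"
    "\<And>q. q \<in> {s..t} \<Longrightarrow> at q within {s'..t'} = at q within {0..1}"
proof -
  have c: "c \<in> \<A>" "0 \<le> s" "s < t" "t \<le> 1" "x ` {s..t} \<subseteq> chart_dom c" using st by (auto simp: chart_interval_def)
  obtain d1 where d1: "d1 > 0" "\<And>q. q \<in> {0..1} \<Longrightarrow> \<bar>q - s\<bar> < d1 \<Longrightarrow> x q \<in> chart_dom c"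
    by (rule chart_interval_nhd[OF x c(1), of s]) (use c in auto)
  obtain d2 where d2: "d2 > 0" "\<And>q. q \<in> {0..1} \<Longrightarrow> \<bar>q - t\<bar> < d2 \<Longrightarrow> x q \<in> chart_dom c"
    by (rule chart_interval_nhd[OF x c(1), of t]) (use c in auto)
  define s' t' where "s' = max 0 (s - d1 / 2)" and "t' = min 1 (t + d2 / 2)"
  have st': "0 \<le> s'" "s' \<le> s" "t \<le> t'" "t' \<le> 1" using c d1 d2 by (auto simp: s'_def t'_def)
  have "x q \<in> chart_dom c" if "q \<in> {s'..t'}" for q
  proof -
    consider "q < s" | "q \<in> {s..t}" | "q > t" by fastforce
    then show ?thesis
    proof cases
      case 1
      then have "\<bar>q - s\<bar> < d1" using that d1(1) by (auto simp: s'_def)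
      then show ?thesis using d1(2)[of q] that st' by auto
    next
      case 2 then show ?thesis using c(5) by blast
    next
      case 3
      then have "\<bar>q - t\<bar> < d2" using that d2(1) by (auto simp: t'_def)
      then show ?thesis using d2(2)[of q] that st' by auto
    qed
  qed
  then have ci: "chart_interval x c s' t'" using c st' unfolding chart_interval_def by auto
  show ?thesis
  proof (rule that[OF ci])
    show "{s..t} \<subseteq> {s'..t'}" using st' by auto
    fix q assume q: "q \<in> {s..t}"
    show "at q within {s'..t'} = at q within {0..1}"
    proof (rule at_within_nhd)
      show "q \<in> {s - d1/2<..<t + d2/2}" "open {s - d1/2<..<t + d2/2}" using q d1 d2 by auto
      show "{s'..t'} \<inter> {s - d1/2<..<t + d2/2} - {q} = {0..1} \<inter> {s - d1/2<..<t + d2/2} - {q}"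
        by (auto simp: s'_def t'_def)
    qed
  qed
qed

text \<open>Differentiability is assumed on every chart interval because it is applied to the
  enlarged one: only there does the derivative at an end point of \<open>{s..t}\<close> coincide
  with the derivative within \<open>{0..1}\<close>.\<close>

lemma has_vector_derivative_within_chart_interval:
  fixes h :: "real \<Rightarrow> 'b"
  assumes x: "continuous_on {0..1::real} x" and st: "chart_interval x c s t"
    and h: "\<And>s t q. chart_interval x c s t \<Longrightarrow> q \<in> {s..t} \<Longrightarrow> \<exists>d. (h has_vector_derivative d) (at q within {s..t})"
    and q: "q \<in> {s..t}"
  shows "(h has_vector_derivative curve_deriv {0..1} h q) (at q within {0..1})"
    and "(h has_vector_derivative d) (at q within {s..t}) \<Longrightarrow> curve_deriv {0..1} h q = d"
proof -
  obtain s' t' where e: "chart_interval x c s' t'" "{s..t} \<subseteq> {s'..t'}"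
    "\<And>q. q \<in> {s..t} \<Longrightarrow> at q within {s'..t'} = at q within {0..1}"
    using chart_interval_extend[OF x st] by metis
  obtain d' where "(h has_vector_derivative d') (at q within {s'..t'})" using h[OF e(1)] q e(2) by blast
  then have d': "(h has_vector_derivative d') (at q within {0..1})" using e(3)[OF q] by simp
  have st01: "s < t" "{s..t} \<subseteq> {0..1}" "q \<in> {0..1}" using st q by (auto simp: chart_interval_def)
  have cd: "curve_deriv {0..1} h q = d'" by (rule curve_deriv_eq[OF d']) (use st01 in auto)
  then show "(h has_vector_derivative curve_deriv {0..1} h q) (at q within {0..1})" using d' by simp
  assume "(h has_vector_derivative d) (at q within {s..t})"
  moreover have "(h has_vector_derivative d') (at q within {s..t})"
    using d' st01 has_vector_derivative_within_subset by blast
  ultimately show "curve_deriv {0..1} h q = d"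
    using cd curve_deriv_eq[OF _ st01(1) q] by metis
qed

lemma cov_velocity_0: "cvel 0 x t c = (if c \<in> charts_at \<A> (x t) then curve_deriv {0..1} (crd c x) t else 0)"
  by (simp add: cov_velocity_def velocity_def)

lemma cov_velocity_Suc: "cvel (Suc j) x t c = (if c \<in> charts_at \<A> (x t)
     then curve_deriv {0..1} (\<lambda>s. cvel j x s c) t +
          Chr c (chart_map c (x t)) (cvel 0 x t c) (cvel j x t c)
     else 0)"
  by (simp add: cov_velocity_def cov_deriv_def)

lemma Hk_curves_continuous: "x \<in> Hk k \<Longrightarrow> continuous_on {0..1} x"
  by (simp add: Hk_curves_def)

lemma Hk_curves_carrier: "x \<in> Hk k \<Longrightarrow> t \<in> {0..1} \<Longrightarrow> x t \<in> \<M>"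
  by (auto simp: Hk_curves_def)

lemma chart_curve_continuous:
  assumes "continuous_on {0..1::real} x" "chart_interval x c s t"
  shows "continuous_on {s..t} (crd c x)"
proof (rule continuous_on_compose)
  show "continuous_on {s..t} x" using assms by (auto simp: chart_interval_def intro: continuous_on_subset)
  show "continuous_on (x ` {s..t}) (chart_map c)"
    using assms(2) chart_homeo(4) by (auto simp: chart_interval_def intro: continuous_on_subset)
qed

lemma chart_curve_Hreg:
  assumes "x \<in> Hk (Suc r)" "chart_interval x c s t"
  shows "Hreg r s t (crd c x)"
proof (rule sobolev_on_Hreg)
  have "\<forall>c\<in>\<A>. \<forall>s t. 0 \<le> s \<and> s < t \<and> t \<le> 1 \<and> x ` {s..t} \<subseteq> chart_dom c \<longrightarrow> sobolev_on (Suc r) s t (crd c x)"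
    using assms(1) unfolding Hk_curves_def by blast
  then show "sobolev_on (Suc r) s t (crd c x)" using assms(2) unfolding chart_interval_def by blast
  show "s < t" using assms(2) by (simp add: chart_interval_def)
  show "continuous_on {s..t} (crd c x)"
    by (rule chart_curve_continuous[OF Hk_curves_continuous[OF assms(1)] assms(2)])
qed

lemma chart_interval_le: "chart_interval x c s t \<Longrightarrow> s < t \<and> t \<le> s + 1"
  by (simp add: chart_interval_def)

lemma chart_interval_charts_at: "chart_interval x c s t \<Longrightarrow> q \<in> {s..t} \<Longrightarrow> c \<in> charts_at \<A> (x q)"
  by (auto simp: chart_interval_def charts_at_def)

lemma chart_interval_compact:
  assumes "continuous_on {0..1::real} x" "chart_interval x c s t"
  shows "compact ((crd c x) ` {s..t})" "(crd c x) ` {s..t} \<subseteq> chart_img c"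
proof -
  show "compact ((crd c x) ` {s..t})"
    by (rule compact_continuous_image[OF chart_curve_continuous[OF assms] compact_Icc])
  show "(crd c x) ` {s..t} \<subseteq> chart_img c"
    using assms(2) by (auto simp: chart_interval_def intro: chart_map_in)
qed

lemma Hol_levi_civita:
  assumes x: "continuous_on {0..1::real} x" "chart_interval x c s t"
    and "Hol i B1 s t (crd c x)" "Hol i B2 s t u" "Hol i B3 s t v"
  shows "\<exists>B. Hol i B s t (\<lambda>q. Chr c (chart_map c (x q)) (u q) (v q))"
proof -
  have st: "s < t" "t \<le> s + 1" using chart_interval_le[OF x(2)] by auto
  note single = UH_single[OF st]
  have "interval_family.UH {()} (\<lambda>_. s) (\<lambda>_. t) i (\<lambda>_ q. Chr c ((crd c x) q) (u q) (v q))"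
  proof (rule UH_levi_civita[OF interval_family_single[OF st] _ chart_interval_compact[OF x]])
    show "c \<in> \<A>" using x(2) by (simp add: chart_interval_def)
    show "(crd c x) q \<in> (crd c x) ` {s..t}" if "q \<in> {s..t}" for q using that by blast
  qed (use assms(3-5) single in blast)+
  then show ?thesis unfolding single by (simp add: o_def)
qed

lemma Hol_add:
  fixes f h :: "real \<Rightarrow> 'b"
  assumes "Hol i B1 s t f" "Hol i B2 s t h" "s < t" "t \<le> s + 1"
  shows "\<exists>B. Hol i B s t (\<lambda>q. f q + h q)"
proof -
  interpret interval_family "{()}" "\<lambda>_. s" "\<lambda>_. t" by (rule interval_family_single[OF assms(3,4)])
  note single = UH_single[OF assms(3,4)]
  show ?thesis using UH_add[of i "\<lambda>_. f" "\<lambda>_. h"] assms(1,2) unfolding single by blast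
qed

text \<open>\<open>u\<close> is the part obtained by differentiating coordinates alone,
  \<open>w\<close> collects the Christoffel terms. These involve lower derivatives only, so
  \<open>w\<close> has one more derivative than \<open>u\<close>. The splitting lets each part keep
  its own class: \<open>Hol\<close> is stable under Christoffel terms by
  \<open>UH_levi_civita\<close>, and \<open>Hreg\<close> is merely differentiated.\<close>

lemma cov_velocity_regular:
  assumes x: "x \<in> Hk (Suc r)" and st: "chart_interval x c s t" and "j < r"
  shows "\<exists>u w B. (\<forall>q\<in>{s..t}. cvel j x q c = u q + w q) \<and> Hreg (r - 1 - j) s t u \<and> Hol (r - j) B s t w"
  using assms(2,3)
proof (induction j arbitrary: s t)
  case 0
  let ?f = "crd c x"
  note xc = Hk_curves_continuous[OF x]
  obtain r' where r': "r = Suc r'" using 0(2) by (cases r) auto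
  have ex: "\<exists>d. (?f has_vector_derivative d) (at q within {s..t})" if "chart_interval x c s t" "q \<in> {s..t}" for s t q
    using chart_curve_Hreg[OF x that(1)] that(2) unfolding r' by auto
  obtain f' where f': "\<forall>q\<in>{s..t}. (?f has_vector_derivative f' q) (at q within {s..t})" "Hreg r' s t f'"
    using chart_curve_Hreg[OF x 0(1)] unfolding r' by auto
  have "cvel 0 x q c = f' q + 0" if q: "q \<in> {s..t}" for q
    using has_vector_derivative_within_chart_interval(2)[OF xc 0(1) ex q bspec[OF f'(1) q]] chart_interval_charts_at[OF 0(1) q]
    by (simp add: cov_velocity_0)
  moreover have "Hol (r - 0) 0 s t (\<lambda>_. 0 :: 'b)"
  proof -
    have "Hol n 0 s t (\<lambda>_. 0 :: 'b)" for n by (induction n) (auto intro!: exI[of _ "\<lambda>_. 0"])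
    then show ?thesis .
  qed
  ultimately show ?case using f'(2) r' by (intro exI[of _ f'] exI[of _ "\<lambda>_. 0"] exI[of _ 0]) auto
next
  case (Suc j)
  let ?y = "\<lambda>q. cvel j x q c"
  note xc = Hk_curves_continuous[OF x]
  have st: "s < t" "t \<le> s + 1" using chart_interval_le[OF Suc.prems(1)] by auto
  obtain i where i: "r - 1 - j = Suc i" "r - j = Suc (Suc i)" "r - 1 - Suc j = i" "r - Suc j = Suc i"
    using Suc.prems(2) by (metis Suc_diff_Suc diff_Suc_1 diff_commute Suc_lessD diff_Suc_eq_diff_pred)
  have jr: "j < r" using Suc.prems(2) by simp
  define Dec where "Dec s t u' w' B \<longleftrightarrow> (\<forall>q\<in>{s..t}. (?y has_vector_derivative (u' q + w' q)) (at q within {s..t})) \<and>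
     Hreg i s t u' \<and> Hol (Suc i) B s t w' \<and> Hol (Suc i) B s t ?y" for s t u' w' B
  have dec: "\<exists>u' w' B. Dec s t u' w' B" if ci: "chart_interval x c s t" for s t
  proof -
    have st: "s < t" "t \<le> s + 1" using chart_interval_le[OF ci] by auto
    obtain u w B where uw: "\<forall>q\<in>{s..t}. ?y q = u q + w q" "Hreg (Suc i) s t u" "Hol (Suc (Suc i)) B s t w"
      using Suc.IH[OF ci jr] unfolding i by blast
    obtain u' where u': "\<forall>q\<in>{s..t}. (u has_vector_derivative u' q) (at q within {s..t})" "Hreg i s t u'"
      using uw(2) by auto
    obtain w' where w': "\<forall>q\<in>{s..t}. (w has_vector_derivative w' q) (at q within {s..t})" "Hol (Suc i) B s t w'"
      using uw(3) unfolding Hol.simps(2)[of "Suc i"] by blast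
    have d: "(?y has_vector_derivative (u' q + w' q)) (at q within {s..t})" if q: "q \<in> {s..t}" for q
      by (rule has_vector_derivative_transform[OF q _ has_vector_derivative_add[OF bspec[OF u'(1) q] bspec[OF w'(1) q]]])
         (use uw(1) in simp)
    obtain B2 where "Hol (Suc i) B2 s t u" using Hreg_imp_Hol[OF uw(2) st] by blast
    then obtain B3 where "Hol (Suc i) B3 s t (\<lambda>q. u q + w q)"
      using Hol_add[OF _ Hol_Suc_imp[OF uw(3) st(2)] st] by blast
    then have "Hol (Suc i) B3 s t ?y" by (rule Hol_cong[rotated]) (use uw(1) in simp)
    then have "Hol (Suc i) (max B B3) s t ?y" by (rule Hol_mono) simp
    moreover have "Hol (Suc i) (max B B3) s t w'" using w'(2) by (rule Hol_mono) simp
    ultimately have "Dec s t u' w' (max B B3)" unfolding Dec_def using d u'(2) by blast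
    then show ?thesis by blast
  qed
  have ex: "\<exists>d. (?y has_vector_derivative d) (at q within {s..t})" if "chart_interval x c s t" "q \<in> {s..t}" for s t q
    using dec[OF that(1)] that(2) unfolding Dec_def by metis
  obtain u' w' B where "Dec s t u' w' B" using dec[OF Suc.prems(1)] by blast
  then have uw': "\<forall>q\<in>{s..t}. (?y has_vector_derivative (u' q + w' q)) (at q within {s..t})"
     "Hreg i s t u'" "Hol (Suc i) B s t w'" "Hol (Suc i) B s t ?y" unfolding Dec_def by simp_all
  define \<Gamma> where "\<Gamma> q = Chr c (chart_map c (x q)) (cvel 0 x q c) (?y q)" for q
  have "\<exists>B. Hol (Suc i) B s t (\<lambda>q. cvel 0 x q c)"
  proof -
    obtain r' where r': "r = Suc r'" "Suc i \<le> r'" using Suc.prems(2) i by (cases r) auto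
    have ex0: "\<exists>d. (chart_map c \<circ> x has_vector_derivative d) (at q within {s..t})" if "chart_interval x c s t" "q \<in> {s..t}" for s t q
      using chart_curve_Hreg[OF x that(1)] that(2) unfolding r' by auto
    obtain f' where f': "\<forall>q\<in>{s..t}. (chart_map c \<circ> x has_vector_derivative f' q) (at q within {s..t})" "Hreg r' s t f'"
      using chart_curve_Hreg[OF x Suc.prems(1)] unfolding r' by auto
    obtain B' where B': "Hol r' B' s t f'" using Hreg_imp_Hol[OF f'(2) st] by blast
    have eq: "cvel 0 x q c = f' q" if q: "q \<in> {s..t}" for q
      using has_vector_derivative_within_chart_interval(2)[OF xc Suc.prems(1) ex0 q bspec[OF f'(1) q]]
        chart_interval_charts_at[OF Suc.prems(1) q] by (simp add: cov_velocity_0)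
    show ?thesis by (rule exI, rule Hol_cong[OF eq Hol_le[OF B' st(2) r'(2)]])
  qed
  moreover have "\<exists>B. Hol (Suc i) B s t (crd c x)"
    using Hreg_imp_Hol[OF chart_curve_Hreg[OF x Suc.prems(1)] st] Hol_le[OF _ st(2), of r _ _ "Suc i"] i by (metis diff_le_self)
  ultimately obtain B4 where B4: "Hol (Suc i) B4 s t \<Gamma>"
    unfolding \<Gamma>_def using Hol_levi_civita[OF xc Suc.prems(1) _ _ uw'(4)] by blast
  then obtain B5 where B5: "Hol (Suc i) B5 s t (\<lambda>q. w' q + \<Gamma> q)"
    using Hol_add[OF uw'(3) _ st] by blast
  have "cvel (Suc j) x q c = u' q + (w' q + \<Gamma> q)" if q: "q \<in> {s..t}" for q
    using has_vector_derivative_within_chart_interval(2)[OF xc Suc.prems(1) ex q bspec[OF uw'(1) q]]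
      chart_interval_charts_at[OF Suc.prems(1) q] by (simp add: cov_velocity_Suc \<Gamma>_def)
  then show ?case unfolding i
    by (intro exI[of _ u'] exI[of _ "\<lambda>q. w' q + \<Gamma> q"] exI[of _ B5]) (use uw'(2) B5 in simp)
qed

end

text \<open>Lebesgue differentiation enters here: off a negligible set \<open>curve_deriv\<close>,
  which has an unspecified value where no derivative exists, equals the square integrable
  density.\<close>

lemma Hreg_0_primitive:
  fixes h :: "real \<Rightarrow> 'b::euclidean_space"
  assumes "Hreg 0 s t h" "0 \<le> s" "t \<le> 1"
  obtains f N where "L2_on s t f" "\<And>q. q \<in> {s..t} \<Longrightarrow> h q = h s + integral {s..q} f" "negligible N"
    "\<And>q. q \<in> {s..t} - N \<Longrightarrow> (h has_vector_derivative f q) (at q within {0..1})"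
    "\<And>q. q \<in> {s..t} - N \<Longrightarrow> curve_deriv {0..1} h q = f q"
proof -
  obtain f where f: "L2_on s t f" "\<forall>q\<in>{s..t}. h q = h s + integral {s..q} f"
    using assms(1) by auto
  obtain N where N: "negligible N"
    "\<And>q. q \<in> {s<..<t} - N \<Longrightarrow> ((\<lambda>u. integral {s..u} f) has_vector_derivative f q) (at q)"
    using integral_has_vector_derivative_AE[OF L2_on_absolutely_integrable[OF f(1)]] by blast
  \<comment> \<open>The end points are discarded, since a derivative within \<open>{0..1}\<close> at
    \<open>s\<close> or \<open>t\<close> may also depend on the curve outside
    \<open>{s..t}\<close>.\<close>
  have d: "(h has_vector_derivative f q) (at q within {0..1})" if q: "q \<in> {s..t} - (N \<union> {s, t})" for q
  proof -
    have q': "q \<in> {s<..<t} - N" using q by auto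
    have "((\<lambda>u. h s + integral {s..u} f) has_vector_derivative f q) (at q)"
      using has_vector_derivative_add[OF has_vector_derivative_const N(2)[OF q'], of "h s"] by simp
    then have "(h has_vector_derivative f q) (at q)"
    proof (rule has_vector_derivative_transform_within_open[where S="{s<..<t}"])
      fix u assume "u \<in> {s<..<t}"
      then have "u \<in> {s..t}" by auto
      from bspec[OF f(2) this] show "h s + integral {s..u} f = h u" by (rule sym)
    qed (use q' in auto)
    then show ?thesis by (rule has_vector_derivative_at_within)
  qed
  have cd: "curve_deriv {0..1} h q = f q" if q: "q \<in> {s..t} - (N \<union> {s, t})" for q
    by (rule curve_deriv_eq[OF d[OF q]]) (use q assms in auto)
  have neg: "negligible (N \<union> {s, t})" using N(1) by (intro negligible_Un) auto
  show ?thesis using that[OF f(1) _ neg d cd] f(2) by blast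
qed

lemma Hol_Suc_imp_Hreg_0:
  fixes h :: "real \<Rightarrow> 'b::euclidean_space"
  assumes "Hol (Suc i) B s t h" "t \<le> s + 1"
  shows "Hreg 0 s t h"
proof -
  obtain h' where h': "\<forall>q\<in>{s..t}. (h has_vector_derivative h' q) (at q within {s..t})" "Hol i B s t h'"
    using assms(1) by auto
  show ?thesis by (rule C1_imp_Hreg_0[OF h'(1) Hol_continuous_on[OF h'(2) assms(2)]])
qed

context riemannian
begin

lemma ddtrans_sym:
  assumes "c \<in> \<A>" "d \<in> \<A>" "p \<in> chart_dom c" "p \<in> chart_dom d"
  shows "ddtrans c d (chart_map c p) u v = ddtrans c d (chart_map c p) v u"
  unfolding ddtrans_def dtrans_def
  by (rule second_derivative_symmetric[OF transition_Cn_on(2,1)[OF assms(1,2)]]) (use assms in blast)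

lemma chart_change_near:
  assumes x: "continuous_on {0..1::real} x" and c: "c \<in> \<A>" "d \<in> \<A>"
    and q: "q \<in> {0..1}" "x q \<in> chart_dom c" "x q \<in> chart_dom d"
  obtains e where "e > 0" "\<And>s. s \<in> {0..1} \<Longrightarrow> \<bar>s - q\<bar> < e \<Longrightarrow> x s \<in> chart_dom c \<and> x s \<in> chart_dom d"
proof -
  obtain d1 where d1: "d1 > 0" "\<And>s. s \<in> {0..1} \<Longrightarrow> \<bar>s - q\<bar> < d1 \<Longrightarrow> x s \<in> chart_dom c"
    using chart_interval_nhd[OF x c(1) q(1,2)] by blast
  obtain d2 where d2: "d2 > 0" "\<And>s. s \<in> {0..1} \<Longrightarrow> \<bar>s - q\<bar> < d2 \<Longrightarrow> x s \<in> chart_dom d"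
    using chart_interval_nhd[OF x c(2) q(1,3)] by blast
  show ?thesis by (rule that[of "min d1 d2"]) (use d1 d2 in auto)
qed

lemma curve_deriv_01: "(h has_vector_derivative v) (at q within {0..1}) \<Longrightarrow> q \<in> {0..1} \<Longrightarrow> curve_deriv {0..1} h q = (v::'b)"
  by (rule curve_deriv_eq) auto

lemma chart_curve_change_derivative:
  assumes x: "continuous_on {0..1::real} x" and c: "c \<in> \<A>" "d \<in> \<A>"
    and q: "q \<in> {0..1}" "x q \<in> chart_dom c" "x q \<in> chart_dom d"
    and v: "(chart_map c \<circ> x has_vector_derivative v) (at q within {0..1})"
  shows "(chart_map d \<circ> x has_vector_derivative dtrans c d (chart_map c (x q)) v) (at q within {0..1})"
proof -
  obtain e where e: "e > 0" "\<And>s. s \<in> {0..1} \<Longrightarrow> \<bar>s - q\<bar> < e \<Longrightarrow> x s \<in> chart_dom c \<and> x s \<in> chart_dom d"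
    using chart_change_near[OF x c q] by blast
  have "(transition c d has_derivative dtrans c d (chart_map c (x q))) (at ((crd c x) q) within (crd c x) ` {0..1})"
    using dtrans_has_derivative[OF c q(2,3)] by (simp add: has_derivative_at_withinI)
  from vector_derivative_diff_chain_within[OF v this]
  show ?thesis
    by (rule has_vector_derivative_transform_within[OF _ e(1) q(1)]) (use e(2) c in \<open>auto simp: dist_real_def\<close>)
qed

lemma velocity_tangent:
  assumes x: "continuous_on {0..1::real} x" and c: "c \<in> \<A>"
    and q: "q \<in> {0..1}" "x q \<in> chart_dom c"
    and v: "(chart_map c \<circ> x has_vector_derivative v) (at q within {0..1})"
  shows "cvel 0 x q \<in> TM (x q)"
proof (rule tangent_spaceI[OF c q(2)])
  fix d assume d: "d \<in> \<A>" "x q \<in> chart_dom d"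
  show "cvel 0 x q d = dtrans c d (chart_map c (x q)) (cvel 0 x q c)"
    using curve_deriv_01[OF chart_curve_change_derivative[OF x c d(1) q d(2) v] q(1)] curve_deriv_01[OF v q(1)] c d q
    by (simp add: cov_velocity_0 charts_at_def)
qed (simp add: cov_velocity_0)

text \<open>The product rule for the transformed coordinates yields an additional second derivative
  of the transition; it cancels against the inhomogeneous term in \<open>levi_civita_change\<close>.
  Differentiability is assumed at the point \<open>q\<close> only, so the lemma also applies almost
  everywhere at the top order.\<close>

lemma cov_velocity_Suc_tangent:
  assumes x: "continuous_on {0..1::real} x" and c: "c \<in> \<A>"
    and q: "q \<in> {0..1}" "x q \<in> chart_dom c"
    and v: "(chart_map c \<circ> x has_vector_derivative v) (at q within {0..1})"
    and T: "\<And>s. s \<in> {0..1} \<Longrightarrow> cvel j x s \<in> TM (x s)"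
    and X: "((\<lambda>s. cvel j x s c) has_vector_derivative X) (at q within {0..1})"
  shows "cvel (Suc j) x q \<in> TM (x q)"
proof (rule tangent_spaceI[OF c q(2)])
  fix d assume d: "d \<in> \<A>" "x q \<in> chart_dom d"
  let ?z = "chart_map c (x q)"
  define Y where "Y s = cvel j x s c" for s
  obtain h where h: "h > 0" "\<And>s. s \<in> {0..1} \<Longrightarrow> \<bar>s - q\<bar> < h \<Longrightarrow> x s \<in> chart_dom c \<and> x s \<in> chart_dom d"
    using chart_change_near[OF x c d(1) q d(2)] by blast
  have Yd: "(Y has_vector_derivative X) (at q within {0..1})" using X unfolding Y_def[abs_def] .
  have ex: "dtrans c d (chart_map c (x s)) u = (\<Sum>e\<in>Basis. (u \<bullet> e) *\<^sub>R dtrans c d (chart_map c (x s)) e)"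
    if "x s \<in> chart_dom c" "x s \<in> chart_dom d" for s u
    by (rule frechet_derivative_euclidean_sum[OF dtrans_has_derivative[OF c d(1) that]])
  have dd: "ddtrans c d ?z v u = (\<Sum>e\<in>Basis. (u \<bullet> e) *\<^sub>R ddtrans c d ?z v e)" for u
  proof -
    have "ddtrans c d ?z u v = (\<Sum>e\<in>Basis. (u \<bullet> e) *\<^sub>R ddtrans c d ?z e v)"
      by (rule frechet_derivative_euclidean_sum[OF ddtrans_has_derivative[OF c d(1) q(2) d(2)]])
    then show ?thesis unfolding ddtrans_sym[OF c d(1) q(2) d(2), of v] .
  qed
  have "((\<lambda>s. \<Sum>e\<in>Basis. (Y s \<bullet> e) *\<^sub>R dtrans c d (chart_map c (x s)) e) has_vector_derivative
     (\<Sum>e\<in>Basis. (Y q \<bullet> e) *\<^sub>R ddtrans c d ?z v e + (X \<bullet> e) *\<^sub>R dtrans c d ?z e)) (at q within {0..1})"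
  proof (intro has_vector_derivative_sum)
    fix e :: 'b
    have 1: "((\<lambda>s. Y s \<bullet> e) has_vector_derivative (X \<bullet> e)) (at q within {0..1})"
      by (rule bounded_linear.has_vector_derivative[OF bounded_linear_inner_left Yd])
    have "((\<lambda>y. dtrans c d y e) has_derivative (\<lambda>u. ddtrans c d ?z u e)) (at ((crd c x) q) within (crd c x) ` {0..1})"
      using ddtrans_has_derivative[OF c d(1) q(2) d(2)] by (simp add: has_derivative_at_withinI)
    from vector_derivative_diff_chain_within[OF v this]
    have 2: "((\<lambda>s. dtrans c d (chart_map c (x s)) e) has_vector_derivative ddtrans c d ?z v e) (at q within {0..1})"
      by (simp add: o_def)
    show "((\<lambda>s. (Y s \<bullet> e) *\<^sub>R dtrans c d (chart_map c (x s)) e) has_vector_derivative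
       (Y q \<bullet> e) *\<^sub>R ddtrans c d ?z v e + (X \<bullet> e) *\<^sub>R dtrans c d ?z e) (at q within {0..1})"
      using has_vector_derivative_scaleR[OF 1[unfolded has_real_derivative_iff_has_vector_derivative[symmetric]] 2] by simp
  qed
  moreover have "(\<Sum>e\<in>Basis. (Y q \<bullet> e) *\<^sub>R ddtrans c d ?z v e + (X \<bullet> e) *\<^sub>R dtrans c d ?z e)
      = ddtrans c d ?z v (Y q) + dtrans c d ?z X"
    unfolding dd[of "Y q"] ex[OF q(2) d(2), of X] by (simp add: sum.distrib)
  ultimately have "((\<lambda>s. \<Sum>e\<in>Basis. (Y s \<bullet> e) *\<^sub>R dtrans c d (chart_map c (x s)) e) has_vector_derivative
     (ddtrans c d ?z v (Y q) + dtrans c d ?z X)) (at q within {0..1})" by simp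
  then have "((\<lambda>s. cvel j x s d) has_vector_derivative (ddtrans c d ?z v (Y q) + dtrans c d ?z X)) (at q within {0..1})"
  proof (rule has_vector_derivative_transform_within[OF _ h(1) q(1)])
    fix s assume s: "s \<in> {0..1}" "dist s q < h"
    then have xs: "x s \<in> chart_dom c" "x s \<in> chart_dom d" using h(2)[of s] by (auto simp: dist_real_def)
    show "(\<Sum>e\<in>Basis. (Y s \<bullet> e) *\<^sub>R dtrans c d (chart_map c (x s)) e) = cvel j x s d"
      unfolding tangent_spaceD[OF T[OF s(1)] c d(1) xs] ex[OF xs, symmetric] Y_def by (rule refl)
  qed
  note cdd = curve_deriv_01[OF this q(1)] and cdc = curve_deriv_01[OF X q(1)]
  have vc: "cvel 0 x q c = v"
    using curve_deriv_01[OF v q(1)] c q by (simp add: cov_velocity_0 charts_at_def)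
  have vd: "cvel 0 x q d = dtrans c d ?z v"
    using curve_deriv_01[OF chart_curve_change_derivative[OF x c d(1) q d(2) v] q(1)] d q by (simp add: cov_velocity_0 charts_at_def)
  have Yd': "cvel j x q d = dtrans c d ?z (Y q)"
    unfolding Y_def by (rule tangent_spaceD[OF T[OF q(1)] c d(1) q(2) d(2)])
  have "cvel (Suc j) x q c = X + Chr c ?z v (Y q)"
    using c q vc cdc by (simp add: cov_velocity_Suc charts_at_def Y_def)
  moreover have "cvel (Suc j) x q d = ddtrans c d ?z v (Y q) + dtrans c d ?z X +
     Chr d (chart_map d (x q)) (dtrans c d ?z v) (dtrans c d ?z (Y q))"
    using d q vd cdd Yd' by (simp add: cov_velocity_Suc charts_at_def)
  ultimately show "cvel (Suc j) x q d = dtrans c d ?z (cvel (Suc j) x q c)"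
    using levi_civita_change[OF c d(1) q(2) d(2), of v "Y q"] linear_add[OF dtrans_linear[OF c d(1) q(2) d(2)]]
    by simp
qed (simp add: cov_velocity_Suc)

lemma chart_interval_at:
  assumes x: "continuous_on {0..1::real} x" and "c \<in> \<A>" "q \<in> {0..1}" "x q \<in> chart_dom c"
  obtains s t where "chart_interval x c s t" "q \<in> {s..t}"
proof -
  obtain d where d: "d > 0" "\<And>r. r \<in> {0..1} \<Longrightarrow> \<bar>r - q\<bar> < d \<Longrightarrow> x r \<in> chart_dom c"
    using chart_interval_nhd[OF assms] by blast
  define e where "e = min (d/2) (1/2)"
  have e: "0 < e" "e < d" "e \<le> 1/2" using d by (auto simp: e_def)
  show ?thesis
  proof (rule that[of "max 0 (q - e)" "min 1 (q + e)"])
    show "chart_interval x c (max 0 (q - e)) (min 1 (q + e))"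
      unfolding chart_interval_def using assms(2,3) e d(2) by (auto intro!: d(2) simp: abs_less_iff)
    show "q \<in> {max 0 (q - e)..min 1 (q + e)}" using assms(3) e by auto
  qed
qed

lemma chart_curve_has_vector_derivative:
  assumes x: "x \<in> Hk (Suc r)" and "0 < r" and c: "c \<in> \<A>" "q \<in> {0..1}" "x q \<in> chart_dom c"
  shows "(chart_map c \<circ> x has_vector_derivative cvel 0 x q c) (at q within {0..1})"
proof -
  note xc = Hk_curves_continuous[OF x]
  obtain s t where st: "chart_interval x c s t" "q \<in> {s..t}" using chart_interval_at[OF xc c] by blast
  obtain r' where r': "r = Suc r'" using \<open>0 < r\<close> by (cases r) auto
  have ex: "\<exists>d. (chart_map c \<circ> x has_vector_derivative d) (at q within {s..t})" if "chart_interval x c s t" "q \<in> {s..t}" for s t q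
    using chart_curve_Hreg[OF x that(1)] that(2) unfolding r' by auto
  show ?thesis
    using has_vector_derivative_within_chart_interval(1)[OF xc st(1) ex st(2)] chart_interval_charts_at[OF st]
    by (simp add: cov_velocity_0)
qed

lemma cov_velocity_Hreg_0:
  assumes x: "x \<in> Hk (Suc r)" and st: "chart_interval x c s t" and "j < r"
  shows "Hreg 0 s t (\<lambda>q. cvel j x q c)"
proof -
  obtain u w B where uw: "\<forall>q\<in>{s..t}. cvel j x q c = u q + w q" "Hreg (r - 1 - j) s t u" "Hol (r - j) B s t w"
    using cov_velocity_regular[OF assms] by blast
  obtain i where i: "r - j = Suc i" using \<open>j < r\<close> by (metis Suc_diff_Suc)
  have "Hreg 0 s t (\<lambda>q. u q + w q)"
    by (rule Hreg_0_add[OF Hreg_imp_Hreg_0[OF uw(2)] Hol_Suc_imp_Hreg_0[OF uw(3)[unfolded i]]]) (use chart_interval_le[OF st] in simp)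
  then show ?thesis by (rule Hreg_cong) (use uw(1) chart_interval_le[OF st] in auto)
qed

lemma cov_velocity_differentiable:
  assumes x: "x \<in> Hk (Suc r)" and "Suc j < r" and c: "c \<in> \<A>" "q \<in> {0..1}" "x q \<in> chart_dom c"
  shows "\<exists>X. ((\<lambda>s. cvel j x s c) has_vector_derivative X) (at q within {0..1})"
proof -
  note xc = Hk_curves_continuous[OF x]
  obtain s t where st: "chart_interval x c s t" "q \<in> {s..t}" using chart_interval_at[OF xc c] by blast
  have ex: "\<exists>d. ((\<lambda>s. cvel j x s c) has_vector_derivative d) (at q within {s..t})"
    if ci: "chart_interval x c s t" and q: "q \<in> {s..t}" for s t q
  proof -
    obtain u w B where uw: "\<forall>q\<in>{s..t}. cvel j x q c = u q + w q" "Hreg (r - 1 - j) s t u" "Hol (r - j) B s t w"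
      using cov_velocity_regular[OF x ci, of j] assms(2) by auto
    obtain i where i: "r - 1 - j = Suc i" "r - j = Suc (Suc i)"
      using assms(2) by (metis Suc_diff_Suc diff_Suc_1 diff_commute Suc_lessD)
    obtain u' where u': "(u has_vector_derivative u') (at q within {s..t})" using uw(2) q unfolding i Hreg.simps by blast
    obtain w' where w': "(w has_vector_derivative w') (at q within {s..t})" using uw(3) q unfolding i Hol.simps(2)[of "Suc i"] by blast
    have "((\<lambda>s. cvel j x s c) has_vector_derivative (u' + w')) (at q within {s..t})"
      by (rule has_vector_derivative_transform[OF q _ has_vector_derivative_add[OF u' w']]) (use uw(1) in simp)
    then show ?thesis by blast
  qed
  show ?thesis using has_vector_derivative_within_chart_interval(1)[OF xc st(1) ex st(2)] by blast
qed

lemma cov_velocity_tangent: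
  assumes x: "x \<in> Hk (Suc r)" and "j < r" "q \<in> {0..1}"
  shows "cvel j x q \<in> TM (x q)"
  using assms(2,3)
proof (induction j arbitrary: q)
  case 0
  obtain c where c: "c \<in> \<A>" "x q \<in> chart_dom c" using Hk_curves_carrier[OF x 0(2)] by (auto simp: carrier_def)
  show ?case
    by (rule velocity_tangent[OF Hk_curves_continuous[OF x] c(1) 0(2) c(2)
      chart_curve_has_vector_derivative[OF x 0(1) c(1) 0(2) c(2)]])
next
  case (Suc j)
  obtain c where c: "c \<in> \<A>" "x q \<in> chart_dom c" using Hk_curves_carrier[OF x Suc.prems(2)] by (auto simp: carrier_def)
  obtain X where X: "((\<lambda>s. cvel j x s c) has_vector_derivative X) (at q within {0..1})"
    using cov_velocity_differentiable[OF x Suc.prems(1) c(1) Suc.prems(2) c(2)] by blast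
  have r0: "0 < r" "j < r" using Suc.prems by auto
  show ?case
    by (rule cov_velocity_Suc_tangent[OF Hk_curves_continuous[OF x] c(1) Suc.prems(2) c(2)
      chart_curve_has_vector_derivative[OF x r0(1) c(1) Suc.prems(2) c(2)] Suc.IH[OF r0(2)] X])
qed

lemma chart_primitive_0:
  assumes x: "x \<in> Hk (Suc r)" and st: "chart_interval x c s t"
  obtains f N where "L2_on s t f" "\<And>q. q \<in> {s..t} \<Longrightarrow> chart_map c (x q) = chart_map c (x s) + integral {s..q} f"
    "negligible N" "\<And>q. q \<in> {s..t} - N \<Longrightarrow> cvel 0 x q c = f q"
    "\<And>q. q \<in> {s..t} - N \<Longrightarrow> cvel 0 x q \<in> TM (x q)"
proof -
  have ci: "0 \<le> s" "t \<le> 1" "c \<in> \<A>" using st by (auto simp: chart_interval_def)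
  obtain f N where f: "L2_on s t f" "\<And>q. q \<in> {s..t} \<Longrightarrow> (crd c x) q = (crd c x) s + integral {s..q} f"
    "negligible N" "\<And>q. q \<in> {s..t} - N \<Longrightarrow> (chart_map c \<circ> x has_vector_derivative f q) (at q within {0..1})"
    "\<And>q. q \<in> {s..t} - N \<Longrightarrow> curve_deriv {0..1} (crd c x) q = f q"
    using Hreg_0_primitive[OF Hreg_imp_Hreg_0[OF chart_curve_Hreg[OF x st]] ci(1,2)] by metis
  show ?thesis
  proof (rule that[OF f(1) _ f(3)])
    show "chart_map c (x q) = chart_map c (x s) + integral {s..q} f" if "q \<in> {s..t}" for q using f(2)[OF that] by simp
    fix q assume q: "q \<in> {s..t} - N"
    have q': "q \<in> {s..t}" "q \<in> {0..1}" using q ci by auto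
    show "cvel 0 x q c = f q" using chart_interval_charts_at[OF st q'(1)] f(5)[OF q] by (simp add: cov_velocity_0)
    show "cvel 0 x q \<in> TM (x q)"
      by (rule velocity_tangent[OF Hk_curves_continuous[OF x] ci(3) q'(2) _ f(4)[OF q]])
         (use chart_interval_charts_at[OF st q'(1)] in \<open>simp add: charts_at_def\<close>)
  qed
qed

text \<open>This includes \<open>Suc j = r\<close>, the order at which the covariant derivative is
  controlled only off a negligible set.\<close>

lemma chart_primitive_Suc:
  assumes x: "x \<in> Hk (Suc r)" and st: "chart_interval x c s t" and "j < r"
  obtains f N where "L2_on s t f" "\<And>q. q \<in> {s..t} \<Longrightarrow> cvel j x q c = cvel j x s c + integral {s..q} f"
    "negligible N" "\<And>q. q \<in> {s..t} - N \<Longrightarrow> cvel (Suc j) x q c =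
       f q + Chr c (chart_map c (x q)) (cvel 0 x q c) (cvel j x q c)"
    "\<And>q. q \<in> {s..t} - N \<Longrightarrow> cvel (Suc j) x q \<in> TM (x q)"
proof -
  have ci: "0 \<le> s" "t \<le> 1" "c \<in> \<A>" using st by (auto simp: chart_interval_def)
  obtain f N where f: "L2_on s t f" "\<And>q. q \<in> {s..t} \<Longrightarrow> cvel j x q c = cvel j x s c + integral {s..q} f"
    "negligible N" "\<And>q. q \<in> {s..t} - N \<Longrightarrow> ((\<lambda>q. cvel j x q c) has_vector_derivative f q) (at q within {0..1})"
    "\<And>q. q \<in> {s..t} - N \<Longrightarrow> curve_deriv {0..1} (\<lambda>q. cvel j x q c) q = f q"
    using Hreg_0_primitive[OF cov_velocity_Hreg_0[OF assms] ci(1,2)] by metis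
  show ?thesis
  proof (rule that[OF f(1,2,3)])
    fix q assume q: "q \<in> {s..t} - N"
    have q': "q \<in> {s..t}" "q \<in> {0..1}" using q ci by auto
    have xq: "x q \<in> chart_dom c" using chart_interval_charts_at[OF st q'(1)] by (simp add: charts_at_def)
    show "cvel (Suc j) x q c =
       f q + Chr c (chart_map c (x q)) (cvel 0 x q c) (cvel j x q c)"
      using chart_interval_charts_at[OF st q'(1)] f(5)[OF q] by (simp add: cov_velocity_Suc)
    have r0: "0 < r" using \<open>j < r\<close> by simp
    show "cvel (Suc j) x q \<in> TM (x q)"
      by (rule cov_velocity_Suc_tangent[OF Hk_curves_continuous[OF x] ci(3) q'(2) xq
         chart_curve_has_vector_derivative[OF x r0 ci(3) q'(2) xq] cov_velocity_tangent[OF x \<open>j < r\<close>] f(4)[OF q]])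
  qed
qed

lemma cov_velocity_Hol_0:
  assumes x: "x \<in> Hk (Suc r)" and st: "chart_interval x c s t" and "j < r"
  shows "\<exists>B. Hol 0 B s t (\<lambda>q. cvel j x q c)"
  using Hreg_imp_Hol[OF cov_velocity_Hreg_0[OF assms]] chart_interval_le[OF st] by blast

lemma chart_curve_Hol_0:
  assumes x: "x \<in> Hk (Suc r)" and st: "chart_interval x c s t"
  shows "\<exists>B. Hol 0 B s t (crd c x)"
  using Hreg_imp_Hol[OF Hreg_imp_Hreg_0[OF chart_curve_Hreg[OF assms]]] chart_interval_le[OF st] by blast

text \<open>Values on a negligible set are left free, because the top covariant derivative is
  determined, and known to be tangent, only almost everywhere.\<close>

definition L2_field :: "(real \<Rightarrow> 'a) \<Rightarrow> (real \<Rightarrow> ('a, 'b) tvec) \<Rightarrow> bool" where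
  "L2_field x X \<longleftrightarrow> (\<forall>c s t. chart_interval x c s t \<longrightarrow> (\<exists>\<psi> N. L2_on s t \<psi> \<and> negligible N \<and>
     (\<forall>q\<in>{s..t} - N. X q c = \<psi> q \<and> X q \<in> TM (x q))))"

lemma L2_field_cov_velocity:
  assumes x: "x \<in> Hk (Suc r)" and "j \<le> r"
  shows "L2_field x (cvel j x)"
  unfolding L2_field_def
proof (intro allI impI)
  fix c s t assume st: "chart_interval x c s t"
  show "\<exists>h N. L2_on s t h \<and> negligible N \<and> (\<forall>q\<in>{s..t} - N. cvel j x q c = h q \<and> cvel j x q \<in> TM (x q))"
  proof (cases j)
    case 0
    then show ?thesis using chart_primitive_0[OF x st] by metis
  next
    case (Suc i)
    then have i: "i < r" using assms(2) by simp
    obtain f N where f: "L2_on s t f" "negligible N" "\<And>q. q \<in> {s..t} - N \<Longrightarrow> cvel (Suc i) x q c =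
       f q + Chr c (chart_map c (x q)) (cvel 0 x q c) (cvel i x q c)"
      "\<And>q. q \<in> {s..t} - N \<Longrightarrow> cvel (Suc i) x q \<in> TM (x q)"
      using chart_primitive_Suc[OF x st i] by metis
    let ?\<Gamma> = "\<lambda>q. Chr c (chart_map c (x q)) (cvel 0 x q c) (cvel i x q c)"
    have "0 < r" using i by simp
    then obtain B2 where B2: "Hol 0 B2 s t (\<lambda>q. cvel 0 x q c)"
      using cov_velocity_Hol_0[OF x st] by blast
    obtain B1 where B1: "Hol 0 B1 s t (crd c x)" using chart_curve_Hol_0[OF x st] by blast
    obtain B3 where B3: "Hol 0 B3 s t (\<lambda>q. cvel i x q c)"
      using cov_velocity_Hol_0[OF x st i] by blast
    obtain B where B: "Hol 0 B s t ?\<Gamma>"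
      using Hol_levi_civita[OF Hk_curves_continuous[OF x] st B1 B2 B3] by blast
    have "continuous_on {s..t} ?\<Gamma>" using Hol_continuous_on[OF B] chart_interval_le[OF st] by blast
    then have "L2_on s t (\<lambda>q. f q + ?\<Gamma> q)" by (intro L2_on_add f(1) L2_on_continuous)
    then show ?thesis using f(2-4) Suc by (intro exI[of _ "\<lambda>q. f q + ?\<Gamma> q"] exI[of _ N]) auto
  qed
qed

lemma L2_on_G_norm:
  assumes x: "continuous_on {0..1::real} x" and st: "chart_interval x c s t" and h: "L2_on s t h"
  shows "L2_on s t (\<lambda>q. sqrt (G c (chart_map c (x q)) (h q) (h q)))"
proof -
  have c: "c \<in> \<A>" using st by (simp add: chart_interval_def)
  note K = chart_interval_compact[OF x st]
  obtain m M where M: "0 < M" "\<And>z u. z \<in> (crd c x) ` {s..t} \<Longrightarrow> sqrt (G c z u u) \<le> M * norm u"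
    using G_norm_bounds[OF c K] by metis
  have mh: "h \<in> borel_measurable (lebesgue_on {s..t})" using h by (simp add: L2_on_def)
  have img: "chart_map c (x q) \<in> chart_img c" if "q \<in> {s..t}" for q using K(2) that by auto
  have meas: "(\<lambda>q. sqrt (G c (chart_map c (x q)) (h q) (h q))) \<in> borel_measurable (lebesgue_on {s..t})"
  proof -
    have mG: "(\<lambda>q. G c (chart_map c (x q)) e f) \<in> borel_measurable (lebesgue_on {s..t})" for e f
    proof (rule continuous_imp_measurable_on_sets_lebesgue)
      have "continuous_on (chart_img c) (\<lambda>z. G c z e f)" using G_Cn_on[OF c, of 0] by simp
      then show "continuous_on {s..t} (\<lambda>q. G c (chart_map c (x q)) e f)"
        by (rule continuous_on_compose2[OF _ chart_curve_continuous[OF x st, unfolded o_def]]) (use img in auto)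
    qed auto
    have S: "(\<lambda>q. \<Sum>e\<in>Basis. \<Sum>f\<in>Basis. (h q \<bullet> e) * (h q \<bullet> f) * G c (chart_map c (x q)) e f) \<in> borel_measurable (lebesgue_on {s..t})"
      by (intro borel_measurable_sum borel_measurable_times mG borel_measurable_inner mh borel_measurable_const)
    have "(\<lambda>q. sqrt (\<Sum>e\<in>Basis. \<Sum>f\<in>Basis. (h q \<bullet> e) * (h q \<bullet> f) * G c (chart_map c (x q)) e f)) \<in> borel_measurable (lebesgue_on {s..t})"
      by (rule borel_measurable_continuous_on[where f=sqrt, OF _ S]) (intro continuous_on_real_sqrt continuous_on_id)
    then show ?thesis
      by (rule measurable_cong[THEN iffD1, rotated]) (use G_sum[OF c img] in auto)
  qed
  show ?thesis
    unfolding L2_on_def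
  proof (intro conjI meas)
    show "integrable (lebesgue_on {s..t}) (\<lambda>q. (norm (sqrt (G c (chart_map c (x q)) (h q) (h q))))\<^sup>2)"
    proof (rule Bochner_Integration.integrable_bound)
      show "integrable (lebesgue_on {s..t}) (\<lambda>q. M\<^sup>2 * (norm (h q))\<^sup>2)" using h by (simp add: L2_on_def)
      show "(\<lambda>q. (norm (sqrt (G c (chart_map c (x q)) (h q) (h q))))\<^sup>2) \<in> borel_measurable (lebesgue_on {s..t})"
        by (intro borel_measurable_power) (use meas in auto)
      show "AE q in lebesgue_on {s..t}. norm ((norm (sqrt (G c (chart_map c (x q)) (h q) (h q))))\<^sup>2) \<le> norm (M\<^sup>2 * (norm (h q))\<^sup>2)"
      proof (rule AE_I2)
        fix q assume "q \<in> space (lebesgue_on {s..t})"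
        then have q: "q \<in> {s..t}" by simp
        then have "sqrt (G c (chart_map c (x q)) (h q) (h q)) \<le> M * norm (h q)" using M(2) by auto
        then have "(sqrt (G c (chart_map c (x q)) (h q) (h q)))\<^sup>2 \<le> (M * norm (h q))\<^sup>2"
          using G_nonneg[OF c img[OF q]] by (intro power_mono) auto
        then show "norm ((norm (sqrt (G c (chart_map c (x q)) (h q) (h q))))\<^sup>2) \<le> norm (M\<^sup>2 * (norm (h q))\<^sup>2)"
          by (simp add: power_mult_distrib)
      qed
    qed
  qed
qed

text \<open>Bisection: around each time a short interval is mapped into one chart, so a property of
  intervals that can be concatenated only has to be checked on chart intervals.\<close>

lemma bolzano_charts:
  assumes x: "continuous_on {0..1::real} x" "x ` {0..1} \<subseteq> \<M>"
    and ab: "0 \<le> a" "a \<le> b" "b \<le> 1"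
    and trans: "\<And>a b c. 0 \<le> a \<Longrightarrow> a \<le> b \<Longrightarrow> b \<le> c \<Longrightarrow> c \<le> 1 \<Longrightarrow> P a b \<Longrightarrow> P b c \<Longrightarrow> P a c"
    and refl: "\<And>a. 0 \<le> a \<Longrightarrow> a \<le> 1 \<Longrightarrow> P a a"
    and chart: "\<And>c s t. chart_interval x c s t \<Longrightarrow> P s t"
  shows "P a b"
proof -
  have "0 \<le> a \<and> b \<le> 1 \<longrightarrow> a \<le> b \<and> P a b"
    using ab(2)
  proof (induction rule: Bolzano)
    case (trans a b c)
    then show ?case using assms(6) by auto
  next
    case (local q)
    show ?case
    proof (cases "q \<in> {0..1}")
      case True
      then obtain c where c: "c \<in> \<A>" "x q \<in> chart_dom c" using x(2) by (force simp: carrier_def)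
      obtain d where d: "d > 0" "\<And>r. r \<in> {0..1} \<Longrightarrow> \<bar>r - q\<bar> < d \<Longrightarrow> x r \<in> chart_dom c"
        using chart_interval_nhd[OF x(1) c(1) True c(2)] by blast
      show ?thesis
      proof (intro exI[of _ d] conjI d(1) allI impI)
        fix a b assume *: "a \<le> q \<and> q \<le> b \<and> b - a < d" "0 \<le> a \<and> b \<le> 1"
        then show "a \<le> b" by linarith
        show "P a b"
        proof (cases "a = b")
          case True then show ?thesis using refl * by auto
        next
          case False
          have "x r \<in> chart_dom c" if "r \<in> {a..b}" for r
            by (rule d(2)) (use that * in \<open>auto simp: abs_less_iff\<close>)
          then have "chart_interval x c a b" using * False c by (auto simp: chart_interval_def)
          then show ?thesis by (rule chart)
        qed
      qed
    next
      case False
      then show ?thesis by (intro exI[of _ 1]) auto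
    qed
  qed
  then show ?thesis using ab by blast
qed

lemma L2_field_integrable:
  assumes x: "continuous_on {0..1::real} x" "x ` {0..1} \<subseteq> \<M>" and X: "L2_field x X"
    and ab: "0 \<le> a" "a \<le> b" "b \<le> 1"
  shows "(\<lambda>q. tnorm g (x q) (X q)) integrable_on {a..b} \<and> (\<lambda>q. (tnorm g (x q) (X q))\<^sup>2) integrable_on {a..b} \<and>
    negligible {q\<in>{a..b}. X q \<notin> TM (x q)}"
proof (rule bolzano_charts[OF x ab])
  fix a b c :: real
  assume "a \<le> b" "b \<le> c"
    "(\<lambda>q. tnorm g (x q) (X q)) integrable_on {a..b} \<and> (\<lambda>q. (tnorm g (x q) (X q))\<^sup>2) integrable_on {a..b} \<and>
    negligible {q\<in>{a..b}. X q \<notin> TM (x q)}"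
    "(\<lambda>q. tnorm g (x q) (X q)) integrable_on {b..c} \<and> (\<lambda>q. (tnorm g (x q) (X q))\<^sup>2) integrable_on {b..c} \<and>
    negligible {q\<in>{b..c}. X q \<notin> TM (x q)}"
  moreover from this have "negligible ({q\<in>{a..b}. X q \<notin> TM (x q)} \<union> {q\<in>{b..c}. X q \<notin> TM (x q)})"
    by (intro negligible_Un) auto
  then have "negligible {q\<in>{a..c}. X q \<notin> TM (x q)}" by (rule negligible_subset) auto
  ultimately show "(\<lambda>q. tnorm g (x q) (X q)) integrable_on {a..c} \<and> (\<lambda>q. (tnorm g (x q) (X q))\<^sup>2) integrable_on {a..c} \<and>
    negligible {q\<in>{a..c}. X q \<notin> TM (x q)}"
    using HK_integrable_combine by blast
next
  fix a :: real
  have i: "h integrable_on {a}" for h :: "real \<Rightarrow> real" using integrable_on_refl[of h a] by simp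
  show "(\<lambda>q. tnorm g (x q) (X q)) integrable_on {a..a} \<and> (\<lambda>q. (tnorm g (x q) (X q))\<^sup>2) integrable_on {a..a} \<and>
    negligible {q\<in>{a..a}. X q \<notin> TM (x q)}"
    by (auto intro: negligible_subset[of "{a}"] i)
next
  fix c s t assume st: "chart_interval x c s t"
  obtain w N where w: "L2_on s t w" "negligible N" "\<forall>q\<in>{s..t} - N. X q c = w q \<and> X q \<in> TM (x q)"
    using X st unfolding L2_field_def by blast
  define h where "h q = sqrt (G c (chart_map c (x q)) (w q) (w q))" for q
  have eq: "tnorm g (x q) (X q) = h q" if "q \<in> {s..t} - N" for q
    using w(3) tnorm_eq_G[of "X q" "x q" c] chart_interval_charts_at[OF st, of q] that by (auto simp: h_def charts_at_def)
  have h: "h integrable_on {s..t}" "(\<lambda>q. (norm (h q))\<^sup>2) integrable_on {s..t}"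
    using L2_on_integrable_on(1,3)[OF L2_on_G_norm[OF x(1) st w(1)]] unfolding h_def by auto
  have 1: "(\<lambda>q. tnorm g (x q) (X q)) integrable_on {s..t}"
    by (rule integrable_spike[OF h(1) w(2)]) (use eq in auto)
  have 2: "(\<lambda>q. (tnorm g (x q) (X q))\<^sup>2) integrable_on {s..t}"
    by (rule integrable_spike[OF h(2) w(2)]) (use eq in auto)
  have 3: "negligible {q\<in>{s..t}. X q \<notin> TM (x q)}"
    by (rule negligible_subset[OF w(2)]) (use w(3) in auto)
  show "(\<lambda>q. tnorm g (x q) (X q)) integrable_on {s..t} \<and> (\<lambda>q. (tnorm g (x q) (X q))\<^sup>2) integrable_on {s..t} \<and>
    negligible {q\<in>{s..t}. X q \<notin> TM (x q)}" using 1 2 3 by blast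
qed

end

context riemannian
begin

section \<open>Growth of the norm of a field along a curve\<close>

lemma continuous_on_G:
  assumes c: "c \<in> \<A>" and f: "continuous_on S f" "\<And>q. q \<in> S \<Longrightarrow> f q \<in> chart_img c"
    and "continuous_on S u" "continuous_on S v"
  shows "continuous_on S (\<lambda>q. G c (f q) (u q) (v q))"
proof -
  have *: "continuous_on S (\<lambda>q. G c (f q) e e')" for e e'
  proof -
    have "continuous_on (chart_img c) (\<lambda>z. G c z e e')" using G_Cn_on[OF c, of 0] by simp
    then show ?thesis by (rule continuous_on_compose2[OF _ f(1)]) (use f(2) in auto)
  qed
  have "continuous_on S (\<lambda>q. \<Sum>e\<in>Basis. \<Sum>e'\<in>Basis. (u q \<bullet> e) * (v q \<bullet> e') * G c (f q) e e')"
    by (intro continuous_on_sum continuous_on_mult continuous_on_inner continuous_on_const * assms(4,5))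
  then show ?thesis by (rule continuous_on_eq) (use G_sum[OF c f(2)] in auto)
qed

definition prim :: "'b \<Rightarrow> real \<Rightarrow> (real \<Rightarrow> 'b) \<Rightarrow> real \<Rightarrow> 'b" where
  "prim a s \<phi> q = a + integral {s..q} \<phi>"

text \<open>The coordinates in \<open>c\<close> of the covariant derivative along \<open>x\<close>
  of the field with coordinates \<open>prim a s \<phi>\<close>. Taking the derivative
  \<open>\<phi>\<close> of the field as the argument makes it possible to approximate
  \<open>\<phi>\<close> while the curve stays fixed.\<close>

definition chart_cov :: "('a, 'b) chart \<Rightarrow> (real \<Rightarrow> 'a) \<Rightarrow> 'b \<Rightarrow> real \<Rightarrow> (real \<Rightarrow> 'b) \<Rightarrow> real \<Rightarrow> 'b" where
  "chart_cov c x a s \<phi> q = \<phi> q + Chr c (chart_map c (x q)) (cvel 0 x q c) (prim a s \<phi> q)"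

definition chart_norm :: "('a, 'b) chart \<Rightarrow> (real \<Rightarrow> 'a) \<Rightarrow> real \<Rightarrow> 'b \<Rightarrow> real" where
  "chart_norm c x q u = sqrt (G c (chart_map c (x q)) u u)"

lemma prim_Hol_0:
  assumes "L2_on s t f" "s < t" "t \<le> s + 1"
  shows "\<exists>B. Hol 0 B s t (prim a s f)"
  by (rule Hreg_imp_Hol[OF _ assms(2,3)]) (use assms(1) in \<open>auto simp: prim_def[abs_def]\<close>)

text \<open>\<open>UH_levi_civita\<close> is applied to the family of constant curves indexed by the
  points of \<open>K\<close>, with basis vectors as fields; bilinearity does the rest.\<close>

lemma levi_civita_bound_compact:
  assumes c: "c \<in> \<A>" and K: "compact K" "K \<subseteq> chart_img c"
  obtains D where "0 \<le> D" "\<And>z u v. z \<in> K \<Longrightarrow> norm (Chr c z u v) \<le> D * norm u * norm v"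
proof -
  have fam: "interval_family K (\<lambda>_. 0) (\<lambda>_. 1)" by unfold_locales simp
  interpret F: interval_family K "\<lambda>_. 0" "\<lambda>_. 1" by (rule fam)
  obtain M where M: "\<forall>z\<in>K. norm z \<le> M" using compact_imp_bounded[OF K(1)] bounded_iff by blast
  have "F.UH 0 (\<lambda>z t. z)" by (rule F.UH_0I[of _ 0]) (use M in \<open>auto simp: F.ubounded_def\<close>)
  from UH_levi_civita[OF fam c K _ this F.UH_const F.UH_const]
  have "F.ubounded (\<lambda>z t. Chr c z e e')" for e e' by (intro F.UH_ubounded) blast
  then have "\<exists>B. \<forall>z\<in>K. norm (Chr c z e e') \<le> B" for e e'
    unfolding F.ubounded_def by (metis atLeastAtMost_iff order_refl zero_le_one)
  then obtain B where B: "\<And>e e' z. z \<in> K \<Longrightarrow> norm (Chr c z e e') \<le> B e e'" by metis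
  define D where "D = (\<Sum>e\<in>(Basis::'b set). \<Sum>e'\<in>(Basis::'b set). \<bar>B e e'\<bar>)"
  show ?thesis
  proof (rule that[of D])
    show "0 \<le> D" unfolding D_def by (intro sum_nonneg) auto
    fix z u v assume z: "z \<in> K"
    let ?L = "Chr c z"
    have bl: "bilinear ?L" using levi_civita_bilinear[OF c] z K(2) by blast
    have l1: "linear (?L u)" for u using bl unfolding bilinear_def by blast
    have l2: "linear (\<lambda>u. ?L u v)" for v using bl unfolding bilinear_def by blast
    have Lv: "?L u v = (\<Sum>e\<in>Basis. \<Sum>e'\<in>Basis. ((u \<bullet> e) * (v \<bullet> e')) *\<^sub>R ?L e e')"
    proof -
      have "?L u v = ?L (\<Sum>e\<in>Basis. (u \<bullet> e) *\<^sub>R e) v" by (simp add: euclidean_representation)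
      also have "\<dots> = (\<Sum>e\<in>Basis. (u \<bullet> e) *\<^sub>R ?L e v)" by (simp add: linear_sum[OF l2] linear_scale[OF l2])
      also have "\<dots> = (\<Sum>e\<in>Basis. (u \<bullet> e) *\<^sub>R ?L e (\<Sum>e'\<in>Basis. (v \<bullet> e') *\<^sub>R e'))" by (simp add: euclidean_representation)
      also have "\<dots> = (\<Sum>e\<in>Basis. \<Sum>e'\<in>Basis. ((u \<bullet> e) * (v \<bullet> e')) *\<^sub>R ?L e e')"
        by (simp add: linear_sum[OF l1] linear_scale[OF l1] scaleR_sum_right)
      finally show ?thesis .
    qed
    have "norm (?L u v) \<le> (\<Sum>e\<in>Basis. \<Sum>e'\<in>Basis. \<bar>B e e'\<bar> * (norm u * norm v))"
      unfolding Lv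
    proof (intro sum_norm_le)
      fix e e' :: 'b assume "e \<in> Basis" "e' \<in> Basis"
      then have "\<bar>u \<bullet> e\<bar> * \<bar>v \<bullet> e'\<bar> \<le> norm u * norm v" by (intro mult_mono Basis_le_norm) auto
      moreover have "norm (?L e e') \<le> \<bar>B e e'\<bar>" using B[OF z, of e e'] by linarith
      ultimately have "(\<bar>u \<bullet> e\<bar> * \<bar>v \<bullet> e'\<bar>) * norm (?L e e') \<le> (norm u * norm v) * \<bar>B e e'\<bar>"
        by (rule mult_mono) auto
      then show "norm (((u \<bullet> e) * (v \<bullet> e')) *\<^sub>R ?L e e') \<le> \<bar>B e e'\<bar> * (norm u * norm v)"
        by (simp add: abs_mult mult.commute)
    qed
    also have "\<dots> = D * norm u * norm v" by (simp add: D_def sum_distrib_right mult.assoc)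
    finally show "norm (?L u v) \<le> D * norm u * norm v" .
  qed
qed

lemma levi_civita_velocity_bound:
  assumes x: "x \<in> Hk (Suc r)" and st: "chart_interval x c s t" and r: "0 < r"
  obtains C where "C \<ge> 0" "\<And>q v. q \<in> {s..t} \<Longrightarrow>
    norm (Chr c (chart_map c (x q)) (cvel 0 x q c) v) \<le> C * norm v"
proof -
  have c: "c \<in> \<A>" using st by (simp add: chart_interval_def)
  obtain D where D: "0 \<le> D" "\<And>z u v. z \<in> crd c x ` {s..t} \<Longrightarrow> norm (Chr c z u v) \<le> D * norm u * norm v"
    using levi_civita_bound_compact[OF c chart_interval_compact[OF Hk_curves_continuous[OF x] st]] by blast
  obtain B where B: "Hol 0 B s t (\<lambda>q. cvel 0 x q c)" using cov_velocity_Hol_0[OF x st r] by blast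
  show ?thesis
  proof (rule that[of "D * \<bar>B\<bar>"])
    fix q v assume q: "q \<in> {s..t}"
    have "norm (Chr c (chart_map c (x q)) (cvel 0 x q c) v) \<le> D * norm (cvel 0 x q c) * norm v"
      by (rule D(2)) (use q in simp)
    also have "\<dots> \<le> D * \<bar>B\<bar> * norm v"
      using Hol_bounded[OF B q] D(1) by (intro mult_right_mono mult_left_mono) auto
    finally show "norm (Chr c (chart_map c (x q)) (cvel 0 x q c) v) \<le> D * \<bar>B\<bar> * norm v" .
  qed (use D(1) in simp)
qed

lemma chart_cov_continuous:
  assumes x: "x \<in> Hk (Suc r)" and st: "chart_interval x c s t" and r: "0 < r"
    and f: "L2_on s t f"
  shows "continuous_on {s..t} (\<lambda>q. Chr c (chart_map c (x q)) (cvel 0 x q c) (prim a s f q))"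
proof -
  note xc = Hk_curves_continuous[OF x]
  have ts: "s < t" "t \<le> s + 1" using chart_interval_le[OF st] by auto
  obtain B1 where B1: "Hol 0 B1 s t (crd c x)" using chart_curve_Hol_0[OF x st] by blast
  obtain B2 where B2: "Hol 0 B2 s t (\<lambda>q. cvel 0 x q c)" using cov_velocity_Hol_0[OF x st r] by blast
  obtain B3 where B3: "Hol 0 B3 s t (prim a s f)" using prim_Hol_0[OF f ts] by blast
  obtain B where "Hol 0 B s t (\<lambda>q. Chr c (chart_map c (x q)) (cvel 0 x q c) (prim a s f q))"
    using Hol_levi_civita[OF xc st B1 B2 B3] by blast
  then show ?thesis using ts(2) by (rule Hol_continuous_on)
qed

text \<open>For a continuous derivative the norm, regularised by \<open>\<epsilon>\<^sup>2\<close> under the square root, is differentiable; the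
  general case follows by approximating the derivative in \<open>L\<^sup>1\<close>.\<close>

lemma chart_norm_growth_continuous:
  assumes x: "x \<in> Hk (Suc r)" and st: "chart_interval x c s t" and r: "0 < r"
    and p: "continuous_on {s..t} p"
  shows "chart_norm c x t (prim a s p t) \<le> chart_norm c x s a +
     integral {s..t} (\<lambda>q. chart_norm c x q (chart_cov c x a s p q))"
proof -
  note xc = Hk_curves_continuous[OF x]
  have c: "c \<in> \<A>" "0 \<le> s" "s < t" "t \<le> 1" using st by (auto simp: chart_interval_def)
  define f where "f q = chart_map c (x q)" for q
  define v where "v q = cvel 0 x q c" for q
  define y where "y = prim a s p"
  define E where "E = chart_cov c x a s p"
  have img: "f q \<in> chart_img c" if "q \<in> {s..t}" for q
    using chart_interval_compact(2)[OF xc st] that by (auto simp: f_def)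
  have fc: "continuous_on {s..t} f" using chart_curve_continuous[OF xc st] by (simp add: f_def[abs_def] o_def)
  have yd: "(y has_vector_derivative p q) (at q within {s..t})" if "q \<in> {s..t}" for q
    using has_vector_derivative_add[OF has_vector_derivative_const integral_has_vector_derivative[OF p that], of a]
    by (simp add: y_def prim_def[abs_def])
  then have yc: "continuous_on {s..t} y"
    unfolding continuous_on_eq_continuous_within using has_vector_derivative_continuous by blast
  have Ec: "continuous_on {s..t} E"
    unfolding E_def chart_cov_def[abs_def]
    by (intro continuous_on_add p chart_cov_continuous[OF x st r L2_on_continuous[OF p]])
  have fd: "(f has_vector_derivative v q) (at q within {s..t})" if q: "q \<in> {s..t}" for q
  proof -
    have "x q \<in> chart_dom c" using st q by (auto simp: chart_interval_def)
    then have "(chart_map c \<circ> x has_vector_derivative v q) (at q within {0..1})"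
      using chart_curve_has_vector_derivative[OF x r c(1), of q] q c by (simp add: v_def)
    then have "(chart_map c \<circ> x has_vector_derivative v q) (at q within {s..t})"
      by (rule has_vector_derivative_within_subset) (use c in auto)
    then show ?thesis by (simp add: f_def[abs_def] o_def)
  qed
  \<comment> \<open>By compatibility with the metric, the derivative of the coefficients supplies
    exactly the Christoffel terms that complete \<open>p\<close> to the covariant derivative
    \<open>E\<close>.\<close>
  have Gd: "((\<lambda>q. G c (f q) (y q) (y q)) has_real_derivative 2 * G c (f q) (E q) (y q)) (at q within {s..t})"
    if q: "q \<in> {s..t}" for q
  proof -
    have "((\<lambda>q. G c (f q) (y q) (y q)) has_derivative
     (\<lambda>h. dG c (f q) (h *\<^sub>R v q) (y q) (y q) + G c (f q) (h *\<^sub>R p q) (y q) + G c (f q) (y q) (h *\<^sub>R p q))) (at q within {s..t})"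
      by (rule G_has_derivative[OF c(1) img q fd[OF q, unfolded has_vector_derivative_def]
           yd[OF q, unfolded has_vector_derivative_def] yd[OF q, unfolded has_vector_derivative_def]])
    moreover have "dG c (f q) (h *\<^sub>R v q) (y q) (y q) + G c (f q) (h *\<^sub>R p q) (y q) + G c (f q) (y q) (h *\<^sub>R p q)
       = 2 * G c (f q) (E q) (y q) * h" for h
    proof -
      note bl = G_metric(1)[OF c(1) img[OF q]] and sy = G_metric(2)[OF c(1) img[OF q]]
      have 1: "dG c (f q) (h *\<^sub>R v q) (y q) (y q) = h * dG c (f q) (v q) (y q) (y q)"
        using linear_scale[OF dG_linear1[OF c(1) img[OF q]], of h] by simp
      have 2: "dG c (f q) (v q) (y q) (y q) = 2 * G c (f q) (Chr c (f q) (v q) (y q)) (y q)"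
        using levi_civita_compatible[OF c(1) img[OF q], of "v q" "y q" "y q"] sy[of "y q"] by simp
      have 3: "E q = p q + Chr c (f q) (v q) (y q)" by (simp add: E_def chart_cov_def f_def v_def y_def)
      show ?thesis unfolding 1 2 3
        by (simp add: bilinear_ladd[OF bl] bilinear_lmul[OF bl] bilinear_rmul[OF bl] sy[of "y q"] algebra_simps)
    qed
    ultimately show ?thesis unfolding has_field_derivative_def by simp
  qed
  have nn: "0 \<le> G c (f q) u u" if "q \<in> {s..t}" for q u using G_nonneg[OF c(1) img[OF that]] .
  define n where "n q = sqrt (G c (f q) (E q) (E q))" for q
  have nc: "continuous_on {s..t} n"
    unfolding n_def by (intro continuous_on_real_sqrt continuous_on_G[OF c(1) fc img Ec Ec])
  have ni: "n integrable_on {s..t}" by (rule integrable_continuous_real[OF nc])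
  have main: "sqrt (G c (f t) (y t) (y t)) \<le> sqrt (G c (f s) (y s) (y s)) + integral {s..t} n + e" if "e > 0" for e
  proof -
    define m where "m q = sqrt (G c (f q) (y q) (y q) + e\<^sup>2)" for q
    have pos: "G c (f q) (y q) (y q) + e\<^sup>2 > 0" if "q \<in> {s..t}" for q
      using nn[OF that, of "y q"] \<open>e > 0\<close> by (simp add: add_nonneg_pos)
    define m' where "m' q = G c (f q) (E q) (y q) / m q" for q
    have md: "(m has_vector_derivative m' q) (at q within {s..t})" if q: "q \<in> {s..t}" for q
    proof -
      have "((\<lambda>q. G c (f q) (y q) (y q) + e\<^sup>2) has_real_derivative 2 * G c (f q) (E q) (y q)) (at q within {s..t})"
        using DERIV_add[OF Gd[OF q] DERIV_const[of "e\<^sup>2"]] by simp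
      from DERIV_chain2[OF DERIV_real_sqrt[OF pos[OF q]] this]
      have "(m has_real_derivative m' q) (at q within {s..t})"
        unfolding m_def[abs_def] m'_def by (simp add: field_simps)
      then show ?thesis by (simp add: has_real_derivative_iff_has_vector_derivative)
    qed
    have FTC: "(m' has_integral (m t - m s)) {s..t}"
      by (rule fundamental_theorem_of_calculus) (use md c in auto)
    have bound: "m' q \<le> n q" if q: "q \<in> {s..t}" for q
    proof -
      have mp: "m q > 0" using pos[OF q] by (simp add: m_def)
      have "G c (f q) (E q) (y q) \<le> n q * sqrt (G c (f q) (y q) (y q))"
        using G_cauchy_schwarz[OF c(1) img[OF q], of "E q" "y q"] by (simp add: n_def)
      also have "\<dots> \<le> n q * m q" unfolding m_def by (intro mult_left_mono real_sqrt_le_mono) (use nn[OF q] in \<open>auto simp: n_def\<close>)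
      finally show ?thesis using mp by (simp add: m'_def field_simps)
    qed
    have "m t - m s \<le> integral {s..t} n"
      by (rule has_integral_le[OF FTC integrable_integral[OF ni] bound])
    moreover have "sqrt (G c (f t) (y t) (y t)) \<le> m t" unfolding m_def by (intro real_sqrt_le_mono) simp
    moreover have "m s \<le> sqrt (G c (f s) (y s) (y s)) + e"
      unfolding m_def using sqrt_add_le_add_sqrt[OF nn[of s "y s"], of "e\<^sup>2"] \<open>e > 0\<close> c by simp
    ultimately show ?thesis by linarith
  qed
  have "sqrt (G c (f t) (y t) (y t)) \<le> sqrt (G c (f s) (y s) (y s)) + integral {s..t} n"
    by (rule field_le_epsilon) (rule main)
  moreover have "y s = a" by (simp add: y_def prim_def)
  ultimately show ?thesis
    by (simp add: chart_norm_def[abs_def] f_def n_def[abs_def] E_def y_def)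
qed

lemma chart_norm_growth:
  assumes x: "x \<in> Hk (Suc r)" and st: "chart_interval x c s t" and r: "0 < r"
    and f: "L2_on s t f"
  shows "chart_norm c x t (prim a s f t) \<le> chart_norm c x s a +
     integral {s..t} (\<lambda>q. chart_norm c x q (chart_cov c x a s f q))"
proof -
  note xc = Hk_curves_continuous[OF x]
  have c: "c \<in> \<A>" "0 \<le> s" "s < t" "t \<le> 1" using st by (auto simp: chart_interval_def)
  have img: "chart_map c (x q) \<in> chart_img c" if "q \<in> {s..t}" for q
    using chart_interval_compact(2)[OF xc st] that by auto
  obtain m M where M: "0 < M" "\<And>z u. z \<in> (crd c x) ` {s..t} \<Longrightarrow> sqrt (G c z u u) \<le> M * norm u"
    using G_norm_bounds[OF c(1) chart_interval_compact[OF xc st]] by metis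
  have nM: "chart_norm c x q u \<le> chart_norm c x q w + M * norm (u - w)" if q: "q \<in> {s..t}" for q u w
  proof -
    have "chart_norm c x q (w + (u - w)) \<le> chart_norm c x q w + chart_norm c x q (u - w)"
      unfolding chart_norm_def by (rule G_norm_triangle[OF c(1) img[OF q]])
    moreover have "chart_norm c x q (u - w) \<le> M * norm (u - w)"
      unfolding chart_norm_def using M(2) q by auto
    ultimately show ?thesis by simp
  qed
  obtain C where C: "C \<ge> 0" "\<And>q v. q \<in> {s..t} \<Longrightarrow>
    norm (Chr c (chart_map c (x q)) (cvel 0 x q c) v) \<le> C * norm v"
    using levi_civita_velocity_bound[OF x st r] by blast
  have cov_L2: "L2_on s t (chart_cov c x a s h)" if "L2_on s t h" for h
    unfolding chart_cov_def[abs_def] by (intro L2_on_add that L2_on_continuous chart_cov_continuous[OF x st r])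
  have ni: "(\<lambda>q. chart_norm c x q (chart_cov c x a s h q)) integrable_on {s..t}" if "L2_on s t h" for h
    using L2_on_integrable_on(1)[OF L2_on_G_norm[OF xc st cov_L2[OF that]]] by (simp add: chart_norm_def)
  have main: "chart_norm c x t (prim a s f t) \<le> chart_norm c x s a +
     integral {s..t} (\<lambda>q. chart_norm c x q (chart_cov c x a s f q)) + k" if "k > 0" for k
  proof -
    \<comment> \<open>Three errors add up to \<open>k\<close>: \<open>M * d\<close> from the value
      at \<open>t\<close>, \<open>M * d\<close> from the approximation of \<open>f\<close> under the
      integral, and \<open>M * (C * d)\<close> from the Christoffel term, where
      \<open>t - s \<le> 1\<close> is used.\<close>
    define d where "d = k / (M * (2 + C))"
    have pC: "M * (2 + C) > 0" using M C by simp
    then have "d > 0" using \<open>k > 0\<close> by (simp add: d_def)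
    obtain h where h: "continuous_on UNIV h" "integral {s..t} (\<lambda>q. norm (f q - h q)) < d"
      using absolutely_integrable_approximate_continuous[OF L2_on_absolutely_integrable[OF f] \<open>d > 0\<close>] by blast
    have hc: "continuous_on {s..t} h" using h(1) by (rule continuous_on_subset) simp
    note h2 = L2_on_continuous[OF hc]
    have dai: "(\<lambda>q. f q - h q) absolutely_integrable_on {s..t}"
      by (intro set_integral_diff L2_on_absolutely_integrable f h2)
    have di: "(\<lambda>q. norm (f q - h q)) integrable_on {s..t}"
      using dai unfolding absolutely_integrable_on_def by (rule conjunct2)
    have pd: "norm (prim a s f q - prim a s h q) \<le> d" if q: "q \<in> {s..t}" for q
    proof -
      have "prim a s f q - prim a s h q = integral {s..q} (\<lambda>q. f q - h q)"
        unfolding prim_def using q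
        by (subst HK_integral_diff)
           (auto intro!: integrable_subinterval_real[OF L2_on_integrable_on(1)[OF f]] integrable_subinterval_real[OF L2_on_integrable_on(1)[OF h2]])
      also have "norm \<dots> \<le> integral {s..q} (\<lambda>q. norm (f q - h q))"
        by (rule integral_norm_bound_integral)
           (use q integrable_subinterval_real[OF set_lebesgue_integral_eq_integral(1)[OF dai]] integrable_subinterval_real[OF di] in auto)
      also have "\<dots> \<le> integral {s..t} (\<lambda>q. norm (f q - h q))"
        by (rule integral_subset_le) (use q di integrable_subinterval_real[OF di] in auto)
      finally show ?thesis using h(2) by linarith
    qed
    have Ed: "chart_norm c x q (chart_cov c x a s h q) \<le> chart_norm c x q (chart_cov c x a s f q) + (M * norm (f q - h q) + M * (C * d))"
      if q: "q \<in> {s..t}" for q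
    proof -
      have l: "linear (Chr c (chart_map c (x q)) (cvel 0 x q c))"
        using levi_civita_bilinear[OF c(1) img[OF q]] by (simp add: bilinear_def)
      have "chart_cov c x a s h q - chart_cov c x a s f q = - (f q - h q) -
         Chr c (chart_map c (x q)) (cvel 0 x q c) (prim a s f q - prim a s h q)"
        by (simp add: chart_cov_def linear_diff[OF l])
      then have "norm (chart_cov c x a s h q - chart_cov c x a s f q) \<le> norm (f q - h q) +
         norm (Chr c (chart_map c (x q)) (cvel 0 x q c) (prim a s f q - prim a s h q))"
        by (metis norm_minus_cancel norm_triangle_ineq4)
      also have "\<dots> \<le> norm (f q - h q) + C * d"
        using C(2)[OF q, of "prim a s f q - prim a s h q"] mult_left_mono[OF pd[OF q] C(1)] by linarith
      finally have "M * norm (chart_cov c x a s h q - chart_cov c x a s f q) \<le> M * (norm (f q - h q) + C * d)"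
        using M(1) by (intro mult_left_mono) auto
      then show ?thesis using nM[OF q, of "chart_cov c x a s h q" "chart_cov c x a s f q"] by (simp add: distrib_left)
    qed
    have "integral {s..t} (\<lambda>q. chart_norm c x q (chart_cov c x a s h q)) \<le>
       integral {s..t} (\<lambda>q. chart_norm c x q (chart_cov c x a s f q) + (M * norm (f q - h q) + M * (C * d)))"
      by (rule integral_le[OF ni[OF h2] _ Ed]) (intro integrable_add ni[OF f] integrable_on_mult_right di integrable_const_ivl)
    also have "\<dots> = integral {s..t} (\<lambda>q. chart_norm c x q (chart_cov c x a s f q)) +
        (M * integral {s..t} (\<lambda>q. norm (f q - h q)) + (t - s) * (M * (C * d)))"
    proof -
      have 1: "(\<lambda>q. M * norm (f q - h q)) integrable_on {s..t}" by (rule integrable_on_mult_right[OF di])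
      have 2: "(\<lambda>q. M * (C * d)) integrable_on {s..t}" by (rule integrable_const_ivl)
      show ?thesis
        unfolding HK_integral_add[OF ni[OF f] integrable_add[OF 1 2]]
          HK_integral_add[OF 1 2] using c by simp
    qed
    also have "\<dots> \<le> integral {s..t} (\<lambda>q. chart_norm c x q (chart_cov c x a s f q)) + (M * d + 1 * (M * (C * d)))"
      using h(2) M(1) C(1) \<open>d > 0\<close> c by (intro add_mono mult_mono order_refl HK_integral_nonneg di) auto
    finally have I: "integral {s..t} (\<lambda>q. chart_norm c x q (chart_cov c x a s h q)) \<le>
       integral {s..t} (\<lambda>q. chart_norm c x q (chart_cov c x a s f q)) + (M * d + M * (C * d))" by simp
    have "chart_norm c x t (prim a s f t) \<le> chart_norm c x t (prim a s h t) + M * norm (prim a s f t - prim a s h t)"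
      by (rule nM) (use c in auto)
    also have "\<dots> \<le> chart_norm c x t (prim a s h t) + M * d"
      using pd[of t] c M(1) by (intro add_mono mult_left_mono) auto
    finally have "chart_norm c x t (prim a s f t) \<le> chart_norm c x s a +
       integral {s..t} (\<lambda>q. chart_norm c x q (chart_cov c x a s f q)) + (M * d + M * (C * d) + M * d)"
      using chart_norm_growth_continuous[OF x st r hc, of a] I by linarith
    moreover have "M * d + M * (C * d) + M * d = (M * (2 + C)) * d" by (simp add: algebra_simps)
    moreover have "(M * (2 + C)) * d = k"
      unfolding d_def by (simp only: times_divide_eq_right nonzero_mult_div_cancel_left[OF less_imp_neq[OF pC, symmetric]])
    ultimately show ?thesis by simp
  qed
  show ?thesis by (rule field_le_epsilon) (rule main)
qed

text \<open>Both sides are independent of the chart and the inequality is preserved by concatenation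
  of intervals, so \<open>bolzano_charts\<close> reduces it to \<open>chart_norm_growth\<close>. For
  \<open>Suc j = r\<close> the integrand matches its chart expression off a negligible set, which
  the integral does not see.\<close>

lemma tnorm_cov_velocity_growth:
  assumes x: "x \<in> Hk (Suc r)" and "j < r" and ab: "0 \<le> a" "a \<le> b" "b \<le> 1"
  shows "speed j x b \<le> speed j x a +
    integral {a..b} (\<lambda>q. speed (Suc j) x q)"
proof -
  note xc = Hk_curves_continuous[OF x]
  have xM: "x ` {0..1} \<subseteq> \<M>" using Hk_curves_carrier[OF x] by blast
  have Lf: "L2_field x (cvel (Suc j) x)" by (rule L2_field_cov_velocity[OF x]) (use \<open>j < r\<close> in simp)
  show ?thesis
  proof (rule bolzano_charts[OF xc xM ab])
    fix a b c :: real
    assume *: "0 \<le> a" "a \<le> b" "b \<le> c" "c \<le> 1"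
      "speed j x b \<le> speed j x a +
         integral {a..b} (\<lambda>q. speed (Suc j) x q)"
      "speed j x c \<le> speed j x b +
         integral {b..c} (\<lambda>q. speed (Suc j) x q)"
    have "(\<lambda>q. speed (Suc j) x q) integrable_on {a..c}"
      using L2_field_integrable[OF xc xM Lf, of a c] * by simp
    from HK_integral_combine[OF *(2,3) this] *(5,6)
    show "speed j x c \<le> speed j x a +
         integral {a..c} (\<lambda>q. speed (Suc j) x q)" by linarith
  next
    fix a :: real
    show "speed j x a \<le> speed j x a +
         integral {a..a} (\<lambda>q. speed (Suc j) x q)" by simp
  next
    fix c s t assume st: "chart_interval x c s t"
    have c: "c \<in> \<A>" "0 \<le> s" "s < t" "t \<le> 1" using st by (auto simp: chart_interval_def)
    obtain f N where f: "L2_on s t f" "\<And>q. q \<in> {s..t} \<Longrightarrow> cvel j x q c = cvel j x s c + integral {s..q} f"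
      "negligible N" "\<And>q. q \<in> {s..t} - N \<Longrightarrow> cvel (Suc j) x q c =
         f q + Chr c (chart_map c (x q)) (cvel 0 x q c) (cvel j x q c)"
      "\<And>q. q \<in> {s..t} - N \<Longrightarrow> cvel (Suc j) x q \<in> TM (x q)"
      using chart_primitive_Suc[OF x st \<open>j < r\<close>] by metis
    define a where "a = cvel j x s c"
    have p: "cvel j x q c = prim a s f q" if "q \<in> {s..t}" for q
      using f(2)[OF that] by (simp add: prim_def a_def)
    have dom: "x q \<in> chart_dom c" if "q \<in> {s..t}" for q using st that by (auto simp: chart_interval_def)
    have n: "speed j x q = chart_norm c x q (prim a s f q)" if q: "q \<in> {s..t}" for q
    proof -
      have "q \<in> {0..1}" using q c by auto
      from tnorm_eq_G[OF cov_velocity_tangent[OF x \<open>j < r\<close> this] c(1) dom[OF q]]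
      show ?thesis by (simp add: chart_norm_def p[OF q])
    qed
    have "integral {s..t} (\<lambda>q. speed (Suc j) x q) = integral {s..t} (\<lambda>q. chart_norm c x q (chart_cov c x a s f q))"
    proof (rule integral_spike[OF f(3)])
      fix q assume q: "q \<in> {s..t} - N"
      have q': "q \<in> {s..t}" using q by simp
      have "cvel (Suc j) x q c = chart_cov c x a s f q"
        using f(4)[OF q] p[OF q'] by (simp add: chart_cov_def)
      then show "chart_norm c x q (chart_cov c x a s f q) = speed (Suc j) x q"
        using tnorm_eq_G[OF f(5)[OF q] c(1) dom[OF q']] by (simp add: chart_norm_def)
    qed
    moreover have "prim a s f s = a" by (simp add: prim_def)
    moreover have "0 < r" using \<open>j < r\<close> by simp
    ultimately show "speed j x t \<le> speed j x s +
         integral {s..t} (\<lambda>q. speed (Suc j) x q)"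
      using chart_norm_growth[OF x st _ f(1), of a] n[of s] n[of t] c by simp
  qed
qed

lemma tnorm_nonneg: "X \<in> TM p \<Longrightarrow> p \<in> \<M> \<Longrightarrow> tnorm g p X \<ge> 0"
proof -
  assume *: "X \<in> TM p" "p \<in> \<M>"
  then obtain c where c: "c \<in> \<A>" "p \<in> chart_dom c" by (auto simp: carrier_def)
  show ?thesis unfolding tnorm_eq_G[OF *(1) c] using G_nonneg[OF c(1) chart_map_in[OF c(2)]] by simp
qed

lemma tnorm_sq_le:
  assumes "X \<in> TM p" "h \<in> TM p" "p \<in> \<M>"
  shows "(tnorm g p X)\<^sup>2 \<le> 2 * (tnorm g p (\<lambda>c. X c - h c))\<^sup>2 + 2 * (tnorm g p h)\<^sup>2"
proof -
  obtain c where c: "c \<in> \<A>" "p \<in> chart_dom c" using assms(3) by (auto simp: carrier_def)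
  have d: "(\<lambda>c. X c - h c) \<in> TM p"
    using tangent_space_add_scale[OF assms, of 1 "-1"] by simp
  have "tnorm g p X \<le> tnorm g p (\<lambda>c. X c - h c) + tnorm g p h"
    using G_norm_triangle[OF c(1) chart_map_in[OF c(2)], of "X c - h c" "h c"]
    by (simp add: tnorm_eq_G[OF assms(1) c] tnorm_eq_G[OF assms(2) c] tnorm_eq_G[OF d c])
  then have "(tnorm g p X)\<^sup>2 \<le> (tnorm g p (\<lambda>c. X c - h c) + tnorm g p h)\<^sup>2"
    using tnorm_nonneg[OF assms(1,3)] by (rule power_mono)
  also have "\<dots> \<le> 2 * (tnorm g p (\<lambda>c. X c - h c))\<^sup>2 + 2 * (tnorm g p h)\<^sup>2"
    using zero_le_power2[of "tnorm g p (\<lambda>c. X c - h c) - tnorm g p h"] by (simp add: power2_sum power2_diff)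
  finally show ?thesis .
qed

lemma L2_field_diff_smooth:
  assumes x: "continuous_on {0..1::real} x" and X: "L2_field x X" and A: "smooth_time_dependent_field \<A> A"
  shows "L2_field x (\<lambda>q c. X q c - A q (x q) c)"
  unfolding L2_field_def
proof (intro allI impI)
  fix c s t assume st: "chart_interval x c s t"
  have c: "c \<in> \<A>" "0 \<le> s" "s < t" "t \<le> 1" "x ` {s..t} \<subseteq> chart_dom c" using st by (auto simp: chart_interval_def)
  obtain h N where h: "L2_on s t h" "negligible N" "\<forall>q\<in>{s..t} - N. X q c = h q \<and> X q \<in> TM (x q)"
    using X st unfolding L2_field_def by blast
  let ?A = "\<lambda>(t, z). A t (chart_inv c z) c"
  let ?S = "{0..1::real} \<times> chart_img c"
  have sm: "smooth_on ?S ?A" using A c(1) unfolding smooth_time_dependent_field_def by blast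
  have AC: "continuous_on ?S ?A"
    unfolding continuous_on_eq_continuous_within
  proof
    fix p assume p: "p \<in> ?S"
    obtain U F where U: "open U" "p \<in> U" "\<forall>n. Cn_on n U F" "\<forall>y\<in>U \<inter> ?S. F y = ?A y"
      using bspec[OF sm[unfolded smooth_on_def] p] by blast
    have "continuous_on U F" using spec[OF U(3), of 0] by simp
    then have "isCont F p" using U(1,2) continuous_on_eq_continuous_at by blast
    then have F: "continuous (at p within ?S) F" by (rule continuous_at_imp_continuous_within)
    show "continuous (at p within ?S) ?A"
    proof (rule continuous_transform_within_openin[OF F, of "?S \<inter> U"])
      show "openin (top_of_set ?S) (?S \<inter> U)" using U(1) by (rule openin_open_Int)
    qed (use U p in auto)
  qed
  have "continuous_on {s..t} (\<lambda>q. (q, chart_map c (x q)))"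
    using chart_curve_continuous[OF x st] by (intro continuous_intros) (simp add: o_def)
  then have "continuous_on {s..t} (\<lambda>q. ?A (q, chart_map c (x q)))"
    by (rule continuous_on_compose2[OF AC]) (use c in \<open>auto intro!: chart_map_in\<close>)
  then have "continuous_on {s..t} (\<lambda>q. A q (x q) c)"
    by (rule continuous_on_eq) (use c chart_inv_map in \<open>force\<close>)
  then have "L2_on s t (\<lambda>q. - A q (x q) c)" by (intro L2_on_continuous continuous_on_minus)
  from L2_on_add[OF h(1) this]
  have 1: "L2_on s t (\<lambda>q. h q + - A q (x q) c)" .
  have "X q c - A q (x q) c = h q + - A q (x q) c \<and> (\<lambda>c. X q c - A q (x q) c) \<in> TM (x q)"
    if q: "q \<in> {s..t} - N" for q
  proof -
    have "q \<in> {0..1}" "x q \<in> chart_dom c" using q c by auto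
    then have xq: "x q \<in> \<M>" using c(1) by (auto simp: carrier_def)
    then have "A q (x q) \<in> TM (x q)"
      using A \<open>q \<in> {0..1}\<close> unfolding smooth_time_dependent_field_def by blast
    with h(3) q tangent_space_add_scale[OF _ _ xq, of "X q" "A q (x q)" 1 "-1"]
    show ?thesis by simp
  qed
  with 1 h(2) show "\<exists>h N. L2_on s t h \<and> negligible N \<and> (\<forall>q\<in>{s..t} - N. X q c - A q (x q) c = h q \<and> (\<lambda>c. X q c - A q (x q) c) \<in> TM (x q))"
    by blast
qed

end

section \<open>Uniform estimates on sublevel sets\<close>

lemma sqrt_modulus:
  assumes "0 < (e::real)"
  obtains d :: real where "0 < d" "\<And>u. 0 \<le> u \<Longrightarrow> u < d \<Longrightarrow> R * sqrt u < e"
proof -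
  have "isCont (\<lambda>u. R * sqrt u) 0" by (intro continuous_intros)
  then obtain d where d: "0 < d" "\<And>u. dist u 0 < d \<Longrightarrow> dist (R * sqrt u) (R * sqrt 0) < e"
    unfolding continuous_at_eps_delta using assms by blast
  show ?thesis
  proof (rule that[OF d(1)])
    fix u :: real assume "0 \<le> u" "u < d"
    then have "dist (R * sqrt u) (R * sqrt 0) < e" by (intro d(2)) simp
    then show "R * sqrt u < e" by (simp add: dist_real_def abs_less_iff)
  qed
qed

lemma integral_le_AE:
  fixes f h :: "real \<Rightarrow> real"
  assumes "f integrable_on S" "h integrable_on S" "negligible N" "\<And>x. x \<in> S - N \<Longrightarrow> f x \<le> h x"
  shows "integral S f \<le> integral S h"
proof -
  have "integral S f = integral S (\<lambda>x. if x \<in> N then h x else f x)"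
    by (rule integral_spike[OF assms(3)]) simp
  also have "\<dots> \<le> integral S h"
    by (rule integral_le[OF integrable_spike[OF assms(1,3)] assms(2)]) (use assms(4) in auto)
  finally show ?thesis .
qed

context riemannian
begin

text \<open>All that later arguments retain of the bound on \<open>J\<close>. Order \<open>r\<close>
  is controlled in integrated form only; the lower orders are controlled pointwise as well.\<close>

definition energy_bounded :: "nat \<Rightarrow> real \<Rightarrow> (real \<Rightarrow> 'a) set \<Rightarrow> bool" where
  "energy_bounded r R U \<longleftrightarrow> 0 \<le> R \<and> U \<subseteq> Hk (Suc r) \<and>
     (\<forall>x\<in>U. (\<forall>j\<le>r. \<forall>s t. 0 \<le> s \<longrightarrow> s \<le> t \<longrightarrow> t \<le> 1 \<longrightarrow>
          integral {s..t} (\<lambda>q. speed j x q) \<le> R * sqrt (t - s)) \<and>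
        (\<forall>j<r. \<forall>q\<in>{0..1}. speed j x q \<le> R))"

lemma cov_velocity_integrable:
  assumes "x \<in> Hk (Suc r)" "j \<le> r" "0 \<le> s" "s \<le> t" "t \<le> 1"
  shows "(\<lambda>q. speed j x q) integrable_on {s..t}"
    "(\<lambda>q. (speed j x q)\<^sup>2) integrable_on {s..t}"
    "negligible {q\<in>{s..t}. cvel j x q \<notin> TM (x q)}"
  using L2_field_integrable[OF Hk_curves_continuous[OF assms(1)] _ L2_field_cov_velocity[OF assms(1,2)] assms(3,4,5)]
    Hk_curves_carrier[OF assms(1)] by blast+

text \<open>The square of a norm is at most \<open>2\<close> times that of the difference plus
  \<open>2\<close> times that of the subtracted vector. The factor \<open>1/2\<close> in
  \<open>J\<close> turns the first \<open>2\<close> into \<open>4\<close>.\<close>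

lemma J_functional_bound:
  assumes x: "x \<in> Hk (Suc r)" and A: "smooth_time_dependent_field \<A> A"
    and B: "\<forall>t\<in>{0..1}. \<forall>p\<in>\<M>. tnorm g p (A t p) \<le> B"
  shows "integral {0..1} (\<lambda>q. (speed r x q)\<^sup>2) \<le> 4 * J_functional \<A> g A (Suc r) x + 2 * B\<^sup>2"
proof -
  let ?D = "\<lambda>q c. cvel r x q c - A q (x q) c"
  let ?h = "\<lambda>q. (tnorm g (x q) (?D q))\<^sup>2"
  note xc = Hk_curves_continuous[OF x]
  have xM: "x ` {0..1} \<subseteq> \<M>" using Hk_curves_carrier[OF x] by blast
  have hi: "?h integrable_on {0..1}"
    using L2_field_integrable[OF xc xM L2_field_diff_smooth[OF xc L2_field_cov_velocity[OF x order_refl] A], of 0 1] by simp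
  have "?h absolutely_integrable_on {0..1}"
    by (rule nonnegative_absolutely_integrable_1[OF hi]) simp
  then have "integrable (lebesgue_on {0..1}) ?h" by (simp add: absolutely_integrable_on_iff_integrable)
  then have "(\<integral>t. ?h t \<partial>lebesgue_on {0..1}) = integral {0..1} ?h"
    by (rule lebesgue_integral_eq_integral) simp
  then have J: "integral {0..1} ?h = 2 * J_functional \<A> g A (Suc r) x"
    unfolding J_functional_def by simp
  have ni: "(\<lambda>q. (speed r x q)\<^sup>2) integrable_on {0..1}"
    and neg: "negligible {q\<in>{0..1}. cvel r x q \<notin> TM (x q)}"
    using cov_velocity_integrable(2,3)[OF x order_refl, of 0 1] by simp_all
  have hi2: "(\<lambda>q. 2 * ?h q + 2 * B\<^sup>2) integrable_on {0..1}"
    by (intro integrable_add integrable_on_mult_right hi integrable_const_ivl)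
  have "integral {0..1} (\<lambda>q. (speed r x q)\<^sup>2) \<le> integral {0..1} (\<lambda>q. 2 * ?h q + 2 * B\<^sup>2)"
  proof (rule integral_le_AE[OF ni hi2 neg])
    fix q :: real assume q: "q \<in> {0..1} - {q\<in>{0..1}. cvel r x q \<notin> TM (x q)}"
    then have q1: "q \<in> {0..1}" "cvel r x q \<in> TM (x q)" by auto
    note xq = Hk_curves_carrier[OF x q1(1)]
    have At: "A q (x q) \<in> TM (x q)"
      using A q1(1) xq unfolding smooth_time_dependent_field_def by blast
    have "(tnorm g (x q) (A q (x q)))\<^sup>2 \<le> B\<^sup>2"
      by (rule power_mono[OF _ tnorm_nonneg[OF At xq]]) (use B q1(1) xq in blast)
    with tnorm_sq_le[OF q1(2) At xq]
    show "(speed r x q)\<^sup>2 \<le> 2 * ?h q + 2 * B\<^sup>2" by linarith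
  qed
  also have "\<dots> = 2 * integral {0..1} ?h + 2 * B\<^sup>2"
    by (subst HK_integral_add) (auto intro!: integrable_on_mult_right hi)
  finally show ?thesis using J by simp
qed

lemma energy_bounded_sublevel:
  assumes U: "U \<subseteq> Hk_curves_between \<A> g (Suc r) v w" and J: "bounded (J_functional \<A> g A (Suc r) ` U)"
    and A: "smooth_time_dependent_field \<A> A" and B: "\<forall>t\<in>{0..1}. \<forall>p\<in>\<M>. tnorm g p (A t p) \<le> B"
  shows "\<exists>R. energy_bounded r R U"
proof -
  let ?N = "\<lambda>j x q. speed j x q"
  define E where "E j \<longleftrightarrow> (\<exists>R. \<forall>x\<in>U. integral {0..1} (\<lambda>q. (?N j x q)\<^sup>2) \<le> R)" for j
  have UH: "x \<in> Hk (Suc r)" if "x \<in> U" for x using U that unfolding Hk_curves_between_def by blast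
  have int_sqrt: "integral {s..t} (?N j x) \<le> (1 + R) * sqrt (t - s)"
    if x: "x \<in> U" and j: "j \<le> r" and st: "0 \<le> s" "s \<le> t" "t \<le> 1" and R: "integral {0..1} (\<lambda>q. (?N j x q)\<^sup>2) \<le> R" for j x s t R
  proof -
    note I = cov_velocity_integrable[OF UH[OF x] j]
    have "integral {s..t} (\<lambda>q. (?N j x q)\<^sup>2) \<le> integral {0..1} (\<lambda>q. (?N j x q)\<^sup>2)"
      by (rule integral_subset_le) (use I(2)[of 0 1] I(2)[OF st] st in auto)
    then show ?thesis using integral_le_sqrt[OF st(2) I(1)[OF st] I(2)[OF st]] R by simp
  qed
  have sup: "\<exists>C. \<forall>x\<in>U. \<forall>q\<in>{0..1}. ?N j x q \<le> C" if j: "j < r" and E: "E (Suc j)" for j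
  proof -
    obtain R where R: "\<forall>x\<in>U. integral {0..1} (\<lambda>q. (?N (Suc j) x q)\<^sup>2) \<le> R" using E E_def by blast
    \<comment> \<open>The norm at time 0 is that of the vector with index \<open>j\<close> in the
      list of \<open>v\<close>, hence the same for all curves; \<open>j < r\<close> ensures that the
      list reaches that far.\<close>
    have "?N j x q \<le> tnorm g (fst v) (snd v ! j) + (1 + \<bar>R\<bar>)" if x: "x \<in> U" and q: "q \<in> {0..1}" for x q
    proof -
      have "boundary_value \<A> g (Suc r) x 0 = v" using U x unfolding Hk_curves_between_def by blast
      then have v: "fst v = x 0" "snd v ! j = cvel j x 0" using j by (auto simp: boundary_value_def)
      have "?N j x q \<le> ?N j x 0 + integral {0..q} (?N (Suc j) x)"
        by (rule tnorm_cov_velocity_growth[OF UH[OF x] j]) (use q in auto)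
      also have "integral {0..q} (?N (Suc j) x) \<le> (1 + \<bar>R\<bar>) * sqrt (q - 0)"
        by (rule int_sqrt[OF x]) (use q j R x in auto)
      also have "\<dots> \<le> (1 + \<bar>R\<bar>) * 1" by (intro mult_left_mono) (use q in auto)
      finally show ?thesis by (simp add: v)
    qed
    then show ?thesis by blast
  qed
  \<comment> \<open>Descending induction from \<open>j = r\<close>, where the bound on
    \<open>J\<close> is used: an L2 bound at order \<open>j + 1\<close> gives a pointwise bound at
    order \<open>j\<close>, which in turn gives an L2 bound there.\<close>
  have Er: "E j" if "j \<le> r" for j
    using that
  proof (induction rule: inc_induct)
    case base
    obtain K where K: "\<forall>x\<in>U. norm (J_functional \<A> g A (Suc r) x) \<le> K"
      using J unfolding bounded_iff by blast
    have "integral {0..1} (\<lambda>q. (?N r x q)\<^sup>2) \<le> 4 * K + 2 * B\<^sup>2" if "x \<in> U" for x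
      using J_functional_bound[OF UH[OF that] A B] bspec[OF K that] by (simp add: abs_le_iff)
    then show ?case unfolding E_def by blast
  next
    case (step n)
    obtain C where C: "\<forall>x\<in>U. \<forall>q\<in>{0..1}. ?N n x q \<le> C" using sup[OF step(2) step(3)] by blast
    have "integral {0..1} (\<lambda>q. (?N n x q)\<^sup>2) \<le> C\<^sup>2" if x: "x \<in> U" for x
    proof -
      have "integral {0..1} (\<lambda>q. (?N n x q)\<^sup>2) \<le> integral {0..1} (\<lambda>q::real. C\<^sup>2)"
      proof (rule integral_le)
        show "(\<lambda>q. (?N n x q)\<^sup>2) integrable_on {0..1}"
          by (rule cov_velocity_integrable(2)[OF UH[OF x]]) (use step(2) in auto)
        fix q :: real assume q: "q \<in> {0..1}"
        show "(?N n x q)\<^sup>2 \<le> C\<^sup>2"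
          by (rule power_mono[OF _ tnorm_nonneg[OF cov_velocity_tangent[OF UH[OF x] step(2) q] Hk_curves_carrier[OF UH[OF x] q]]])
            (use C x q in blast)
      qed auto
      then show ?thesis by simp
    qed
    then show ?case unfolding E_def by blast
  qed
  obtain R1 where R1: "\<And>j x. j \<le> r \<Longrightarrow> x \<in> U \<Longrightarrow> integral {0..1} (\<lambda>q. (?N j x q)\<^sup>2) \<le> R1 j"
    using choice[of "\<lambda>j R. j \<le> r \<longrightarrow> (\<forall>x\<in>U. integral {0..1} (\<lambda>q. (?N j x q)\<^sup>2) \<le> R)"] Er unfolding E_def by blast
  have "\<exists>C. \<forall>x\<in>U. \<forall>q\<in>{0..1}. ?N j x q \<le> C" if "j < r" for j using sup[OF that Er] that by simp
  then obtain R2 where R2: "\<And>j x q. j < r \<Longrightarrow> x \<in> U \<Longrightarrow> q \<in> {0..1} \<Longrightarrow> ?N j x q \<le> R2 j" by metis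
  define R where "R = 1 + (\<Sum>j\<le>r. \<bar>R1 j\<bar>) + (\<Sum>j\<le>r. \<bar>R2 j\<bar>)"
  have R: "1 + R1 j \<le> R" "R2 j \<le> R" if "j \<le> r" for j
  proof -
    have "\<bar>R1 j\<bar> \<le> (\<Sum>j\<le>r. \<bar>R1 j\<bar>)" "\<bar>R2 j\<bar> \<le> (\<Sum>j\<le>r. \<bar>R2 j\<bar>)" using that by (auto intro!: member_le_sum)
    then show "1 + R1 j \<le> R" "R2 j \<le> R" unfolding R_def by linarith+
  qed
  have "energy_bounded r R U"
    unfolding energy_bounded_def
  proof (intro conjI ballI allI impI)
    show "0 \<le> R" unfolding R_def by (intro add_nonneg_nonneg sum_nonneg) auto
    show "U \<subseteq> Hk (Suc r)" using UH by blast
    fix x j assume x: "x \<in> U"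
    show "integral {s..t} (?N j x) \<le> R * sqrt (t - s)" if "j \<le> r" "0 \<le> s" "s \<le> t" "t \<le> 1" for s t
    proof -
      have "integral {s..t} (?N j x) \<le> (1 + R1 j) * sqrt (t - s)" by (rule int_sqrt[OF x that R1[OF that(1) x]])
      also have "\<dots> \<le> R * sqrt (t - s)" by (intro mult_right_mono R(1) that(1)) (use that in simp)
      finally show ?thesis .
    qed
    show "?N j x q \<le> R" if "j < r" "q \<in> {0..1}" for q
      using R2[OF that(1) x that(2)] R(2)[of j] that(1) by linarith
  qed
  then show ?thesis by blast
qed

lemma cov_velocity_has_vector_derivative:
  assumes x: "x \<in> Hk (Suc r)" and st: "chart_interval x c s t" and q: "q \<in> {s..t}"
  shows "0 < r \<Longrightarrow> (chart_map c \<circ> x has_vector_derivative cvel 0 x q c) (at q within {s..t})"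
    "Suc j < r \<Longrightarrow> ((\<lambda>q. cvel j x q c) has_vector_derivative
       cvel (Suc j) x q c - Chr c (chart_map c (x q)) (cvel 0 x q c) (cvel j x q c))
       (at q within {s..t})"
proof -
  have c: "c \<in> \<A>" "q \<in> {0..1}" "x q \<in> chart_dom c" "{s..t} \<subseteq> {0..1}" using st q by (auto simp: chart_interval_def)
  show "(chart_map c \<circ> x has_vector_derivative cvel 0 x q c) (at q within {s..t})" if "0 < r"
    by (rule has_vector_derivative_within_subset[OF chart_curve_has_vector_derivative[OF x that c(1,2,3)] c(4)])
  assume j: "Suc j < r"
  obtain X where X: "((\<lambda>s. cvel j x s c) has_vector_derivative X) (at q within {0..1})"
    using cov_velocity_differentiable[OF x j c(1,2,3)] by blast
  have "X = cvel (Suc j) x q c - Chr c (chart_map c (x q)) (cvel 0 x q c) (cvel j x q c)"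
    using curve_deriv_01[OF X c(2)] chart_interval_charts_at[OF st q] by (simp add: cov_velocity_Suc)
  then show "((\<lambda>q. cvel j x q c) has_vector_derivative
       cvel (Suc j) x q c - Chr c (chart_map c (x q)) (cvel 0 x q c) (cvel j x q c))
       (at q within {s..t})"
    using has_vector_derivative_within_subset[OF X c(4)] by simp
qed

lemma sqrt_modulus_symmetric:
  fixes h :: "real \<Rightarrow> 'c::real_normed_vector"
  assumes "\<And>s t. s \<in> S \<Longrightarrow> t \<in> S \<Longrightarrow> s < t \<Longrightarrow> norm (h t - h s) \<le> C * sqrt (t - s)" "s \<in> S" "t \<in> S"
  shows "norm (h t - h s) \<le> C * sqrt \<bar>t - s\<bar>"
  using assms(1)[of s t] assms(1)[of t s] assms(2,3)
  by (cases s t rule: linorder_cases) (auto simp: norm_minus_commute)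

text \<open>The family is indexed by all triples of a curve of \<open>U\<close> and the end points
  of a chart interval mapped into \<open>K\<close>, so each \<open>UH\<close> statement has one
  constant for everything. Integrated bounds give Hoelder estimates for the coordinates of
  \<open>x\<close> and of its covariant derivatives; the relation between consecutive covariant
  derivatives then raises the regularity step by step.\<close>

lemma chart_curves_uniform_Hol:
  assumes U: "energy_bounded r R U" and c: "c \<in> \<A>" and K: "compact K" "K \<subseteq> chart_img c"
  obtains B where "\<And>x s t. x \<in> U \<Longrightarrow> chart_interval x c s t \<Longrightarrow> (crd c x) ` {s..t} \<subseteq> K \<Longrightarrow> Hol r B s t (crd c x)"
proof -
  let ?N = "\<lambda>j x q. speed j x q"
  define I where "I = {(x, s, t). x \<in> U \<and> chart_interval x c s t \<and> (crd c x) ` {s..t} \<subseteq> K}"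
  define a where "a k = fst (snd k)" for k :: "(real \<Rightarrow> 'a) \<times> real \<times> real"
  define b where "b k = snd (snd k)" for k :: "(real \<Rightarrow> 'a) \<times> real \<times> real"
  have fam: "interval_family I a b"
    by unfold_locales (auto simp: I_def a_def b_def dest: chart_interval_le)
  interpret F: interval_family I a b by (rule fam)
  define f where "f k = chart_map c \<circ> fst k" for k :: "(real \<Rightarrow> 'a) \<times> real \<times> real"
  define y where "y j k q = cvel j (fst k) q c" for j and k :: "(real \<Rightarrow> 'a) \<times> real \<times> real" and q
  have I: "fst k \<in> U" "fst k \<in> Hk (Suc r)" "chart_interval (fst k) c (a k) (b k)"
     "\<And>q. q \<in> {a k..b k} \<Longrightarrow> f k q \<in> K" if "k \<in> I" for k
    using that U by (auto simp: I_def a_def b_def f_def energy_bounded_def)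
  have J: "q \<in> {0..1}" "fst k q \<in> chart_dom c" if "k \<in> I" "q \<in> {a k..b k}" for k q
    using I(3)[OF that(1)] that(2) by (auto simp: chart_interval_def)
  have R0: "0 \<le> R" using U by (simp add: energy_bounded_def)
  have RI: "integral {s..t} (?N j x) \<le> R * sqrt (t - s)" if "x \<in> U" "j \<le> r" "0 \<le> s" "s \<le> t" "t \<le> 1" for j x s t
    using U that unfolding energy_bounded_def by blast
  have RN: "?N j x q \<le> R" if "x \<in> U" "j < r" "q \<in> {0..1}" for j x q using U that unfolding energy_bounded_def by blast
  obtain m where m: "0 < m" "\<And>z u. z \<in> K \<Longrightarrow> m * norm u \<le> sqrt (G c z u u)"
    using G_norm_bounds[OF c K] by metis
  obtain D where D: "0 \<le> D" "\<And>z u v. z \<in> K \<Longrightarrow> norm (Chr c z u v) \<le> D * norm u * norm v"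
    using levi_civita_bound_compact[OF c K] by blast
  have mN: "norm (y j k q) \<le> ?N j (fst k) q / m"
    if k: "k \<in> I" and q: "q \<in> {a k..b k}" and T: "cvel j (fst k) q \<in> TM (fst k q)" for j k q
    using m(2)[OF I(4)[OF k q], of "y j k q"] m(1) tnorm_eq_G[OF T c J(2)[OF k q]]
    by (simp add: f_def y_def field_simps)
  have yb: "norm (y j k q) \<le> R / m" if k: "k \<in> I" and q: "q \<in> {a k..b k}" and j: "j < r" for j k q
  proof -
    have "norm (y j k q) \<le> ?N j (fst k) q / m"
      by (rule mN[OF k q cov_velocity_tangent[OF I(2)[OF k] j J(1)[OF k q]]])
    also have "\<dots> \<le> R / m" by (intro divide_right_mono RN[OF I(1)[OF k] j J(1)[OF k q]]) (use m(1) in simp)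
    finally show ?thesis .
  qed
  have sub: "chart_interval (fst k) c s t" "0 \<le> s" "t \<le> 1" if "k \<in> I" "s \<in> {a k..b k}" "t \<in> {a k..b k}" "s < t" for k s t
    using I(3)[OF that(1)] that(2-4) by (fastforce simp: chart_interval_def)+
  \<comment> \<open>One estimate for two uses: \<open>E\<close> is 0 for the curve itself and a
    bound on the Christoffel term for a covariant derivative. Division by \<open>m\<close> passes
    from the Riemannian to the Euclidean norm.\<close>
  have prim_bound: "norm (integral {s..t} p) \<le> (R / m + E) * sqrt (t - s)"
    if k: "k \<in> I" and st: "s \<in> {a k..b k}" "t \<in> {a k..b k}" "s < t" and j: "j \<le> r" and p: "L2_on s t p" and N: "negligible N"
      and E: "0 \<le> E" "\<And>q. q \<in> {s..t} - N \<Longrightarrow> norm (p q) \<le> norm (y j k q) + E"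
      and T: "\<And>q. q \<in> {s..t} - N \<Longrightarrow> cvel j (fst k) q \<in> TM (fst k q)" for k s t j p N E
  proof -
    note s = sub[OF k st]
    have Ni: "(\<lambda>q. ?N j (fst k) q / m + E) integrable_on {s..t}"
      by (intro integrable_add integrable_on_divide integrable_const_ivl
         cov_velocity_integrable(1)[OF I(2)[OF k] j s(2) less_imp_le[OF st(3)] s(3)])
    have "norm (integral {s..t} p) \<le> integral {s..t} (\<lambda>q. norm (p q))"
      by (rule integral_norm_bound_integral) (use L2_on_integrable_on[OF p] in auto)
    also have "\<dots> \<le> integral {s..t} (\<lambda>q. ?N j (fst k) q / m + E)"
    proof (rule integral_le_AE[OF L2_on_integrable_on(2)[OF p] Ni N])
      fix q assume q: "q \<in> {s..t} - N"
      then have "q \<in> {a k..b k}" using st by auto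
      from mN[OF k this T[OF q]] E(2)[OF q] show "norm (p q) \<le> ?N j (fst k) q / m + E" by linarith
    qed
    also have "\<dots> = integral {s..t} (?N j (fst k)) / m + (t - s) * E"
      using st by (subst HK_integral_add)
        (auto intro!: integrable_on_divide cov_velocity_integrable(1)[OF I(2)[OF k] j s(2) less_imp_le[OF st(3)] s(3)])
    also have "\<dots> \<le> R * sqrt (t - s) / m + sqrt (t - s) * E"
    proof (intro add_mono divide_right_mono mult_right_mono)
      show "integral {s..t} (?N j (fst k)) \<le> R * sqrt (t - s)"
        using RI[OF I(1)[OF k] j s(2) less_imp_le[OF st(3)] s(3)] .
      have "(t - s)\<^sup>2 \<le> t - s" unfolding power2_eq_square by (rule mult_left_le) (use s st in auto)
      then show "t - s \<le> sqrt (t - s)" by (rule real_le_rsqrt)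
    qed (use m E in auto)
    also have "\<dots> = (R / m + E) * sqrt (t - s)" by (simp add: algebra_simps)
    finally show ?thesis .
  qed
  have f0: "F.UH 0 f"
  proof (rule F.UH_0I[of _ "R / m"])
    obtain M where M: "\<forall>z\<in>K. norm z \<le> M" using compact_imp_bounded[OF K(1)] bounded_iff by blast
    then show "F.ubounded f" unfolding F.ubounded_def using I(4) by blast
    fix k s t assume k: "k \<in> I" and s: "s \<in> {a k..b k}" and t: "t \<in> {a k..b k}"
    show "norm (f k t - f k s) \<le> R / m * sqrt \<bar>t - s\<bar>"
    proof (rule sqrt_modulus_symmetric[OF _ s t])
      fix s t assume st: "s \<in> {a k..b k}" "t \<in> {a k..b k}" "s < t"
      obtain p N where p: "L2_on s t p" "\<And>q. q \<in> {s..t} \<Longrightarrow> chart_map c (fst k q) = chart_map c (fst k s) + integral {s..q} p"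
        "negligible N" "\<And>q. q \<in> {s..t} - N \<Longrightarrow> cvel 0 (fst k) q c = p q"
        "\<And>q. q \<in> {s..t} - N \<Longrightarrow> cvel 0 (fst k) q \<in> TM (fst k q)"
        using chart_primitive_0[OF I(2)[OF k] sub(1)[OF k st]] by metis
      have "f k t - f k s = integral {s..t} p" using p(2)[of t] st by (simp add: f_def)
      moreover have "norm (integral {s..t} p) \<le> (R / m + 0) * sqrt (t - s)"
        by (rule prim_bound[OF k st le0 p(1,3) order_refl _ p(5)]) (use p(4) in \<open>auto simp: y_def\<close>)
      ultimately show "norm (f k t - f k s) \<le> R / m * sqrt (t - s)" by simp
    qed
  qed
  have y0: "F.UH 0 (y j)" if j: "j < r" for j
  proof (rule F.UH_0I[of _ "R / m + D * (R / m) * (R / m)"])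
    show "F.ubounded (y j)" unfolding F.ubounded_def using yb[OF _ _ j] by blast
    fix k s t assume k: "k \<in> I" and s: "s \<in> {a k..b k}" and t: "t \<in> {a k..b k}"
    show "norm (y j k t - y j k s) \<le> (R / m + D * (R / m) * (R / m)) * sqrt \<bar>t - s\<bar>"
    proof (rule sqrt_modulus_symmetric[OF _ s t])
      fix s t assume st: "s \<in> {a k..b k}" "t \<in> {a k..b k}" "s < t"
      obtain p N where p: "L2_on s t p" "\<And>q. q \<in> {s..t} \<Longrightarrow> cvel j (fst k) q c = cvel j (fst k) s c + integral {s..q} p"
        "negligible N" "\<And>q. q \<in> {s..t} - N \<Longrightarrow> cvel (Suc j) (fst k) q c =
           p q + Chr c (chart_map c (fst k q)) (cvel 0 (fst k) q c) (cvel j (fst k) q c)"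
        "\<And>q. q \<in> {s..t} - N \<Longrightarrow> cvel (Suc j) (fst k) q \<in> TM (fst k q)"
        using chart_primitive_Suc[OF I(2)[OF k] sub(1)[OF k st] j] by metis
      have b: "norm (p q) \<le> norm (y (Suc j) k q) + D * (R / m) * (R / m)" if q: "q \<in> {s..t} - N" for q
      proof -
        have q': "q \<in> {a k..b k}" using st q by auto
        have "p q = y (Suc j) k q - Chr c (f k q) (y 0 k q) (y j k q)"
          using p(4)[OF q] by (simp add: y_def f_def)
        then have "norm (p q) \<le> norm (y (Suc j) k q) + norm (Chr c (f k q) (y 0 k q) (y j k q))"
          using norm_triangle_ineq4 by metis
        also have "norm (Chr c (f k q) (y 0 k q) (y j k q)) \<le> D * norm (y 0 k q) * norm (y j k q)"
          by (rule D(2)[OF I(4)[OF k q']])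
        also have "\<dots> \<le> D * (R / m) * (R / m)"
          by (intro mult_mono mult_left_mono yb[OF k q']) (use j D R0 m in auto)
        finally show ?thesis by simp
      qed
      have "y j k t - y j k s = integral {s..t} p" using p(2)[of t] st by (simp add: y_def)
      moreover have "norm (integral {s..t} p) \<le> (R / m + D * (R / m) * (R / m)) * sqrt (t - s)"
        by (rule prim_bound[OF k st _ p(1,3) _ b p(5)]) (use j D R0 m in auto)
      ultimately show "norm (y j k t - y j k s) \<le> (R / m + D * (R / m) * (R / m)) * sqrt (t - s)" by simp
    qed
  qed
  have fd: "F.UH (Suc n) f" if "F.UH n (y 0)" "0 < r" for n
    by (rule F.UH_SucI[OF F.UH_ubounded[OF f0] _ that(1)])
      (use cov_velocity_has_vector_derivative(1)[OF I(2,3)] that(2) in \<open>simp add: f_def y_def\<close>)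
  \<comment> \<open>In coordinates, \<open>y j\<close> has derivative \<open>y (Suc j)\<close> minus
    a Christoffel term in \<open>y 0\<close> and \<open>y j\<close>. One more order for
    \<open>y j\<close> thus costs one more covariant derivative, which is why
    \<open>j + n < r\<close> is the range.\<close>
  have yn: "\<forall>j. j + n < r \<longrightarrow> F.UH n (y j)" for n
  proof (induction n)
    case 0
    then show ?case using y0 by simp
  next
    case (Suc n)
    show ?case
    proof (intro allI impI)
      fix j assume j: "j + Suc n < r"
      have 1: "F.UH n (y 0)" "F.UH n (y j)" "F.UH n (y (Suc j))" using Suc j by auto
      have "F.UH n f" using F.UH_Suc_imp[OF fd[OF 1(1)]] j by simp
      from F.UH_diff[OF 1(3) UH_levi_civita[OF fam c K I(4) this 1(1,2)]]
      have 2: "F.UH n (\<lambda>k q. y (Suc j) k q - Chr c (f k q) (y 0 k q) (y j k q))" .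
      show "F.UH (Suc n) (y j)"
      proof (rule F.UH_SucI[OF F.UH_ubounded[OF 1(2)] _ 2])
        fix k q assume "k \<in> I" "q \<in> {a k..b k}"
        from cov_velocity_has_vector_derivative(2)[OF I(2,3)[OF this(1)] this(2), of j] j
        show "(y j k has_vector_derivative y (Suc j) k q - Chr c (f k q) (y 0 k q) (y j k q)) (at q within {a k..b k})"
          by (simp add: y_def[abs_def] f_def)
      qed
    qed
  qed
  have "F.UH r f"
  proof (cases r)
    case (Suc n)
    then show ?thesis using fd[of n] yn[of n] by simp
  qed (use f0 in simp)
  then obtain B where B: "\<forall>k\<in>I. Hol r B (a k) (b k) (f k)" unfolding F.UH_def by blast
  show ?thesis
  proof (rule that[of B])
    fix x s t assume "x \<in> U" "chart_interval x c s t" "(crd c x) ` {s..t} \<subseteq> K"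
    then have "(x, s, t) \<in> I" by (simp add: I_def)
    from bspec[OF B this] show "Hol r B s t (crd c x)" by (simp add: a_def b_def f_def)
  qed
qed

end

section \<open>Riemannian distance\<close>

text \<open>The converse passage, from primitives to weak derivatives. It lets the piecewise C1
  competitors in \<open>riemannian_dist\<close> be treated as curves of class H1.\<close>

lemma Hreg_0_imp_sobolev_on:
  fixes f :: "real \<Rightarrow> 'b::euclidean_space"
  assumes "Hreg 0 a b f" and ab: "a < b"
  shows "sobolev_on (Suc 0) a b f"
proof -
  obtain f' where f': "L2_on a b f'" "\<And>t. t \<in> {a..b} \<Longrightarrow> f t = f a + integral {a..t} f'"
    using assms(1) unfolding Hreg.simps by blast
  have fc: "continuous_on {a..b} f" by (rule Hreg_continuous_on[OF assms(1)])
  have f'a: "f' absolutely_integrable_on {a..b}" by (rule L2_on_absolutely_integrable[OF f'(1)])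
  have "(\<integral>t. deriv p t *\<^sub>R f t \<partial>lebesgue_on {a..b}) = - (\<integral>t. p t *\<^sub>R f' t \<partial>lebesgue_on {a..b})"
    if p: "test_function a b p" for p
  proof -
    define D where "D = deriv p"
    then have dD: "deriv p = D" by simp
    note dp = test_function_facts(1)[OF p, of _ "{a..b}", unfolded dD]
      and Dc = test_function_facts(2)[OF p, of "{a..b}", unfolded dD]
      and pc = test_function_facts(3)[OF p, of "{a..b}"]
    have za: "p a = 0" "p b = 0" by (rule test_function_facts(4)[OF p], simp)+
    have "(D has_integral (p b - p a)) {a..b}"
      by (rule fundamental_theorem_of_calculus) (use dp ab in \<open>auto simp: has_real_derivative_iff_has_vector_derivative\<close>)
    then have 0: "((\<lambda>t. D t *\<^sub>R f a) has_integral 0) {a..b}"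
      using has_integral_scaleR_left[of D 0 "{a..b}" "f a"] za by simp
    have i: "(\<lambda>t. D t *\<^sub>R integral {a..t} f') integrable_on {a..b}"
      by (intro integrable_continuous_real continuous_intros Dc indefinite_integral_continuous_1 L2_on_integrable_on(1)[OF f'(1)])
    have "integral {a..b} (\<lambda>t. D t *\<^sub>R f t) = integral {a..b} (\<lambda>t. D t *\<^sub>R f a + D t *\<^sub>R integral {a..t} f')"
    proof (rule HK_integral_cong)
      fix t assume "t \<in> {a..b}"
      then show "D t *\<^sub>R f t = D t *\<^sub>R f a + D t *\<^sub>R integral {a..t} f'"
        using f'(2) by (metis scaleR_right_distrib)
    qed
    also have "\<dots> = 0 + integral {a..b} (\<lambda>t. D t *\<^sub>R integral {a..t} f')"
      by (rule integral_unique[OF has_integral_add[OF 0 integrable_integral[OF i]]])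
    finally have 1: "integral {a..b} (\<lambda>t. D t *\<^sub>R f t) = integral {a..b} (\<lambda>t. D t *\<^sub>R integral {a..t} f')" by simp
    have 2: "integral {a..b} (\<lambda>t. D t *\<^sub>R integral {a..t} f') = - integral {a..b} (\<lambda>t. p t *\<^sub>R f' t)"
      using integral_by_parts_primitive[OF less_imp_le[OF ab] f'a dp Dc] za by simp
    have fa: "f absolutely_integrable_on {a..b}" by (rule absolutely_integrable_continuous_real[OF fc])
    show ?thesis unfolding dD using 1 2 continuous_scaleR_absolutely_integrable[OF Dc fa]
        continuous_scaleR_absolutely_integrable[OF pc f'a]
      by (simp add: absolutely_integrable_on_iff_integrable lebesgue_integral_eq_integral)
  qed
  then have "weak_deriv_on a b f f'" unfolding weak_deriv_on_def by blast
  then show ?thesis using L2_on_continuous[OF fc] f'(1) by auto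
qed

lemma L2_on_iff_absolutely_integrable:
  fixes f :: "real \<Rightarrow> 'b::euclidean_space"
  shows "L2_on a b f \<longleftrightarrow> f absolutely_integrable_on {a..b} \<and> (\<lambda>t. (norm (f t))\<^sup>2) absolutely_integrable_on {a..b}"
proof
  assume "L2_on a b f"
  then show "f absolutely_integrable_on {a..b} \<and> (\<lambda>t. (norm (f t))\<^sup>2) absolutely_integrable_on {a..b}"
    using L2_on_absolutely_integrable[of a b f] by (auto simp: L2_on_def absolutely_integrable_on_iff_integrable)
next
  assume "f absolutely_integrable_on {a..b} \<and> (\<lambda>t. (norm (f t))\<^sup>2) absolutely_integrable_on {a..b}"
  then show "L2_on a b f"
    by (auto simp: L2_on_def absolutely_integrable_on_iff_integrable)
qed

lemma L2_on_combine:
  fixes f h :: "real \<Rightarrow> 'b::euclidean_space"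
  assumes "L2_on a b f" "L2_on b c h" "a \<le> b" "b \<le> c"
  shows "L2_on a c (\<lambda>t. if t \<le> b then f t else h t)"
proof -
  let ?k = "\<lambda>t. if t \<le> b then f t else h t"
  have U: "{a..c} = {a..b} \<union> {b..c}" using assms by auto
  have cmb: "k absolutely_integrable_on {a..c}" if "p absolutely_integrable_on {a..b}" "q absolutely_integrable_on {b..c}"
     "\<And>t. t \<le> b \<Longrightarrow> k t = p t" "\<And>t. b < t \<Longrightarrow> k t = q t" for k p q :: "real \<Rightarrow> 'd::euclidean_space"
    unfolding U
  proof (rule set_integrable_Un)
    show "k absolutely_integrable_on {a..b}" using that(1) by (rule absolutely_integrable_spike[where S="{}"]) (use that(3) in auto)
    show "k absolutely_integrable_on {b..c}" using that(2)
      by (rule absolutely_integrable_spike[where S="{b}"]) (use that(4) in auto)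
  qed auto
  show ?thesis using assms(1,2) unfolding L2_on_iff_absolutely_integrable
    by (intro conjI cmb[of f h] cmb[of "\<lambda>t. (norm (f t))\<^sup>2" "\<lambda>t. (norm (h t))\<^sup>2"]) auto
qed

lemma Hreg_0_combine:
  fixes f :: "real \<Rightarrow> 'b::euclidean_space"
  assumes "Hreg 0 a b f" "Hreg 0 b c f" "a \<le> b" "b \<le> c"
  shows "Hreg 0 a c f"
proof -
  obtain p where p: "L2_on a b p" "\<And>t. t \<in> {a..b} \<Longrightarrow> f t = f a + integral {a..t} p" using assms(1) unfolding Hreg.simps by blast
  obtain h where h: "L2_on b c h" "\<And>t. t \<in> {b..c} \<Longrightarrow> f t = f b + integral {b..t} h" using assms(2) unfolding Hreg.simps by blast
  let ?k = "\<lambda>t. if t \<le> b then p t else h t"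
  note k = L2_on_combine[OF p(1) h(1) assms(3,4)]
  have 1: "integral {a..t} ?k = integral {a..t} p" if "t \<le> b" for t
    by (rule HK_integral_cong) (use that in auto)
  have 2: "integral {b..t} ?k = integral {b..t} h" for t
    by (rule integral_spike[of "{b}"]) auto
  have "f t = f a + integral {a..t} ?k" if t: "t \<in> {a..c}" for t
  proof (cases "t \<le> b")
    case True then show ?thesis using 1[OF True] p(2)[of t] t by auto
  next
    case False
    have "?k integrable_on {a..t}"
      using integrable_subinterval_real[OF L2_on_integrable_on(1)[OF k]] t by auto
    then have "integral {a..t} ?k = integral {a..b} ?k + integral {b..t} ?k"
      using HK_integral_combine[of a b t ?k] False assms by simp
    then show ?thesis using 1[of b] 2[of t] p(2)[of b] h(2)[of t] False t assms by simp
  qed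
  then show ?thesis using k unfolding Hreg.simps by blast
qed

context riemannian
begin

lemma Cr_curve_on_Hreg_0:
  assumes "Cr_curve_on \<A> 1 a b x" "c \<in> \<A>" "a \<le> s" "s < t" "t \<le> b" "x ` {s..t} \<subseteq> chart_dom c"
  shows "Hreg 0 s t (crd c x)"
proof (rule C1_imp_Hreg_0)
  have *: "Cr_vec_curve (Suc 0) {s..t} (crd c x)" using assms unfolding Cr_curve_on_def One_nat_def by blast
  show "\<forall>q\<in>{s..t}. (chart_map c \<circ> x has_vector_derivative curve_deriv {s..t} (crd c x) q) (at q within {s..t})"
    using * unfolding Cr_vec_curve.simps curve_deriv_def by (simp add: vector_derivative_works)
  show "continuous_on {s..t} (curve_deriv {s..t} (crd c x))" using * by simp
qed

text \<open>Primitives of square integrable functions can be joined at a break point although the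
  velocity may jump there. All estimates for H1 curves thereby become available for the curves whose
  lengths define the distance.\<close>

lemma piecewise_C1_curve_Hk:
  assumes "piecewise_C1_curve \<A> y"
  shows "restrict y {0..1} \<in> Hk (Suc 0)"
proof -
  obtain n :: nat and T where T: "T 0 = 0" "T n = 1" "\<And>i. i < n \<Longrightarrow> T i < T (Suc i) \<and> Cr_curve_on \<A> 1 (T i) (T (Suc i)) y"
    using assms unfolding piecewise_C1_curve_def by blast
  have "n > 0" using T(1,2) by (cases n) auto
  have y0: "y 0 \<in> \<M>"
  proof -
    have "Cr_curve_on \<A> 1 (T 0) (T (Suc 0)) y" "T 0 < T (Suc 0)" using T(3)[of 0] \<open>n > 0\<close> by auto
    then show ?thesis using T(1) unfolding Cr_curve_on_def by auto
  qed
  have "0 \<le> T i \<and> continuous_on {0..T i} y \<and> y ` {0..T i} \<subseteq> \<M> \<and>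
     (\<forall>c\<in>\<A>. \<forall>s t. 0 \<le> s \<and> s < t \<and> t \<le> T i \<and> y ` {s..t} \<subseteq> chart_dom c \<longrightarrow> Hreg 0 s t (crd c y))" if "i \<le> n" for i
    using that
  proof (induction i)
    case 0
    then show ?case using T(1) y0 by auto
  next
    case (Suc i)
    then have IH: "0 \<le> T i" "continuous_on {0..T i} y" "y ` {0..T i} \<subseteq> \<M>"
      "\<And>c s t. c \<in> \<A> \<Longrightarrow> 0 \<le> s \<Longrightarrow> s < t \<Longrightarrow> t \<le> T i \<Longrightarrow> y ` {s..t} \<subseteq> chart_dom c \<Longrightarrow> Hreg 0 s t (crd c y)"
      by auto
    have i: "T i < T (Suc i)" "Cr_curve_on \<A> 1 (T i) (T (Suc i)) y" using T(3)[of i] Suc.prems by auto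
    have U: "{0..T (Suc i)} = {0..T i} \<union> {T i..T (Suc i)}" using IH(1) i(1) by auto
    have "continuous_on {0..T (Suc i)} y"
      unfolding U by (rule continuous_on_closed_Un) (use IH(2) i(2) in \<open>auto simp: Cr_curve_on_def\<close>)
    moreover have "y ` {0..T (Suc i)} \<subseteq> \<M>"
      unfolding U using IH(3) i(2) unfolding Cr_curve_on_def by blast
    moreover have "Hreg 0 s t (crd c y)"
      if c: "c \<in> \<A>" and st: "0 \<le> s" "s < t" "t \<le> T (Suc i)" and d: "y ` {s..t} \<subseteq> chart_dom c" for c s t
    proof -
      consider "t \<le> T i" | "T i \<le> s" | "s < T i" "T i < t" by linarith
      then show ?thesis
      proof cases
        case 1 then show ?thesis using IH(4) c st d by blast
      next
        case 2 then show ?thesis using Cr_curve_on_Hreg_0[OF i(2) c] st d by blast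
      next
        case 3
        have "{s..T i} \<subseteq> {s..t}" "{T i..t} \<subseteq> {s..t}" using 3 by auto
        then have "y ` {s..T i} \<subseteq> chart_dom c" "y ` {T i..t} \<subseteq> chart_dom c" using d by blast+
        then show ?thesis
          using Hreg_0_combine[OF IH(4)[OF c st(1) 3(1) order_refl] Cr_curve_on_Hreg_0[OF i(2) c order_refl 3(2) st(3)]] 3 by simp
      qed
    qed
    ultimately show ?case using IH(1) i(1) by simp
  qed
  from this[OF order_refl] have y: "continuous_on {0..1} y" "y ` {0..1} \<subseteq> \<M>"
     "\<And>c s t. c \<in> \<A> \<Longrightarrow> 0 \<le> s \<Longrightarrow> s < t \<Longrightarrow> t \<le> 1 \<Longrightarrow> y ` {s..t} \<subseteq> chart_dom c \<Longrightarrow> Hreg 0 s t (crd c y)"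
    unfolding T(2) by blast+
  show ?thesis
    unfolding Hk_curves_def
  proof (intro CollectI conjI ballI allI impI)
    show "restrict y {0..1} \<in> extensional {0..1}" by simp
    show "continuous_on {0..1} (restrict y {0..1})"
      using y(1) by (rule continuous_on_eq) simp
    show "restrict y {0..1} ` {0..1} \<subseteq> \<M>" using y(2) by auto
    fix c s t assume c: "c \<in> \<A>" and st: "0 \<le> s \<and> s < t \<and> t \<le> 1 \<and> restrict y {0..1} ` {s..t} \<subseteq> chart_dom c"
    then have "y ` {s..t} \<subseteq> chart_dom c" by auto
    then have "Hreg 0 s t (crd c y)" using y(3)[OF c] st by blast
    then have "Hreg 0 s t (chart_map c \<circ> restrict y {0..1})" by (rule Hreg_cong) (use st in auto)
    then show "sobolev_on (Suc 0) s t (chart_map c \<circ> restrict y {0..1})" using st by (intro Hreg_0_imp_sobolev_on) auto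
  qed
qed

lemma velocity_restrict:
  assumes "t \<in> {0..1}"
  shows "velocity \<A> (restrict y {0..1}) t = velocity \<A> y t"
proof -
  have "curve_deriv {0..1} (chart_map c \<circ> restrict y {0..1}) t = curve_deriv {0..1} (crd c y) t" for c
    unfolding curve_deriv_def by (rule vector_derivative_cong_eq) (use assms in \<open>auto simp: eventually_at_topological\<close>)
  then show ?thesis using assms by (auto simp: velocity_def fun_eq_iff)
qed

lemma curve_length_eq_integral:
  assumes "piecewise_C1_curve \<A> y"
  shows "curve_length \<A> g y = integral {0..1} (\<lambda>q. tnorm g (restrict y {0..1} q) (cvel 0 (restrict y {0..1}) q))"
proof -
  let ?x = "restrict y {0..1}"
  let ?N = "\<lambda>q. tnorm g (?x q) (cvel 0 ?x q)"
  note x = piecewise_C1_curve_Hk[OF assms]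
  have I: "?N integrable_on {0..1}" by (rule cov_velocity_integrable(1)[OF x le0]) simp_all
  have neg: "negligible {q \<in> {0..1}. cvel 0 ?x q \<notin> TM (?x q)}"
    by (rule cov_velocity_integrable(3)[OF x le0]) simp_all
  have "?N absolutely_integrable_on {0..1}"
  proof (rule absolutely_integrable_spike)
    show "(\<lambda>q. \<bar>?N q\<bar>) absolutely_integrable_on {0..1}"
    proof (rule nonnegative_absolutely_integrable_1)
      show "(\<lambda>q. \<bar>?N q\<bar>) integrable_on {0..1}"
        using I by (rule integrable_spike[OF _ neg])
          (use Hk_curves_carrier[OF x] in \<open>auto simp: tnorm_nonneg\<close>)
    qed simp
    show "negligible {q \<in> {0..1}. cvel 0 ?x q \<notin> TM (?x q)}" by (rule neg)
  qed (use Hk_curves_carrier[OF x] in \<open>auto simp: tnorm_nonneg\<close>)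
  then have "(\<integral>t. ?N t \<partial>lebesgue_on {0..1}) = integral {0..1} ?N"
    by (intro lebesgue_integral_eq_integral) (simp_all add: absolutely_integrable_on_iff_integrable)
  moreover have "curve_length \<A> g y = (\<integral>t. ?N t \<partial>lebesgue_on {0..1})"
    unfolding curve_length_def
    by (rule Bochner_Integration.integral_cong) (auto simp: cov_velocity_def velocity_restrict)
  ultimately show ?thesis by simp
qed

text \<open>Where the velocity fails to be tangent, the value of \<open>g\<close> is arbitrary and
  \<open>tnorm\<close> may be negative. The passage to absolute values changes the integrand on this
  negligible set only.\<close>

lemma cov_velocity_norm_integral_mono:
  assumes x: "x \<in> Hk (Suc r)" and ab: "{s..t} \<subseteq> {a..b}" "0 \<le> a" "b \<le> 1" "s \<le> t"
  shows "integral {s..t} (\<lambda>q. speed 0 x q) \<le> integral {a..b} (\<lambda>q. speed 0 x q)"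
proof -
  let ?N = "\<lambda>q. speed 0 x q"
  have st: "a \<le> s" "t \<le> b" using ab by auto
  note I = cov_velocity_integrable[OF x le0]
  have neg: "negligible {q\<in>{0..1}. cvel 0 x q \<notin> TM (x q)}" (is "negligible ?Z") using I(3)[of 0 1] by simp
  have e: "integral {u..v} ?N = integral {u..v} (\<lambda>q. \<bar>?N q\<bar>)" if "0 \<le> u" "v \<le> 1" for u v
    by (rule integral_spike[OF neg]) (use that Hk_curves_carrier[OF x] in \<open>auto simp: tnorm_nonneg\<close>)
  have i: "(\<lambda>q. \<bar>?N q\<bar>) integrable_on {u..v}" if "0 \<le> u" "u \<le> v" "v \<le> 1" for u v
    using I(1)[OF that] by (rule integrable_spike[OF _ neg]) (use that Hk_curves_carrier[OF x] in \<open>auto simp: tnorm_nonneg\<close>)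
  have "integral {s..t} (\<lambda>q. \<bar>?N q\<bar>) \<le> integral {a..b} (\<lambda>q. \<bar>?N q\<bar>)"
    by (rule integral_subset_le[OF ab(1)]) (use ab st i in auto)
  then show ?thesis using e[of s t] e[of a b] ab st by simp
qed

section \<open>Curves too short to leave a chart ball\<close>

lemma chart_displacement:
  assumes x: "x \<in> Hk (Suc r)" and st: "chart_interval x c s t"
    and m: "\<And>q u. q \<in> {s..t} \<Longrightarrow> m * norm u \<le> sqrt (G c (chart_map c (x q)) u u)" "0 < m"
  shows "m * norm (chart_map c (x t) - chart_map c (x s)) \<le> integral {s..t} (\<lambda>q. speed 0 x q)"
proof -
  have c: "c \<in> \<A>" "0 \<le> s" "s < t" "t \<le> 1" "x ` {s..t} \<subseteq> chart_dom c" using st by (auto simp: chart_interval_def)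
  obtain f N where f: "L2_on s t f" "\<And>q. q \<in> {s..t} \<Longrightarrow> chart_map c (x q) = chart_map c (x s) + integral {s..q} f"
    "negligible N" "\<And>q. q \<in> {s..t} - N \<Longrightarrow> cvel 0 x q c = f q"
    "\<And>q. q \<in> {s..t} - N \<Longrightarrow> cvel 0 x q \<in> TM (x q)"
    using chart_primitive_0[OF x st] by metis
  have "m * norm (chart_map c (x t) - chart_map c (x s)) = m * norm (integral {s..t} f)" using f(2)[of t] c by simp
  also have "\<dots> \<le> m * integral {s..t} (\<lambda>q. norm (f q))"
    by (intro mult_left_mono integral_norm_bound_integral) (use L2_on_integrable_on[OF f(1)] m(2) in auto)
  also have "\<dots> = integral {s..t} (\<lambda>q. m * norm (f q))" by simp
  also have "\<dots> \<le> integral {s..t} (\<lambda>q. speed 0 x q)"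
  proof (rule integral_le_AE[OF integrable_on_mult_right[OF L2_on_integrable_on(2)[OF f(1)]]
        cov_velocity_integrable(1)[OF x le0 c(2) less_imp_le[OF c(3)] c(4)] f(3)])
    fix q assume q: "q \<in> {s..t} - N"
    then have "x q \<in> chart_dom c" using c by auto
    from tnorm_eq_G[OF f(5)[OF q] c(1) this] f(4)[OF q] m(1)[of q "f q"] q
    show "m * norm (f q) \<le> speed 0 x q" by simp
  qed
  finally show ?thesis .
qed

text \<open>Before a first exit time \<open>t1\<close> from the ball of radius \<open>2 * R\<close>
  the displacement in the chart is at most the length divided by \<open>m\<close>. The curve
  therefore stays in a strictly smaller closed ball, whose image in the manifold is compact and
  hence closed, and it is still there at \<open>t1\<close>.\<close>

lemma short_curve_stays_near:
  assumes x: "x \<in> Hk (Suc r)" and c: "c \<in> \<A>" "cball z0 (2 * R) \<subseteq> chart_img c" "0 < R"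
    and m: "\<And>z u. z \<in> cball z0 (2 * R) \<Longrightarrow> m * norm u \<le> sqrt (G c z u u)" "0 < m"
    and x0: "x 0 \<in> chart_dom c" "chart_map c (x 0) \<in> cball z0 R"
    and L: "integral {0..1} (\<lambda>q. speed 0 x q) < m * R"
  shows "x 1 \<in> chart_dom c \<and> chart_map c (x 1) \<in> cball z0 (2 * R)"
proof -
  let ?L = "integral {0..1} (\<lambda>q. speed 0 x q)"
  note xc = Hk_curves_continuous[OF x]
  define V where "V = chart_inv c ` ball z0 (2 * R)"
  have sub: "ball z0 (2 * R) \<subseteq> chart_img c" using c(2) by (meson ball_subset_cball subset_trans)
  have V: "p \<in> V \<longleftrightarrow> p \<in> chart_dom c \<and> chart_map c p \<in> ball z0 (2 * R)" for p
  proof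
    assume "p \<in> V"
    then obtain z where "z \<in> ball z0 (2 * R)" "p = chart_inv c z" unfolding V_def by blast
    then show "p \<in> chart_dom c \<and> chart_map c p \<in> ball z0 (2 * R)"
      using sub c(1) chart_inv_in chart_map_inv by (metis subsetD)
  next
    assume "p \<in> chart_dom c \<and> chart_map c p \<in> ball z0 (2 * R)"
    then show "p \<in> V" unfolding V_def using chart_inv_map[OF c(1)] by (metis imageI)
  qed
  have "V = chart_map c -` ball z0 (2 * R) \<inter> chart_dom c" using V by blast
  moreover have "open (chart_map c -` ball z0 (2 * R) \<inter> chart_dom c)"
    using chart_homeo(1,4)[OF c(1)] continuous_on_open_vimage open_ball by blast
  ultimately have oV: "open V" by simp
  have "{t\<in>{0..1}. x t \<notin> V} = {}"
  proof (rule ccontr)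
    assume ne: "{t\<in>{0..1}. x t \<notin> V} \<noteq> {}" (is "?S \<noteq> {}")
    have "?S = {0..1} \<inter> x -` (- V)" by blast
    moreover have "closed ({0..1} \<inter> x -` (- V))"
      by (rule continuous_closed_preimage[OF xc closed_atLeastAtMost closed_Compl[OF oV]])
    ultimately have cl: "closed ?S" by simp
    have bb: "bdd_below ?S" by (auto intro: bdd_belowI[of _ 0])
    define t1 where "t1 = Inf ?S"
    have t1: "t1 \<in> ?S" unfolding t1_def by (rule closed_contains_Inf[OF ne bb cl])
    have lt: "x t \<in> V" if "0 \<le> t" "t < t1" for t
    proof (rule ccontr)
      assume "x t \<notin> V"
      then have "t \<in> ?S" using that t1 by auto
      then have "t1 \<le> t" unfolding t1_def using bb by (rule cInf_lower)
      then show False using that by simp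
    qed
    have "chart_map c (x 0) \<in> ball z0 (2 * R)" using x0(2) c(3) by auto
    then have "x 0 \<in> V" using V x0(1) by blast
    then have "t1 > 0" using t1 by (cases "t1 = 0") auto
    \<comment> \<open>Starting distance plus maximal displacement; the strict bound on the length
      keeps it below \<open>2 * R\<close>.\<close>
    define R' where "R' = R + ?L / m"
    have R': "R' < 2 * R" using L m(2) by (simp add: R'_def field_simps)
    define C where "C = chart_inv c ` cball z0 R'"
    have sub': "cball z0 R' \<subseteq> ball z0 (2 * R)" using R' by auto
    have "compact C" unfolding C_def
      by (intro compact_continuous_image compact_cball continuous_on_subset[OF chart_homeo(5)[OF c(1)]]) (use sub sub' in blast)
    then have "closed C" by (rule compact_imp_closed)
    have "x t \<in> C" if t: "0 \<le> t" "t < t1" for t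
    proof (cases "t = 0")
      case True
      have "?L \<ge> 0" using cov_velocity_norm_integral_mono[OF x, of 0 0 0 1] by simp
      then have "chart_map c (x 0) \<in> cball z0 R'" using x0(2) m(2) by (auto simp: R'_def intro: order_trans)
      then show ?thesis unfolding C_def True using chart_inv_map[OF c(1) x0(1)] by (metis imageI)
    next
      case False
      have ci: "chart_interval x c 0 t" using t t1 False c(1) lt V by (auto simp: chart_interval_def)
      have "m * norm (chart_map c (x t) - chart_map c (x 0)) \<le> integral {0..t} (\<lambda>q. speed 0 x q)"
      proof (rule chart_displacement[OF x ci _ m(2)])
        fix q u assume "q \<in> {0..t}"
        then have "chart_map c (x q) \<in> ball z0 (2 * R)" using lt[of q] V t by auto
        then show "m * norm u \<le> sqrt (G c (chart_map c (x q)) u u)" using m(1) by (meson ball_subset_cball subsetD)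
      qed
      also have "\<dots> \<le> ?L" by (rule cov_velocity_norm_integral_mono[OF x]) (use t t1 in auto)
      finally have "dist (chart_map c (x 0)) (chart_map c (x t)) \<le> ?L / m"
        using m(2) by (simp add: field_simps dist_norm norm_minus_commute)
      then have "chart_map c (x t) \<in> cball z0 R'"
        using x0(2) dist_triangle[of z0 "chart_map c (x t)" "chart_map c (x 0)"] by (simp add: R'_def)
      moreover have "x t \<in> chart_dom c" using lt[OF t] V by blast
      ultimately show ?thesis unfolding C_def using chart_inv_map[OF c(1)] by (metis imageI)
    qed
    then have "{0..<t1} \<subseteq> {0..1} \<inter> x -` C" using t1 by auto
    moreover have "closed ({0..1} \<inter> x -` C)" using continuous_closed_preimage[OF xc _ \<open>closed C\<close>] by simp
    ultimately have "closure {0..<t1} \<subseteq> {0..1} \<inter> x -` C" by (rule closure_minimal)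
    moreover have "t1 \<in> closure {0..<t1}" using \<open>t1 > 0\<close> by simp
    ultimately have "x t1 \<in> C" by blast
    then have "x t1 \<in> V" unfolding C_def V_def using sub' by blast
    then show False using t1 by blast
  qed
  then have "x 1 \<in> V" by auto
  then show ?thesis using V ball_subset_cball by blast
qed

text \<open>The threshold \<open>m * r\<close> comes from the lower norm bound on the larger ball,
  so it is the same for all starting points in the smaller one.\<close>

lemma riemannian_dist_small_imp_near:
  assumes c: "c \<in> \<A>" "cball z0 (2 * r) \<subseteq> chart_img c" "0 < r"
  obtains e :: real where "0 < e" "\<And>p q. p \<in> chart_dom c \<Longrightarrow> chart_map c p \<in> cball z0 r \<Longrightarrow> riemannian_dist \<A> g p q < ennreal e \<Longrightarrow>
      q \<in> chart_dom c \<and> chart_map c q \<in> cball z0 (2 * r)"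
proof -
  obtain m where m: "0 < m" "\<And>z u. z \<in> cball z0 (2 * r) \<Longrightarrow> m * norm u \<le> sqrt (G c z u u)"
    using G_norm_bounds[OF c(1) compact_cball c(2)] by metis
  show ?thesis
  proof (rule that[of "m * r"])
    show "0 < m * r" using m c by simp
    fix p q assume p: "p \<in> chart_dom c" "chart_map c p \<in> cball z0 r" "riemannian_dist \<A> g p q < ennreal (m * r)"
    then obtain y where y: "piecewise_C1_curve \<A> y" "y 0 = p" "y 1 = q" "ennreal (curve_length \<A> g y) < ennreal (m * r)"
      unfolding riemannian_dist_def INF_less_iff by blast
    have "curve_length \<A> g y < m * r" using y(4) m c by (simp add: ennreal_less_iff ennreal_lessI split: ) (metis ennreal_leI linorder_not_less)
    then show "q \<in> chart_dom c \<and> chart_map c q \<in> cball z0 (2 * r)"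
      using short_curve_stays_near[OF piecewise_C1_curve_Hk[OF y(1)] c m(2) m(1)] p(1,2) y(2,3)
      unfolding curve_length_eq_integral[OF y(1)] by simp
  qed
qed

end

lemma curve_deriv_cong:
  assumes "\<And>t. t \<in> S \<Longrightarrow> f t = h t" "t \<in> S"
  shows "curve_deriv S f t = curve_deriv S h t"
  unfolding curve_deriv_def
  by (rule vector_derivative_cong_eq) (use assms in \<open>auto simp: eventually_at_topological\<close>)

lemma Cr_vec_curve_cong:
  "(\<And>t. t \<in> S \<Longrightarrow> f t = h t) \<Longrightarrow> Cr_vec_curve r S f \<Longrightarrow> Cr_vec_curve r S h"
proof (induction r arbitrary: f h)
  case 0
  have "continuous_on S h" by (rule continuous_on_eq[of S f]) (use 0 in auto)
  then show ?case by simp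
next
  case (Suc r)
  have "h differentiable (at t within S)" if t: "t \<in> S" for t
  proof -
    have "f differentiable (at t within S)" using Suc.prems(2) t by simp
    then obtain D where "(f has_derivative D) (at t within S)" unfolding differentiable_def by blast
    then have "(h has_derivative D) (at t within S)"
      by (rule has_derivative_transform_within[OF _ zero_less_one t]) (use Suc.prems(1) in auto)
    then show ?thesis unfolding differentiable_def by blast
  qed
  moreover have "Cr_vec_curve r S (curve_deriv S h)"
    by (rule Suc.IH[of "curve_deriv S f"]) (use Suc.prems curve_deriv_cong[of S f h] in auto)
  ultimately show ?case by simp
qed

lemma Cr_curve_on_cong:
  assumes "Cr_curve_on \<A> r a b x" "\<And>t. t \<in> {a..b} \<Longrightarrow> y t = x t"
  shows "Cr_curve_on \<A> r a b y"
  unfolding Cr_curve_on_def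
proof (intro conjI ballI allI impI)
  show "continuous_on {a..b} y" by (rule continuous_on_eq[of _ x]) (use assms in \<open>auto simp: Cr_curve_on_def\<close>)
  show "y ` {a..b} \<subseteq> carrier \<A>" using assms by (auto simp: Cr_curve_on_def)
  fix c s t assume *: "c \<in> \<A>" "a \<le> s \<and> s < t \<and> t \<le> b \<and> y ` {s..t} \<subseteq> chart_dom c"
  then have e: "y q = x q" if "q \<in> {s..t}" for q using assms(2) that by auto
  have "x ` {s..t} \<subseteq> chart_dom c" using * e by (auto simp: image_subset_iff)
  then have "Cr_vec_curve r {s..t} (chart_map c \<circ> x)" using assms(1) * unfolding Cr_curve_on_def by blast
  then show "Cr_vec_curve r {s..t} (chart_map c \<circ> y)" by (rule Cr_vec_curve_cong[rotated]) (use e in auto)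
qed

section \<open>Broken lines and their lengths\<close>

context riemannian
begin

text \<open>\<open>reach p q L\<close>: a broken line of length at most \<open>L\<close>, each piece of which is a straight
  segment in some chart, leads from \<open>p\<close> to \<open>q\<close>.  Unlike Riemannian distance, this relation is
  closed under concatenation by definition.\<close>

inductive reach :: "'a \<Rightarrow> 'a \<Rightarrow> real \<Rightarrow> bool" where
  refl: "p \<in> \<M> \<Longrightarrow> reach p p 0"
| step: "reach p q L \<Longrightarrow> c \<in> \<A> \<Longrightarrow> q \<in> chart_dom c \<Longrightarrow> q' \<in> chart_dom c \<Longrightarrow>
    closed_segment (chart_map c q) (chart_map c q') \<subseteq> chart_img c \<Longrightarrow> 0 \<le> l \<Longrightarrow>
    (\<And>z. z \<in> closed_segment (chart_map c q) (chart_map c q') \<Longrightarrow>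
       sqrt (G c z (chart_map c q' - chart_map c q) (chart_map c q' - chart_map c q)) \<le> l) \<Longrightarrow>
    reach p q' (L + l)"

lemma reach_nonneg: "reach p q L \<Longrightarrow> 0 \<le> L"
  by (induction rule: reach.induct) auto

lemma reach_carrier: "reach p q L \<Longrightarrow> p \<in> \<M> \<and> q \<in> \<M>"
  by (induction rule: reach.induct) (auto simp: carrier_def)

lemma reach_trans:
  assumes "reach p q L" "reach q r L'"
  shows "reach p r (L + L')"
  using assms(2,1)
proof (induction rule: reach.induct)
  case (refl q)
  then show ?case by simp
next
  case (step q r L' c r' l)
  have "reach p r' ((L + L') + l)"
    by (rule reach.step[OF step(8)[OF step(9)] step(2-7)])
  then show ?case by (simp add: add.assoc)
qed

lemma reach_sym: "reach p q L \<Longrightarrow> reach q p L"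
proof (induction rule: reach.induct)
  case (refl p)
  then show ?case by (rule reach.refl)
next
  case (step p q L c q' l)
  have q': "q' \<in> \<M>" using step(2,4) by (auto simp: carrier_def)
  have "sqrt (G c z (chart_map c q - chart_map c q') (chart_map c q - chart_map c q')) \<le> l"
    if z: "z \<in> closed_segment (chart_map c q') (chart_map c q)" for z
  proof -
    have z': "z \<in> closed_segment (chart_map c q) (chart_map c q')" using z by (simp add: closed_segment_commute)
    then have "bilinear (G c z)" using G_metric(1)[OF step(2)] step(5) by blast
    from bilinear_lneg[OF this, of "chart_map c q' - chart_map c q"] bilinear_rneg[OF this, of _ "chart_map c q' - chart_map c q"]
    show ?thesis using step(7)[OF z'] by simp
  qed
  then have "reach q' q (0 + l)"
    using step(5) by (intro reach.step[OF reach.refl[OF q'] step(2,4,3) _ step(6)]) (simp_all add: closed_segment_commute)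
  from reach_trans[OF this step(8)] show ?case by (simp add: add.commute)
qed

text \<open>In \<open>c\<close> the curve is affine. Any other chart sees it through a transition
  map, whose regularity along the compact piece is provided by \<open>UH_compose\<close> for a
  one-element family.\<close>

lemma segment_Cr_curve_on:
  assumes c: "c \<in> \<A>" and seg: "closed_segment u v \<subseteq> chart_img c" and mb: "0 \<le> m" "m < b" "b \<le> 1"
  shows "Cr_curve_on \<A> 1 m b (\<lambda>t. chart_inv c (u + ((t - m) / (b - m)) *\<^sub>R (v - u)))"
proof -
  define h where "h t = u + ((t - m) / (b - m)) *\<^sub>R (v - u)" for t
  have hs: "h t \<in> closed_segment u v" if "t \<in> {m..b}" for t
    unfolding closed_segment_def mem_Collect_eq
    by (rule exI[of _ "(t - m) / (b - m)"]) (use that mb in \<open>auto simp: h_def algebra_simps\<close>)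
  have hi: "h t \<in> chart_img c" if "t \<in> {m..b}" for t using hs[OF that] seg by blast
  have hc: "continuous_on S h" for S unfolding h_def by (intro continuous_intros) (use mb in auto)
  let ?y = "\<lambda>t. chart_inv c (h t)"
  have "Cr_curve_on \<A> 1 m b ?y"
    unfolding Cr_curve_on_def
  proof (intro conjI ballI allI impI)
    show "continuous_on {m..b} ?y"
      by (rule continuous_on_compose2[OF chart_homeo(5)[OF c] hc]) (use hi in auto)
    show "?y ` {m..b} \<subseteq> \<M>" using chart_inv_in[OF c hi] c by (auto simp: carrier_def)
    fix d s t assume d: "d \<in> \<A>" and st: "m \<le> s \<and> s < t \<and> t \<le> b \<and> ?y ` {s..t} \<subseteq> chart_dom d"
    have s: "s < t" "t \<le> s + 1" using st mb by auto
    have fam: "interval_family {()} (\<lambda>_. s) (\<lambda>_. t)" by (rule interval_family_single[OF s])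
    interpret F: interval_family "{()}" "\<lambda>_. s" "\<lambda>_. t" by (rule fam)
    have hd: "(h has_vector_derivative (1 / (b - m)) *\<^sub>R (v - u)) (at q within {s..t})" for q
      unfolding h_def using mb by (auto intro!: derivative_eq_intros)
    have K: "compact (h ` {s..t})" by (intro compact_continuous_image hc compact_Icc)
    then have "bounded (h ` {s..t})" by (rule compact_imp_bounded)
    then have "F.ubounded (\<lambda>_. h)" unfolding F.ubounded_def bounded_iff by auto
    then have h1: "F.UH (Suc 0) (\<lambda>_. h)"
      by (rule F.UH_SucI[where h'="\<lambda>_ _. (1 / (b - m)) *\<^sub>R (v - u)", OF _ hd F.UH_const])
    have KW: "h ` {s..t} \<subseteq> chart_map c ` (chart_dom c \<inter> chart_dom d)"
    proof
      fix z assume "z \<in> h ` {s..t}"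
      then obtain q where q: "q \<in> {s..t}" "z = h q" by blast
      then have "h q \<in> chart_img c" "?y q \<in> chart_dom d" using hi[of q] st by auto
      then show "z \<in> chart_map c ` (chart_dom c \<inter> chart_dom d)"
        using chart_inv_in[OF c] chart_map_inv[OF c] q(2) by (intro image_eqI[of _ _ "?y q"]) auto
    qed
    have "F.UH (Suc 0) (\<lambda>k q. transition c d (h q))"
      by (rule F.UH_compose[OF transition_Cn_on(1)[OF c d] K KW h1 _ transition_Cn_on(2)[OF c d]]) simp
    then obtain B where "Hol (Suc 0) B s t (\<lambda>q. transition c d (h q))" using UH_single[OF s] by blast
    from Hol_imp_Cr_vec_curve[OF this s] show "Cr_vec_curve 1 {s..t} (chart_map d \<circ> ?y)"
      by (simp add: transition_def o_def)
  qed
  then show ?thesis unfolding h_def .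
qed

lemma velocity_cong_open:
  assumes "open T" "t \<in> T" "t \<in> {0..1}" "\<And>s. s \<in> T \<Longrightarrow> y s = x s"
  shows "velocity \<A> y t = velocity \<A> x t"
proof -
  have "curve_deriv {0..1} (crd c y) t = curve_deriv {0..1} (crd c x) t" for c
    unfolding curve_deriv_def
    by (rule vector_derivative_cong_eq) (use assms in \<open>auto simp: eventually_nhds\<close>)
  then show ?thesis using assms by (auto simp: velocity_def fun_eq_iff)
qed

text \<open>In the inductive step the earlier broken line runs in the first half of the time
  interval and the new segment in the second half. Being constant outside \<open>{a..b}\<close> lets
  the pieces fit together at the midpoint. The speed bound \<open>h\<close> is asserted off the
  break points, where the velocity may jump.\<close>

lemma reach_curve:
  assumes "reach p q L" "0 \<le> a" "a < b" "b \<le> 1"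
  shows "\<exists>y h N. continuous_on UNIV y \<and> (\<forall>t\<le>a. y t = p) \<and> (\<forall>t\<ge>b. y t = q) \<and>
     (\<exists>(n::nat) \<tau>. \<tau> 0 = a \<and> \<tau> n = b \<and> (\<forall>i<n. \<tau> i < \<tau> (Suc i) \<and> Cr_curve_on \<A> 1 (\<tau> i) (\<tau> (Suc i)) y)) \<and>
     (h has_integral L) {a..b} \<and> negligible N \<and> (\<forall>t\<in>{a..b} - N. tnorm g (y t) (velocity \<A> y t) \<le> h t)"
  using assms
proof (induction arbitrary: a b rule: reach.induct)
  case (refl p)
  obtain c where c: "c \<in> \<A>" "p \<in> chart_dom c" using refl(1) by (auto simp: carrier_def)
  have C: "Cr_curve_on \<A> 1 a b (\<lambda>_. p)"
    using segment_Cr_curve_on[OF c(1), of "chart_map c p" "chart_map c p" a b] c refl chart_map_in[OF c(2)] by simp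
  have v: "velocity \<A> (\<lambda>_. p) t = (\<lambda>_. 0)" if "t \<in> {a..b}" for t
  proof -
    have t: "t \<in> {0..1}" using that refl by auto
    have "curve_deriv {0..1} (\<lambda>_::real. z) t = 0" for z :: 'b by (rule curve_deriv_eq) (use t in auto)
    then show ?thesis by (auto simp: velocity_def o_def)
  qed
  have "tnorm g p (\<lambda>_. 0) = 0"
  proof -
    have "(\<lambda>_. 0) \<in> TM p"
      using velocity_tangent[of "\<lambda>_. p" c a 0] c refl v[of a] by (simp add: o_def cov_velocity_def)
    from tnorm_eq_G[OF this c] bilinear_lzero[OF G_metric(1)[OF c(1) chart_map_in[OF c(2)]]] show ?thesis by simp
  qed
  then have "(\<forall>t\<in>{a..b} - {}. tnorm g p (velocity \<A> (\<lambda>_. p) t) \<le> 0)" using v by simp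
  moreover have "\<exists>(n::nat) \<tau>. \<tau> 0 = a \<and> \<tau> n = b \<and> (\<forall>i<n. \<tau> i < \<tau> (Suc i) \<and> Cr_curve_on \<A> 1 (\<tau> i) (\<tau> (Suc i)) (\<lambda>_. p))"
    by (rule exI[of _ 1], rule exI[of _ "\<lambda>i. if i = 0 then a else b"]) (use C refl in auto)
  ultimately show ?case
    by (intro exI[of _ "\<lambda>_. p"] exI[of _ "\<lambda>_. 0"] exI[of _ "{}"] conjI) auto
next
  case (step p q L c q' l)
  define m where "m = (a + b) / 2"
  have m: "a < m" "m < b" "0 \<le> m" "m \<le> 1" using step.prems by (auto simp: m_def)
  obtain y1 h1 N1 n \<tau> where y1: "continuous_on UNIV y1" "\<And>t. t \<le> a \<Longrightarrow> y1 t = p" "\<And>t. t \<ge> m \<Longrightarrow> y1 t = q"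
     "\<tau> 0 = a" "\<tau> (n::nat) = m" "\<And>i. i < n \<Longrightarrow> \<tau> i < \<tau> (Suc i) \<and> Cr_curve_on \<A> 1 (\<tau> i) (\<tau> (Suc i)) y1"
     "(h1 has_integral L) {a..m}" "negligible N1" "\<And>t. t \<in> {a..m} - N1 \<Longrightarrow> tnorm g (y1 t) (velocity \<A> y1 t) \<le> h1 t"
    using step.IH[OF step.prems(1) m(1,4)] by blast
  let ?u = "chart_map c q" and ?v = "chart_map c q'"
  define \<sigma> where "\<sigma> t = max 0 (min 1 ((t - m) / (b - m)))" for t
  define y2 where "y2 t = chart_inv c (?u + \<sigma> t *\<^sub>R (?v - ?u))" for t
  define y where "y t = (if t \<le> m then y1 t else y2 t)" for t
  have \<sigma>: "\<sigma> t \<in> {0..1}" for t by (simp add: \<sigma>_def)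
  have \<sigma>m: "\<sigma> t = (t - m) / (b - m)" if "t \<in> {m..b}" for t using that m by (simp add: \<sigma>_def min_def max_def)
  have seg: "?u + \<sigma> t *\<^sub>R (?v - ?u) \<in> closed_segment ?u ?v" for t
    unfolding closed_segment_def mem_Collect_eq
    by (rule exI[of _ "\<sigma> t"]) (use \<sigma>[of t] in \<open>auto simp: algebra_simps\<close>)
  have img: "?u + \<sigma> t *\<^sub>R (?v - ?u) \<in> chart_img c" for t using seg step(5) by blast
  have "continuous_on UNIV \<sigma>" unfolding \<sigma>_def by (intro continuous_intros) (use m in auto)
  then have "continuous_on UNIV (\<lambda>t. ?u + \<sigma> t *\<^sub>R (?v - ?u))" by (intro continuous_intros)
  then have y2c: "continuous_on UNIV y2"
    unfolding y2_def by (rule continuous_on_compose2[OF chart_homeo(5)[OF step(2)]]) (use img in auto)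
  have y2m: "y2 m = q" using \<sigma>m[of m] m step(2,3) by (simp add: y2_def)
  have yc: "continuous_on UNIV y"
    unfolding y_def by (rule continuous_on_cases_le) (use y1(1,3) y2c y2m in \<open>auto intro: continuous_on_subset\<close>)
  have ya: "y t = p" if "t \<le> a" for t using that m y1(2) by (simp add: y_def)
  have yb: "y t = q'" if "t \<ge> b" for t
  proof -
    have "1 \<le> (t - m) / (b - m)" using that m by (simp add: field_simps)
    then have "\<sigma> t = 1" by (simp add: \<sigma>_def)
    then show ?thesis using that m step(2,4) by (simp add: y_def y2_def)
  qed
  have y_le: "y t = y1 t" if "t \<le> m" for t using that by (simp add: y_def)
  have y_ge: "y t = y2 t" if "t \<ge> m" for t using that y2m y1(3)[of m] by (auto simp: y_def)
  have Cmb: "Cr_curve_on \<A> 1 m b y"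
    by (rule Cr_curve_on_cong[OF segment_Cr_curve_on[OF step(2,5) m(3,2) step.prems(3)]])
      (use y_ge \<sigma>m in \<open>auto simp: y2_def\<close>)
  define \<tau>' where "\<tau>' i = (if i \<le> n then \<tau> i else b)" for i
  have \<tau>mono: "\<tau> i \<le> m" if "i \<le> n" for i
    using that
  proof (induction rule: inc_induct)
    case base then show ?case using y1(5) by simp
  next
    case (step k) then show ?case using y1(6)[of k] by auto
  qed
  have parts: "\<tau>' 0 = a \<and> \<tau>' (Suc n) = b \<and> (\<forall>i<Suc n. \<tau>' i < \<tau>' (Suc i) \<and> Cr_curve_on \<A> 1 (\<tau>' i) (\<tau>' (Suc i)) y)"
  proof (intro conjI allI impI)
    show "\<tau>' 0 = a" "\<tau>' (Suc n) = b" using y1(4) by (auto simp: \<tau>'_def)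
    fix i assume i: "i < Suc n"
    show "\<tau>' i < \<tau>' (Suc i)" using y1(5,6) m i by (auto simp: \<tau>'_def less_Suc_eq)
    show "Cr_curve_on \<A> 1 (\<tau>' i) (\<tau>' (Suc i)) y"
    proof (cases "i = n")
      case True then show ?thesis using Cmb y1(5) by (simp add: \<tau>'_def)
    next
      case False
      then have i': "i < n" using i by simp
      have "Cr_curve_on \<A> 1 (\<tau> i) (\<tau> (Suc i)) y"
        by (rule Cr_curve_on_cong[of _ _ _ _ y1]) (use y1(6)[OF i'] \<tau>mono[of "Suc i"] i' y_le in auto)
      then show ?thesis using i' by (simp add: \<tau>'_def)
    qed
  qed
  \<comment> \<open>The segment is run through in time \<open>b - m\<close> instead of 1, so its
    speed is scaled by \<open>1 / (b - m)\<close> and the integral over \<open>{m..b}\<close> is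
    again \<open>l\<close>.\<close>
  define h where "h t = (if t \<le> m then h1 t else l / (b - m))" for t
  have "(h has_integral L) {a..m}" using y1(7) by (rule has_integral_eq[rotated]) (simp add: h_def)
  moreover have "(h has_integral l) {m..b}"
  proof (rule has_integral_spike[of "{m}"])
    show "((\<lambda>_. l / (b - m)) has_integral l) {m..b}"
      using has_integral_const_real[of "l / (b - m)" m b] m by simp
  qed (auto simp: h_def)
  ultimately have hI: "(h has_integral (L + l)) {a..b}" using m by (intro has_integral_combine[of a m b]) auto
  have vel: "tnorm g (y t) (velocity \<A> y t) \<le> h t" if t: "t \<in> {a..b} - (N1 \<union> {a, m, b})" for t
  proof (cases "t < m")
    case True
    have "velocity \<A> y t = velocity \<A> y1 t"
      by (rule velocity_cong_open[of "{..<m}"]) (use True t step.prems y_le in auto)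
    then show ?thesis using y1(9)[of t] True t y_le[of t] by (simp add: h_def)
  next
    case False
    then have t': "t \<in> {m<..<b}" "t \<in> {0..1}" using t step.prems m by auto
    let ?w = "(1 / (b - m)) *\<^sub>R (?v - ?u)"
    have "((\<lambda>t. ?u + ((t - m) / (b - m)) *\<^sub>R (?v - ?u)) has_vector_derivative ?w) (at t)"
      using m by (auto intro!: derivative_eq_intros)
    then have "(chart_map c \<circ> y has_vector_derivative ?w) (at t)"
    proof (rule has_vector_derivative_transform_within_open[of _ _ _ "{m<..<b}"])
      fix s assume s: "s \<in> {m<..<b}"
      then show "?u + ((s - m) / (b - m)) *\<^sub>R (?v - ?u) = (crd c y) s"
        using y_ge[of s] \<sigma>m[of s] chart_map_inv[OF step(2) img[of s]] by (simp add: y2_def)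
    qed (use t' in auto)
    then have D: "(chart_map c \<circ> y has_vector_derivative ?w) (at t within {0..1})" by (rule has_vector_derivative_at_within)
    have yt: "y t = chart_inv c (?u + \<sigma> t *\<^sub>R (?v - ?u))" using y_ge[of t] t' by (simp add: y2_def)
    have dom: "y t \<in> chart_dom c" unfolding yt by (rule chart_inv_in[OF step(2) img])
    have zt: "chart_map c (y t) = ?u + \<sigma> t *\<^sub>R (?v - ?u)" unfolding yt by (rule chart_map_inv[OF step(2) img])
    have T: "cvel 0 y t \<in> TM (y t)"
      by (rule velocity_tangent[OF continuous_on_subset[OF yc subset_UNIV] step(2) t'(2) dom D])
    have "cvel 0 y t c = ?w"
      using curve_deriv_01[OF D t'(2)] dom step(2) by (simp add: cov_velocity_0 charts_at_def)
    then have "tnorm g (y t) (velocity \<A> y t) = sqrt (G c (chart_map c (y t)) ?w ?w)"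
      using tnorm_eq_G[OF T step(2) dom] by (simp add: cov_velocity_def)
    also have "\<dots> = sqrt ((1 / (b - m))\<^sup>2 * G c (chart_map c (y t)) (?v - ?u) (?v - ?u))"
      by (simp only: bilinear_lmul[OF G_metric(1)[OF step(2) chart_map_in[OF dom]]]
          bilinear_rmul[OF G_metric(1)[OF step(2) chart_map_in[OF dom]]] power2_eq_square real_scaleR_def mult.assoc)
    also have "\<dots> = (1 / (b - m)) * sqrt (G c (chart_map c (y t)) (?v - ?u) (?v - ?u))"
      using m by (simp add: real_sqrt_mult)
    also have "\<dots> \<le> (1 / (b - m)) * l"
      using step(7)[OF seg[of t]] m unfolding zt by (intro mult_left_mono) auto
    finally show ?thesis using t' by (simp add: h_def)
  qed
  have neg: "negligible (N1 \<union> {a, m, b})" using y1(8) by (intro negligible_Un) auto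
  show ?case
    using yc ya yb parts hI neg vel by blast
qed

lemma riemannian_dist_le_reach:
  assumes "reach p q L"
  shows "riemannian_dist \<A> g p q \<le> ennreal L"
proof -
  obtain y h N where y': "\<forall>t\<le>0. y t = p" "\<forall>t\<ge>1. y t = q"
      "\<exists>(n::nat) T. T 0 = 0 \<and> T n = 1 \<and> (\<forall>i<n. T i < T (Suc i) \<and> Cr_curve_on \<A> 1 (T i) (T (Suc i)) y)"
      and y: "(h has_integral L) {0..1}" "negligible N"
      "\<forall>t\<in>{0..1} - N. tnorm g (y t) (velocity \<A> y t) \<le> h t"
    using reach_curve[OF assms order_refl zero_less_one order_refl] by blast
  have y0: "y 0 = p" "y 1 = q" "piecewise_C1_curve \<A> y"
    using y' unfolding piecewise_C1_curve_def by auto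
  note x = piecewise_C1_curve_Hk[OF y0(3)]
  have "curve_length \<A> g y \<le> integral {0..1} h"
    unfolding curve_length_eq_integral[OF y0(3)]
  proof (rule integral_le_AE[OF cov_velocity_integrable(1)[OF x le0] has_integral_integrable[OF y(1)] y(2)])
    fix t assume t: "t \<in> {0..1} - N"
    have "cvel 0 (restrict y {0..1}) t = velocity \<A> y t"
      using velocity_restrict[of t y] t by (simp add: cov_velocity_def)
    then show "tnorm g (restrict y {0..1} t) (cvel 0 (restrict y {0..1}) t) \<le> h t"
      using bspec[OF y(3) t] t by simp
  qed auto
  then have "curve_length \<A> g y \<le> L" using y(1) by (simp add: integral_unique)
  then have "ennreal (curve_length \<A> g y) \<le> ennreal L" by (rule ennreal_leI)
  moreover have "riemannian_dist \<A> g p q \<le> ennreal (curve_length \<A> g y)"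
    unfolding riemannian_dist_def by (rule INF_lower) (use y0 in simp)
  ultimately show ?thesis by (rule order_trans[rotated])
qed

text \<open>On unit vectors the norm is at least \<open>m\<close> and, by uniform continuity, varies
  by less than \<open>m\<close> over a small ball. That makes any two of its values comparable with
  factor 2, and homogeneity extends this to all vectors.\<close>

lemma metric_comparable:
  assumes c: "c \<in> \<A>" and z0: "z0 \<in> chart_img c"
  obtains r where "0 < r" "cball z0 r \<subseteq> chart_img c"
    "\<And>z z' u. z \<in> cball z0 r \<Longrightarrow> z' \<in> cball z0 r \<Longrightarrow> sqrt (G c z u u) \<le> 2 * sqrt (G c z' u u)"
proof -
  obtain r0 where r0: "0 < r0" "cball z0 r0 \<subseteq> chart_img c"
    using open_contains_cball[of "chart_img c"] chart_homeo(2)[OF c] z0 by blast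
  obtain m where m: "0 < m" "\<And>z u. z \<in> cball z0 r0 \<Longrightarrow> m * norm u \<le> sqrt (G c z u u)"
    using G_norm_bounds[OF c compact_cball r0(2)] by metis
  let ?S = "cball z0 r0 \<times> sphere (0::'b) 1"
  have "continuous_on ?S (\<lambda>p. sqrt (G c (fst p) (snd p) (snd p)))"
    by (intro continuous_on_real_sqrt continuous_on_G[OF c] continuous_on_fst continuous_on_snd continuous_on_id) (use r0 in auto)
  then have "uniformly_continuous_on ?S (\<lambda>p. sqrt (G c (fst p) (snd p) (snd p)))"
    by (rule compact_uniformly_continuous) (intro compact_Times compact_cball compact_sphere)
  then obtain d where d: "0 < d" "\<And>p p'. p \<in> ?S \<Longrightarrow> p' \<in> ?S \<Longrightarrow> dist p' p < d \<Longrightarrow>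
      dist (sqrt (G c (fst p') (snd p') (snd p'))) (sqrt (G c (fst p) (snd p) (snd p))) < m"
    unfolding uniformly_continuous_on_def using m(1) by metis
  define r where "r = min r0 (d / 3)"
  have r: "0 < r" "r \<le> r0" "r \<le> d / 3" using r0 d by (auto simp: r_def)
  show ?thesis
  proof (rule that[OF r(1)])
    show "cball z0 r \<subseteq> chart_img c" using r0(2) r(2) by (meson subset_cball subset_trans)
    fix z z' u assume z: "z \<in> cball z0 r" "z' \<in> cball z0 r"
    have z0': "z \<in> cball z0 r0" "z' \<in> cball z0 r0" using z r(2) by auto
    have img: "z \<in> chart_img c" "z' \<in> chart_img c" using z0' r0(2) by auto
    show "sqrt (G c z u u) \<le> 2 * sqrt (G c z' u u)"
    proof (cases "u = 0")
      case True
      then show ?thesis using bilinear_lzero[OF G_metric(1)[OF c]] img by simp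
    next
      case False
      define e where "e = (1 / norm u) *\<^sub>R u"
      have e: "e \<in> sphere 0 1" "u = norm u *\<^sub>R e" using False by (auto simp: e_def)
      have "dist z z' \<le> 2 * r" using z dist_triangle2[of z z' z0] by (auto simp: dist_commute)
      then have "dist (z, e) (z', e) < d" using r d(1) by (simp add: dist_Pair_Pair)
      then have "dist (sqrt (G c z e e)) (sqrt (G c z' e e)) < m"
        using d(2)[of "(z', e)" "(z, e)"] z0' e(1) by simp
      then have 1: "sqrt (G c z e e) < sqrt (G c z' e e) + m" by (simp add: dist_real_def abs_less_iff)
      have 2: "m \<le> sqrt (G c z' e e)" using m(2)[OF z0'(2), of e] e(1) by simp
      have sc: "sqrt (G c w u u) = norm u * sqrt (G c w e e)" if "w \<in> chart_img c" for w
      proof -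
        have "G c w u u = (norm u)\<^sup>2 * G c w e e"
          using bilinear_lmul[OF G_metric(1)[OF c that], of "norm u" e] bilinear_rmul[OF G_metric(1)[OF c that], of _ "norm u" e] e(2)
          by (metis mult.assoc power2_eq_square real_scaleR_def)
        then show ?thesis by (simp add: real_sqrt_mult)
      qed
      have "norm u * sqrt (G c z e e) \<le> norm u * (2 * sqrt (G c z' e e))"
        using 1 2 by (intro mult_left_mono) auto
      then show ?thesis unfolding sc[OF img(1)] sc[OF img(2)] by simp
    qed
  qed
qed

end

context riemannian
begin

text \<open>A short arc is replaced by the straight segment in a chart. Measured with the metric
  frozen at \<open>x q\<close>, the segment has at most twice the length of the arc; moving the base
  point back along the segment costs another factor 2.\<close>

lemma Hk_reach_local:
  assumes x: "x \<in> Hk (Suc r)" and q: "q \<in> {0..1}"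
  shows "\<exists>d>0. \<forall>s t. 0 \<le> s \<and> s \<le> q \<and> q \<le> t \<and> t \<le> 1 \<and> t - s < d \<longrightarrow>
     reach (x s) (x t) (4 * integral {s..t} (\<lambda>q. speed 0 x q))"
proof -
  let ?N = "\<lambda>q. speed 0 x q"
  note xc = Hk_curves_continuous[OF x]
  obtain c where c: "c \<in> \<A>" "x q \<in> chart_dom c" using Hk_curves_carrier[OF x q] by (auto simp: carrier_def)
  let ?z0 = "chart_map c (x q)"
  note z0 = chart_map_in[OF c(2)]
  obtain R where R: "0 < R" "cball ?z0 R \<subseteq> chart_img c"
    "\<And>z z' u. z \<in> cball ?z0 R \<Longrightarrow> z' \<in> cball ?z0 R \<Longrightarrow> sqrt (G c z u u) \<le> 2 * sqrt (G c z' u u)"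
    using metric_comparable[OF c(1) z0] by blast
  obtain d1 where d1: "d1 > 0" "\<And>r. r \<in> {0..1} \<Longrightarrow> \<bar>r - q\<bar> < d1 \<Longrightarrow> x r \<in> chart_dom c"
    using chart_interval_nhd[OF xc c(1) q c(2)] by blast
  have "continuous_on ({0..1} \<inter> {r. \<bar>r - q\<bar> < d1}) (crd c x)"
    by (intro continuous_on_compose continuous_on_subset[OF xc] continuous_on_subset[OF chart_homeo(4)[OF c(1)]]) (use d1(2) in auto)
  then obtain d2 where d2: "d2 > 0" "\<And>r. r \<in> {0..1} \<inter> {r. \<bar>r - q\<bar> < d1} \<Longrightarrow> dist r q < d2 \<Longrightarrow> dist (chart_map c (x r)) ?z0 < R"
    unfolding continuous_on_iff using R(1) q d1(1) by fastforce
  have near: "x r \<in> chart_dom c \<and> chart_map c (x r) \<in> cball ?z0 R" if "r \<in> {0..1}" "\<bar>r - q\<bar> < min d1 d2" for r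
    using d1(2)[of r] d2(2)[of r] that by (auto simp: dist_real_def dist_commute)
  show ?thesis
  proof (intro exI[of _ "min d1 d2"] conjI allI impI)
    show "0 < min d1 d2" using d1 d2 by simp
    fix s t assume st: "0 \<le> s \<and> s \<le> q \<and> q \<le> t \<and> t \<le> 1 \<and> t - s < min d1 d2"
    have nr: "x r \<in> chart_dom c" "chart_map c (x r) \<in> cball ?z0 R" if "r \<in> {s..t}" for r
      using near[of r] that st by (auto simp: abs_less_iff)
    show "reach (x s) (x t) (4 * integral {s..t} ?N)"
    proof (cases "s = t")
      case True
      then show ?thesis using reach.refl[of "x s"] Hk_curves_carrier[OF x, of s] st by simp
    next
      case False
      then have ci: "chart_interval x c s t" using st c nr by (auto simp: chart_interval_def)
      have st': "0 \<le> s" "s \<le> t" "t \<le> 1" using st by auto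
      obtain f N where f: "L2_on s t f" "\<And>q. q \<in> {s..t} \<Longrightarrow> chart_map c (x q) = chart_map c (x s) + integral {s..q} f"
        "negligible N" "\<And>q. q \<in> {s..t} - N \<Longrightarrow> cvel 0 x q c = f q"
        "\<And>q. q \<in> {s..t} - N \<Longrightarrow> cvel 0 x q \<in> TM (x q)"
        using chart_primitive_0[OF x ci] by metis
      define D where "D = chart_map c (x t) - chart_map c (x s)"
      have D: "D = integral {s..t} f" using f(2)[of t] st' by (simp add: D_def)
      have bl: "bilinear (G c ?z0)" by (rule G_metric(1)[OF c(1) z0])
      then have lin: "bounded_linear (\<lambda>u. G c ?z0 u D)"
        unfolding bilinear_def by (intro linear_conv_bounded_linear[THEN iffD1]) blast
      define I where "I = integral {s..t} ?N"
      have Ni: "?N integrable_on {s..t}" by (rule cov_velocity_integrable(1)[OF x le0 st'])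
      have I0: "0 \<le> I" using cov_velocity_norm_integral_mono[OF x, of s s s t] st' by (simp add: I_def)
      define n where "n = sqrt (G c ?z0 D D)"
      have nn: "0 \<le> G c ?z0 D D" by (rule G_nonneg[OF c(1) z0])
      have "G c ?z0 D D = integral {s..t} ((\<lambda>u. G c ?z0 u D) \<circ> f)"
        using integral_linear[OF L2_on_integrable_on(1)[OF f(1)] lin] D by simp
      also have "\<dots> \<le> integral {s..t} (\<lambda>q. (2 * n) * ?N q)"
      proof (rule integral_le_AE[OF integrable_linear[OF L2_on_integrable_on(1)[OF f(1)] lin] integrable_on_mult_right[OF Ni] f(3)])
        fix q' assume q': "q' \<in> {s..t} - N"
        then have q2: "q' \<in> {s..t}" by simp
        have "G c ?z0 (f q') D \<le> sqrt (G c ?z0 (f q') (f q')) * n"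
          using G_cauchy_schwarz[OF c(1) z0, of "f q'" D] by (simp add: n_def)
        also have "\<dots> \<le> (2 * ?N q') * n"
        proof (rule mult_right_mono)
          have "sqrt (G c ?z0 (f q') (f q')) \<le> 2 * sqrt (G c (chart_map c (x q')) (f q') (f q'))"
            by (rule R(3)) (use R(1) nr(2)[OF q2] in auto)
          then show "sqrt (G c ?z0 (f q') (f q')) \<le> 2 * ?N q'"
            using tnorm_eq_G[OF f(5)[OF q'] c(1) nr(1)[OF q2]] f(4)[OF q'] by simp
        qed (use nn in \<open>simp add: n_def\<close>)
        finally show "((\<lambda>u. G c ?z0 u D) \<circ> f) q' \<le> (2 * n) * ?N q'" by (simp add: mult_ac)
      qed
      also have "\<dots> = 2 * n * I" by (simp add: I_def)
      finally have "n * n \<le> 2 * n * I" using nn by (simp add: n_def)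
      then have "n * n \<le> n * (2 * I)" by (simp add: mult_ac)
      then have nI: "n \<le> 2 * I"
        using nn I0 mult_left_le_imp_le[of n n "2 * I"] by (cases "n = 0") (auto simp: n_def less_le)
      have seg: "closed_segment (chart_map c (x s)) (chart_map c (x t)) \<subseteq> cball ?z0 R"
        by (rule closed_segment_subset) (use nr st' in auto)
      have "reach (x s) (x t) (0 + 4 * I)"
      proof (rule reach.step[OF reach.refl c(1)])
        show "x s \<in> \<M>" using Hk_curves_carrier[OF x, of s] st' by simp
        show "x s \<in> chart_dom c" "x t \<in> chart_dom c" using nr(1) st' by auto
        show "closed_segment (chart_map c (x s)) (chart_map c (x t)) \<subseteq> chart_img c" using seg R(2) by blast
        show "0 \<le> 4 * I" using I0 by simp
        fix z assume "z \<in> closed_segment (chart_map c (x s)) (chart_map c (x t))"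
        then have "sqrt (G c z D D) \<le> 2 * n" unfolding n_def by (intro R(3)) (use seg R(1) in auto)
        then show "sqrt (G c z (chart_map c (x t) - chart_map c (x s)) (chart_map c (x t) - chart_map c (x s))) \<le> 4 * I"
          using nI unfolding D_def[symmetric] by linarith
      qed
      then show ?thesis by (simp add: I_def)
    qed
  qed
qed

text \<open>Both broken lines and integrals add up under concatenation, so the local statement
  spreads by bisection. This bounds distances along H1 curves, for which
  \<open>riemannian_dist\<close> itself provides no competitor.\<close>

lemma Hk_reach:
  assumes x: "x \<in> Hk (Suc r)" and ab: "0 \<le> a" "a \<le> b" "b \<le> 1"
  shows "reach (x a) (x b) (4 * integral {a..b} (\<lambda>q. speed 0 x q))"
proof -
  let ?N = "\<lambda>q. speed 0 x q"
  let ?P = "\<lambda>a b. 0 \<le> a \<and> b \<le> 1 \<longrightarrow> reach (x a) (x b) (4 * integral {a..b} ?N)"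
  have "?P a b"
  proof (rule Bolzano[of a b ?P])
    show "a \<le> b" by (rule ab(2))
    fix a b c :: real assume *: "?P a b" "?P b c" "a \<le> b" "b \<le> c"
    show "?P a c"
    proof
      assume ac: "0 \<le> a \<and> c \<le> 1"
      then have "?N integrable_on {a..c}" using cov_velocity_integrable(1)[OF x le0, of a c] * by simp
      from HK_integral_combine[OF *(3,4) this]
      have "4 * integral {a..c} ?N = 4 * integral {a..b} ?N + 4 * integral {b..c} ?N" by simp
      then show "reach (x a) (x c) (4 * integral {a..c} ?N)" using reach_trans * ac by simp
    qed
  next
    fix q assume q: "a \<le> q" "q \<le> b"
    then have "q \<in> {0..1}" using ab by simp
    from Hk_reach_local[OF x this] obtain d where "d > 0" "\<forall>s t. 0 \<le> s \<and> s \<le> q \<and> q \<le> t \<and> t \<le> 1 \<and> t - s < d \<longrightarrow>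
       reach (x s) (x t) (4 * integral {s..t} ?N)" by blast
    then show "\<exists>d>0. \<forall>a b. a \<le> q \<and> q \<le> b \<and> b - a < d \<longrightarrow> ?P a b" by blast
  qed
  then show ?thesis using ab by blast
qed

text \<open>The converse of \<open>riemannian_dist_le_reach\<close> up to the factor 4 of
  \<open>Hk_reach\<close>; the strict inequality provides an actual competitor curve.\<close>

lemma reach_of_riemannian_dist:
  assumes "riemannian_dist \<A> g p q < ennreal e"
  obtains L where "L < 4 * e" "reach p q L"
proof -
  obtain y where y: "piecewise_C1_curve \<A> y" "y 0 = p" "y 1 = q" "ennreal (curve_length \<A> g y) < ennreal e"
    using assms unfolding riemannian_dist_def INF_less_iff by blast
  have "curve_length \<A> g y < e" using y(4) ennreal_leI[of e "curve_length \<A> g y"] by (metis linorder_not_less)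
  moreover have "reach p q (4 * curve_length \<A> g y)"
    using Hk_reach[OF piecewise_C1_curve_Hk[OF y(1)], of 0 1] y(2,3) unfolding curve_length_eq_integral[OF y(1)] by simp
  ultimately show ?thesis using that[of "4 * curve_length \<A> g y"] by simp
qed

lemma reach_near:
  assumes c: "c \<in> \<A>" "p \<in> chart_dom c" and "0 < e"
  obtains V where "open V" "p \<in> V" "\<And>q. q \<in> V \<Longrightarrow> \<exists>L<e. reach p q L"
proof -
  note z0 = chart_map_in[OF c(2)]
  obtain r where r: "0 < r" "cball (chart_map c p) r \<subseteq> chart_img c"
    using open_contains_cball[of "chart_img c"] chart_homeo(2)[OF c(1)] z0 by blast
  obtain m M where M: "0 < M" "\<And>z u. z \<in> cball (chart_map c p) r \<Longrightarrow> sqrt (G c z u u) \<le> M * norm u"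
    using G_norm_bounds[OF c(1) compact_cball r(2)] by metis
  define r' where "r' = min r (e / M)"
  have r': "0 < r'" "r' \<le> r" "r' \<le> e / M" using r M \<open>0 < e\<close> by (auto simp: r'_def)
  define V where "V = chart_map c -` ball (chart_map c p) r' \<inter> chart_dom c"
  show ?thesis
  proof (rule that[of V])
    show "open V" unfolding V_def
      using chart_homeo(1,4)[OF c(1)] continuous_on_open_vimage open_ball by blast
    show "p \<in> V" using c r' by (simp add: V_def)
    fix q assume "q \<in> V"
    then have q: "q \<in> chart_dom c" "dist (chart_map c p) (chart_map c q) < r'" by (auto simp: V_def)
    let ?D = "chart_map c q - chart_map c p"
    have seg: "closed_segment (chart_map c p) (chart_map c q) \<subseteq> cball (chart_map c p) r"
      by (rule closed_segment_subset) (use q r' r(1) in auto)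
    have "reach p q (0 + M * norm ?D)"
      by (rule reach.step[OF reach.refl c q(1)]) (use c seg r(2) M in \<open>auto simp: carrier_def\<close>)
    moreover have "M * norm ?D < e"
    proof -
      have "norm ?D < e / M" using q(2) r'(3) by (simp add: dist_norm norm_minus_commute)
      then show ?thesis using M(1) by (simp add: field_simps)
    qed
    ultimately show "\<exists>L<e. reach p q L" by auto
  qed
qed

text \<open>Including 1 in the set keeps the infimum real and meaningful for points that no broken
  line connects, so that \<open>rdist\<close> is a metric on the whole carrier. Only small distances
  matter for topology and completeness.\<close>

definition rdist :: "'a \<Rightarrow> 'a \<Rightarrow> real" where
  "rdist p q = Inf (insert 1 {L. reach p q L})"

lemma rdist_bdd: "bdd_below (insert 1 {L. reach p q L})"
  by (rule bdd_belowI[of _ 0]) (auto dest: reach_nonneg)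

lemma rdist_le: "reach p q L \<Longrightarrow> rdist p q \<le> L"
  unfolding rdist_def by (rule cInf_lower[OF _ rdist_bdd]) simp

lemma rdist_le_1: "rdist p q \<le> 1"
  unfolding rdist_def by (rule cInf_lower[OF _ rdist_bdd]) simp

lemma rdist_nonneg: "0 \<le> rdist p q"
  unfolding rdist_def by (rule cInf_greatest) (auto dest: reach_nonneg)

text \<open>Below the truncation level 1 the infimum is approached by actual broken lines.\<close>

lemma rdist_less:
  assumes "rdist p q < e" "e \<le> 1"
  obtains L where "L < e" "reach p q L"
proof -
  obtain L where "L \<in> insert 1 {L. reach p q L}" "L < e"
    using cInf_lessD[of "insert 1 {L. reach p q L}" e] assms(1) unfolding rdist_def by blast
  then show ?thesis using that assms(2) by auto
qed

lemma rdist_commute: "rdist p q = rdist q p"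
proof -
  have "{L. reach p q L} = {L. reach q p L}" using reach_sym by blast
  then show ?thesis by (simp add: rdist_def)
qed

lemma rdist_triangle: "rdist p r \<le> rdist p q + rdist q r"
proof (rule field_le_epsilon)
  fix e :: real assume e: "0 < e"
  show "rdist p r \<le> rdist p q + rdist q r + e"
  \<comment> \<open>Otherwise one of the two distances exceeds \<open>1 - e / 2\<close>, and
    truncation at 1 gives the claim.\<close>
  proof (cases "rdist p q + e / 2 \<le> 1 \<and> rdist q r + e / 2 \<le> 1")
    case True
    obtain L where L: "L < rdist p q + e / 2" "reach p q L" by (rule rdist_less[of p q "rdist p q + e / 2"]) (use e True in auto)
    obtain L' where L': "L' < rdist q r + e / 2" "reach q r L'" by (rule rdist_less[of q r "rdist q r + e / 2"]) (use e True in auto)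
    show ?thesis using rdist_le[OF reach_trans[OF L(2) L'(2)]] L(1) L'(1) by simp
  next
    case False
    then show ?thesis using rdist_le_1[of p r] rdist_nonneg[of p q] rdist_nonneg[of q r] e by linarith
  qed
qed

lemma rdist_small_imp_near:
  assumes "c \<in> \<A>" "cball z0 (2 * r) \<subseteq> chart_img c" "0 < r"
  obtains e :: real where "0 < e" "\<And>p q. p \<in> chart_dom c \<Longrightarrow> chart_map c p \<in> cball z0 r \<Longrightarrow> rdist p q < e \<Longrightarrow>
      q \<in> chart_dom c \<and> chart_map c q \<in> cball z0 (2 * r)"
proof -
  obtain e :: real where e: "0 < e" "\<And>p q. p \<in> chart_dom c \<Longrightarrow> chart_map c p \<in> cball z0 r \<Longrightarrow> riemannian_dist \<A> g p q < ennreal e \<Longrightarrow>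
      q \<in> chart_dom c \<and> chart_map c q \<in> cball z0 (2 * r)"
    using riemannian_dist_small_imp_near[OF assms] by metis
  show ?thesis
  proof (rule that[of "min e 1"])
    show "0 < min e 1" using e by simp
    fix p q assume p: "p \<in> chart_dom c" "chart_map c p \<in> cball z0 r" and "rdist p q < min e 1"
    then obtain L where L: "L < min e 1" "reach p q L" by (metis rdist_less min.cobounded2)
    have "ennreal L < ennreal e" using L(1) e(1) by (intro ennreal_lessI) auto
    then have "riemannian_dist \<A> g p q < ennreal e" using riemannian_dist_le_reach[OF L(2)] by (rule le_less_trans[rotated])
    then show "q \<in> chart_dom c \<and> chart_map c q \<in> cball z0 (2 * r)" using e(2) p by blast
  qed
qed

lemma rdist_open:
  assumes "open W" "p \<in> W" "p \<in> \<M>"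
  obtains d :: real where "0 < d" "\<And>q. rdist p q < d \<Longrightarrow> q \<in> W"
proof -
  obtain c where c: "c \<in> \<A>" "p \<in> chart_dom c" using assms(3) by (auto simp: carrier_def)
  have o: "open (chart_map c ` (chart_dom c \<inter> W))" by (rule open_chart_image[OF c(1) assms(1)])
  have "chart_map c p \<in> chart_map c ` (chart_dom c \<inter> W)" using c assms by blast
  then obtain e where e: "0 < e" "cball (chart_map c p) e \<subseteq> chart_map c ` (chart_dom c \<inter> W)"
    using o open_contains_cball by blast
  have sub: "cball (chart_map c p) (2 * (e / 2)) \<subseteq> chart_img c" "0 < e / 2" using e by (auto simp: chart_img_def)
  obtain d :: real where d: "0 < d" "\<And>p' q. p' \<in> chart_dom c \<Longrightarrow> chart_map c p' \<in> cball (chart_map c p) (e / 2) \<Longrightarrow> rdist p' q < d \<Longrightarrow>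
      q \<in> chart_dom c \<and> chart_map c q \<in> cball (chart_map c p) (2 * (e / 2))"
    using rdist_small_imp_near[OF c(1) sub] by metis
  show ?thesis
  proof (rule that[OF d(1)])
    fix q assume "rdist p q < d"
    then have q: "q \<in> chart_dom c" "chart_map c q \<in> cball (chart_map c p) e" using d(2)[OF c(2)] e by auto
    then obtain q' where "q' \<in> chart_dom c" "q' \<in> W" "chart_map c q = chart_map c q'" using e(2) by blast
    then show "q \<in> W" using chart_inv_map[OF c(1)] q(1) by metis
  qed
qed

lemma rdist_metric: "Metric_space (\<M>) rdist"
proof
  show "0 \<le> rdist p q" for p q by (rule rdist_nonneg)
  show "rdist p q = rdist q p" for p q by (rule rdist_commute)
  show "rdist p r \<le> rdist p q + rdist q r" for p q r by (rule rdist_triangle)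
  fix p q assume p: "p \<in> \<M>" and q: "q \<in> \<M>"
  show "rdist p q = 0 \<longleftrightarrow> p = q"
  proof
    assume 0: "rdist p q = 0"
    show "p = q"
    proof (rule ccontr)
      assume "p \<noteq> q"
      then obtain W where W: "open W" "p \<in> W" "q \<notin> W" using hausdorff by blast
      obtain e :: real where "0 < e" "\<And>q. rdist p q < e \<Longrightarrow> q \<in> W" using rdist_open[OF W(1,2) p] by metis
      then show False using 0 W(3) by metis
    qed
  next
    assume "p = q"
    then show "rdist p q = 0" using rdist_le[OF reach.refl[OF p]] rdist_nonneg[of p q] by simp
  qed
qed

lemma open_carrier: "open (\<M>)"
  unfolding carrier_def using chart_homeo(1) by blast

text \<open>Chart balls contain metric balls by \<open>rdist_open\<close>, since short curves cannot
  leave a chart; metric balls contain chart neighbourhoods by \<open>reach_near\<close>, since short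
  segments have small length.\<close>

lemma openin_rdist: "openin (Metric_space.mtopology (\<M>) rdist) S \<longleftrightarrow> open S \<and> S \<subseteq> \<M>"
proof -
  interpret M: Metric_space "\<M>" rdist by (rule rdist_metric)
  show ?thesis
  proof
    assume S: "openin M.mtopology S"
    then have sub: "S \<subseteq> \<M>" unfolding M.openin_mtopology by blast
    have "\<exists>V. open V \<and> p \<in> V \<and> V \<subseteq> S" if p: "p \<in> S" for p
    proof -
      obtain e where e: "0 < e" "M.mball p e \<subseteq> S" using S p unfolding M.openin_mtopology by blast
      obtain c where c: "c \<in> \<A>" "p \<in> chart_dom c" using p sub by (auto simp: carrier_def)
      obtain V where V: "open V" "p \<in> V" "\<And>q. q \<in> V \<Longrightarrow> \<exists>L<e. reach p q L" using reach_near[OF c e(1)] by blast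
      have "q \<in> M.mball p e" if "q \<in> V" for q
        using V(3)[OF that] rdist_le reach_carrier by (force simp: M.in_mball)
      then show ?thesis using V(1,2) e(2) by blast
    qed
    then have "open S" by (subst open_subopen) blast
    then show "open S \<and> S \<subseteq> \<M>" using sub by blast
  next
    assume S: "open S \<and> S \<subseteq> \<M>"
    have "\<exists>r>0. M.mball p r \<subseteq> S" if pS: "p \<in> S" for p
    proof -
      have "p \<in> \<M>" "open S" using pS S by blast+
      then obtain e :: real where "0 < e" "\<And>q. rdist p q < e \<Longrightarrow> q \<in> S"
        using rdist_open[of S p] pS by metis
      then show ?thesis by (intro exI[of _ e]) (auto simp: M.in_mball)
    qed
    then show "openin M.mtopology S" unfolding M.openin_mtopology using S by blast
  qed
qed

lemma compactin_rdist: "compactin (Metric_space.mtopology (\<M>) rdist) K \<longleftrightarrow> compact K \<and> K \<subseteq> \<M>"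
proof -
  have "Metric_space.mtopology (\<M>) rdist = top_of_set (\<M>)"
    unfolding topology_eq openin_rdist by (simp add: openin_open_eq[OF open_carrier] conj_commute)
  then show ?thesis by (auto simp: compactin_subtopology)
qed

text \<open>The Cauchy property passes from \<open>rdist\<close> to \<open>riemannian_dist\<close>
  because a broken line bounds the latter by its length. The limit passes back at the cost of the
  factor 4.\<close>

lemma complete_rdist:
  assumes "complete_riemannian \<A> g"
  shows "Metric_space.mcomplete (\<M>) rdist"
proof -
  interpret M: Metric_space "\<M>" rdist by (rule rdist_metric)
  show ?thesis
    unfolding M.mcomplete_def
  proof (intro allI impI)
    fix s :: "nat \<Rightarrow> 'a" assume s: "M.MCauchy s"
    have "\<exists>N. \<forall>m\<ge>N. \<forall>n\<ge>N. riemannian_dist \<A> g (s m) (s n) < e" if e0: "e > 0" for e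
    proof -
      \<comment> \<open>\<open>e\<close> may be infinite, so a real threshold is chosen below
        it.\<close>
      obtain e1 where e1: "0 < e1" "e1 < e" using dense[OF e0] by blast
      then obtain e' where e': "0 < e'" "ennreal e' < e" by (cases e1) auto
      have "0 < min e' 1" using e' by simp
      then obtain N where N: "\<forall>m n. N \<le> m \<longrightarrow> N \<le> n \<longrightarrow> rdist (s m) (s n) < min e' 1"
        using s unfolding M.MCauchy_def by metis
      have "riemannian_dist \<A> g (s m) (s n) < e" if mn: "m \<ge> N" "n \<ge> N" for m n
      proof -
        obtain L where L: "L < min e' 1" "reach (s m) (s n) L" using N mn by (metis rdist_less min.cobounded2)
        have "riemannian_dist \<A> g (s m) (s n) \<le> ennreal L" by (rule riemannian_dist_le_reach[OF L(2)])
        also have "\<dots> \<le> ennreal e'" using L(1) by (intro ennreal_leI) simp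
        finally show ?thesis using e'(2) by (rule le_less_trans)
      qed
      then show ?thesis by blast
    qed
    moreover have "range s \<subseteq> \<M>" using s by (simp add: M.MCauchy_def)
    ultimately obtain p where p: "p \<in> \<M>" "(\<lambda>n. riemannian_dist \<A> g (s n) p) \<longlonglongrightarrow> 0"
      using assms unfolding complete_riemannian_def by blast
    have "\<exists>N. \<forall>n\<ge>N. s n \<in> \<M> \<and> rdist (s n) p < d" if "d > 0" for d
    proof -
      have "0 < ennreal (d / 4)" using that by simp
      then have "eventually (\<lambda>n. riemannian_dist \<A> g (s n) p < ennreal (d / 4)) sequentially"
        using p(2) by (rule order_tendstoD(2)[rotated])
      then obtain N where N: "\<And>n. n \<ge> N \<Longrightarrow> riemannian_dist \<A> g (s n) p < ennreal (d / 4)"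
        unfolding eventually_sequentially by blast
      have "s n \<in> \<M> \<and> rdist (s n) p < d" if nN: "n \<ge> N" for n
      proof -
        obtain L where "L < 4 * (d / 4)" "reach (s n) p L" using reach_of_riemannian_dist[OF N[OF nN]] by blast
        then show ?thesis using rdist_le[of "s n" p L] reach_carrier[of "s n" p L] by simp
      qed
      then show ?thesis by blast
    qed
    then have "limitin M.mtopology s p sequentially"
      unfolding M.limit_metric_sequentially using p(1) by blast
    then show "\<exists>p. limitin M.mtopology s p sequentially" by blast
  qed
qed

text \<open>A set that lies arbitrarily close to compact sets is totally bounded, and in a complete
  metric space its closure is then compact.\<close>

lemma approximable_by_compacts_imp_compact:
  assumes comp: "complete_riemannian \<A> g" and S: "S \<subseteq> \<M>"
    and approx: "\<And>e. 0 < e \<Longrightarrow> \<exists>K. compact K \<and> K \<subseteq> \<M> \<and> (\<forall>p\<in>S. \<exists>q\<in>K. rdist q p < e)"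
  obtains K where "compact K" "K \<subseteq> \<M>" "S \<subseteq> K"
proof -
  interpret M: Metric_space "\<M>" rdist by (rule rdist_metric)
  have "M.mtotally_bounded S"
    unfolding M.mtotally_bounded_def
  proof (intro allI impI)
    fix e :: real assume e: "0 < e"
    then have e4: "0 < e / 4" by simp
    obtain K where K: "compact K" "K \<subseteq> \<M>" "\<forall>p\<in>S. \<exists>q\<in>K. rdist q p < e / 4"
      using approx[OF e4] by blast
    have "M.mtotally_bounded K" using M.compactin_imp_mtotally_bounded[of K] compactin_rdist K by blast
    then obtain F where F: "finite F" "F \<subseteq> K" "K \<subseteq> (\<Union>x\<in>F. M.mball x (e / 4))"
      using e4 unfolding M.mtotally_bounded_def by meson
    \<comment> \<open>Total boundedness demands centres in \<open>S\<close> itself. Each useful net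
      point is moved to a point of \<open>S\<close> within \<open>e / 2\<close>; two radii
      \<open>e / 4\<close> bring a point of \<open>S\<close> within \<open>e / 2\<close> of the net,
      and the total is less than \<open>e\<close>.\<close>
    define F' where "F' = {f\<in>F. \<exists>s\<in>S. rdist f s < e / 2}"
    have "\<forall>f\<in>F'. \<exists>s\<in>S. rdist f s < e / 2" by (simp add: F'_def)
    then obtain k where k: "\<And>f. f \<in> F' \<Longrightarrow> k f \<in> S \<and> rdist f (k f) < e / 2" by metis
    show "\<exists>K. finite K \<and> K \<subseteq> S \<and> S \<subseteq> (\<Union>x\<in>K. M.mball x e)"
    proof (intro exI[of _ "k ` F'"] conjI)
      show "finite (k ` F')" using F(1) by (simp add: F'_def)
      show "k ` F' \<subseteq> S" using k by blast
      show "S \<subseteq> (\<Union>x\<in>k ` F'. M.mball x e)"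
      proof
        fix s assume s: "s \<in> S"
        then obtain q where q: "q \<in> K" "rdist q s < e / 4" using K(3) by blast
        then obtain f where f: "f \<in> F" "rdist f q < e / 4" using F(3) by (auto simp: M.in_mball)
        have fs: "rdist f s < e / 2" using rdist_triangle[of f s q] q f by linarith
        then have fF: "f \<in> F'" using f s by (auto simp: F'_def)
        have "rdist (k f) s < e"
          using rdist_triangle[of "k f" s f] k[OF fF] fs rdist_commute[of f "k f"] by linarith
        then show "s \<in> (\<Union>x\<in>k ` F'. M.mball x e)" using fF k[OF fF] s S by (auto simp: M.in_mball)
      qed
    qed
  qed
  then have "compactin M.mtopology (M.mtopology closure_of S)"
    using M.mtotally_bounded_eq_compact_closure_of[OF complete_rdist[OF comp]] by blast
  then have "compact (M.mtopology closure_of S)" "M.mtopology closure_of S \<subseteq> \<M>" using compactin_rdist by blast+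
  moreover have "S \<subseteq> M.mtopology closure_of S" by (rule closure_of_subset) (use S in simp)
  ultimately show ?thesis by (rule that)
qed

text \<open>Local compactness made uniform: around each point a chart ball gives a radius valid for
  all nearby centres, and a finite subcover of \<open>K\<close> allows the minimum to be
  taken.\<close>

lemma compact_neighbourhood:
  assumes K: "compact K" "K \<subseteq> \<M>"
  obtains r K' where "0 < r" "compact K'" "K' \<subseteq> \<M>" "\<And>p q. p \<in> K \<Longrightarrow> rdist p q < r \<Longrightarrow> q \<in> K'"
proof -
  have "\<exists>V C r. open V \<and> p \<in> V \<and> compact C \<and> C \<subseteq> \<M> \<and> 0 < r \<and> (\<forall>p'\<in>V. \<forall>q. rdist p' q < r \<longrightarrow> q \<in> C)"
    if p: "p \<in> K" for p
  proof -
    obtain c where c: "c \<in> \<A>" "p \<in> chart_dom c" using p K by (auto simp: carrier_def)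
    obtain e where e: "0 < e" "cball (chart_map c p) e \<subseteq> chart_img c"
      using open_contains_cball[of "chart_img c"] chart_homeo(2)[OF c(1)] chart_map_in[OF c(2)] by blast
    then have sub: "cball (chart_map c p) (2 * (e / 2)) \<subseteq> chart_img c" "0 < e / 2" by auto
    obtain r :: real where r: "0 < r" "\<And>p' q. p' \<in> chart_dom c \<Longrightarrow> chart_map c p' \<in> cball (chart_map c p) (e / 2) \<Longrightarrow> rdist p' q < r \<Longrightarrow>
        q \<in> chart_dom c \<and> chart_map c q \<in> cball (chart_map c p) (2 * (e / 2))"
      using rdist_small_imp_near[OF c(1) sub] by metis
    define V where "V = chart_map c -` ball (chart_map c p) (e / 2) \<inter> chart_dom c"
    define C where "C = chart_inv c ` cball (chart_map c p) e"
    have "open V" unfolding V_def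
      using chart_homeo(1,4)[OF c(1)] continuous_on_open_vimage open_ball by blast
    moreover have "p \<in> V" using c e by (simp add: V_def)
    moreover have "compact C" unfolding C_def
      by (intro compact_continuous_image compact_cball continuous_on_subset[OF chart_homeo(5)[OF c(1)] e(2)])
    moreover have "C \<subseteq> \<M>" unfolding C_def carrier_def using chart_inv_in[OF c(1)] e(2) c(1) by blast
    moreover have "q \<in> C" if "p' \<in> V" "rdist p' q < r" for p' q
    proof -
      have "p' \<in> chart_dom c" "chart_map c p' \<in> cball (chart_map c p) (e / 2)" using that(1) by (auto simp: V_def)
      from r(2)[OF this that(2)] have "q \<in> chart_dom c" "chart_map c q \<in> cball (chart_map c p) e" by auto
      then show ?thesis unfolding C_def using chart_inv_map[OF c(1)] by (metis imageI)
    qed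
    ultimately show ?thesis using r(1) by blast
  qed
  then obtain V C r where V: "\<And>p. p \<in> K \<Longrightarrow> open (V p) \<and> p \<in> V p \<and> compact (C p) \<and> C p \<subseteq> \<M> \<and> 0 < (r p :: real) \<and>
     (\<forall>p'\<in>V p. \<forall>q. rdist p' q < r p \<longrightarrow> q \<in> C p)" by metis
  obtain D where D: "D \<subseteq> K" "finite D" "K \<subseteq> (\<Union>p\<in>D. V p)"
    using compactE_image[OF K(1), of K V] V by blast
  define r0 where "r0 = Min (insert 1 (r ` D))"
  show ?thesis
  proof (rule that[of r0 "\<Union>p\<in>D. C p"])
    have "\<forall>p\<in>D. 0 < r p" using V D(1) by blast
    then show "0 < r0" unfolding r0_def using D(2) by simp
    have "\<forall>p\<in>D. compact (C p)" using V D(1) by blast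
    then show "compact (\<Union>p\<in>D. C p)" using D(2) by (intro compact_UN) auto
    show "(\<Union>p\<in>D. C p) \<subseteq> \<M>" using V D(1) by blast
    fix p q assume p: "p \<in> K" "rdist p q < r0"
    then obtain d where d: "d \<in> D" "p \<in> V d" using D(3) by blast
    have "r0 \<le> r d" unfolding r0_def using D(2) d(1) by simp
    then have "q \<in> C d" using V[of d] d D(1) p(2) by fastforce
    then show "q \<in> (\<Union>p\<in>D. C p)" using d(1) by blast
  qed
qed

lemma energy_bounded_rdist:
  assumes "energy_bounded r R U" "x \<in> U" "0 \<le> s" "s \<le> t" "t \<le> 1"
  shows "rdist (x s) (x t) \<le> 4 * R * sqrt (t - s)"
proof -
  have x: "x \<in> Hk (Suc r)" using assms(1,2) unfolding energy_bounded_def by blast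
  have "rdist (x s) (x t) \<le> 4 * integral {s..t} (\<lambda>q. speed 0 x q)"
    by (rule rdist_le[OF Hk_reach[OF x assms(3-5)]])
  moreover have "integral {s..t} (\<lambda>q. speed 0 x q) \<le> R * sqrt (t - s)"
    using assms unfolding energy_bounded_def by blast
  ultimately show ?thesis by linarith
qed

text \<open>This replaces the Hopf-Rinow theorem: the set of times up to which all curves stay in some
  compact set is closed by completeness and open by local compactness.\<close>

lemma energy_bounded_compact_range:
  assumes comp: "complete_riemannian \<A> g" and U: "energy_bounded r R U" and p: "\<And>x. x \<in> U \<Longrightarrow> x 0 = p"
  obtains K where "compact K" "K \<subseteq> \<M>" "\<And>x t. x \<in> U \<Longrightarrow> t \<in> {0..1} \<Longrightarrow> x t \<in> K"
proof -
  define P where "P T \<longleftrightarrow> (\<exists>K. compact K \<and> K \<subseteq> \<M> \<and> (\<forall>x\<in>U. \<forall>t\<in>{0..T}. x t \<in> K))" for T :: real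
  have R: "0 \<le> R" using U by (simp add: energy_bounded_def)
  have xM: "x t \<in> \<M>" if "x \<in> U" "t \<in> {0..1}" for x t
    using U that Hk_curves_carrier unfolding energy_bounded_def by blast
  have mod: "\<exists>d>0. \<forall>u\<in>{0..d}. 4 * R * sqrt u < e" if e: "e > 0" for e
  proof -
    obtain d where "0 < d" "\<And>u. 0 \<le> u \<Longrightarrow> u < d \<Longrightarrow> 4 * R * sqrt u < e" using sqrt_modulus[OF e] by blast
    then show ?thesis by (intro exI[of _ "d / 2"]) auto
  qed
  have P0: "P 0"
  proof (cases "U = {}")
    case True
    then show ?thesis unfolding P_def by (intro exI[of _ "{}"]) auto
  next
    case False
    then have "p \<in> \<M>" using p xM[of _ 0] by fastforce
    then show ?thesis unfolding P_def using p by (intro exI[of _ "{p}"]) auto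
  qed
  define A where "A = {T\<in>{0..1}. P T}"
  have A: "A \<noteq> {}" "bdd_above A" using P0 unfolding A_def by (force, intro bdd_aboveI[of _ 1], simp)
  define T where "T = Sup A"
  have T01: "T \<in> {0..1}"
    using cSup_upper[OF _ A(2), of 0] P0 cSup_least[OF A(1), of 1] by (auto simp: A_def T_def)
  have PT: "P T"
  proof -
    let ?S = "{x t |x t. x \<in> U \<and> t \<in> {0..T}}"
    obtain K where K: "compact K" "K \<subseteq> \<M>" "?S \<subseteq> K"
    proof (rule approximable_by_compacts_imp_compact[OF comp, of ?S])
      show "?S \<subseteq> \<M>" using xM T01 by fastforce
      fix e :: real assume "0 < e"
      then obtain d where d: "d > 0" "\<forall>u\<in>{0..d}. 4 * R * sqrt u < e" using mod by blast
      obtain T' where T': "T' \<in> A" "T - d < T'" using less_cSupD[OF A(1), of "T - d"] d(1) unfolding T_def by auto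
      then obtain K where K: "compact K" "K \<subseteq> \<M>" "\<forall>x\<in>U. \<forall>t\<in>{0..T'}. x t \<in> K" unfolding A_def P_def by blast
      have T'01: "0 \<le> T'" using T' by (simp add: A_def)
      have "\<exists>q\<in>K. rdist q (x t) < e" if x: "x \<in> U" and t: "t \<in> {0..T}" for x t
      proof (cases "t \<le> T'")
        case True
        have "rdist (x t) (x t) \<le> 0" by (rule rdist_le[OF reach.refl[OF xM[OF x]]]) (use t T01 in auto)
        then show ?thesis using K(3) x t True \<open>0 < e\<close> by (intro bexI[of _ "x t"]) auto
      next
        case False
        have "rdist (x T') (x t) \<le> 4 * R * sqrt (t - T')"
          by (rule energy_bounded_rdist[OF U x]) (use False T'01 t T01 in auto)
        also have "\<dots> < e" using d(2) False t T'(2) by auto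
        finally show ?thesis using K(3) x T'01 by (intro bexI[of _ "x T'"]) auto
      qed
      then show "\<exists>K. compact K \<and> K \<subseteq> \<M> \<and> (\<forall>p\<in>?S. \<exists>q\<in>K. rdist q p < e)" using K(1,2) by blast
    qed
    then show ?thesis unfolding P_def by blast
  qed
  have "T = 1"
  proof (rule ccontr)
    assume "T \<noteq> 1"
    then have T1: "T < 1" using T01 by simp
    obtain K where K: "compact K" "K \<subseteq> \<M>" "\<forall>x\<in>U. \<forall>t\<in>{0..T}. x t \<in> K" using PT unfolding P_def by blast
    obtain e K' where K': "0 < e" "compact K'" "K' \<subseteq> \<M>" "\<And>p q. p \<in> K \<Longrightarrow> rdist p q < e \<Longrightarrow> q \<in> K'"
      using compact_neighbourhood[OF K(1,2)] by metis
    obtain d where d: "d > 0" "\<forall>u\<in>{0..d}. 4 * R * sqrt u < e" using mod[OF K'(1)] by blast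
    define T' where "T' = min 1 (T + d)"
    have T': "T < T'" "T' \<le> 1" "T' \<le> T + d" using T1 d(1) by (auto simp: T'_def)
    have "x t \<in> K \<union> K'" if x: "x \<in> U" and t: "t \<in> {0..T'}" for x t
    proof (cases "t \<le> T")
      case True then show ?thesis using K(3) x t by auto
    next
      case False
      have "rdist (x T) (x t) \<le> 4 * R * sqrt (t - T)"
        by (rule energy_bounded_rdist[OF U x]) (use False T01 t T' in auto)
      also have "\<dots> < e" using d(2) False t T' by auto
      finally show ?thesis using K'(4)[of "x T" "x t"] K(3) x T01 by auto
    qed
    then have "P T'" unfolding P_def using K K' by (intro exI[of _ "K \<union> K'"]) auto
    then have "T' \<in> A" using T' T01 by (simp add: A_def)
    then have "T' \<le> T" unfolding T_def using A(2) by (rule cSup_upper)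
    then show False using T'(1) by simp
  qed
  then show ?thesis using PT that unfolding P_def by blast
qed

end

section \<open>Compactness in the topology of uniform convergence of derivatives\<close>

lemma Cr_vec_curve_continuous_curve_deriv:
  "Cr_vec_curve r S f \<Longrightarrow> j \<le> r \<Longrightarrow> continuous_on S ((curve_deriv S ^^ j) f)"
proof (induction r arbitrary: f j)
  case 0
  then show ?case by simp
next
  case (Suc r)
  show ?case
  proof (cases j)
    case 0
    then show ?thesis using Suc.prems(1) differentiable_imp_continuous_on[of f S]
      unfolding differentiable_on_def by simp
  next
    case (Suc i)
    then show ?thesis using Suc.IH[of "curve_deriv S f" i] Suc.prems by (simp add: funpow_Suc_right del: funpow.simps)
  qed
qed

abbreviation pointwise_topology :: "(real \<Rightarrow> 'a::topological_space) topology" where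
  "pointwise_topology \<equiv> product_topology (\<lambda>_. euclidean) {0..1}"

context riemannian
begin

definition equi_curves :: "'a set \<Rightarrow> real \<Rightarrow> (real \<Rightarrow> 'a) set" where
  "equi_curves K R = {x \<in> extensional {0..1}. (\<forall>t\<in>{0..1}. x t \<in> K) \<and>
     (\<forall>s t. 0 \<le> s \<longrightarrow> s \<le> t \<longrightarrow> t \<le> 1 \<longrightarrow> rdist (x s) (x t) \<le> R * sqrt (t - s))}"

definition uniformly_Hol :: "nat \<Rightarrow> (real \<Rightarrow> 'a) set \<Rightarrow> bool" where
  "uniformly_Hol r V \<longleftrightarrow> (\<forall>c\<in>\<A>. \<forall>C. compact C \<longrightarrow> C \<subseteq> chart_img c \<longrightarrow> (\<exists>B. \<forall>x\<in>V. \<forall>s t.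
     chart_interval x c s t \<longrightarrow> (crd c x) ` {s..t} \<subseteq> C \<longrightarrow> Hol r B s t (crd c x)))"

lemma rdist_ball_open:
  assumes "p \<in> \<M>"
  shows "open {q\<in>\<M>. rdist p q < e}"
proof -
  interpret M: Metric_space "\<M>" rdist by (rule rdist_metric)
  have "M.mball p e = {q\<in>\<M>. rdist p q < e}" using assms by (auto simp: M.in_mball)
  then show ?thesis using M.openin_mball[of p e] openin_rdist by simp
qed

lemma rdist_self: "p \<in> \<M> \<Longrightarrow> rdist p p = 0"
  using rdist_le[OF reach.refl] rdist_nonneg[of p p] by force

text \<open>Equicontinuity lets finitely many times decide uniform closeness. \<open>F\<close> is a
  grid finer than the common modulus of continuity for \<open>e / 3\<close>, so it depends on
  \<open>e\<close> and \<open>R\<close> but not on the curves.\<close>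

lemma equi_curves_net:
  assumes "0 < e"
  obtains F where "finite F" "F \<subseteq> {0..1::real}"
    "\<And>x y t. x \<in> equi_curves K R \<Longrightarrow> y \<in> equi_curves K R \<Longrightarrow> (\<And>t. t \<in> F \<Longrightarrow> rdist (x t) (y t) < e / 3) \<Longrightarrow>
       t \<in> {0..1} \<Longrightarrow> rdist (x t) (y t) < e"
proof -
  obtain d where d: "0 < d" "\<And>u. 0 \<le> u \<Longrightarrow> u < d \<Longrightarrow> R * sqrt u < e / 3" using sqrt_modulus[of "e / 3" R] assms by auto
  obtain n where n: "inverse (real (Suc n)) < d" using reals_Archimedean[OF d(1)] by blast
  define N where "N = real (Suc n)"
  have N: "0 < N" "1 / N < d" using n by (auto simp: N_def inverse_eq_divide)
  define F where "F = (\<lambda>i. real i / N) ` {..Suc n}"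
  show ?thesis
  proof (rule that[of F])
    show "finite F" by (simp add: F_def)
    show "F \<subseteq> {0..1}" using N by (auto simp: F_def N_def)
    fix x y t assume x: "x \<in> equi_curves K R" and y: "y \<in> equi_curves K R"
      and F: "\<And>t. t \<in> F \<Longrightarrow> rdist (x t) (y t) < e / 3" and t: "t \<in> {0..1::real}"
    define i where "i = nat \<lfloor>t * N\<rfloor>"
    have tN: "0 \<le> t * N" using t N by simp
    then have i: "real i \<le> t * N" "t * N < real i + 1" unfolding i_def by (auto simp: of_nat_nat)
    have "t * N \<le> N" using t N by (simp add: mult_left_le_one_le)
    then have "real i \<le> real (Suc n)" using order_trans[OF i(1)] unfolding N_def by blast
    then have iF: "real i / N \<in> F" unfolding F_def by auto
    let ?s = "real i / N"
    have "t < (real i + 1) / N" using i(2) N(1) by (simp add: pos_less_divide_eq)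
    then have s: "0 \<le> ?s" "?s \<le> t" "t - ?s < 1 / N"
      using i(1) N(1) by (simp_all add: pos_divide_le_eq add_divide_distrib)
    have m: "rdist (z ?s) (z t) < e / 3" if "z \<in> equi_curves K R" for z
    proof -
      have "rdist (z ?s) (z t) \<le> R * sqrt (t - ?s)" using that s t unfolding equi_curves_def by auto
      also have "\<dots> < e / 3" by (rule d(2)) (use s N in auto)
      finally show ?thesis .
    qed
    have "rdist (x t) (y t) \<le> rdist (x t) (x ?s) + (rdist (x ?s) (y ?s) + rdist (y ?s) (y t))"
      using rdist_triangle[of "x t" "y t" "x ?s"] rdist_triangle[of "x ?s" "y t" "y ?s"] by linarith
    then show "rdist (x t) (y t) < e" using m[OF x] m[OF y] F[OF iF] rdist_commute[of "x t" "x ?s"] by linarith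
  qed
qed

text \<open>A basic open set of the product topology: only the finitely many times in
  \<open>F\<close> are constrained.\<close>

definition net_ball :: "real set \<Rightarrow> (real \<Rightarrow> 'a) \<Rightarrow> real \<Rightarrow> (real \<Rightarrow> 'a) set" where
  "net_ball F y \<epsilon> = (\<Pi>\<^sub>E t\<in>{0..1}. if t \<in> F then {q\<in>\<M>. rdist (y t) q < \<epsilon>} else UNIV)"

lemma openin_net_ball:
  assumes "finite F" "\<And>t. t \<in> F \<Longrightarrow> y t \<in> \<M>"
  shows "openin pointwise_topology (net_ball F y e)"
  unfolding net_ball_def
proof (rule product_topology_basis)
  show "openin euclidean (if t \<in> F then {q\<in>\<M>. rdist (y t) q < e} else UNIV)" for t
    using rdist_ball_open[OF assms(2)] by simp
  show "finite {t. (if t \<in> F then {q\<in>\<M>. rdist (y t) q < e} else UNIV) \<noteq> topspace euclidean}"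
    by (rule finite_subset[OF _ assms(1)]) auto
qed

lemma net_ballD: "z \<in> net_ball F y e \<Longrightarrow> t \<in> F \<Longrightarrow> t \<in> {0..1} \<Longrightarrow> rdist (y t) (z t) < e"
  unfolding net_ball_def by (drule PiE_mem[of _ _ _ t]) auto

lemma net_ball_self:
  assumes "y \<in> extensional {0..1}" "\<And>t. t \<in> {0..1} \<Longrightarrow> y t \<in> \<M>" "0 < e"
  shows "y \<in> net_ball F y e"
  unfolding net_ball_def using assms by (auto simp: rdist_self PiE_def Pi_def)

lemma equi_curves_closure:
  assumes K: "compact K" "K \<subseteq> \<M>" and U: "U \<subseteq> equi_curves K R"
  shows "pointwise_topology closure_of U \<subseteq> equi_curves K R"
proof
  fix x assume x: "x \<in> pointwise_topology closure_of U"
  have "closedin pointwise_topology (\<Pi>\<^sub>E t\<in>{0..1::real}. K)"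
  proof (rule compactin_imp_closedin)
    have "Hausdorff_space (euclidean :: 'a topology)"
      unfolding Hausdorff_space_def disjnt_def using hausdorff by simp blast
    then show "Hausdorff_space (pointwise_topology :: (real \<Rightarrow> 'a) topology)"
      by (simp add: Hausdorff_space_product_topology)
  qed (use K in \<open>simp add: compactin_PiE\<close>)
  moreover have "U \<subseteq> (\<Pi>\<^sub>E t\<in>{0..1}. K)" using U by (auto simp: equi_curves_def PiE_def Pi_def)
  ultimately have "pointwise_topology closure_of U \<subseteq> (\<Pi>\<^sub>E t\<in>{0..1}. K)" by (rule closure_of_minimal[rotated])
  then have xK: "x \<in> extensional {0..1}" "\<And>t. t \<in> {0..1} \<Longrightarrow> x t \<in> K" using x by (auto simp: PiE_def Pi_def)
  have "rdist (x s) (x t) \<le> R * sqrt (t - s)" if st: "0 \<le> s" "s \<le> t" "t \<le> 1" for s t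
  proof (rule field_le_epsilon)
    fix e :: real assume e: "0 < e"
    have "openin pointwise_topology (net_ball {s, t} x (e / 2))"
      by (rule openin_net_ball) (use st xK(2) K(2) in auto)
    moreover have "x \<in> net_ball {s, t} x (e / 2)"
      by (rule net_ball_self) (use xK K(2) e in auto)
    ultimately obtain u where u: "u \<in> U" "u \<in> net_ball {s, t} x (e / 2)" using x unfolding in_closure_of by blast
    have "rdist (x s) (u s) < e / 2" "rdist (x t) (u t) < e / 2" using net_ballD[OF u(2)] st by auto
    moreover have "rdist (u s) (u t) \<le> R * sqrt (t - s)" using U u(1) st unfolding equi_curves_def by blast
    moreover have "rdist (x s) (x t) \<le> rdist (x s) (u s) + (rdist (u s) (u t) + rdist (u t) (x t))"
      using rdist_triangle[of "x s" "x t" "u s"] rdist_triangle[of "u s" "x t" "u t"] by linarith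
    ultimately show "rdist (x s) (x t) \<le> R * sqrt (t - s) + e" using rdist_commute[of "u t" "x t"] by linarith
  qed
  then show "x \<in> equi_curves K R" using xK unfolding equi_curves_def by blast
qed

text \<open>Pointwise adherence is automatically uniform: approximation at the times of a finite net
  is spread to all times by equicontinuity.\<close>

lemma equi_curves_closure_approx:
  assumes K: "compact K" "K \<subseteq> \<M>" and U: "U \<subseteq> equi_curves K R"
    and x: "x \<in> pointwise_topology closure_of U" and "0 < e"
  obtains u where "u \<in> U" "\<And>t. t \<in> {0..1} \<Longrightarrow> rdist (x t) (u t) < e"
proof -
  have xe: "x \<in> equi_curves K R" using equi_curves_closure[OF K U] x by blast
  then have xK: "x \<in> extensional {0..1}" "\<And>t. t \<in> {0..1} \<Longrightarrow> x t \<in> \<M>" using K(2) unfolding equi_curves_def by auto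
  obtain F where F: "finite F" "F \<subseteq> {0..1::real}"
    "\<And>x y t. x \<in> equi_curves K R \<Longrightarrow> y \<in> equi_curves K R \<Longrightarrow> (\<And>t. t \<in> F \<Longrightarrow> rdist (x t) (y t) < e / 3) \<Longrightarrow>
       t \<in> {0..1} \<Longrightarrow> rdist (x t) (y t) < e"
    using equi_curves_net[OF \<open>0 < e\<close>, of K R] by metis
  have "openin pointwise_topology (net_ball F x (e / 3))" by (rule openin_net_ball) (use F xK in auto)
  moreover have "x \<in> net_ball F x (e / 3)" by (rule net_ball_self) (use xK \<open>0 < e\<close> in auto)
  ultimately obtain u where u: "u \<in> U" "u \<in> net_ball F x (e / 3)" using x unfolding in_closure_of by blast
  have ue: "u \<in> equi_curves K R" using u(1) U by blast
  have "rdist (x t) (u t) < e" if "t \<in> {0..1}" for t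
    by (rule F(3)[OF xe ue _ that]) (use net_ballD[OF u(2)] F(2) in blast)
  then show ?thesis using that u(1) by blast
qed

lemma equi_curves_continuous:
  assumes "K \<subseteq> \<M>" "x \<in> equi_curves K R"
  shows "continuous_on {0..1} x"
  unfolding continuous_on_topological
proof (intro ballI allI impI)
  fix t W assume t: "t \<in> {0..1}" and W: "open W" "x t \<in> W"
  have "x t \<in> \<M>" using assms t unfolding equi_curves_def by blast
  then obtain e :: real where e: "0 < e" "\<And>q. rdist (x t) q < e \<Longrightarrow> q \<in> W" using rdist_open[OF W] by metis
  obtain d where d: "0 < d" "\<And>u. 0 \<le> u \<Longrightarrow> u < d \<Longrightarrow> R * sqrt u < e" using sqrt_modulus[OF e(1), of R] by metis
  have "x s \<in> W" if s: "s \<in> {0..1}" "s \<in> ball t d" for s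
  proof (rule e(2))
    have "rdist (x (min s t)) (x (max s t)) \<le> R * sqrt (max s t - min s t)"
      using assms(2) s(1) t unfolding equi_curves_def by (simp add: min_def max_def)
    also have "\<dots> < e" by (rule d(2)) (use s(2) in \<open>auto simp: dist_real_def min_def max_def\<close>)
    finally show "rdist (x t) (x s) < e" using rdist_commute[of "x s" "x t"] by (auto simp: min_def max_def split: if_splits)
  qed
  then show "\<exists>B. open B \<and> t \<in> B \<and> (\<forall>s\<in>{0..1}. s \<in> B \<longrightarrow> x s \<in> W)"
    using d(1) by (intro exI[of _ "ball t d"]) auto
qed

text \<open>A Lebesgue number for the cover of \<open>D\<close> by small chart balls gives one
  \<open>e\<close> for all points of \<open>D\<close>.\<close>

lemma rdist_close_imp_chart_close:
  assumes c: "c \<in> \<A>" and D: "compact D" "D \<subseteq> chart_dom c" and "0 < h"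
  obtains e where "0 < e" "\<And>p q. p \<in> D \<Longrightarrow> rdist p q < e \<Longrightarrow> q \<in> chart_dom c \<and> dist (chart_map c p) (chart_map c q) < h"
proof -
  interpret M: Metric_space "\<M>" rdist by (rule rdist_metric)
  define W where "W p = chart_map c -` ball (chart_map c p) (h / 2) \<inter> chart_dom c" for p
  have dM: "chart_dom c \<subseteq> \<M>" using c by (auto simp: carrier_def)
  have "open (W p)" for p unfolding W_def
    using chart_homeo(1,4)[OF c] continuous_on_open_vimage open_ball by blast
  then have o: "openin M.mtopology (W p)" for p using openin_rdist dM by (auto simp: W_def)
  have "D \<subseteq> \<Union>(W ` D)" using D(2) \<open>0 < h\<close> by (auto simp: W_def)
  moreover have "compactin M.mtopology D" using compactin_rdist D dM by blast
  ultimately obtain e where e: "0 < e" "\<forall>x\<in>D. \<exists>V\<in>W ` D. M.mball x e \<subseteq> V"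
    using M.lebesgue_number[of D "W ` D"] o by blast
  show ?thesis
  proof (rule that[of "min e 1"])
    show "0 < min e 1" using e(1) by simp
    fix p q assume p: "p \<in> D" "rdist p q < min e 1"
    then obtain L where "reach p q L" by (metis rdist_less min.cobounded2)
    then have pq: "p \<in> \<M>" "q \<in> \<M>" using reach_carrier by blast+
    obtain p' where "p' \<in> D" "M.mball p e \<subseteq> W p'" using e(2) p(1) by blast
    moreover have "q \<in> M.mball p e" "p \<in> M.mball p e" using pq p(2) e(1) by (auto simp: M.in_mball)
    ultimately have "q \<in> W p'" "p \<in> W p'" by blast+
    then have "q \<in> chart_dom c" "dist (chart_map c p') (chart_map c p) < h / 2" "dist (chart_map c p') (chart_map c q) < h / 2"
      by (auto simp: W_def)
    then show "q \<in> chart_dom c \<and> dist (chart_map c p) (chart_map c q) < h"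
      using dist_triangle_half_r[of "chart_map c p'" "chart_map c p" h "chart_map c q"] by simp
  qed
qed

definition chart_tube :: "('a, 'b) chart \<Rightarrow> 'b set \<Rightarrow> (real \<Rightarrow> 'a) \<Rightarrow> real \<Rightarrow> real \<Rightarrow> real \<Rightarrow> bool" where
  "chart_tube c C y s t h \<longleftrightarrow> (\<exists>e>0. \<forall>z. (\<forall>q\<in>{s..t}. rdist (y q) (z q) < e) \<longrightarrow>
     chart_interval z c s t \<and> (crd c z) ` {s..t} \<subseteq> C \<and>
     (\<forall>q\<in>{s..t}. dist (chart_map c (y q)) (chart_map c (z q)) < h))"

text \<open>Approximating curves may leave \<open>C\<close> slightly, so a larger compact set
  \<open>C'\<close> is fixed before any curve is chosen; the Hoelder constant belonging to
  \<open>C'\<close> then covers a curve together with all its approximants.\<close>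

lemma chart_interval_neighbourhood:
  assumes c: "c \<in> \<A>" and C: "compact C" "C \<subseteq> chart_img c"
  obtains C' where "compact C'" "C' \<subseteq> chart_img c" "C \<subseteq> C'"
    "\<And>y s t h. continuous_on {0..1} y \<Longrightarrow> chart_interval y c s t \<Longrightarrow> (crd c y) ` {s..t} \<subseteq> C \<Longrightarrow> 0 < h \<Longrightarrow>
       chart_tube c C' y s t h"
proof -
  obtain h0 where h0: "0 < h0" "(\<Union>z\<in>C. cball z h0) \<subseteq> chart_img c"
    using compact_subset_open_imp_cball_epsilon_subset[OF C(1) chart_homeo(2)[OF c] C(2)] by blast
  show ?thesis
  proof (rule that[of "\<Union>z\<in>C. cball z h0"])
    show "compact (\<Union>z\<in>C. cball z h0)" by (rule compact_minkowski_sum_cball[OF C(1)])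
    show "C \<subseteq> (\<Union>z\<in>C. cball z h0)" using h0(1) by force
    fix y s t and h :: real
    assume yc: "continuous_on {0..1} y" and st: "chart_interval y c s t" and yC: "(crd c y) ` {s..t} \<subseteq> C" and h: "0 < h"
    have D: "compact (y ` {s..t})" "y ` {s..t} \<subseteq> chart_dom c" using st
      by (auto intro!: compact_continuous_image continuous_on_subset[OF yc] simp: chart_interval_def)
    have m: "0 < min h h0" using h h0 by simp
    obtain e where e: "0 < e" "\<And>p q. p \<in> y ` {s..t} \<Longrightarrow> rdist p q < e \<Longrightarrow> q \<in> chart_dom c \<and> dist (chart_map c p) (chart_map c q) < min h h0"
      using rdist_close_imp_chart_close[OF c D m] by metis
    have "chart_interval z c s t \<and> (crd c z) ` {s..t} \<subseteq> (\<Union>z\<in>C. cball z h0) \<and>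
         (\<forall>q\<in>{s..t}. dist (chart_map c (y q)) (chart_map c (z q)) < h)"
      if z: "\<forall>q\<in>{s..t}. rdist (y q) (z q) < e" for z
    proof -
      have zq: "z q \<in> chart_dom c \<and> dist (chart_map c (y q)) (chart_map c (z q)) < min h h0" if "q \<in> {s..t}" for q
        by (rule e(2)) (use z that in auto)
      have "(crd c z) q \<in> (\<Union>z\<in>C. cball z h0)" if "q \<in> {s..t}" for q
        using zq[OF that] yC that by (intro UN_I[of "chart_map c (y q)"]) (auto simp: less_imp_le)
      then show ?thesis using zq st by (auto simp: chart_interval_def)
    qed
    then show "chart_tube c (\<Union>z\<in>C. cball z h0) y s t h"
      unfolding chart_tube_def using e(1) by blast
  qed (rule h0(2))
qed

text \<open>Each \<open>x\<close> in the closure is, on a given chart interval, a uniform limit of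
  curves in \<open>U\<close> whose coordinates lie in \<open>C'\<close>. They share the constant
  \<open>B\<close> for \<open>C'\<close>, which \<open>Hol_limit\<close> hands on to
  \<open>x\<close>.\<close>

lemma uniformly_Hol_closure:
  assumes K: "compact K" "K \<subseteq> \<M>" and U: "U \<subseteq> equi_curves K R" and H: "uniformly_Hol r U"
  shows "uniformly_Hol r (pointwise_topology closure_of U)"
  unfolding uniformly_Hol_def
proof (intro ballI allI impI)
  fix c C assume c: "c \<in> \<A>" and C: "compact C" "C \<subseteq> chart_img c"
  obtain C' where C': "compact C'" "C' \<subseteq> chart_img c" "C \<subseteq> C'"
    "\<And>y s t h. continuous_on {0..1} y \<Longrightarrow> chart_interval y c s t \<Longrightarrow> (crd c y) ` {s..t} \<subseteq> C \<Longrightarrow> 0 < h \<Longrightarrow>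
       chart_tube c C' y s t h"
    using chart_interval_neighbourhood[OF c C] by metis
  obtain B where B: "\<And>x s t. x \<in> U \<Longrightarrow> chart_interval x c s t \<Longrightarrow> (crd c x) ` {s..t} \<subseteq> C' \<Longrightarrow> Hol r B s t (crd c x)"
    using H C'(1,2) c unfolding uniformly_Hol_def by metis
  have "Hol r B s t (crd c x)"
    if x: "x \<in> pointwise_topology closure_of U" and st: "chart_interval x c s t" and xC: "(crd c x) ` {s..t} \<subseteq> C" for x s t
  proof -
    have xe: "x \<in> equi_curves K R" using equi_curves_closure[OF K U] x by blast
    note xc = equi_curves_continuous[OF K(2) xe]
    have "\<exists>u. u \<in> U \<and> chart_interval u c s t \<and> (crd c u) ` {s..t} \<subseteq> C' \<and>
         (\<forall>q\<in>{s..t}. dist (chart_map c (x q)) (chart_map c (u q)) < inverse (real (Suc n)))" for n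
    proof -
      have "0 < inverse (real (Suc n))" by simp
      then obtain d where d: "d > 0" "\<forall>z. (\<forall>q\<in>{s..t}. rdist (x q) (z q) < d) \<longrightarrow> chart_interval z c s t \<and> (crd c z) ` {s..t} \<subseteq> C' \<and>
         (\<forall>q\<in>{s..t}. dist (chart_map c (x q)) (chart_map c (z q)) < inverse (real (Suc n)))"
        using C'(4)[OF xc st xC] unfolding chart_tube_def by blast
      obtain u where u: "u \<in> U" "\<And>t. t \<in> {0..1} \<Longrightarrow> rdist (x t) (u t) < d"
        using equi_curves_closure_approx[OF K U x d(1)] by blast
      have "{s..t} \<subseteq> {0..1}" using st by (auto simp: chart_interval_def)
      then have "\<forall>q\<in>{s..t}. rdist (x q) (u q) < d" using u(2) by blast
      then show ?thesis using d(2) u(1) by blast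
    qed
    then obtain u where u: "\<And>n. u n \<in> U \<and> chart_interval (u n) c s t \<and> (chart_map c \<circ> u n) ` {s..t} \<subseteq> C' \<and>
         (\<forall>q\<in>{s..t}. dist (chart_map c (x q)) (chart_map c (u n q)) < inverse (real (Suc n)))" by metis
    have st': "s < t" "t \<le> s + 1" using chart_interval_le[OF st] by auto
    show ?thesis
    proof (rule Hol_limit[OF st'])
      show "Hol r B s t (chart_map c \<circ> u n)" for n using B u by blast
      show "uniform_limit {s..t} (\<lambda>n. chart_map c \<circ> u n) (crd c x) sequentially"
        unfolding uniform_limit_sequentially_iff
      proof (intro allI impI)
        fix e :: real assume "0 < e"
        then obtain N where N: "inverse (real (Suc N)) < e" using reals_Archimedean by blast
        have "dist ((chart_map c \<circ> u n) q) ((crd c x) q) < e" if "q \<in> {s..t}" "n \<ge> N" for q n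
        proof -
          have "dist (chart_map c (x q)) (chart_map c (u n q)) < inverse (real (Suc n))" using u that(1) by blast
          also have "\<dots> \<le> inverse (real (Suc N))" using that(2) by (intro le_imp_inverse_le) auto
          finally show ?thesis using N by (simp add: dist_commute)
        qed
        then show "\<exists>N. \<forall>n\<ge>N. \<forall>q\<in>{s..t}. dist ((chart_map c \<circ> u n) q) ((crd c x) q) < e" by blast
      qed
    qed
  qed
  then show "\<exists>B. \<forall>x\<in>pointwise_topology closure_of U. \<forall>s t.
     chart_interval x c s t \<longrightarrow> (crd c x) ` {s..t} \<subseteq> C \<longrightarrow> Hol r B s t (crd c x)" by blast
qed

lemma uniformly_Hol_Cr_curves:
  assumes K: "K \<subseteq> \<M>" and x: "x \<in> equi_curves K R" "x \<in> V" and H: "uniformly_Hol r V"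
  shows "x \<in> Cr_curves \<A> r"
proof -
  note xc = equi_curves_continuous[OF K x(1)]
  have "Cr_vec_curve r {s..t} (crd c x)"
    if c: "c \<in> \<A>" and st: "0 \<le> s \<and> s < t \<and> t \<le> 1 \<and> x ` {s..t} \<subseteq> chart_dom c" for c s t
  proof -
    have ci: "chart_interval x c s t" using c st by (simp add: chart_interval_def)
    have st': "s < t" "t \<le> s + 1" using st by auto
    obtain B where "Hol r B s t (crd c x)"
      using H[unfolded uniformly_Hol_def, rule_format, OF c chart_interval_compact[OF xc ci]] ci x(2) by blast
    then show ?thesis by (rule Hol_imp_Cr_vec_curve[OF _ st'])
  qed
  then show ?thesis using xc x(1) K unfolding Cr_curves_def Cr_curve_on_def equi_curves_def by auto
qed

text \<open>Closeness at finitely many times gives uniform closeness in \<open>rdist\<close> by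
  equicontinuity, then closeness of the coordinates on the chart interval, then closeness of all
  derivatives up to \<open>r\<close> by interpolation in the common Hoelder class.\<close>

lemma pointwise_continuous_Cr_topology:
  assumes K: "K \<subseteq> \<M>" and V: "V \<subseteq> equi_curves K R" and H: "uniformly_Hol r V"
  shows "continuous_map (subtopology pointwise_topology V) (Cr_topology \<A> r) (\<lambda>x. x)"
  unfolding Cr_topology_def
proof (rule continuous_on_generated_topo)
  let ?X = "subtopology pointwise_topology V"
  let ?B = "{Cr_nbhd \<A> r x c a b e | x c a b e. x \<in> Cr_curves \<A> r \<and> c \<in> \<A> \<and>
        0 \<le> a \<and> a < b \<and> b \<le> 1 \<and> x ` {a..b} \<subseteq> chart_dom c \<and> 0 < e}"
  have VC: "x \<in> Cr_curves \<A> r" if "x \<in> V" for x using uniformly_Hol_Cr_curves[OF K _ that H] V that by blast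
  have top: "topspace ?X = V"
    using V by (auto simp: equi_curves_def PiE_def)
  show "(\<lambda>x. x) ` topspace ?X \<subseteq> \<Union>?B"
  proof
    fix x assume "x \<in> (\<lambda>x. x) ` topspace ?X"
    then have xV: "x \<in> V" using top by simp
    then have xe: "x \<in> equi_curves K R" using V by blast
    then have "x 0 \<in> \<M>" using K unfolding equi_curves_def by auto
    then obtain c where c: "c \<in> \<A>" "x 0 \<in> chart_dom c" by (auto simp: carrier_def)
    have "0 \<in> {0..1::real}" by simp
    from chart_interval_at[OF equi_curves_continuous[OF K xe] c(1) this c(2)]
    obtain a b where "chart_interval x c a b" by metis
    then have ab: "0 \<le> a \<and> a < b \<and> b \<le> 1 \<and> x ` {a..b} \<subseteq> chart_dom c" by (auto simp: chart_interval_def)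
    have "x \<in> Cr_nbhd \<A> r x c a b 1" using VC[OF xV] ab by (simp add: Cr_nbhd_def)
    moreover have "Cr_nbhd \<A> r x c a b 1 \<in> ?B" using VC[OF xV] ab c(1) zero_less_one by blast
    ultimately show "x \<in> \<Union>?B" by blast
  qed
  fix S assume "S \<in> ?B"
  then obtain x c a b e where S: "S = Cr_nbhd \<A> r x c a b e" and x: "x \<in> Cr_curves \<A> r" and c: "c \<in> \<A>"
    and ab: "0 \<le> a" "a < b" "b \<le> 1" "x ` {a..b} \<subseteq> chart_dom c" and e: "0 < e" by blast
  let ?D = "\<lambda>j y. (curve_deriv {a..b} ^^ j) (crd c y)"
  have Dc: "continuous_on {a..b} (?D j y)" if "y \<in> Cr_curves \<A> r" "y ` {a..b} \<subseteq> chart_dom c" "j \<le> r" for y j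
  proof (rule Cr_vec_curve_continuous_curve_deriv[OF _ that(3)])
    show "Cr_vec_curve r {a..b} (crd c y)"
      using that(1,2) c ab unfolding Cr_curves_def Cr_curve_on_def by blast
  qed
  show "openin ?X ((\<lambda>x. x) -` S \<inter> topspace ?X)"
  proof (subst openin_subopen, intro ballI)
    fix y assume "y \<in> (\<lambda>x. x) -` S \<inter> topspace ?X"
    then have yV: "y \<in> V" and yS: "y \<in> Cr_nbhd \<A> r x c a b e" using top S by auto
    then have ye: "y \<in> equi_curves K R" using V by blast
    note yc = equi_curves_continuous[OF K ye]
    have yC: "y \<in> Cr_curves \<A> r" "y ` {a..b} \<subseteq> chart_dom c" and
      yd: "\<And>j t. j \<le> r \<Longrightarrow> t \<in> {a..b} \<Longrightarrow> norm (?D j y t - ?D j x t) < e"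
      using yS by (auto simp: Cr_nbhd_def)
    have ci: "chart_interval y c a b" using ab yC c by (simp add: chart_interval_def)
    \<comment> \<open>The subbasic set is centred at \<open>x\<close>, not at \<open>y\<close>.
      Compactness of \<open>{a..b}\<close> turns the strict inequalities for \<open>y\<close> into a
      positive margin, half of which is granted to nearby curves.\<close>
    have "\<exists>d>0. \<forall>t\<in>{a..b}. norm (?D j y t - ?D j x t) \<le> e - d" if j: "j \<le> r" for j
    proof -
      have cn: "continuous_on {a..b} (\<lambda>t. norm (?D j y t - ?D j x t))"
        by (intro continuous_on_norm continuous_on_diff Dc yC x ab(4) j)
      then obtain t0 where t0: "t0 \<in> {a..b}" "\<forall>t\<in>{a..b}. norm (?D j y t - ?D j x t) \<le> norm (?D j y t0 - ?D j x t0)"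
        using continuous_attains_sup[OF compact_Icc _ cn] ab(2) by force
      then show ?thesis using yd[OF j t0(1)] by (intro exI[of _ "e - norm (?D j y t0 - ?D j x t0)"]) auto
    qed
    then obtain d where d: "\<And>j. j \<le> r \<Longrightarrow> 0 < d j" "\<And>j t. j \<le> r \<Longrightarrow> t \<in> {a..b} \<Longrightarrow> norm (?D j y t - ?D j x t) \<le> e - d j" by metis
    define d0 where "d0 = Min (d ` {..r})"
    have d0: "0 < d0" "\<And>j. j \<le> r \<Longrightarrow> d0 \<le> d j" unfolding d0_def using d(1) by auto
    obtain C' where C': "compact C'" "C' \<subseteq> chart_img c" "(crd c y) ` {a..b} \<subseteq> C'"
      "\<And>y' s t n. continuous_on {0..1} y' \<Longrightarrow> chart_interval y' c s t \<Longrightarrow> (crd c y') ` {s..t} \<subseteq> (crd c y) ` {a..b} \<Longrightarrow> 0 < n \<Longrightarrow>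
       chart_tube c C' y' s t n"
      using chart_interval_neighbourhood[OF c chart_interval_compact[OF yc ci]] by metis
    obtain B where B: "\<And>x s t. x \<in> V \<Longrightarrow> chart_interval x c s t \<Longrightarrow> (crd c x) ` {s..t} \<subseteq> C' \<Longrightarrow> Hol r B s t (crd c x)"
      using H C'(1,2) c unfolding uniformly_Hol_def by metis
    have ab1: "a < b" "b \<le> a + 1" "0 < d0 / 2" using ab d0 by auto
    obtain \<delta> where \<delta>: "0 < \<delta>" "\<forall>f h :: real \<Rightarrow> 'b. Hol r B a b f \<longrightarrow> Hol r B a b h \<longrightarrow> (\<forall>t\<in>{a..b}. norm (f t - h t) \<le> \<delta>) \<longrightarrow>
        (\<forall>j\<le>r. \<forall>t\<in>{a..b}. norm ((curve_deriv {a..b} ^^ j) f t - (curve_deriv {a..b} ^^ j) h t) \<le> d0 / 2)"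
      using Hol_curve_deriv_close[OF ab1] by blast
    obtain \<epsilon> where \<epsilon>: "0 < \<epsilon>" "\<forall>z. (\<forall>q\<in>{a..b}. rdist (y q) (z q) < \<epsilon>) \<longrightarrow> chart_interval z c a b \<and> (crd c z) ` {a..b} \<subseteq> C' \<and>
         (\<forall>q\<in>{a..b}. dist (chart_map c (y q)) (chart_map c (z q)) < \<delta>)"
      using C'(4)[OF yc ci order_refl \<delta>(1)] unfolding chart_tube_def by blast
    obtain F where F: "finite F" "F \<subseteq> {0..1::real}"
      "\<And>x y t. x \<in> equi_curves K R \<Longrightarrow> y \<in> equi_curves K R \<Longrightarrow> (\<And>t. t \<in> F \<Longrightarrow> rdist (x t) (y t) < \<epsilon> / 3) \<Longrightarrow>
         t \<in> {0..1} \<Longrightarrow> rdist (x t) (y t) < \<epsilon>"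
      using equi_curves_net[OF \<epsilon>(1), of K R] by metis
    have yM: "y \<in> extensional {0..1}" "\<And>t. t \<in> {0..1} \<Longrightarrow> y t \<in> \<M>" using ye K unfolding equi_curves_def by auto
    have "openin ?X (net_ball F y (\<epsilon> / 3) \<inter> V)"
      by (rule openin_subtopology_Int) (rule openin_net_ball, use F yM in auto)
    moreover have "y \<in> net_ball F y (\<epsilon> / 3) \<inter> V" using net_ball_self[OF yM] \<epsilon>(1) yV by simp
    moreover have "z \<in> S" if z: "z \<in> net_ball F y (\<epsilon> / 3)" "z \<in> V" for z
    proof -
      have ze: "z \<in> equi_curves K R" using V z(2) by blast
      have "rdist (y q) (z q) < \<epsilon>" if "q \<in> {0..1}" for q
        by (rule F(3)[OF ye ze _ that]) (use net_ballD[OF z(1)] F(2) in blast)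
      then have "\<forall>q\<in>{a..b}. rdist (y q) (z q) < \<epsilon>" using ab by auto
      then have zc: "chart_interval z c a b" "(crd c z) ` {a..b} \<subseteq> C'"
        "\<forall>q\<in>{a..b}. dist (chart_map c (y q)) (chart_map c (z q)) < \<delta>" using \<epsilon>(2) by blast+
      have "\<forall>t\<in>{a..b}. norm ((crd c z) t - (crd c y) t) \<le> \<delta>"
        using zc(3) by (auto simp: dist_norm norm_minus_commute less_imp_le)
      then have zy: "norm (?D j z t - ?D j y t) \<le> d0 / 2" if "j \<le> r" "t \<in> {a..b}" for j t
        using \<delta>(2) B[OF z(2) zc(1,2)] B[OF yV ci C'(3)] that by blast
      have "norm (?D j z t - ?D j x t) < e" if jt: "j \<le> r" "t \<in> {a..b}" for j t
      proof -
        have "norm (?D j z t - ?D j x t) \<le> norm (?D j z t - ?D j y t) + norm (?D j y t - ?D j x t)"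
          using norm_triangle_ineq[of "?D j z t - ?D j y t" "?D j y t - ?D j x t"] by simp
        then show ?thesis using zy[OF jt] d(2)[OF jt] d0(2)[OF jt(1)] d0(1) by linarith
      qed
      then show ?thesis using VC[OF z(2)] zc(1) by (simp add: S Cr_nbhd_def chart_interval_def)
    qed
    ultimately show "\<exists>T. openin ?X T \<and> y \<in> T \<and> T \<subseteq> (\<lambda>x. x) -` S \<inter> topspace ?X"
      unfolding top by (intro exI[of _ "net_ball F y (\<epsilon> / 3) \<inter> V"]) blast
  qed
qed

text \<open>Through this direction the closure of \<open>U\<close> in the finer topology lies inside
  its pointwise closure, so it is a closed subset of a compact set.\<close>

lemma Cr_topology_continuous_pointwise:
  "continuous_map (Cr_topology \<A> r) pointwise_topology (\<lambda>x. x)"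
proof -
  let ?B = "{Cr_nbhd \<A> r x c a b e | x c a b e. x \<in> Cr_curves \<A> r \<and> c \<in> \<A> \<and>
        0 \<le> a \<and> a < b \<and> b \<le> 1 \<and> x ` {a..b} \<subseteq> chart_dom c \<and> 0 < e}"
  have top: "topspace (Cr_topology \<A> r) \<subseteq> Cr_curves \<A> r"
    unfolding Cr_topology_def topology_generated_by_topspace by (auto simp: Cr_nbhd_def)
  have ev: "continuous_map (Cr_topology \<A> r) euclidean (\<lambda>x. x t)" if t: "t \<in> {0..1}" for t
    unfolding continuous_map_def
  proof (intro conjI allI impI)
    fix W :: "'a set" assume "openin euclidean W"
    then have W: "open W" by simp
    show "openin (Cr_topology \<A> r) {x \<in> topspace (Cr_topology \<A> r). x t \<in> W}"
    proof (subst openin_subopen, intro ballI)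
      fix x assume "x \<in> {x \<in> topspace (Cr_topology \<A> r). x t \<in> W}"
      then have x: "x \<in> Cr_curves \<A> r" "x t \<in> W" using top by auto
      then have xc: "continuous_on {0..1} x" "x t \<in> \<M>"
        using t by (auto simp: Cr_curves_def Cr_curve_on_def)
      then obtain c where c: "c \<in> \<A>" "x t \<in> chart_dom c" by (auto simp: carrier_def)
      obtain a b where ci: "chart_interval x c a b" "t \<in> {a..b}" using chart_interval_at[OF xc(1) c(1) t c(2)] by blast
      have "chart_map c (x t) \<in> chart_map c ` (chart_dom c \<inter> W)" using c x by blast
      then obtain e where e: "0 < e" "ball (chart_map c (x t)) e \<subseteq> chart_map c ` (chart_dom c \<inter> W)"
        using open_chart_image[OF c(1) W] open_contains_ball by blast
      let ?N = "Cr_nbhd \<A> r x c a b e"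
      have ab: "0 \<le> a" "a < b" "b \<le> 1" "x ` {a..b} \<subseteq> chart_dom c" using ci(1) by (auto simp: chart_interval_def)
      then have "?N \<in> ?B" using x(1) c(1) e(1) by blast
      then have "openin (Cr_topology \<A> r) ?N" unfolding Cr_topology_def by (rule topology_generated_by_Basis)
      moreover have "x \<in> ?N" using x(1) ab e(1) by (simp add: Cr_nbhd_def)
      moreover have "y t \<in> W" if y: "y \<in> ?N" for y
      proof -
        have yd: "y t \<in> chart_dom c" using y ci(2) by (auto simp: Cr_nbhd_def)
        have "\<forall>j\<le>r. \<forall>t\<in>{a..b}. norm ((curve_deriv {a..b} ^^ j) (crd c y) t - (curve_deriv {a..b} ^^ j) (crd c x) t) < e"
          using y by (simp add: Cr_nbhd_def)
        from bspec[OF spec[OF this, of 0, THEN mp, OF le0] ci(2)] have "norm (chart_map c (y t) - chart_map c (x t)) < e" by simp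
        then have "chart_map c (y t) \<in> ball (chart_map c (x t)) e" by (simp add: dist_norm norm_minus_commute)
        then obtain q where "q \<in> chart_dom c" "q \<in> W" "chart_map c (y t) = chart_map c q" using e(2) by blast
        then show ?thesis using chart_inv_map[OF c(1)] yd by metis
      qed
      moreover have "?N \<subseteq> topspace (Cr_topology \<A> r)" using \<open>openin (Cr_topology \<A> r) ?N\<close> by (rule openin_subset)
      ultimately show "\<exists>T. openin (Cr_topology \<A> r) T \<and> x \<in> T \<and> T \<subseteq> {x \<in> topspace (Cr_topology \<A> r). x t \<in> W}"
        by (intro exI[of _ ?N]) blast
    qed
  qed auto
  show ?thesis
    unfolding continuous_map_componentwise
  proof (intro conjI ballI)
    show "(\<lambda>x. x) ` topspace (Cr_topology \<A> r) \<subseteq> extensional {0..1}" using top by (auto simp: Cr_curves_def)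
  qed (rule ev)
qed

lemma uniformly_Hol_relatively_compact:
  assumes K: "compact K" "K \<subseteq> \<M>" and U: "U \<subseteq> equi_curves K R" and H: "uniformly_Hol r U"
  shows "relatively_compact_in (Cr_topology \<A> r) U"
proof -
  let ?T = "Cr_topology \<A> r"
  define V where "V = pointwise_topology closure_of U"
  have V: "V \<subseteq> equi_curves K R" "uniformly_Hol r V"
    unfolding V_def using equi_curves_closure[OF K U] uniformly_Hol_closure[OF K U H] by auto
  have cl: "closedin pointwise_topology V" unfolding V_def by (rule closedin_closure_of)
  have VP: "V \<subseteq> (\<Pi>\<^sub>E t\<in>{0..1}. K)" using V(1) by (auto simp: equi_curves_def PiE_def Pi_def)
  have "compactin pointwise_topology (\<Pi>\<^sub>E t\<in>{0..1::real}. K)" using K(1) by (simp add: compactin_PiE)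
  then have "compactin pointwise_topology V" using VP cl by (rule closed_compactin)
  then have "compactin (subtopology pointwise_topology V) V" by (simp add: compactin_subtopology)
  from image_compactin[OF this pointwise_continuous_Cr_topology[OF K(2) V]]
  have VT: "compactin ?T V" by simp
  have "U \<subseteq> topspace pointwise_topology" using U by (auto simp: equi_curves_def PiE_def)
  then have UV: "U \<subseteq> V" unfolding V_def by (rule closure_of_subset)
  then have UT: "U \<subseteq> topspace ?T" using compactin_subset_topspace[OF VT] by blast
  have "?T closure_of U \<subseteq> V"
    using continuous_map_image_closure_subset[OF Cr_topology_continuous_pointwise, of r U] by (simp add: V_def)
  then have "compactin ?T (?T closure_of U)" by (rule closed_compactin[OF VT _ closedin_closure_of])
  then show ?thesis using UT unfolding relatively_compact_in_def by blast
qed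

lemma energy_bounded_relatively_compact:
  assumes "complete_riemannian \<A> g" "energy_bounded r R U" "\<And>x. x \<in> U \<Longrightarrow> x 0 = p"
  shows "relatively_compact_in (Cr_topology \<A> r) U"
proof -
  obtain K where K: "compact K" "K \<subseteq> \<M>" "\<And>x t. x \<in> U \<Longrightarrow> t \<in> {0..1} \<Longrightarrow> x t \<in> K"
    using energy_bounded_compact_range[where U=U and p=p, OF assms(1,2)] assms(3) by metis
  have UH: "U \<subseteq> Hk (Suc r)" using assms(2) by (simp add: energy_bounded_def)
  show ?thesis
  proof (rule uniformly_Hol_relatively_compact[OF K(1,2)])
    show "U \<subseteq> equi_curves K (4 * R)"
    proof
      fix x assume x: "x \<in> U"
      then have "x \<in> extensional {0..1}" using UH by (auto simp: Hk_curves_def)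
      then show "x \<in> equi_curves K (4 * R)"
        using K(3)[OF x] energy_bounded_rdist[OF assms(2) x] unfolding equi_curves_def by blast
    qed
    show "uniformly_Hol r U"
      unfolding uniformly_Hol_def using chart_curves_uniform_Hol[OF assms(2)] by metis
  qed
qed

end

theorem proposition8:
  fixes \<A> :: "('a::{t2_space, second_countable_topology}, 'b::euclidean_space) chart set"
    and g :: "('a, 'b) metric"
    and A :: "real \<Rightarrow> 'a \<Rightarrow> ('a, 'b) tvec"
    and k :: nat
    and v w :: "'a \<times> ('a, 'b) tvec list"
  assumes "riemannian_manifold \<A> g"
    and "complete_riemannian \<A> g"
    and "k \<ge> 1"
    and "smooth_time_dependent_field \<A> A"
    and "v \<in> whitney_sum (k - 1) \<A>"
    and "w \<in> whitney_sum (k - 1) \<A>"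
    and "\<exists>B. \<forall>t\<in>{0..1}. \<forall>p\<in>carrier \<A>. tnorm g p (A t p) \<le> B"
  shows "weakly_proper (J_functional \<A> g A k) (Hk_curves_between \<A> g k v w)
           (Cr_topology \<A> (k - 1))"
proof -
  interpret riemannian \<A> g by unfold_locales (rule assms(1))
  obtain r where k: "k = Suc r" using assms(3) by (cases k) auto
  obtain B where B: "\<forall>t\<in>{0..1}. \<forall>p\<in>carrier \<A>. tnorm g p (A t p) \<le> B" using assms(7) by blast
  have "relatively_compact_in (Cr_topology \<A> r) U"
    if U: "U \<subseteq> Hk_curves_between \<A> g (Suc r) v w" "bounded (J_functional \<A> g A (Suc r) ` U)" for U
  proof -
    obtain R where R: "energy_bounded r R U" using energy_bounded_sublevel[OF U assms(4) B] by blast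
    show ?thesis
    proof (rule energy_bounded_relatively_compact[OF assms(2) R])
      fix x assume "x \<in> U"
      then have "boundary_value \<A> g (Suc r) x 0 = v" using U(1) unfolding Hk_curves_between_def by blast
      then show "x 0 = fst v" by (auto simp: boundary_value_def)
    qed
  qed
  then show ?thesis unfolding weakly_proper_def k by simp
qed

end
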